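(* Let $M$ be a spherical space form with fundamental group $G\simeq\Gamma_d(m,n,r)$ of Type I. If $m=p^k$ or $m=2p^k$ for some odd prime $p$ and some $k\in\mathbb{N}$, then any spherical space form isospectral to $M$ has fundamental group isomorphic to $G$.
   Context: A spherical space form is a Riemannian manifold of the form $S^q/G$, where $q\geq 2$, $S^q$ is the unit sphere in $\mathbb{R}^{q+1}$ with its round metric of constant sectional curvature $1$, and $G$ is a finite subgroup of the orthogonal group $\mathrm{O}(q+1)$ acting freely on $S^q$. (Its fundamental group is isomorphic to $G$.) For a compact Riemannian manifold $(M,g)$, $\mathrm{Spec}(M,g)$ is the collection of eigenvalues, counted with multiplicity, of the Laplace–Beltrami operator on functions. Two compact Riemannian manifolds are isospectral if their spectra coincide. A finite group is of Type I if all its Sylow subgroups are cyclic. Notation: let $m,n,r$ be positive integers satisfying $\gcd((r-1)n,m)=1$ and $r^n\equiv 1\pmod m$, and let $d$ be the order of the class of $r$ in the multiplicative group $\mathbb{Z}_m^\times$ of integers modulo $m$. Then $\Gamma_d(m,n,r)$ denotes the group with generators $A,B$ and relations $A^m=B^n=1$, $BAB^{-1}=A^r$. It has order $mn$ and is of Type I, and every Type I group is isomorphic to one of this form (Burnside). Whenever $\Gamma_d(m,n,r)$ is written, it is understood that $m,n,r,d$ satisfy these conditions. Here $\mathbb{N}$ is the set of positive integers. *)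

theory Defs
  imports
    "HOL-Analysis.Analysis"
    "HOL-Algebra.Group"
    "HOL-Library.Function_Algebras"
    "HOL-Number_Theory.Number_Theory"
begin

section \<open>Group presentations\<close>

text \<open>A word is a list of letters; \<open>(a, True)\<close> stands for the generator \<open>a\<close> and
  \<open>(a, False)\<close> for its inverse.\<close>

type_synonym 'g word = "('g \<times> bool) list"

inductive pres_eq :: "('g word \<times> 'g word) set \<Rightarrow> 'g word \<Rightarrow> 'g word \<Rightarrow> bool"
  for R :: "('g word \<times> 'g word) set" where
  pres_rel: "(u, v) \<in> R \<Longrightarrow> pres_eq R u v"
| pres_cancel: "pres_eq R [(a, e), (a, \<not> e)] []"
| pres_refl: "pres_eq R u u"
| pres_sym: "pres_eq R u v \<Longrightarrow> pres_eq R v u"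
| pres_trans: "pres_eq R u v \<Longrightarrow> pres_eq R v w \<Longrightarrow> pres_eq R u w"
| pres_append: "pres_eq R u u' \<Longrightarrow> pres_eq R v v' \<Longrightarrow> pres_eq R (u @ v) (u' @ v')"

definition presented_group :: "('g word \<times> 'g word) set \<Rightarrow> 'g word set monoid" where
  "presented_group R =
    \<lparr> carrier = UNIV // {(u, v). pres_eq R u v},
      mult = (\<lambda>C D. \<Union>u\<in>C. \<Union>v\<in>D. {w. pres_eq R (u @ v) w}),
      one = {w. pres_eq R [] w} \<rparr>"

datatype metacyclic_gen = gen_A | gen_B

text \<open>The group \<open>\<Gamma>\<^sub>d(m,n,r)\<close>. The number \<open>d\<close> is determined by \<open>m\<close> and \<open>r\<close> and does not
  enter the presentation; it occurs in the standing conditions below.\<close>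

definition Gamma_group :: "nat \<Rightarrow> nat \<Rightarrow> nat \<Rightarrow> metacyclic_gen word set monoid" where
  "Gamma_group m n r = presented_group
    {(replicate m (gen_A, True), []),
     (replicate n (gen_B, True), []),
     ([(gen_B, True), (gen_A, True), (gen_B, False)], replicate r (gen_A, True))}"

definition Gamma_params :: "nat \<Rightarrow> nat \<Rightarrow> nat \<Rightarrow> nat \<Rightarrow> bool" where
  "Gamma_params d m n r \<longleftrightarrow>
    m > 0 \<and> n > 0 \<and> r > 0 \<and> gcd ((r - 1) * n) m = 1 \<and> [r ^ n = 1] (mod m) \<and> d = ord m r"


section \<open>The fundamental group of a topological space\<close>

definition loops_at :: "'a topology \<Rightarrow> 'a \<Rightarrow> (real \<Rightarrow> 'a) set" where
  "loops_at X x = {p. pathin X p \<and> p 0 = x \<and> p 1 = x}"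

definition loop_homotopy :: "'a topology \<Rightarrow> 'a \<Rightarrow> ((real \<Rightarrow> 'a) \<times> (real \<Rightarrow> 'a)) set" where
  "loop_homotopy X x = {(p, q). p \<in> loops_at X x \<and> q \<in> loops_at X x \<and>
    homotopic_with (\<lambda>h. h 0 = x \<and> h 1 = x) (top_of_set {0..1}) X p q}"

text \<open>The library's \<^const>\<open>joinpaths\<close> requires the class \<open>topological_space\<close>, of which the type
  of orbits used below is not an instance.\<close>

definition loop_concat :: "(real \<Rightarrow> 'a) \<Rightarrow> (real \<Rightarrow> 'a) \<Rightarrow> real \<Rightarrow> 'a" where
  "loop_concat p q = (\<lambda>t. if t \<le> 1/2 then p (2 * t) else q (2 * t - 1))"

definition fundamental_group :: "'a topology \<Rightarrow> 'a \<Rightarrow> (real \<Rightarrow> 'a) set monoid" where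
  "fundamental_group X x =
    \<lparr> carrier = loops_at X x // loop_homotopy X x,
      mult = (\<lambda>C D. \<Union>p\<in>C. \<Union>q\<in>D. loop_homotopy X x `` {loop_concat p q}),
      one = loop_homotopy X x `` {\<lambda>t. x} \<rparr>"


section \<open>Spherical space forms\<close>

definition orthogonal_group :: "(real^'n^'n) monoid" where
  "orthogonal_group = \<lparr> carrier = {Q. orthogonal_matrix Q}, mult = (**), one = mat 1 \<rparr>"

text \<open>The ambient space \<open>real^'n\<close> is \<open>\<real>\<^bsup>q+1\<^esup>\<close>, so \<open>q = CARD('n) - 1 \<ge> 2\<close>.\<close>

definition spherical_space_form :: "(real^'n^'n) set \<Rightarrow> bool" where
  "spherical_space_form G \<longleftrightarrow>
    CARD('n) \<ge> 3 \<and> subgroup G orthogonal_group \<and> finite G \<and>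
    (\<forall>g\<in>G. \<forall>x\<in>sphere 0 1. g *v x = x \<longrightarrow> g = mat 1)"

definition orbit_map :: "(real^'n^'n) set \<Rightarrow> real^'n \<Rightarrow> (real^'n) set" where
  "orbit_map G x = (\<lambda>g. g *v x) ` G"

definition quotient_topology :: "'a topology \<Rightarrow> ('a \<Rightarrow> 'b) \<Rightarrow> 'b topology" where
  "quotient_topology X f =
    topology (\<lambda>U. U \<subseteq> f ` topspace X \<and> openin X {x \<in> topspace X. f x \<in> U})"

lemma openin_quotient_topology:
  "openin (quotient_topology X f) U \<longleftrightarrow>
    U \<subseteq> f ` topspace X \<and> openin X {x \<in> topspace X. f x \<in> U}"
proof -
  have "istopology (\<lambda>U. U \<subseteq> f ` topspace X \<and> openin X {x \<in> topspace X. f x \<in> U})"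
    unfolding istopology_def
  proof (intro conjI allI impI)
    fix S T
    assume S: "S \<subseteq> f ` topspace X \<and> openin X {x \<in> topspace X. f x \<in> S}"
      and T: "T \<subseteq> f ` topspace X \<and> openin X {x \<in> topspace X. f x \<in> T}"
    then show "S \<inter> T \<subseteq> f ` topspace X" by blast
    have "{x \<in> topspace X. f x \<in> S \<inter> T} =
        {x \<in> topspace X. f x \<in> S} \<inter> {x \<in> topspace X. f x \<in> T}" by blast
    with S T show "openin X {x \<in> topspace X. f x \<in> S \<inter> T}" by (simp add: openin_Int)
  next
    fix K assume K: "\<forall>U\<in>K. U \<subseteq> f ` topspace X \<and> openin X {x \<in> topspace X. f x \<in> U}"
    then show "\<Union> K \<subseteq> f ` topspace X" by blast
    have "{x \<in> topspace X. f x \<in> \<Union> K} = (\<Union>U\<in>K. {x \<in> topspace X. f x \<in> U})" by blast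
    with K show "openin X {x \<in> topspace X. f x \<in> \<Union> K}" by (auto intro: openin_Union)
  qed
  then show ?thesis by (simp add: quotient_topology_def topology_inverse')
qed

lemma topspace_quotient_topology: "topspace (quotient_topology X f) = f ` topspace X"
proof -
  have "{x \<in> topspace X. f x \<in> f ` topspace X} = topspace X" by blast
  then have "openin (quotient_topology X f) (f ` topspace X)"
    by (simp add: openin_quotient_topology)
  then show ?thesis
    by (metis openin_quotient_topology openin_subset openin_topspace subset_antisym)
qed

lemma quotient_map_quotient_topology: "quotient_map X (quotient_topology X f) f"
  unfolding quotient_map_def by (auto simp: topspace_quotient_topology openin_quotient_topology)

definition orbit_space :: "(real^'n^'n) set \<Rightarrow> (real^'n) set topology" where
  "orbit_space G = quotient_topology (top_of_set (sphere 0 1)) (orbit_map G)"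


section \<open>The Laplace--Beltrami operator and the spectrum\<close>

text \<open>Intended for open \<open>S\<close>.\<close>

primrec C_k_on :: "nat \<Rightarrow> 'a::real_normed_vector set \<Rightarrow> ('a \<Rightarrow> 'b::real_normed_vector) \<Rightarrow> bool" where
  "C_k_on 0 S f \<longleftrightarrow> continuous_on S f"
| "C_k_on (Suc k) S f \<longleftrightarrow> (\<forall>x\<in>S. f differentiable (at x)) \<and>
    (\<forall>v. C_k_on k S (\<lambda>x. frechet_derivative f (at x) v))"

text \<open>A function or vector field on the unit sphere is extended to the complement of the origin
  so as to be constant along rays. For a function this extension is smooth iff the function is
  smooth on the sphere, and its gradient at a point of the sphere is tangential and equal to the
  Riemannian gradient for the round metric.
  The Levi-Civita connection of the sphere is the tangential part of the ambient derivative, so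
  the divergence of a tangential field \<open>X\<close> at \<open>x\<close> is the sum of \<open>(D X\<^sub>x e) \<bullet> e\<close> over an
  orthonormal basis of the tangent space. As the radial derivative of the extension vanishes,
  this is the full trace of its derivative.\<close>

definition radial_ext :: "('a::euclidean_space \<Rightarrow> 'b) \<Rightarrow> 'a \<Rightarrow> 'b" where
  "radial_ext f = (\<lambda>x. f (x /\<^sub>R norm x))"

definition smooth_on_sphere :: "('a::euclidean_space \<Rightarrow> real) \<Rightarrow> bool" where
  "smooth_on_sphere f \<longleftrightarrow> (\<forall>k. C_k_on k (- {0}) (radial_ext f))"

definition sphere_grad :: "('a::euclidean_space \<Rightarrow> real) \<Rightarrow> 'a \<Rightarrow> 'a" where
  "sphere_grad f x = (\<Sum>b\<in>Basis. frechet_derivative (radial_ext f) (at x) b *\<^sub>R b)"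

definition sphere_div :: "('a::euclidean_space \<Rightarrow> 'a) \<Rightarrow> 'a \<Rightarrow> real" where
  "sphere_div X x = (\<Sum>b\<in>Basis. frechet_derivative (radial_ext X) (at x) b \<bullet> b)"

definition sphere_laplacian :: "('a::euclidean_space \<Rightarrow> real) \<Rightarrow> 'a \<Rightarrow> real" where
  "sphere_laplacian f x = - sphere_div (sphere_grad f) x"

text \<open>The projection from the sphere to the orbit space is a Riemannian covering. Hence a function
  on the orbit space is smooth iff its lift to the sphere is, and its Laplacian is the one of its
  lift. Functions on the orbit space are represented by functions which vanish outside it.\<close>

definition eigenspace :: "(real^'n^'n) set \<Rightarrow> real \<Rightarrow> ((real^'n) set \<Rightarrow> real) set" where
  "eigenspace G \<mu> = {f.
    (\<forall>P. P \<notin> topspace (orbit_space G) \<longrightarrow> f P = 0) \<and>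
    smooth_on_sphere (f \<circ> orbit_map G) \<and>
    (\<forall>x\<in>sphere 0 1. sphere_laplacian (f \<circ> orbit_map G) x = \<mu> * f (orbit_map G x))}"

lemma vector_space_real_functions:
  "vector_space (\<lambda>(c::real) (f::'a \<Rightarrow> real) P. c * f P)"
  by unfold_locales (auto simp: fun_eq_iff algebra_simps)

text \<open>The spectrum as a multiset: every real number is mapped to its multiplicity as an eigenvalue
  (\<open>0\<close> for a number that is not an eigenvalue). The library's \<open>dim\<close> of an infinite-dimensional
  space is \<open>0\<close>, but the eigenspaces are finite-dimensional, the orbit space being compact.\<close>

definition Spec :: "(real^'n^'n) set \<Rightarrow> real \<Rightarrow> nat" where
  "Spec G \<mu> = vector_space.dim (\<lambda>c f P. c * f P) (eigenspace G \<mu>)"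

definition isospectral :: "(real^'n^'n) set \<Rightarrow> (real^'m^'m) set \<Rightarrow> bool" where
  "isospectral G H \<longleftrightarrow> Spec G = Spec H"

end

theory Submission
  imports Defs "HOL-Algebra.Multiplicative_Group" "HOL-Algebra.Sylow" "HOL-Computational_Algebra.Polynomial"
begin

text \<open>The eigenvalues of a spherical space form with group \<open>G \<subseteq> O(n)\<close> are the numbers \<open>k (k + n - 2)\<close>,
  with the \<open>G\<close>-invariant harmonic polynomials of degree \<open>k\<close> as eigenspaces. By Molien's formula, the
  generating function of their dimensions is the average over \<open>g \<in> G\<close> of \<open>(1 - z\<^sup>2) / det (1 - zg)\<close>.
  Its behaviour at \<open>z = 1\<close> yields the dimension \<open>n\<close> and the order of \<open>G\<close>. As \<open>G\<close> acts freely, all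
  eigenvalues of \<open>g\<close> have the order of \<open>g\<close>; comparing the leading coefficients at \<open>exp (2\<pi>i/K)\<close>, where
  no cancellation occurs, one finds that the spectrum determines which \<open>K \<ge> 3\<close> are orders of elements of \<open>G\<close>.

  The sphere being simply connected, the fundamental group is \<open>G\<close>. The conditions on \<open>m\<close>, \<open>n\<close>, \<open>r\<close> force
  \<open>m\<close> to be odd, so \<open>m = p\<^sup>k\<close>. In \<open>\<Gamma>\<^sub>d(p\<^sup>k,n,r)\<close> there are elements of order \<open>n\<close> and
  \<open>p\<^sup>kn/d\<close>, and \<open>p\<^sup>kn/d\<close> is the largest element order divisible by \<open>p\<^sup>k\<close>. Since \<open>d < p\<close>, a group of
  order \<open>p\<^sup>kn\<close> with such elements is a group \<open>\<Gamma>\<^sub>d(p\<^sup>k,n,r')\<close> with the same \<open>d\<close>; since the units modulo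
  \<open>p\<^sup>k\<close> form a cyclic group, it does not depend on \<open>r'\<close>.\<close>


section \<open>Directional derivatives and the Euclidean Laplacian\<close>

text \<open>The eigenspaces named above have to be proved complete: a smooth eigenfunction on the
  sphere is the restriction of a harmonic polynomial. Eigenfunctions for different eigenvalues are
  orthogonal, the restricted polynomials are dense by Stone-Weierstrass, and integrals over the
  sphere are replaced by integrals over an annulus of functions constant along rays. The two space
  forms may have different dimensions, so at first the degree k of an eigenvalue cannot be read off.
  A generating function in t to the power sqrt mu, which mentions neither k nor n, yields n and the
  order of the group; only then can the Molien series be compared. Cancellation is the danger at the
  other roots of unity. Eigenvalues come in conjugate pairs, and each pair contributes 1/zeta times
  a real number. For zeta = exp (2 pi i/K) this number is positive; at another primitive root it
  need not be. The pairing requires nonreal eigenvalues, whence K >= 3. Elements of order 2 are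
  obtained from Sylow's theorem instead.\<close>

interpretation fun_vs: vector_space "\<lambda>(c::'k::field) (f::'a \<Rightarrow> 'k) P. c * f P"
  by unfold_locales (auto simp: fun_eq_iff algebra_simps)

lemma sum_fun_apply: "(\<Sum>i\<in>I. f i) x = (\<Sum>i\<in>I. f i x)" for f :: "'i \<Rightarrow> 'a \<Rightarrow> 'k::comm_monoid_add"
  by (induction I rule: infinite_finite_induct) auto

text \<open>The direction comes first so that \<open>pdiff v\<close> is an operator on functions and
  second derivatives are the iterates \<open>pdiff w (pdiff v f)\<close>.\<close>

definition pdiff :: "'a \<Rightarrow> ('a::real_normed_vector \<Rightarrow> real) \<Rightarrow> 'a \<Rightarrow> real" where
  "pdiff v f x = frechet_derivative f (at x) v"

lemma pdiff_eq: "(f has_derivative D) (at x) \<Longrightarrow> pdiff v f x = D v"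
  unfolding pdiff_def by (metis frechet_derivative_at)

lemma has_derivative_pdiff:
  "f differentiable (at x) \<Longrightarrow> (f has_derivative (\<lambda>v. pdiff v f x)) (at x)"
  unfolding pdiff_def using frechet_derivative_works by metis

lemma pdiff_linear: "f differentiable (at x) \<Longrightarrow> linear (\<lambda>v. pdiff v f x)"
  using has_derivative_linear has_derivative_pdiff by blast

lemma pdiff_const [simp]: "pdiff v (\<lambda>x. c) x = 0"
  by (rule pdiff_eq[where D="\<lambda>_. 0"]) simp

lemma pdiff_inner [simp]: "pdiff v (\<lambda>x. x \<bullet> b) x = v \<bullet> b"
  by (rule pdiff_eq) (auto intro!: derivative_eq_intros)

lemma pdiff_add:
  "f differentiable (at x) \<Longrightarrow> g differentiable (at x) \<Longrightarrow>
   pdiff v (\<lambda>x. f x + g x) x = pdiff v f x + pdiff v g x"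
  by (rule pdiff_eq) (auto intro!: derivative_eq_intros has_derivative_pdiff)

lemma pdiff_diff:
  "f differentiable (at x) \<Longrightarrow> g differentiable (at x) \<Longrightarrow>
   pdiff v (\<lambda>x. f x - g x) x = pdiff v f x - pdiff v g x"
  by (rule pdiff_eq) (auto intro!: derivative_eq_intros has_derivative_pdiff)

lemma pdiff_mult:
  "f differentiable (at x) \<Longrightarrow> g differentiable (at x) \<Longrightarrow>
   pdiff v (\<lambda>x. f x * g x) x = f x * pdiff v g x + pdiff v f x * g x"
  by (rule pdiff_eq[where D="\<lambda>v. f x * pdiff v g x + pdiff v f x * g x"])
     (auto intro!: derivative_eq_intros has_derivative_pdiff)

lemma pdiff_cmult:
  "f differentiable (at x) \<Longrightarrow> pdiff v (\<lambda>x. c * f x) x = c * pdiff v f x"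
  by (simp add: pdiff_mult)

lemma pdiff_linear_comp:
  assumes "bounded_linear g" "f differentiable (at (g x))"
  shows "pdiff v (\<lambda>x. f (g x)) x = pdiff (g v) f (g x)"
proof (rule pdiff_eq)
  show "((\<lambda>x. f (g x)) has_derivative (\<lambda>v. pdiff (g v) f (g x))) (at x)"
    using has_derivative_compose[OF bounded_linear_imp_has_derivative[OF assms(1)]
        has_derivative_pdiff[OF assms(2)]] .
qed

lemma has_derivative_cong_open:
  assumes "open S" "x \<in> S" "\<And>y. y \<in> S \<Longrightarrow> f y = g y"
  shows "(f has_derivative D) (at x) \<longleftrightarrow> (g has_derivative D) (at x)"
  using assms has_derivative_transform_within_open[of f D x UNIV S g]
    has_derivative_transform_within_open[of g D x UNIV S f] by auto

text \<open>Differentiability is not assumed: \<open>frechet_derivative\<close> is a choice from a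
  predicate, and functions that agree near \<open>x\<close> give the same predicate.\<close>

lemma pdiff_cong_open:
  assumes "open S" "x \<in> S" "\<And>y. y \<in> S \<Longrightarrow> f y = g y"
  shows "pdiff v f x = pdiff v g x"
  unfolding pdiff_def frechet_derivative_def
  using has_derivative_cong_open[OF assms] by presburger

lemma differentiable_cong_open:
  assumes "open S" "x \<in> S" "\<And>y. y \<in> S \<Longrightarrow> f y = g y"
  shows "f differentiable (at x) \<longleftrightarrow> g differentiable (at x)"
  unfolding differentiable_def by (simp add: has_derivative_cong_open[OF assms])

text \<open>Continuity of the second derivatives is left out, since the product rule for
  \<open>lap\<close> is pointwise.\<close>

definition twice_diff_on :: "'a::real_normed_vector set \<Rightarrow> ('a \<Rightarrow> real) \<Rightarrow> bool" where
  "twice_diff_on S f \<longleftrightarrow> (\<forall>x\<in>S. f differentiable (at x) \<and> (\<forall>v. pdiff v f differentiable (at x)))"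

definition lap :: "('a::euclidean_space \<Rightarrow> real) \<Rightarrow> 'a \<Rightarrow> real" where
  "lap f x = (\<Sum>b\<in>Basis. pdiff b (pdiff b f) x)"

lemma lap_cong_open:
  assumes "open S" "x \<in> S" "\<And>y. y \<in> S \<Longrightarrow> f y = g y"
  shows "lap f x = lap g x"
  unfolding lap_def
  by (intro sum.cong refl pdiff_cong_open[OF assms(1,2)]) (auto intro: pdiff_cong_open[OF assms(1)] assms(3))

lemma pdiff_pdiff_mult:
  assumes S: "open S" "x \<in> S" and f: "twice_diff_on S f" and g: "twice_diff_on S g"
  shows "pdiff w (pdiff v (\<lambda>x. f x * g x)) x =
    f x * pdiff w (pdiff v g) x + pdiff w f x * pdiff v g x + pdiff v f x * pdiff w g x
      + pdiff w (pdiff v f) x * g x"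
    and "pdiff v (\<lambda>x. f x * g x) differentiable (at x)"
proof -
  have *: "pdiff v (\<lambda>x. f x * g x) y = f y * pdiff v g y + pdiff v f y * g y" if "y \<in> S" for y
    using that f g by (auto simp: twice_diff_on_def intro: pdiff_mult)
  have d: "f differentiable (at x)" "g differentiable (at x)"
    "pdiff v f differentiable (at x)" "pdiff v g differentiable (at x)"
    using S f g by (auto simp: twice_diff_on_def)
  show "pdiff w (pdiff v (\<lambda>x. f x * g x)) x =
    f x * pdiff w (pdiff v g) x + pdiff w f x * pdiff v g x + pdiff v f x * pdiff w g x
      + pdiff w (pdiff v f) x * g x"
    by (subst pdiff_cong_open[OF S *]) (use d in \<open>auto simp: pdiff_add pdiff_mult\<close>)
  show "pdiff v (\<lambda>x. f x * g x) differentiable (at x)"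
    by (subst differentiable_cong_open[OF S *]) (use d in auto)
qed

lemma twice_diff_on_mult:
  assumes "open S" "twice_diff_on S f" "twice_diff_on S g"
  shows "twice_diff_on S (\<lambda>x. f x * g x)"
  using pdiff_pdiff_mult(2)[OF assms(1) _ assms(2,3)] assms
  by (auto simp: twice_diff_on_def)

lemma lap_mult:
  assumes "open S" "x \<in> S" "twice_diff_on S f" "twice_diff_on S g"
  shows "lap (\<lambda>x. f x * g x) x =
    f x * lap g x + 2 * (\<Sum>b\<in>Basis. pdiff b f x * pdiff b g x) + lap f x * g x"
  unfolding lap_def
  by (simp add: pdiff_pdiff_mult(1)[OF assms] sum.distrib sum_distrib_left sum_distrib_right)

lemma twice_diff_on_add:
  assumes "open S" "twice_diff_on S f" "twice_diff_on S g"
  shows "twice_diff_on S (\<lambda>x. f x + g x)"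
  unfolding twice_diff_on_def
proof safe
  fix x v assume x: "x \<in> S"
  then show "(\<lambda>x. f x + g x) differentiable (at x)" using assms by (auto simp: twice_diff_on_def)
  have *: "pdiff v (\<lambda>x. f x + g x) y = pdiff v f y + pdiff v g y" if "y \<in> S" for y
    using that assms by (auto simp: twice_diff_on_def intro: pdiff_add)
  show "pdiff v (\<lambda>x. f x + g x) differentiable (at x)"
    by (subst differentiable_cong_open[OF assms(1) x *]) (use x assms in \<open>auto simp: twice_diff_on_def\<close>)
qed

lemma lap_add:
  assumes "open S" "x \<in> S" "twice_diff_on S f" "twice_diff_on S g"
  shows "lap (\<lambda>x. f x + g x) x = lap f x + lap g x"
proof -
  have *: "pdiff v (\<lambda>x. f x + g x) y = pdiff v f y + pdiff v g y" if "y \<in> S" for y v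
    using that assms by (auto simp: twice_diff_on_def intro: pdiff_add)
  have "pdiff b (pdiff b (\<lambda>x. f x + g x)) x = pdiff b (pdiff b f) x + pdiff b (pdiff b g) x" for b
    by (subst pdiff_cong_open[OF assms(1,2) *]) (use assms in \<open>auto simp: twice_diff_on_def pdiff_add\<close>)
  then show ?thesis by (simp add: lap_def sum.distrib)
qed

lemma twice_diff_on_const: "twice_diff_on S (\<lambda>x. c)"
proof -
  have "pdiff v (\<lambda>x. c) = (\<lambda>x. 0)" for v :: 'a by (auto simp: fun_eq_iff)
  then show ?thesis by (auto simp: twice_diff_on_def)
qed

lemma lap_const [simp]: "lap (\<lambda>x. c) x = 0"
proof -
  have "pdiff v (\<lambda>x. c) = (\<lambda>x. 0)" for v :: 'a by (auto simp: fun_eq_iff)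
  then show ?thesis by (auto simp: lap_def)
qed

lemma lap_cmult:
  assumes "open S" "x \<in> S" "twice_diff_on S f"
  shows "lap (\<lambda>x. c * f x) x = c * lap f x"
  using lap_mult[OF assms(1,2) twice_diff_on_const assms(3), of c] by simp

lemma twice_diff_on_cmult:
  assumes "open S" "twice_diff_on S f" shows "twice_diff_on S (\<lambda>x. c * f x)"
  by (rule twice_diff_on_mult[OF assms(1) twice_diff_on_const assms(2)])

lemma twice_diff_on_norm2: "twice_diff_on S (\<lambda>x::'a::euclidean_space. x \<bullet> x)"
proof -
  have *: "pdiff v (\<lambda>x. x \<bullet> x) = (\<lambda>x. 2 * (x \<bullet> v))" for v :: 'a
    by (rule ext, rule pdiff_eq) (auto intro!: derivative_eq_intros simp: inner_commute)
  then show ?thesis by (auto simp: twice_diff_on_def)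
qed

lemma pdiff_norm2: "pdiff v (\<lambda>x. x \<bullet> x) x = 2 * (x \<bullet> v)"
  by (rule pdiff_eq) (auto intro!: derivative_eq_intros simp: inner_commute)

lemma lap_norm2: "lap (\<lambda>x::'a::euclidean_space. x \<bullet> x) x = 2 * DIM('a)"
proof -
  have *: "pdiff v (\<lambda>x. x \<bullet> x) = (\<lambda>x. 2 * (x \<bullet> v))" for v :: 'a
    by (rule ext) (rule pdiff_norm2)
  have **: "pdiff b (\<lambda>x. 2 * (x \<bullet> b)) x = 2" if "b \<in> Basis" for b x :: 'a
    using that by (simp add: pdiff_cmult)
  show ?thesis unfolding lap_def by (simp add: * **)
qed

lemma sum_pdiff_Basis:
  fixes f :: "'a::euclidean_space \<Rightarrow> real"
  assumes "f differentiable (at x)"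
  shows "(\<Sum>b\<in>Basis. (y \<bullet> b) * pdiff b f x) = pdiff y f x"
proof -
  interpret l: linear "\<lambda>v. pdiff v f x" by (rule pdiff_linear[OF assms])
  have "pdiff y f x = pdiff (\<Sum>b\<in>Basis. (y \<bullet> b) *\<^sub>R b) f x" by (simp add: euclidean_representation)
  also have "\<dots> = (\<Sum>b\<in>Basis. (y \<bullet> b) * pdiff b f x)" by (simp add: l.sum l.scale)
  finally show ?thesis by simp
qed


section \<open>Homogeneous polynomials\<close>

definition mset_monom :: "('b \<Rightarrow> 'a \<Rightarrow> 'k::comm_ring_1) \<Rightarrow> 'b multiset \<Rightarrow> 'a \<Rightarrow> 'k" where
  "mset_monom l M x = (\<Prod>b\<in>#M. l b x)"

definition msets_of_size :: "'b set \<Rightarrow> nat \<Rightarrow> 'b multiset set" where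
  "msets_of_size X k = {M. set_mset M \<subseteq> X \<and> size M = k}"

text \<open>Polynomials are treated as functions. The interpretation \<open>l\<close> of the
  variables is a parameter so that one theory covers real coordinates, complex-valued coordinates
  and the eigenforms of a linear map.\<close>

definition hpoly_of :: "('b \<Rightarrow> 'a \<Rightarrow> 'k::field) \<Rightarrow> 'b set \<Rightarrow> nat \<Rightarrow> ('a \<Rightarrow> 'k) set" where
  "hpoly_of l X k = fun_vs.span (mset_monom l ` msets_of_size X k)"

definition hpoly :: "nat \<Rightarrow> ('a::euclidean_space \<Rightarrow> real) set" where
  "hpoly k = hpoly_of (\<lambda>b x. x \<bullet> b) Basis k"

lemma mset_monom_empty [simp]: "mset_monom l {#} x = 1"
  and mset_monom_add [simp]: "mset_monom l (add_mset b M) x = l b x * mset_monom l M x"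
  by (simp_all add: mset_monom_def)

text \<open>Monomials are built factor by factor, so only constants, sums and multiplication by a
  variable have to be checked. The zero function has a case of its own because it belongs to every
  degree.\<close>

lemma hpoly_of_induct [consumes 1, case_names zero const add step]:
  assumes p: "p \<in> hpoly_of l X k"
    and zero: "\<And>k. P k (\<lambda>x. 0)"
    and const: "\<And>c. P 0 (\<lambda>x. c)"
    and add: "\<And>k p q. p \<in> hpoly_of l X k \<Longrightarrow> q \<in> hpoly_of l X k \<Longrightarrow> P k p \<Longrightarrow> P k q \<Longrightarrow> P k (\<lambda>x. p x + q x)"
    and step: "\<And>k p b. p \<in> hpoly_of l X k \<Longrightarrow> P k p \<Longrightarrow> b \<in> X \<Longrightarrow> P (Suc k) (\<lambda>x. l b x * p x)"
  shows "P k p"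
proof -
  have *: "(\<lambda>x. c * mset_monom l M x) \<in> hpoly_of l X k" if "set_mset M \<subseteq> X" "size M = k" for M k c
    unfolding hpoly_of_def
    by (rule fun_vs.span_scale, rule fun_vs.span_base) (use that in \<open>auto simp: msets_of_size_def\<close>)
  have mon: "P (size M) (\<lambda>x. c * mset_monom l M x)" if "set_mset M \<subseteq> X" for M c
    using that
  proof (induction M)
    case empty
    then show ?case using const[of c] by simp
  next
    case (add b M)
    then have "P (Suc (size M)) (\<lambda>x. l b x * (c * mset_monom l M x))"
      by (intro step *) auto
    then show ?case by (simp add: mult_ac)
  qed
  \<comment> \<open>Membership is carried along because the premise \<open>add\<close> of the rule
    asks for it.\<close>
  have "p \<in> hpoly_of l X k \<and> P k p"
    using p unfolding hpoly_of_def
  proof (induction rule: fun_vs.span_induct_alt)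
    case base
    then show ?case using zero fun_vs.span_zero by (auto simp: zero_fun_def)
  next
    case (step c x y)
    then obtain M where M: "x = mset_monom l M" "set_mset M \<subseteq> X" "size M = k"
      by (auto simp: msets_of_size_def)
    have "P k (\<lambda>u. c * x u + y u)"
      by (rule add) (use step M mon[of M c] *[of M k c] in \<open>auto simp: hpoly_of_def\<close>)
    moreover have "(\<lambda>u. c * x u + y u) \<in> fun_vs.span (mset_monom l ` msets_of_size X k)"
      using fun_vs.span_add[OF *[of M k c, unfolded hpoly_of_def] conjunct1[OF step(2)]] M
      by (simp add: plus_fun_def)
    ultimately show ?case by (simp add: plus_fun_def)
  qed
  then show ?thesis by simp
qed

lemma subspace_hpoly_of: "fun_vs.subspace (hpoly_of l X k)"
  unfolding hpoly_of_def by (rule fun_vs.subspace_span)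

lemma hpoly_of_zero [simp, intro]: "(\<lambda>x. 0) \<in> hpoly_of l X k"
  using fun_vs.subspace_0[OF subspace_hpoly_of] by (simp add: zero_fun_def)

lemma hpoly_of_add: "p \<in> hpoly_of l X k \<Longrightarrow> q \<in> hpoly_of l X k \<Longrightarrow> (\<lambda>x. p x + q x) \<in> hpoly_of l X k"
  using fun_vs.subspace_add[OF subspace_hpoly_of] by (fastforce simp: plus_fun_def)

lemma hpoly_of_diff: "p \<in> hpoly_of l X k \<Longrightarrow> q \<in> hpoly_of l X k \<Longrightarrow> (\<lambda>x. p x - q x) \<in> hpoly_of l X k"
  using fun_vs.subspace_diff[OF subspace_hpoly_of] by (fastforce simp: fun_diff_def)

lemma hpoly_of_cmult: "p \<in> hpoly_of l X k \<Longrightarrow> (\<lambda>x. c * p x) \<in> hpoly_of l X k"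
  using fun_vs.subspace_scale[OF subspace_hpoly_of] by fastforce

lemma hpoly_of_sum: "(\<And>i. i \<in> I \<Longrightarrow> p i \<in> hpoly_of l X k) \<Longrightarrow> (\<lambda>x. \<Sum>i\<in>I. p i x) \<in> hpoly_of l X k"
  by (induction I rule: infinite_finite_induct) (auto intro: hpoly_of_add)

lemma mset_monom_in_hpoly_of:
  "set_mset M \<subseteq> X \<Longrightarrow> mset_monom l M \<in> hpoly_of l X (size M)"
  unfolding hpoly_of_def by (rule fun_vs.span_base) (auto simp: msets_of_size_def)

lemma hpoly_of_const: "(\<lambda>x. c) \<in> hpoly_of l X 0"
proof -
  have "mset_monom l {#} = (\<lambda>x. 1)" by (auto simp: fun_eq_iff)
  then show ?thesis using hpoly_of_cmult[OF mset_monom_in_hpoly_of[of "{#}" X l], of c] by simp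
qed

lemma hpoly_of_step:
  assumes "b \<in> X" "p \<in> hpoly_of l X k" shows "(\<lambda>x. l b x * p x) \<in> hpoly_of l X (Suc k)"
  using assms(2) unfolding hpoly_of_def
proof (induction rule: fun_vs.span_induct_alt)
  case base
  then show ?case using hpoly_of_zero[of l X "Suc k"] by (simp add: zero_fun_def hpoly_of_def)
next
  case (step c x y)
  then obtain M where M: "x = mset_monom l M" "set_mset M \<subseteq> X" "size M = k"
    by (auto simp: msets_of_size_def)
  have "mset_monom l (add_mset b M) \<in> hpoly_of l X (Suc k)"
    using mset_monom_in_hpoly_of[of "add_mset b M" X l] M assms by simp
  from hpoly_of_add[OF hpoly_of_cmult[OF this, of c] step(2)[folded hpoly_of_def]]
  show ?case using M by (simp add: hpoly_of_def algebra_simps plus_fun_def)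
qed

lemma hpoly_of_linear_form: "b \<in> X \<Longrightarrow> l b \<in> hpoly_of l X 1"
  using hpoly_of_step[OF _ hpoly_of_const[of 1 l X]] by simp

lemma hpoly_of_mult:
  assumes "p \<in> hpoly_of l X i" "q \<in> hpoly_of l X j"
  shows "(\<lambda>x. p x * q x) \<in> hpoly_of l X (i + j)"
  using assms(1)
proof (induction rule: hpoly_of_induct)
  case zero then show ?case by simp
next
  case (const c) then show ?case using assms hpoly_of_cmult by auto
next
  case (add k p q) then show ?case using hpoly_of_add by (force simp: algebra_simps)
next
  case (step k p b) then show ?case using hpoly_of_step[OF step.hyps(2) step.IH] by (simp add: mult_ac)
qed

text \<open>With \<open>g\<close> the identity this changes the interpretation of the variables, as
  from coordinates to eigenforms; with \<open>g\<close> linear it shows that degrees are preserved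
  by linear maps.\<close>

lemma hpoly_of_subst:
  assumes "p \<in> hpoly_of l X k" "\<And>b. b \<in> X \<Longrightarrow> (\<lambda>x. l b (g x)) \<in> hpoly_of l' Y 1"
  shows "(\<lambda>x. p (g x)) \<in> hpoly_of l' Y k"
  using assms(1)
proof (induction rule: hpoly_of_induct)
  case zero then show ?case by simp
next
  case (const c) then show ?case by (rule hpoly_of_const)
next
  case (add k p q) then show ?case using hpoly_of_add by force
next
  case (step k p b) then show ?case using hpoly_of_mult[OF assms(2)[OF step.hyps(2)] step.IH] by simp
qed

lemma hpoly_inner: "(\<lambda>x. x \<bullet> v) \<in> hpoly 1"
proof -
  have "(\<lambda>x. x \<bullet> v) = (\<lambda>x. \<Sum>b\<in>Basis. (v \<bullet> b) * (x \<bullet> b))"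
    by (auto simp: fun_eq_iff euclidean_inner[of _ v] mult_ac)
  moreover have "(\<lambda>x. \<Sum>b\<in>Basis. (v \<bullet> b) * (x \<bullet> b)) \<in> hpoly 1" unfolding hpoly_def
    by (intro hpoly_of_sum hpoly_of_cmult hpoly_of_linear_form) auto
  ultimately show ?thesis by metis
qed

lemma hpoly_linear_comp:
  fixes g :: "'a::euclidean_space \<Rightarrow> 'a"
  assumes "p \<in> hpoly k" "linear g" shows "(\<lambda>x. p (g x)) \<in> hpoly k"
  using assms(1) unfolding hpoly_def
proof (rule hpoly_of_subst)
  fix b :: 'a
  have "(\<lambda>x. g x \<bullet> b) = (\<lambda>x. x \<bullet> adjoint g b)"
    using adjoint_works[OF assms(2)] by (auto simp: inner_commute)
  then show "(\<lambda>x. g x \<bullet> b) \<in> hpoly_of (\<lambda>b x. x \<bullet> b) Basis 1"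
    using hpoly_inner[of "adjoint g b"] by (simp add: hpoly_def)
qed

lemma hpoly_norm2: "(\<lambda>x. x \<bullet> x) \<in> hpoly 2"
proof -
  have "(\<lambda>x::'a. \<Sum>b\<in>Basis. (x \<bullet> b) * (x \<bullet> b)) \<in> hpoly_of (\<lambda>b x. x \<bullet> b) Basis (1 + 1)"
    by (intro hpoly_of_sum hpoly_of_mult hpoly_of_linear_form) auto
  then show ?thesis by (simp add: hpoly_def euclidean_inner[of x x for x::'a, symmetric] numeral_2_eq_2)
qed

lemma hpoly_differentiable [simp]:
  assumes "p \<in> hpoly k" shows "p differentiable (at x)"
  using assms unfolding hpoly_def by (induction rule: hpoly_of_induct) auto

lemma hpoly_homogeneous:
  assumes "p \<in> hpoly k" shows "p (c *\<^sub>R x) = c ^ k * p x"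
  using assms unfolding hpoly_def by (induction rule: hpoly_of_induct) (auto simp: algebra_simps)

text \<open>The last conjunct is Euler's identity. The middle one is needed inside the induction:
  for k = 0 the subtraction k - 1 is truncated, and a variable times \<open>pdiff v p\<close> has
  the required degree 0 only because that derivative vanishes.\<close>

lemma hpoly_pdiff_aux:
  assumes "p \<in> hpoly k"
  shows "pdiff v p \<in> hpoly (k - 1) \<and> (k = 0 \<longrightarrow> pdiff v p = (\<lambda>x. 0)) \<and> pdiff x p x = k * p x"
  using assms unfolding hpoly_def
proof (induction rule: hpoly_of_induct)
  case zero
  have "pdiff v (\<lambda>x. 0) = (\<lambda>x. 0)" by (auto simp: fun_eq_iff)
  then show ?case by auto
next
  case (const c)
  have "pdiff v (\<lambda>x. c) = (\<lambda>x. 0)" by (auto simp: fun_eq_iff)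
  then show ?case by auto
next
  case (add k p q)
  note d = hpoly_differentiable[unfolded hpoly_def, OF add(1)] hpoly_differentiable[unfolded hpoly_def, OF add(2)]
  have "pdiff v (\<lambda>x. p x + q x) = (\<lambda>x. pdiff v p x + pdiff v q x)" using d by (auto simp: pdiff_add)
  then show ?case using add hpoly_of_add d by (auto simp: pdiff_add algebra_simps)
next
  case (step k p b)
  note d = hpoly_differentiable[unfolded hpoly_def, OF step(1)]
  have eq: "pdiff v (\<lambda>x. (x \<bullet> b) * p x) = (\<lambda>x. (v \<bullet> b) * p x + (x \<bullet> b) * pdiff v p x)"
    using d by (auto simp: pdiff_mult)
  have "(\<lambda>x. (x \<bullet> b) * pdiff v p x) \<in> hpoly_of (\<lambda>b x. x \<bullet> b) Basis k"
  proof (cases k)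
    case 0
    then show ?thesis using step by auto
  next
    case (Suc k')
    then show ?thesis using step hpoly_of_step[of b Basis "pdiff v p" "\<lambda>b x. x \<bullet> b" k'] by auto
  qed
  then show ?case unfolding eq using step d
    by (auto intro!: hpoly_of_add hpoly_of_cmult simp: pdiff_mult) (simp_all add: algebra_simps)
qed

lemma hpoly_pdiff: "p \<in> hpoly k \<Longrightarrow> pdiff v p \<in> hpoly (k - 1)"
  and hpoly_0_pdiff: "p \<in> hpoly 0 \<Longrightarrow> pdiff v p = (\<lambda>x. 0)"
  and hpoly_euler: "p \<in> hpoly k \<Longrightarrow> pdiff x p x = k * p x"
  using hpoly_pdiff_aux by blast+

lemma hpoly_twice_diff: "p \<in> hpoly k \<Longrightarrow> twice_diff_on S p"
  unfolding twice_diff_on_def using hpoly_pdiff hpoly_differentiable by blast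

lemma hpoly_lap: "p \<in> hpoly k \<Longrightarrow> lap p \<in> hpoly (k - 2)"
proof -
  assume p: "p \<in> hpoly k"
  have "(\<lambda>x. \<Sum>b\<in>Basis. pdiff b (pdiff b p) x) \<in> hpoly (k - 1 - 1)"
    unfolding hpoly_def by (intro hpoly_of_sum) (rule hpoly_pdiff[OF hpoly_pdiff[OF p], unfolded hpoly_def])
  then show ?thesis by (simp add: lap_def[abs_def] numeral_2_eq_2)
qed

lemma hpoly_lap_0: "p \<in> hpoly k \<Longrightarrow> k < 2 \<Longrightarrow> lap p = (\<lambda>x. 0)"
proof -
  assume p: "p \<in> hpoly k" and k: "k < 2"
  have "pdiff b p \<in> hpoly 0" for b using hpoly_pdiff[OF p] k by (metis One_nat_def Suc_1 diff_is_0_eq less_Suc_eq_le)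
  then have "pdiff b (pdiff b p) = (\<lambda>x. 0)" for b by (rule hpoly_0_pdiff)
  then show ?thesis by (simp add: lap_def[abs_def])
qed

text \<open>Product rule: r^2 has Laplacian 2n and gradient 2x, and Euler's identity turns the mixed
  term into 4k p.\<close>

lemma lap_norm2_mult:
  fixes p :: "'a::euclidean_space \<Rightarrow> real"
  assumes "p \<in> hpoly k"
  shows "lap (\<lambda>x. (x \<bullet> x) * p x) = (\<lambda>x. (2 * DIM('a) + 4 * k) * p x + (x \<bullet> x) * lap p x)"
proof
  fix x :: 'a
  have "lap (\<lambda>x. (x \<bullet> x) * p x) x =
     (x \<bullet> x) * lap p x + 2 * (\<Sum>b\<in>Basis. pdiff b (\<lambda>x. x \<bullet> x) x * pdiff b p x) + lap (\<lambda>x. x \<bullet> x) x * p x"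
    by (rule lap_mult[of UNIV]) (auto intro: twice_diff_on_norm2 hpoly_twice_diff assms)
  also have "(\<Sum>b\<in>Basis. pdiff b (\<lambda>x. x \<bullet> x) x * pdiff b p x) = 2 * (\<Sum>b\<in>Basis. (x \<bullet> b) * pdiff b p x)"
    by (simp add: pdiff_norm2 sum_distrib_left mult_ac)
  also have "\<dots> = 2 * (k * p x)"
    using hpoly_euler[OF assms, of x] sum_pdiff_Basis[OF hpoly_differentiable[OF assms], of x x] by simp
  finally show "lap (\<lambda>x. (x \<bullet> x) * p x) x = (2 * DIM('a) + 4 * k) * p x + (x \<bullet> x) * lap p x"
    by (simp add: lap_norm2 algebra_simps)
qed

text \<open>The Laplacian is the trace of the Hessian form \<open>Q\<close>, and this trace is the
  same for every orthonormal basis, in particular for the image of the standard one under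
  \<open>g\<close>.\<close>

lemma lap_orthogonal_comp:
  fixes g :: "'a::euclidean_space \<Rightarrow> 'a"
  assumes g: "orthogonal_transformation g" and p: "p \<in> hpoly k"
  shows "lap (\<lambda>x. p (g x)) x = lap p (g x)"
proof -
  have lg: "linear g" using g by (simp add: orthogonal_transformation_def)
  have blg: "bounded_linear g" using lg by (simp add: linear_conv_bounded_linear)
  have p': "pdiff v p \<in> hpoly (k - 1)" for v using hpoly_pdiff[OF p] .
  have 1: "pdiff v (\<lambda>x. p (g x)) = (\<lambda>x. pdiff (g v) p (g x))" for v
    by (rule ext, rule pdiff_linear_comp[OF blg hpoly_differentiable[OF p]])
  have 2: "pdiff v (\<lambda>x. pdiff w p (g x)) x = pdiff (g v) (pdiff w p) (g x)" for v w
    by (rule pdiff_linear_comp[OF blg hpoly_differentiable[OF p']])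
  define y where "y = g x"
  define Q where "Q c d = pdiff c (pdiff d p) y" for c d
  have Q: "Q v w = (\<Sum>c\<in>Basis. \<Sum>d\<in>Basis. (v \<bullet> c) * (w \<bullet> d) * Q c d)" for v w
  proof -
    have "pdiff w p = (\<lambda>x. \<Sum>d\<in>Basis. (w \<bullet> d) * pdiff d p x)"
      using sum_pdiff_Basis[OF hpoly_differentiable[OF p], of w] by auto
    then have "Q v w = pdiff v (\<lambda>x. \<Sum>d\<in>Basis. (w \<bullet> d) * pdiff d p x) y" by (simp add: Q_def)
    also have "\<dots> = (\<Sum>d\<in>Basis. (w \<bullet> d) * Q v d)"
      unfolding Q_def
      by (rule pdiff_eq[where D="\<lambda>v. \<Sum>d\<in>Basis. (w \<bullet> d) * pdiff v (pdiff d p) y"])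
         (auto intro!: derivative_eq_intros has_derivative_pdiff hpoly_differentiable[OF p'])
    also have "\<dots> = (\<Sum>d\<in>Basis. (w \<bullet> d) * (\<Sum>c\<in>Basis. (v \<bullet> c) * Q c d))"
      by (simp add: Q_def sum_pdiff_Basis[OF hpoly_differentiable[OF p']])
    also have "\<dots> = (\<Sum>c\<in>Basis. \<Sum>d\<in>Basis. (v \<bullet> c) * (w \<bullet> d) * Q c d)"
      by (subst sum.swap) (simp add: sum_distrib_left mult_ac)
    finally show ?thesis .
  qed
  have adj: "g (adjoint g z) = z" "g b \<bullet> c = b \<bullet> adjoint g c" for z b c
  proof -
    show *: "g b \<bullet> c = b \<bullet> adjoint g c" for b c using adjoint_works[OF lg] by (simp add: inner_commute)
    obtain w where w: "z = g w" using orthogonal_transformation_surj[OF g] by (metis surjD)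
    have "adjoint g (g w) = w"
      using g by (intro vector_eq_rdot[THEN iffD1]) (metis * inner_commute orthogonal_transformation_def)
    then show "g (adjoint g z) = z" using w by simp
  qed
  \<comment> \<open>Parseval's identity for the basis \<open>g b\<close>: the adjoint is the inverse
    of \<open>g\<close>, hence preserves inner products.\<close>
  have orth: "(\<Sum>b\<in>Basis. (g b \<bullet> c) * (g b \<bullet> d)) = c \<bullet> d" for c d
  proof -
    have "(\<Sum>b\<in>Basis. (g b \<bullet> c) * (g b \<bullet> d)) = (\<Sum>b\<in>Basis. (b \<bullet> adjoint g c) * (b \<bullet> adjoint g d))"
      by (simp only: adj(2))
    also have "\<dots> = adjoint g c \<bullet> adjoint g d"
      by (simp add: euclidean_inner[of "adjoint g c"] inner_commute)
    also have "\<dots> = g (adjoint g c) \<bullet> g (adjoint g d)"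
      using g by (simp add: orthogonal_transformation_def)
    finally show ?thesis by (simp add: adj)
  qed
  have "lap (\<lambda>x. p (g x)) x = (\<Sum>b\<in>Basis. Q (g b) (g b))"
    by (simp add: lap_def 1 2 Q_def y_def)
  also have "\<dots> = (\<Sum>b\<in>Basis. \<Sum>c\<in>Basis. \<Sum>d\<in>Basis. (g b \<bullet> c) * (g b \<bullet> d) * Q c d)"
    by (rule sum.cong[OF refl], rule Q)
  also have "\<dots> = (\<Sum>c\<in>Basis. \<Sum>d\<in>Basis. \<Sum>b\<in>Basis. (g b \<bullet> c) * (g b \<bullet> d) * Q c d)"
    by (subst sum.swap, rule sum.cong[OF refl], subst sum.swap, rule refl)
  also have "\<dots> = (\<Sum>c\<in>Basis. \<Sum>d\<in>Basis. (c \<bullet> d) * Q c d)"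
    by (simp add: sum_distrib_right[symmetric] orth)
  also have "\<dots> = (\<Sum>c\<in>Basis. Q c c)"
    by (intro sum.cong refl) (simp add: inner_Basis if_distrib if_distribR cong: if_cong)
  finally show ?thesis by (simp add: lap_def Q_def y_def)
qed


section \<open>Invariant harmonic polynomials\<close>

text \<open>Any set of maps is allowed. The empty set imposes no condition, so
  \<open>inv_hpoly {}\<close> and \<open>inv_harmonic {}\<close> are the full spaces of polynomials
  and harmonics.\<close>

definition inv_hpoly :: "('a \<Rightarrow> 'a) set \<Rightarrow> nat \<Rightarrow> ('a::euclidean_space \<Rightarrow> real) set" where
  "inv_hpoly \<G> k = {p \<in> hpoly k. \<forall>g\<in>\<G>. \<forall>x. p (g x) = p x}"

definition inv_harmonic :: "('a \<Rightarrow> 'a) set \<Rightarrow> nat \<Rightarrow> ('a::euclidean_space \<Rightarrow> real) set" where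
  "inv_harmonic \<G> k = {p \<in> inv_hpoly \<G> k. lap p = (\<lambda>x. 0)}"

lemma inv_hpolyI:
  "p \<in> hpoly k \<Longrightarrow> (\<And>g x. g \<in> \<G> \<Longrightarrow> p (g x) = p x) \<Longrightarrow> p \<in> inv_hpoly \<G> k"
  unfolding inv_hpoly_def by blast

lemma inv_hpolyD:
  "p \<in> inv_hpoly \<G> k \<Longrightarrow> p \<in> hpoly k"
  "p \<in> inv_hpoly \<G> k \<Longrightarrow> g \<in> \<G> \<Longrightarrow> p (g x) = p x"
  unfolding inv_hpoly_def by blast+

lemma inv_harmonicD:
  "p \<in> inv_harmonic \<G> k \<Longrightarrow> p \<in> inv_hpoly \<G> k" "p \<in> inv_harmonic \<G> k \<Longrightarrow> lap p = (\<lambda>x. 0)"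
  unfolding inv_harmonic_def by blast+

lemma inv_harmonicI: "p \<in> inv_hpoly \<G> k \<Longrightarrow> lap p = (\<lambda>x. 0) \<Longrightarrow> p \<in> inv_harmonic \<G> k"
  unfolding inv_harmonic_def by blast

lemma hpoly_add: "p \<in> hpoly k \<Longrightarrow> q \<in> hpoly k \<Longrightarrow> (\<lambda>x. p x + q x) \<in> hpoly k"
  and hpoly_diff: "p \<in> hpoly k \<Longrightarrow> q \<in> hpoly k \<Longrightarrow> (\<lambda>x. p x - q x) \<in> hpoly k"
  and hpoly_cmult: "p \<in> hpoly k \<Longrightarrow> (\<lambda>x. c * p x) \<in> hpoly k"
  and hpoly_zero: "(\<lambda>x. 0) \<in> hpoly k"
  by (simp_all add: hpoly_def hpoly_of_add hpoly_of_diff hpoly_of_cmult)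

lemma hpoly_norm2_mult: "p \<in> hpoly k \<Longrightarrow> (\<lambda>x. (x \<bullet> x) * p x) \<in> hpoly (k + 2)"
  using hpoly_of_mult[OF hpoly_norm2[unfolded hpoly_def], of p k] by (simp add: hpoly_def add.commute)

lemma lap_hpoly_add: "p \<in> hpoly k \<Longrightarrow> q \<in> hpoly j \<Longrightarrow> lap (\<lambda>x. p x + q x) = (\<lambda>x. lap p x + lap q x)"
  using lap_add[OF open_UNIV UNIV_I hpoly_twice_diff hpoly_twice_diff, of p k q j] by blast

lemma lap_hpoly_cmult: "p \<in> hpoly k \<Longrightarrow> lap (\<lambda>x. c * p x) = (\<lambda>x. c * lap p x)"
  using lap_cmult[OF open_UNIV UNIV_I hpoly_twice_diff, of p k] by blast

lemma lap_hpoly_diff: "p \<in> hpoly k \<Longrightarrow> q \<in> hpoly j \<Longrightarrow> lap (\<lambda>x. p x - q x) = (\<lambda>x. lap p x - lap q x)"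
  using lap_hpoly_add[of p k "\<lambda>x. -1 * q x" j] lap_hpoly_cmult[of q j "-1"] hpoly_cmult[of q j "-1"] by simp

text \<open>The operator \<open>p \<mapsto> \<Delta>(r\<^sup>2p) + cp\<close> is bijective on homogeneous polynomials of a given degree
  for \<open>c \<ge> 0\<close>: since it equals \<open>ap + r\<^sup>2\<Delta>p\<close> with \<open>a = 2n + 4k + c > 0\<close>, applying \<open>\<Delta>\<close> reduces
  the equation for \<open>p\<close> to one for \<open>\<Delta>p\<close>, of the same shape and with \<open>c\<close> replaced by \<open>a\<close>.\<close>

lemma lap_norm2_mult_inj:
  fixes p :: "'a::euclidean_space \<Rightarrow> real"
  assumes "p \<in> hpoly k" "c \<ge> 0" "\<And>x. lap (\<lambda>x. (x \<bullet> x) * p x) x + c * p x = 0"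
  shows "p = (\<lambda>x. 0)"
  using assms
proof (induction k arbitrary: p c rule: less_induct)
  case (less k)
  define a where "a = real (2 * DIM('a) + 4 * k) + c"
  have a: "a > 0" using less.prems(2) by (simp add: a_def add_pos_nonneg)
  have eq: "a * p x + (x \<bullet> x) * lap p x = 0" for x
    using less.prems(3)[of x] lap_norm2_mult[OF less.prems(1)] by (simp add: a_def algebra_simps)
  have "lap p = (\<lambda>x. 0)"
  proof (cases "k < 2")
    case True
    then show ?thesis using hpoly_lap_0 less.prems(1) by blast
  next
    case False
    have lp: "lap p \<in> hpoly (k - 2)" by (rule hpoly_lap[OF less.prems(1)])
    show ?thesis
    proof (rule less.IH[OF _ lp, of a])
      fix x
      have "lap (\<lambda>x. a * p x + (x \<bullet> x) * lap p x) x = 0" by (simp add: eq)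
      also have "lap (\<lambda>x. a * p x + (x \<bullet> x) * lap p x) x = a * lap p x + lap (\<lambda>x. (x \<bullet> x) * lap p x) x"
        by (simp add: lap_hpoly_add[OF hpoly_cmult[OF less.prems(1)] hpoly_norm2_mult[OF lp]]
            lap_hpoly_cmult[OF less.prems(1)])
      finally show "lap (\<lambda>x. (x \<bullet> x) * lap p x) x + a * lap p x = 0" by simp
    qed (use False a in auto)
  qed
  then show ?case using eq a by auto
qed

lemma inv_hpoly_lap:
  assumes "\<And>g. g \<in> \<G> \<Longrightarrow> orthogonal_transformation g" "p \<in> inv_hpoly \<G> k"
  shows "lap p \<in> inv_hpoly \<G> (k - 2)"
proof -
  note p = inv_hpolyD(1)[OF assms(2)]
  have "lap p (g x) = lap p x" if "g \<in> \<G>" for g x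
    using lap_orthogonal_comp[OF assms(1)[OF that] p, of x] inv_hpolyD(2)[OF assms(2) that] by simp
  then show ?thesis using hpoly_lap[OF p] by (intro inv_hpolyI)
qed

text \<open>\<open>P\<close>, which will turn out to be the Laplacian of \<open>p\<close>, is
  constructed first in degree k - 2 with constant \<open>a\<close>; then p = (q - r^2 P) / a. Each
  step visibly preserves invariance.\<close>

lemma lap_norm2_mult_surj:
  fixes q :: "'a::euclidean_space \<Rightarrow> real"
  assumes "\<And>g. g \<in> \<G> \<Longrightarrow> orthogonal_transformation g"
    and "q \<in> inv_hpoly \<G> k" "c \<ge> 0"
  shows "\<exists>p\<in>inv_hpoly \<G> k. \<forall>x. lap (\<lambda>x. (x \<bullet> x) * p x) x + c * p x = q x"
  using assms(2,3)
proof (induction k arbitrary: q c rule: less_induct)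
  case (less k)
  define a where "a = real (2 * DIM('a) + 4 * k) + c"
  have a: "a > 0" using less.prems(2) by (simp add: a_def add_pos_nonneg)
  note q = inv_hpolyD(1)[OF less.prems(1)]
  \<comment> \<open>The degree is stated for r^2 P and not for \<open>P\<close>, because k - 2 is
    truncated for k < 2, where \<open>P\<close> is 0.\<close>
  have "\<exists>P. (\<lambda>x. (x \<bullet> x) * P x) \<in> hpoly k \<and> (\<forall>g\<in>\<G>. \<forall>x. P (g x) = P x) \<and>
      (\<forall>x. lap (\<lambda>x. (x \<bullet> x) * P x) x + a * P x = lap q x)"
  proof (cases "k < 2")
    case True
    then show ?thesis using hpoly_lap_0[OF q True] by (intro exI[of _ "\<lambda>x. 0"]) (auto simp: hpoly_zero)
  next
    case False
    obtain P where P: "P \<in> inv_hpoly \<G> (k - 2)" "\<And>x. lap (\<lambda>x. (x \<bullet> x) * P x) x + a * P x = lap q x"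
      using less.IH[OF _ inv_hpoly_lap[OF assms(1) less.prems(1)], of a] False a by (metis diff_less less_imp_le not_less pos2 order.strict_trans2)
    then have "(\<lambda>x. (x \<bullet> x) * P x) \<in> hpoly (k - 2 + 2)"
      by (intro hpoly_norm2_mult inv_hpolyD(1))
    moreover have "k - 2 + 2 = k" using False by simp
    ultimately show ?thesis using P(2) inv_hpolyD(2)[OF P(1)] by (intro exI[of _ P]) metis
  qed
  then obtain P where P: "(\<lambda>x. (x \<bullet> x) * P x) \<in> hpoly k" "\<And>g x. g \<in> \<G> \<Longrightarrow> P (g x) = P x"
      "\<And>x. lap (\<lambda>x. (x \<bullet> x) * P x) x + a * P x = lap q x" by blast
  define p where "p x = (1 / a) * (q x - (x \<bullet> x) * P x)" for x
  have ph: "p \<in> hpoly k" unfolding p_def[abs_def] by (intro hpoly_cmult hpoly_diff q P)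
  have "g x \<bullet> g x = x \<bullet> x" if "g \<in> \<G>" for g x using assms(1)[OF that] by (simp add: orthogonal_transformation_def)
  then have pi: "p \<in> inv_hpoly \<G> k"
    using P(2) inv_hpolyD(2)[OF less.prems(1)] by (intro inv_hpolyI ph) (simp add: p_def)
  have lp: "lap p x = P x" for x
  proof -
    have "lap p x = (1 / a) * (lap q x - lap (\<lambda>x. (x \<bullet> x) * P x) x)"
      unfolding p_def[abs_def] by (simp only: lap_hpoly_cmult[OF hpoly_diff[OF q P(1)]] lap_hpoly_diff[OF q P(1)])
    also have "\<dots> = P x" using P(3)[of x] a by (simp add: field_simps)
    finally show ?thesis .
  qed
  have "lap (\<lambda>x. (x \<bullet> x) * p x) x + c * p x = q x" for x
  proof -
    have "lap (\<lambda>x. (x \<bullet> x) * p x) x + c * p x = a * p x + (x \<bullet> x) * lap p x"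
      using lap_norm2_mult[OF ph] by (simp add: a_def algebra_simps)
    also have "\<dots> = q x" unfolding lp using a by (simp add: p_def)
    finally show ?thesis .
  qed
  with pi show ?case by blast
qed

text \<open>The case c = 0 of the preceding lemma provides q such that r^2 q has the same Laplacian
  as p.\<close>

lemma harmonic_decomposition:
  assumes "\<And>g. g \<in> \<G> \<Longrightarrow> orthogonal_transformation g" "p \<in> inv_hpoly \<G> (k + 2)"
  obtains h q where "h \<in> inv_harmonic \<G> (k + 2)" "q \<in> inv_hpoly \<G> k" "p = (\<lambda>x. h x + (x \<bullet> x) * q x)"
proof -
  obtain q where q: "q \<in> inv_hpoly \<G> k" "\<And>x. lap (\<lambda>x. (x \<bullet> x) * q x) x = lap p x"
    using lap_norm2_mult_surj[OF assms(1) inv_hpoly_lap[OF assms], of 0] by auto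
  define h where "h x = p x - (x \<bullet> x) * q x" for x
  note p = inv_hpolyD(1)[OF assms(2)]
  have rq: "(\<lambda>x. (x \<bullet> x) * q x) \<in> hpoly (k + 2)" using q by (intro hpoly_norm2_mult inv_hpolyD(1))
  have "h \<in> hpoly (k + 2)" unfolding h_def[abs_def] by (intro hpoly_diff p rq)
  moreover have "g x \<bullet> g x = x \<bullet> x" if "g \<in> \<G>" for g x using assms(1)[OF that] by (simp add: orthogonal_transformation_def)
  ultimately have "h \<in> inv_hpoly \<G> (k + 2)"
    using inv_hpolyD(2)[OF assms(2)] inv_hpolyD(2)[OF q(1)] by (intro inv_hpolyI) (simp_all add: h_def)
  moreover have "lap h = (\<lambda>x. 0)" unfolding h_def[abs_def] lap_hpoly_diff[OF p rq] using q by simp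
  ultimately show ?thesis using q that[of h q] by (simp add: inv_harmonic_def h_def)
qed

lemma subspace_inv_hpoly: "fun_vs.subspace (inv_hpoly \<G> k)"
  by (rule fun_vs.subspaceI)
     (simp_all add: inv_hpoly_def zero_fun_def plus_fun_def hpoly_zero hpoly_add hpoly_cmult)

lemma subspace_inv_harmonic: "fun_vs.subspace (inv_harmonic \<G> k)"
proof (rule fun_vs.subspaceI)
  show "0 \<in> inv_harmonic \<G> k"
    using fun_vs.subspace_0[OF subspace_inv_hpoly] by (auto simp: inv_harmonic_def zero_fun_def)
next
  fix p q :: "'a \<Rightarrow> real" and c assume p: "p \<in> inv_harmonic \<G> k"
  show "(\<lambda>x. c * p x) \<in> inv_harmonic \<G> k"
    using fun_vs.subspace_scale[OF subspace_inv_hpoly inv_harmonicD(1)[OF p], of c]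
      lap_hpoly_cmult[OF inv_hpolyD(1)[OF inv_harmonicD(1)[OF p]], of c] inv_harmonicD(2)[OF p]
    by (intro inv_harmonicI) simp_all
  assume q: "q \<in> inv_harmonic \<G> k"
  have "p + q \<in> inv_hpoly \<G> k" using fun_vs.subspace_add[OF subspace_inv_hpoly] inv_harmonicD(1) p q
    by blast
  moreover have "lap (p + q) = (\<lambda>x. 0)"
    using lap_hpoly_add[OF inv_hpolyD(1)[OF inv_harmonicD(1)[OF p]] inv_hpolyD(1)[OF inv_harmonicD(1)[OF q]]]
    by (simp add: inv_harmonicD(2)[OF p] inv_harmonicD(2)[OF q] plus_fun_def)
  ultimately show "p + q \<in> inv_harmonic \<G> k" by (simp add: inv_harmonic_def)
qed

lemma finite_msets_of_size: "finite X \<Longrightarrow> finite (msets_of_size X k)"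
proof (induction k)
  case 0 then show ?case by (simp add: msets_of_size_def)
next
  case (Suc k)
  have "msets_of_size X (Suc k) \<subseteq> (\<lambda>(b, M). add_mset b M) ` (X \<times> msets_of_size X k)"
  proof
    fix M assume M: "M \<in> msets_of_size X (Suc k)"
    then obtain b M' where "M = add_mset b M'" by (auto simp: msets_of_size_def dest!: size_eq_Suc_imp_eq_union)
    then show "M \<in> (\<lambda>(b, M). add_mset b M) ` (X \<times> msets_of_size X k)"
      using M by (force simp: msets_of_size_def)
  qed
  then show ?case using Suc by (auto intro: finite_subset)
qed

text \<open>The finitely many monomials of degree k bound the size of every independent set, so
  \<open>dim\<close> is here the size of an actual basis.\<close>

lemma finite_basis_hpoly_subspace:
  assumes "W \<subseteq> hpoly k"
  obtains B where "finite B" "fun_vs.independent B" "B \<subseteq> W" "W \<subseteq> fun_vs.span B" "card B = fun_vs.dim W"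
proof -
  obtain B where B: "B \<subseteq> W" "fun_vs.independent B" "W \<subseteq> fun_vs.span B" "card B = fun_vs.dim W"
    by (rule fun_vs.basis_exists)
  moreover have "finite B"
    using fun_vs.independent_span_bound[OF finite_imageI[OF finite_msets_of_size[OF finite_Basis]] B(2)]
      B(1) assms unfolding hpoly_def hpoly_of_def by blast
  ultimately show ?thesis using that by blast
qed

context vector_space begin

lemma dim_direct_sum:
  assumes fin: "finite A" "finite B" and ind: "independent A" "independent B"
    and int: "\<And>x. x \<in> span A \<Longrightarrow> x \<in> span B \<Longrightarrow> x = 0"
    and V: "\<And>x. x \<in> V \<longleftrightarrow> (\<exists>a\<in>span A. \<exists>b\<in>span B. x = a + b)"
  shows "dim V = card A + card B"
proof -
  have disj: "A \<inter> B = {}"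
    using int span_base ind(1) dependent_zero by blast
  have "independent (A \<union> B)"
  proof (rule independent_if_scalars_zero)
    fix f x assume 0: "(\<Sum>x\<in>A \<union> B. scale (f x) x) = 0" and x: "x \<in> A \<union> B"
    have "(\<Sum>x\<in>A. scale (f x) x) + (\<Sum>x\<in>B. scale (f x) x) = 0"
      using 0 by (simp add: sum.union_disjoint[OF fin disj])
    then have eq: "(\<Sum>x\<in>A. scale (f x) x) = - (\<Sum>x\<in>B. scale (f x) x)" by (simp add: eq_neg_iff_add_eq_0)
    have "(\<Sum>x\<in>A. scale (f x) x) \<in> span A" "- (\<Sum>x\<in>B. scale (f x) x) \<in> span B"
      by (intro span_neg span_sum span_scale span_base; simp)+
    then have "(\<Sum>x\<in>A. scale (f x) x) = 0" using eq int by metis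
    moreover from this have "(\<Sum>x\<in>B. scale (f x) x) = 0" using eq by simp
    ultimately show "f x = 0"
      using x independentD[OF ind(1) fin(1) order_refl] independentD[OF ind(2) fin(2) order_refl] by blast
  qed (use fin in auto)
  moreover have "span (A \<union> B) = V"
    by (auto simp: span_Un) (use V in blast)+
  ultimately have "dim V = card (A \<union> B)" using dim_eq_card by (metis span_span)
  then show ?thesis using fin disj by (simp add: card_Un_disjoint)
qed

end

lemma fun_vs_linear_mult:
  "Vector_Spaces.linear (\<lambda>(c::'k::field) (f::'a \<Rightarrow> 'k) P. c * f P) (\<lambda>c f P. c * f P) (\<lambda>f P. w P * f P)"
  by unfold_locales (auto simp: fun_eq_iff algebra_simps)

lemma norm2_mult_inj:
  assumes "p \<in> hpoly k" "(\<lambda>x. (x \<bullet> x) * p x) = (\<lambda>x. 0)" shows "p = (\<lambda>x. 0)"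
  by (rule lap_norm2_mult_inj[OF assms(1), of 0]) (simp_all add: assms(2))

text \<open>Multiplication by r^2 embeds degree k as a complement of the harmonic part of degree k +
  2: if r^2 q is harmonic, then q = 0. The relation converts multiplicities in the spectrum into
  dimensions that Molien's formula computes.\<close>

lemma dim_inv_hpoly_Suc_Suc:
  assumes "\<And>g. g \<in> \<G> \<Longrightarrow> orthogonal_transformation g"
  shows "fun_vs.dim (inv_hpoly \<G> (k + 2)) = fun_vs.dim (inv_harmonic \<G> (k + 2)) + fun_vs.dim (inv_hpoly \<G> k)"
proof -
  obtain A where A: "finite A" "fun_vs.independent A" "A \<subseteq> inv_harmonic \<G> (k + 2)"
      "inv_harmonic \<G> (k + 2) \<subseteq> fun_vs.span A" "card A = fun_vs.dim (inv_harmonic \<G> (k + 2))"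
    using finite_basis_hpoly_subspace[of "inv_harmonic \<G> (k + 2)" "k + 2"]
      inv_harmonicD(1) inv_hpolyD(1) by blast
  obtain B where B: "finite B" "fun_vs.independent B" "B \<subseteq> inv_hpoly \<G> k"
      "inv_hpoly \<G> k \<subseteq> fun_vs.span B" "card B = fun_vs.dim (inv_hpoly \<G> k)"
    using finite_basis_hpoly_subspace[of "inv_hpoly \<G> k" k] inv_hpolyD(1) by blast
  define T where "T = (\<lambda>(f::'a \<Rightarrow> real) x. (x \<bullet> x) * f x)"
  interpret T: Vector_Spaces.linear "\<lambda>c f P. c * f P" "\<lambda>c f P. c * f P" T
    unfolding T_def by (rule fun_vs_linear_mult)
  have spA: "fun_vs.span A = inv_harmonic \<G> (k + 2)"
    using A fun_vs.span_minimal[OF A(3) subspace_inv_harmonic] by blast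
  have spB: "fun_vs.span B = inv_hpoly \<G> k"
    using B fun_vs.span_minimal[OF B(3) subspace_inv_hpoly] by blast
  have inj: "inj_on T (fun_vs.span B)"
  proof (rule T.inj_on_iff_eq_0[THEN iffD2], rule fun_vs.subspace_span, safe)
    fix p assume "p \<in> fun_vs.span B" "T p = 0"
    then show "p = 0" using norm2_mult_inj[of p k] inv_hpolyD(1)[of p] by (simp add: spB T_def zero_fun_def)
  qed
  have ind: "fun_vs.independent (T ` B)" by (rule T.independent_injective_image[OF B(2) inj])
  have card: "card (T ` B) = card B"
    using inj fun_vs.span_superset by (metis card_image inj_on_subset)
  have "fun_vs.dim (inv_hpoly \<G> (k + 2)) = card A + card (T ` B)"
  proof (rule fun_vs.dim_direct_sum[OF A(1) finite_imageI[OF B(1)] A(2) ind])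
    fix p assume p: "p \<in> fun_vs.span A" "p \<in> fun_vs.span (T ` B)"
    then obtain q where q: "q \<in> inv_hpoly \<G> k" "p = T q" using T.span_image spB by auto
    have "lap (T q) = (\<lambda>x. 0)" using p q spA inv_harmonicD(2) by blast
    then have "q = (\<lambda>x. 0)" using lap_norm2_mult_inj[OF inv_hpolyD(1)[OF q(1)], of 0] by (simp add: T_def)
    then show "p = 0" using q(2) by (simp add: T_def zero_fun_def)
  next
    fix p show "p \<in> inv_hpoly \<G> (k + 2) \<longleftrightarrow> (\<exists>a\<in>fun_vs.span A. \<exists>b\<in>fun_vs.span (T ` B). p = a + b)"
    proof
      assume "p \<in> inv_hpoly \<G> (k + 2)"
      from harmonic_decomposition[OF assms this] obtain h q where
        "h \<in> inv_harmonic \<G> (k + 2)" "q \<in> inv_hpoly \<G> k" "p = (\<lambda>x. h x + (x \<bullet> x) * q x)" by blast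
      then show "\<exists>a\<in>fun_vs.span A. \<exists>b\<in>fun_vs.span (T ` B). p = a + b"
        unfolding T.span_image spA spB by (intro bexI[of _ h] bexI[of _ "T q"] imageI) (simp_all add: T_def plus_fun_def)
    next
      assume "\<exists>a\<in>fun_vs.span A. \<exists>b\<in>fun_vs.span (T ` B). p = a + b"
      then obtain a q where aq: "a \<in> inv_harmonic \<G> (k + 2)" "q \<in> inv_hpoly \<G> k" "p = a + T q"
        by (auto simp: T.span_image spA spB)
      have "g x \<bullet> g x = x \<bullet> x" if "g \<in> \<G>" for g x
        using assms(1)[OF that] by (simp add: orthogonal_transformation_def)
      then have "T q \<in> inv_hpoly \<G> (k + 2)" unfolding T_def
        using inv_hpolyD(2)[OF aq(2)] by (intro inv_hpolyI hpoly_norm2_mult inv_hpolyD(1)[OF aq(2)]) simp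
      then show "p \<in> inv_hpoly \<G> (k + 2)"
        using aq(3) fun_vs.subspace_add[OF subspace_inv_hpoly inv_harmonicD(1)[OF aq(1)]] by simp
    qed
  qed
  then show ?thesis using A B card by simp
qed

lemma inv_harmonic_low_degree: "k < 2 \<Longrightarrow> inv_harmonic \<G> k = inv_hpoly \<G> k"
  using hpoly_lap_0 inv_hpolyD(1) unfolding inv_harmonic_def by blast


section \<open>The Laplacian on the sphere\<close>

text \<open>The difference quotients have integral 0 by translation invariance of Lebesgue measure
  and converge to the derivative. They are bounded by \<open>K\<close>, and as the steps are at most
  1, they vanish outside the ball of radius R + |b|; so dominated convergence applies.\<close>

lemma integral_pdiff_eq_0:
  fixes f :: "'a::euclidean_space \<Rightarrow> real"
  assumes diff: "\<And>x. f differentiable (at x)"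
    and cont: "continuous_on UNIV (pdiff b f)"
    and supp: "\<And>x. norm x \<ge> R \<Longrightarrow> f x = 0"
  shows "integral\<^sup>L lborel (pdiff b f) = 0"
proof -
  have contf: "continuous_on A f" for A
    by (meson diff continuous_at_imp_continuous_on differentiable_imp_continuous_within)
  have supp': "pdiff b f x = 0" if "norm x > R" for x
  proof -
    have "pdiff b f x = pdiff b (\<lambda>x. 0) x"
      by (rule pdiff_cong_open[of "- cball 0 R"]) (use that supp in auto)
    then show ?thesis by simp
  qed
  have "bounded (pdiff b f ` cball 0 R)"
    by (intro compact_imp_bounded compact_continuous_image) (auto intro: continuous_on_subset[OF cont])
  then obtain K0 where K0: "\<And>x. x \<in> cball 0 R \<Longrightarrow> \<bar>pdiff b f x\<bar> \<le> K0"
    unfolding bounded_iff by (metis image_eqI real_norm_def)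
  define K where "K = max K0 0"
  have K: "\<bar>pdiff b f x\<bar> \<le> K" for x
    using K0[of x] supp'[of x] by (cases "norm x \<le> R") (auto simp: K_def)
  have K_nonneg: "K \<ge> 0" by (simp add: K_def)
  have deriv: "((\<lambda>t. f (x + t *\<^sub>R b)) has_real_derivative pdiff b f (x + t *\<^sub>R b)) (at t)" for x t
  proof -
    interpret l: linear "\<lambda>v. pdiff v f (x + t *\<^sub>R b)" by (rule pdiff_linear[OF diff])
    have "((\<lambda>t. f (x + t *\<^sub>R b)) has_derivative (\<lambda>s. pdiff (s *\<^sub>R b) f (x + t *\<^sub>R b))) (at t)"
      by (rule has_derivative_compose[OF _ has_derivative_pdiff[OF diff], where f="\<lambda>t. x + t *\<^sub>R b"])
         (auto intro!: derivative_eq_intros)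
    then show ?thesis by (simp add: has_field_derivative_def l.scale mult_commute_abs)
  qed
  have lip: "\<bar>f (x + t *\<^sub>R b) - f x\<bar> \<le> K * t" if t: "t > 0" for x t
  proof -
    obtain s where "0 < s" "s < t" "f (x + t *\<^sub>R b) - f (x + 0 *\<^sub>R b) = (t - 0) * pdiff b f (x + s *\<^sub>R b)"
      using MVT2[OF t deriv[of x]] by blast
    then show ?thesis using t K[of "x + s *\<^sub>R b"] by (simp add: abs_mult mult.commute mult_left_mono)
  qed
  define h where "h n = 1 / real (Suc n)" for n
  have h: "0 < h n" "h n \<le> 1" for n by (auto simp: h_def)
  define s where "s n x = (f (x + h n *\<^sub>R b) - f x) / h n" for n x
  have int0: "integrable lborel f"
  proof -
    have "f = (\<lambda>x. indicator (cball 0 R) x *\<^sub>R f x)"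
      using supp by (auto simp: fun_eq_iff indicator_def not_le intro: less_imp_le)
    then show ?thesis using borel_integrable_compact[of "cball 0 R" f] contf by (metis compact_cball)
  qed
  have shift: "integrable lborel (\<lambda>x. f (x + c))" "integral\<^sup>L lborel (\<lambda>x. f (x + c)) = integral\<^sup>L lborel f" for c
  proof -
    have m: "f \<in> borel_measurable borel" using contf borel_measurable_continuous_onI by blast
    have "integrable (distr lborel borel ((+) c)) f" using int0 by (simp add: lborel_distr_plus)
    then show "integrable lborel (\<lambda>x. f (x + c))"
      using m by (subst (asm) integrable_distr_eq) (auto simp: add.commute)
    have "integral\<^sup>L lborel f = integral\<^sup>L (distr lborel borel ((+) c)) f" by (simp add: lborel_distr_plus)
    also have "\<dots> = integral\<^sup>L lborel (\<lambda>x. f (c + x))" using m by (intro integral_distr) auto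
    finally show "integral\<^sup>L lborel (\<lambda>x. f (x + c)) = integral\<^sup>L lborel f" by (simp add: add.commute)
  qed
  have "(\<lambda>n. integral\<^sup>L lborel (s n)) \<longlonglongrightarrow> integral\<^sup>L lborel (pdiff b f)"
  proof (rule integral_dominated_convergence[where w="\<lambda>x. indicator (cball 0 (R + norm b)) x *\<^sub>R K"])
    show "pdiff b f \<in> borel_measurable lborel" using cont by (simp add: borel_measurable_continuous_onI)
    show "s n \<in> borel_measurable lborel" for n
      unfolding s_def using int0 shift by (intro borel_measurable_divide borel_measurable_diff) auto
    show "integrable lborel (\<lambda>x. indicator (cball 0 (R + norm b)) x *\<^sub>R K)"
      by (rule borel_integrable_compact) auto
    show "AE x in lborel. (\<lambda>n. s n x) \<longlonglongrightarrow> pdiff b f x"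
    proof (rule AE_I2)
      fix x
      have "((\<lambda>t. (f (x + t *\<^sub>R b) - f x) / t) \<longlongrightarrow> pdiff b f x) (at 0)"
        using deriv[of x 0] by (simp add: has_field_derivative_iff)
      moreover have "filterlim h (at 0) sequentially"
        unfolding filterlim_at using h(1) LIMSEQ_Suc[OF lim_inverse_n'] unfolding h_def
        by (auto intro!: always_eventually)
      ultimately show "(\<lambda>n. s n x) \<longlonglongrightarrow> pdiff b f x"
        unfolding s_def by (rule filterlim_compose)
    qed
    show "AE x in lborel. norm (s n x) \<le> indicator (cball 0 (R + norm b)) x *\<^sub>R K" for n
    proof (rule AE_I2)
      fix x
      show "norm (s n x) \<le> indicator (cball 0 (R + norm b)) x *\<^sub>R K"
      proof (cases "norm x \<le> R + norm b")
        case True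
        have "\<bar>f (x + h n *\<^sub>R b) - f x\<bar> \<le> K * h n" by (rule lip[OF h(1)])
        then show ?thesis using True h(1)[of n] by (simp add: s_def abs_divide pos_divide_le_eq)
      next
        case False
        have "norm x \<le> norm (x + h n *\<^sub>R b) + norm (h n *\<^sub>R b)" by (metis add_diff_cancel norm_triangle_ineq4)
        moreover have "norm (h n *\<^sub>R b) \<le> norm b" using h[of n] by (simp add: mult_left_le_one_le)
        ultimately have "norm (x + h n *\<^sub>R b) \<ge> R" using False by linarith
        moreover have "norm x \<ge> R" using False norm_ge_zero[of b] by linarith
        ultimately show ?thesis using supp False K_nonneg by (simp add: s_def)
      qed
    qed
  qed
  moreover have "integral\<^sup>L lborel (s n) = 0" for n
    unfolding s_def using shift[of "h n *\<^sub>R b"] int0 by simp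
  ultimately have "(\<lambda>n. 0) \<longlonglongrightarrow> integral\<^sup>L lborel (pdiff b f)" by simp
  then show ?thesis by (simp add: LIMSEQ_const_iff)
qed

lemma differentiable_imp_continuous_on_at:
  "(\<And>x. x \<in> A \<Longrightarrow> f differentiable (at x)) \<Longrightarrow> continuous_on A f"
  by (meson continuous_at_imp_continuous_on differentiable_imp_continuous_within)

section \<open>A radial cutoff on the annulus between radii 1 and 2\<close>

text \<open>The argument is the squared norm, so the bounds 1 and 4 are the squares of the radii.
  Vanishing near the origin removes the singularity of radial extensions, vanishing far out gives
  compact support, and the square makes the function continuously differentiable at both
  ends.\<close>

definition cutoff :: "real \<Rightarrow> real" where
  "cutoff s = (max 0 ((s - 1) * (4 - s)))\<^sup>2"

definition cutoff' :: "real \<Rightarrow> real" where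
  "cutoff' s = 2 * max 0 ((s - 1) * (4 - s)) * (5 - 2 * s)"

lemma DERIV_max_0_square: "((\<lambda>y::real. (max 0 y)\<^sup>2) has_real_derivative 2 * max 0 y) (at y)"
proof -
  consider "y > 0" | "y < 0" | "y = 0" by linarith
  then show ?thesis
  proof cases
    case 1
    have "((\<lambda>y. y\<^sup>2) has_real_derivative 2 * max 0 y) (at y)"
      using 1 by (auto intro!: derivative_eq_intros)
    then show ?thesis
      by (rule has_field_derivative_transform_within_open[of _ _ _ "{0<..}"]) (use 1 in auto)
  next
    case 2
    have "((\<lambda>y. 0) has_real_derivative 2 * max 0 y) (at y)"
      using 2 by (auto intro!: derivative_eq_intros)
    then show ?thesis
      by (rule has_field_derivative_transform_within_open[of _ _ _ "{..<0}"]) (use 2 in auto)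
  next
    case 3
    have "((\<lambda>h::real. (max 0 h)\<^sup>2 / h) \<longlongrightarrow> 0) (at 0)"
    proof (rule Lim_null_comparison)
      show "\<forall>\<^sub>F h in at 0. norm ((max 0 h)\<^sup>2 / h) \<le> \<bar>h::real\<bar>"
        by (auto intro!: always_eventually simp: max_def power2_eq_square)
      show "((\<lambda>h::real. \<bar>h\<bar>) \<longlongrightarrow> 0) (at 0)" by (intro tendsto_eq_intros) auto
    qed
    then show ?thesis using 3 by (simp add: has_field_derivative_iff)
  qed
qed

lemma DERIV_cutoff: "(cutoff has_real_derivative cutoff' s) (at s)"
proof -
  have "((\<lambda>s. (s - 1) * (4 - s)) has_real_derivative (5 - 2 * s)) (at s)"
    by (auto intro!: derivative_eq_intros simp: algebra_simps)
  from DERIV_chain2[OF DERIV_max_0_square this] show ?thesis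
    by (simp add: cutoff_def[abs_def] cutoff'_def)
qed

lemma cutoff_nonneg: "cutoff s \<ge> 0" by (simp add: cutoff_def)

lemma cutoff_pos: "1 < s \<Longrightarrow> s < 4 \<Longrightarrow> cutoff s > 0" by (simp add: cutoff_def)

lemma cutoff_zero: "s \<le> 1 \<or> s \<ge> 4 \<Longrightarrow> cutoff s = 0"
  by (auto simp: cutoff_def max_def mult_le_0_iff zero_le_mult_iff)

lemma continuous_cutoff: "continuous_on A cutoff" "continuous_on A cutoff'"
  unfolding cutoff_def[abs_def] cutoff'_def[abs_def] by (intro continuous_intros)+

section \<open>Functions constant along rays and the spherical Laplacian\<close>

lemma radial_ext_scale: "c > 0 \<Longrightarrow> radial_ext u (c *\<^sub>R x) = radial_ext u x"
proof -
  assume "c > 0"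
  then have "inverse (norm (c *\<^sub>R x)) *\<^sub>R (c *\<^sub>R x) = inverse (norm x) *\<^sub>R x" by simp
  then show ?thesis by (simp only: radial_ext_def)
qed

lemma pdiff_radial_ext_scale:
  fixes u :: "'a::euclidean_space \<Rightarrow> real"
  assumes c: "c > 0" and F: "radial_ext u differentiable (at (c *\<^sub>R x))"
  shows "pdiff v (radial_ext u) (c *\<^sub>R x) = pdiff v (radial_ext u) x / c"
proof -
  interpret l: linear "\<lambda>v. pdiff v (radial_ext u) (c *\<^sub>R x)" by (rule pdiff_linear[OF F])
  have "radial_ext u = (\<lambda>x. radial_ext u (c *\<^sub>R x))" using radial_ext_scale[OF c] by metis
  then have "pdiff v (radial_ext u) x = pdiff v (\<lambda>x. radial_ext u (c *\<^sub>R x)) x" by simp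
  also have "\<dots> = pdiff (c *\<^sub>R v) (radial_ext u) (c *\<^sub>R x)"
    by (rule pdiff_linear_comp[OF bounded_linear_scaleR_right F])
  finally show ?thesis using c by (simp add: l.scale)
qed

lemma pdiff_radial_ext_self:
  fixes u :: "'a::euclidean_space \<Rightarrow> real"
  assumes F: "radial_ext u differentiable (at x)"
  shows "pdiff x (radial_ext u) x = 0"
proof -
  interpret l: linear "\<lambda>v. pdiff v (radial_ext u) x" by (rule pdiff_linear[OF F])
  have "((\<lambda>t. radial_ext u (t *\<^sub>R x)) has_derivative (\<lambda>s. pdiff (s *\<^sub>R x) (radial_ext u) x)) (at (1::real))"
    by (rule has_derivative_compose[where f="\<lambda>t. t *\<^sub>R x"])
       (use has_derivative_pdiff[OF F] in \<open>auto intro!: derivative_eq_intros\<close>)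
  moreover have "((\<lambda>t. radial_ext u (t *\<^sub>R x)) has_derivative (\<lambda>s. 0)) (at (1::real))"
    by (subst has_derivative_cong_open[of "{0<..}" _ _ "\<lambda>_. radial_ext u x"]) (auto simp: radial_ext_scale)
  ultimately have "(\<lambda>s. pdiff (s *\<^sub>R x) (radial_ext u) x) = (\<lambda>s::real. 0)"
    by (rule has_derivative_unique)
  from fun_cong[OF this, of 1] show ?thesis by simp
qed

text \<open>The regularity that Green's formula uses: continuity of the second derivatives makes the
  divergence integrable.\<close>

definition C2_sphere :: "('a::euclidean_space \<Rightarrow> real) \<Rightarrow> bool" where
  "C2_sphere u \<longleftrightarrow> twice_diff_on (- {0}) (radial_ext u) \<and>
    (\<forall>v w. continuous_on (- {0}) (pdiff w (pdiff v (radial_ext u))))"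

lemma smooth_on_sphere_imp_C2:
  assumes "smooth_on_sphere u" shows "C2_sphere u"
proof -
  have "C_k_on (Suc (Suc 0)) (- {0}) (radial_ext u)" using assms by (simp only: smooth_on_sphere_def)
  then show ?thesis by (simp add: C2_sphere_def twice_diff_on_def pdiff_def[abs_def])
qed

lemma pdiff_norm: "x \<noteq> 0 \<Longrightarrow> pdiff v norm x = (x \<bullet> v) / norm x" for x :: "'a::euclidean_space"
  by (subst pdiff_eq[OF has_derivative_norm])
     (auto simp: sgn_div_norm divide_inverse inner_commute mult.commute)

text \<open>The gradient of a function constant along rays is homogeneous of degree -1, so the
  extension of the spherical gradient is |y| times the Euclidean one. The factor |y| adds only a
  radial derivative to the divergence, and that vanishes.\<close>

lemma sphere_laplacian_eq_lap:
  fixes u :: "'a::euclidean_space \<Rightarrow> real"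
  assumes F: "twice_diff_on (- {0}) (radial_ext u)" and x: "norm x = 1"
  shows "sphere_laplacian u x = - lap (radial_ext u) x"
proof -
  let ?F = "radial_ext u"
  have d: "?F differentiable (at y)" "pdiff v ?F differentiable (at y)" if "y \<noteq> 0" for y v
    using F that by (auto simp: twice_diff_on_def)
  have x0: "x \<noteq> 0" using x by auto
  have ext: "radial_ext (sphere_grad u) y = (\<Sum>b\<in>Basis. (norm y * pdiff b ?F y) *\<^sub>R b)" if "y \<noteq> 0" for y
  proof -
    have "pdiff b ?F (inverse (norm y) *\<^sub>R y) = norm y * pdiff b ?F y" for b
      using pdiff_radial_ext_scale[of "inverse (norm y)" u y b] d(1) that by (simp add: field_simps)
    moreover have "radial_ext (sphere_grad u) y = (\<Sum>b\<in>Basis. pdiff b ?F (y /\<^sub>R norm y) *\<^sub>R b)"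
      by (simp add: radial_ext_def[of "sphere_grad u"] sphere_grad_def pdiff_def)
    ultimately show ?thesis by simp
  qed
  have nd: "(\<lambda>y. norm y * pdiff b ?F y) differentiable (at x)" for b
    using d(2)[OF x0] x0 by (intro differentiable_mult) auto
  have "((\<lambda>y. \<Sum>b\<in>Basis. (norm y * pdiff b ?F y) *\<^sub>R b) has_derivative
      (\<lambda>v. \<Sum>b\<in>Basis. pdiff v (\<lambda>y. norm y * pdiff b ?F y) x *\<^sub>R b)) (at x)"
    by (intro has_derivative_sum has_derivative_scaleR_left has_derivative_pdiff nd)
  then have "(radial_ext (sphere_grad u) has_derivative
      (\<lambda>v. \<Sum>b\<in>Basis. pdiff v (\<lambda>y. norm y * pdiff b ?F y) x *\<^sub>R b)) (at x)"
    by (subst has_derivative_cong_open[of "- {0}"]) (use ext x0 in auto)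
  then have fd: "frechet_derivative (radial_ext (sphere_grad u)) (at x) =
      (\<lambda>v. \<Sum>b\<in>Basis. pdiff v (\<lambda>y. norm y * pdiff b ?F y) x *\<^sub>R b)"
    by (rule frechet_derivative_at[symmetric])
  have "sphere_div (sphere_grad u) x = (\<Sum>b\<in>Basis. pdiff b (\<lambda>y. norm y * pdiff b ?F y) x)"
    unfolding sphere_div_def fd
    by (intro sum.cong refl) (simp add: inner_sum_left inner_Basis if_distrib cong: if_cong)
  also have "\<dots> = (\<Sum>b\<in>Basis. pdiff b (pdiff b ?F) x + (x \<bullet> b) * pdiff b ?F x)"
    by (intro sum.cong refl, subst pdiff_mult) (use d[OF x0] x x0 in \<open>auto simp: pdiff_norm\<close>)
  also have "\<dots> = lap ?F x + pdiff x ?F x"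
    by (simp add: sum.distrib lap_def sum_pdiff_Basis[OF d(1)[OF x0]])
  also have "pdiff x ?F x = 0" by (rule pdiff_radial_ext_self[OF d(1)[OF x0]])
  finally show ?thesis by (simp add: sphere_laplacian_def)
qed

lemma lap_radial_ext_scale:
  fixes u :: "'a::euclidean_space \<Rightarrow> real"
  assumes F: "twice_diff_on (- {0}) (radial_ext u)" and x: "x \<noteq> 0" and c: "c > 0"
  shows "lap (radial_ext u) (c *\<^sub>R x) = lap (radial_ext u) x / c\<^sup>2"
proof -
  let ?F = "radial_ext u"
  have d: "?F differentiable (at y)" "pdiff v ?F differentiable (at y)" if "y \<noteq> 0" for y v
    using F that by (auto simp: twice_diff_on_def)
  have "pdiff b (pdiff b ?F) (c *\<^sub>R x) = pdiff b (pdiff b ?F) x / c\<^sup>2" for b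
  proof -
    interpret l: linear "\<lambda>v. pdiff v (pdiff b ?F) (c *\<^sub>R x)" by (rule pdiff_linear[OF d(2)]) (use c x in auto)
    have "pdiff b (\<lambda>y. pdiff b ?F (c *\<^sub>R y)) x = pdiff b (\<lambda>y. (1 / c) * pdiff b ?F y) x"
      by (rule pdiff_cong_open[of "- {0}"]) (use c x d in \<open>auto simp: pdiff_radial_ext_scale\<close>)
    also have "\<dots> = pdiff b (pdiff b ?F) x / c" using pdiff_cmult[OF d(2)[OF x], of b "1/c"] by simp
    finally have "pdiff (c *\<^sub>R b) (pdiff b ?F) (c *\<^sub>R x) = pdiff b (pdiff b ?F) x / c"
      using pdiff_linear_comp[OF bounded_linear_scaleR_right d(2), of c x b b] c x by simp
    then show ?thesis using c by (simp add: l.scale field_simps power2_eq_square)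
  qed
  then show ?thesis unfolding lap_def sum_divide_distrib by simp
qed

section \<open>The inner product on the sphere and orthogonality of eigenfunctions\<close>

text \<open>In polar coordinates this is a positive constant times the L^2 product for surface
  measure. The denominator is the factor that appears when an eigenfunction equation is extended
  along rays, where the Laplacian is homogeneous of degree -2.\<close>

definition sphere_inner :: "('a::euclidean_space \<Rightarrow> real) \<Rightarrow> ('a \<Rightarrow> real) \<Rightarrow> real" where
  "sphere_inner u v = (LINT x|lborel. cutoff (x \<bullet> x) / (x \<bullet> x) * (radial_ext u x * radial_ext v x))"

text \<open>Green's formula on an annulus, with a radial cutoff in place of boundary terms: the gradients
  of functions that are constant along rays are orthogonal to the gradient of the cutoff.\<close>

lemma radial_green:
  fixes u v :: "'a::euclidean_space \<Rightarrow> real"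
  assumes u: "C2_sphere u" and v: "C2_sphere v"
  shows "(LINT x|lborel. cutoff (x \<bullet> x) * (radial_ext u x * lap (radial_ext v) x - radial_ext v x * lap (radial_ext u) x)) = 0"
proof -
  let ?F = "radial_ext u" and ?H = "radial_ext v"
  have dF: "?F differentiable (at y)" "pdiff w ?F differentiable (at y)"
    and dH: "?H differentiable (at y)" "pdiff w ?H differentiable (at y)" if "y \<noteq> 0" for y w
    using u v that by (auto simp: C2_sphere_def twice_diff_on_def)
  have cF: "continuous_on (- {0}) ?F" "continuous_on (- {0}) (pdiff w ?F)" "continuous_on (- {0}) (pdiff w' (pdiff w ?F))"
    and cH: "continuous_on (- {0}) ?H" "continuous_on (- {0}) (pdiff w ?H)" "continuous_on (- {0}) (pdiff w' (pdiff w ?H))" for w w'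
    using u v by (auto simp: C2_sphere_def intro!: differentiable_imp_continuous_on_at intro: dF dH)
  have dc: "(\<lambda>x::'a. cutoff (x \<bullet> x)) differentiable (at x)"
    and pc: "pdiff w (\<lambda>x::'a. cutoff (x \<bullet> x)) x = cutoff' (x \<bullet> x) * (2 * (x \<bullet> w))" for x w
  proof -
    have "((\<lambda>x::'a. cutoff (x \<bullet> x)) has_derivative (\<lambda>w. cutoff' (x \<bullet> x) * (2 * (x \<bullet> w)))) (at x)"
      by (rule has_derivative_compose[OF _ DERIV_cutoff[unfolded has_field_derivative_def], where f="\<lambda>x. x \<bullet> x"])
         (auto intro!: derivative_eq_intros simp: inner_commute)
    then show "(\<lambda>x::'a. cutoff (x \<bullet> x)) differentiable (at x)"
      "pdiff w (\<lambda>x::'a. cutoff (x \<bullet> x)) x = cutoff' (x \<bullet> x) * (2 * (x \<bullet> w))"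
      by (auto simp: differentiable_def intro: pdiff_eq)
  qed
  \<comment> \<open>The components of the vector field cutoff * (F grad H - H grad F), whose
    divergence is to be integrated.\<close>
  define f where "f b x = cutoff (x \<bullet> x) * (?F x * pdiff b ?H x - ?H x * pdiff b ?F x)" for b x
  have f_near_0: "f b x = 0" if "x \<in> ball 0 1" for b x
  proof -
    have "x \<bullet> x \<le> 1" using that by (simp add: dot_square_norm power_le_one)
    then show ?thesis by (simp add: f_def cutoff_zero)
  qed
  have df: "f b differentiable (at x)" for b x
  proof (cases "x = 0")
    case True
    have "f b differentiable (at x) \<longleftrightarrow> (\<lambda>x. 0 :: real) differentiable (at x)"
      by (rule differentiable_cong_open[of "ball 0 1"]) (use f_near_0 True in auto)
    then show ?thesis by simp
  next
    case False
    then show ?thesis unfolding f_def[abs_def]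
      by (intro differentiable_mult differentiable_diff dc dF dH)
  qed
  have pf0: "pdiff b (f b) x = 0" if "x \<in> ball 0 1" for b x
    using pdiff_cong_open[of "ball 0 1" x "f b" "\<lambda>x. 0" b] f_near_0 that by auto
  have pf: "pdiff b (f b) x = cutoff (x \<bullet> x) * (?F x * pdiff b (pdiff b ?H) x - ?H x * pdiff b (pdiff b ?F) x)
      + cutoff' (x \<bullet> x) * (2 * (x \<bullet> b)) * (?F x * pdiff b ?H x - ?H x * pdiff b ?F x)" if "x \<noteq> 0" for b x
    unfolding f_def[abs_def]
    by (subst pdiff_mult) (auto simp: pc dc pdiff_diff pdiff_mult dF[OF that] dH[OF that] algebra_simps)
  have "continuous_on (ball 0 1 \<union> - {0}) (pdiff b (f b))" for b
  proof (rule continuous_on_open_Un)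
    show "continuous_on (ball 0 1) (pdiff b (f b))"
      by (subst continuous_on_cong[OF refl pf0]) auto
    have "continuous_on (- {0}) (\<lambda>x. cutoff (x \<bullet> x) * (?F x * pdiff b (pdiff b ?H) x - ?H x * pdiff b (pdiff b ?F) x)
      + cutoff' (x \<bullet> x) * (2 * (x \<bullet> b)) * (?F x * pdiff b ?H x - ?H x * pdiff b ?F x))"
      by (intro continuous_intros cF cH continuous_on_compose2[OF continuous_cutoff(1)[of UNIV]]
          continuous_on_compose2[OF continuous_cutoff(2)[of UNIV]]) auto
    then show "continuous_on (- {0}) (pdiff b (f b))"
      by (subst continuous_on_cong[OF refl pf]) auto
  qed auto
  moreover have "ball 0 1 \<union> - {0} = (UNIV :: 'a set)" by auto
  ultimately have cont: "continuous_on UNIV (pdiff b (f b))" for b by simp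
  have supp: "f b x = 0" if "norm x \<ge> 2" for b x
  proof -
    have "x \<bullet> x \<ge> 4" using that power_mono[of 2 "norm x" 2] by (simp add: dot_square_norm)
    then show ?thesis by (simp add: f_def cutoff_zero)
  qed
  have psupp: "pdiff b (f b) x = 0" if "norm x > 2" for b x
    using pdiff_cong_open[of "- cball 0 2" x "f b" "\<lambda>x. 0" b] supp that by auto
  have "pdiff b (f b) = (\<lambda>x. indicator (cball 0 2) x *\<^sub>R pdiff b (f b) x)" for b
    using psupp by (force simp: fun_eq_iff indicator_def)
  then have int: "integrable lborel (pdiff b (f b))" for b
    using borel_integrable_compact[of "cball 0 2" "pdiff b (f b)"] continuous_on_subset[OF cont] by auto
  have "(LINT x|lborel. (\<Sum>b\<in>Basis. pdiff b (f b) x)) = (\<Sum>b\<in>Basis. LINT x|lborel. pdiff b (f b) x)"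
    by (rule Bochner_Integration.integral_sum) (rule int)
  also have "\<dots> = 0"
    using integral_pdiff_eq_0[OF df cont supp] by simp
  finally have int_0: "(LINT x|lborel. (\<Sum>b\<in>Basis. pdiff b (f b) x)) = 0" .
  have sum_eq: "(\<Sum>b\<in>Basis. pdiff b (f b) x) =
     cutoff (x \<bullet> x) * (?F x * lap ?H x - ?H x * lap ?F x)" for x
  proof (cases "x = 0")
    case True
    then show ?thesis by (simp add: pf0 cutoff_zero)
  next
    case False
    have "(\<Sum>b\<in>Basis. cutoff' (x \<bullet> x) * (2 * (x \<bullet> b)) * (?F x * pdiff b ?H x - ?H x * pdiff b ?F x)) =
      2 * cutoff' (x \<bullet> x) * (?F x * (\<Sum>b\<in>Basis. (x \<bullet> b) * pdiff b ?H x) - ?H x * (\<Sum>b\<in>Basis. (x \<bullet> b) * pdiff b ?F x))"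
      by (simp add: sum_distrib_left sum_subtractf algebra_simps)
    also have "\<dots> = 0"
      by (simp add: sum_pdiff_Basis dF[OF False] dH[OF False] pdiff_radial_ext_self)
    finally show ?thesis
      by (simp add: pf[OF False] sum.distrib lap_def sum_distrib_left sum_subtractf right_diff_distrib)
  qed
  show ?thesis using int_0 unfolding sum_eq .
qed

lemma lap_radial_ext_eigen:
  fixes u :: "'a::euclidean_space \<Rightarrow> real"
  assumes u: "C2_sphere u" "\<And>x. x \<in> sphere 0 1 \<Longrightarrow> sphere_laplacian u x = \<mu> * u x" and x: "x \<noteq> 0"
  shows "lap (radial_ext u) x = - \<mu> * radial_ext u x / (x \<bullet> x)"
proof -
  define y where "y = x /\<^sub>R norm x"
  have y: "norm y = 1" "x = norm x *\<^sub>R y" "y \<noteq> 0" using x by (auto simp: y_def)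
  have F: "twice_diff_on (- {0}) (radial_ext u)" using u by (simp add: C2_sphere_def)
  have "lap (radial_ext u) x = lap (radial_ext u) y / (norm x)\<^sup>2"
    using lap_radial_ext_scale[OF F, of y "norm x"] y x by auto
  also have "lap (radial_ext u) y = - \<mu> * u y"
    using sphere_laplacian_eq_lap[OF F y(1)] u(2)[of y] y by simp
  finally show ?thesis by (simp add: radial_ext_def y_def dot_square_norm)
qed

text \<open>For eigenfunctions, the integrand of Green's formula is \<mu> - \<nu> times that of the
  inner product.\<close>

lemma sphere_inner_eigen_orthogonal:
  fixes u v :: "'a::euclidean_space \<Rightarrow> real"
  assumes u: "C2_sphere u" "\<And>x. x \<in> sphere 0 1 \<Longrightarrow> sphere_laplacian u x = \<mu> * u x"
    and v: "C2_sphere v" "\<And>x. x \<in> sphere 0 1 \<Longrightarrow> sphere_laplacian v x = \<nu> * v x"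
    and "\<mu> \<noteq> \<nu>"
  shows "sphere_inner u v = 0"
proof -
  have "cutoff (x \<bullet> x) * (radial_ext u x * lap (radial_ext v) x - radial_ext v x * lap (radial_ext u) x) =
     (\<mu> - \<nu>) * (cutoff (x \<bullet> x) / (x \<bullet> x) * (radial_ext u x * radial_ext v x))" for x :: 'a
  proof (cases "x = 0")
    case True then show ?thesis by (simp add: cutoff_zero)
  next
    case False
    have "lap (radial_ext u) x = - \<mu> * radial_ext u x / (x \<bullet> x)"
      "lap (radial_ext v) x = - \<nu> * radial_ext v x / (x \<bullet> x)"
      by (rule lap_radial_ext_eigen; use u v False in simp)+
    then show ?thesis by (simp add: divide_inverse algebra_simps)
  qed
  with radial_green[OF u(1) v(1)] have "(\<mu> - \<nu>) * sphere_inner u v = 0"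
    unfolding sphere_inner_def by (simp only: integral_mult_right_zero)
  then show ?thesis using assms by simp
qed

lemma continuous_on_radial_ext:
  assumes "continuous_on (sphere 0 1) u" shows "continuous_on (- {0}) (radial_ext u)"
  unfolding radial_ext_def
  by (rule continuous_on_compose2[OF assms]) (auto intro!: continuous_intros, metis left_inverse norm_eq_zero)

lemma continuous_sphere_inner_integrand:
  fixes u v :: "'a::euclidean_space \<Rightarrow> real"
  assumes "continuous_on (sphere 0 1) u" "continuous_on (sphere 0 1) v"
  shows "continuous_on UNIV (\<lambda>x. cutoff (x \<bullet> x) / (x \<bullet> x) * (radial_ext u x * radial_ext v x))" (is "continuous_on _ ?f")
    and "norm x \<ge> 2 \<Longrightarrow> cutoff (x \<bullet> x) / (x \<bullet> x) * (radial_ext u x * radial_ext v x) = 0"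
    and "integrable lborel (\<lambda>x. cutoff (x \<bullet> x) / (x \<bullet> x) * (radial_ext u x * radial_ext v x))"
proof -
  have 0: "?f x = 0" if "x \<in> ball 0 1" for x
  proof -
    have "x \<bullet> x \<le> 1" using that by (simp add: dot_square_norm power_le_one)
    then show ?thesis by (simp add: cutoff_zero)
  qed
  have "continuous_on (ball 0 1 \<union> - {0}) ?f"
  proof (rule continuous_on_open_Un)
    show "continuous_on (ball 0 1) ?f" by (subst continuous_on_cong[OF refl 0]) auto
    show "continuous_on (- {0}) ?f"
      by (intro continuous_intros continuous_on_radial_ext assms continuous_on_compose2[OF continuous_cutoff(1)[of UNIV]]) auto
  qed auto
  moreover have "ball 0 1 \<union> - {0} = (UNIV :: 'a set)" by auto
  ultimately show c: "continuous_on UNIV ?f" by simp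
  show supp: "?f x = 0" if "norm x \<ge> 2" for x
  proof -
    have "x \<bullet> x \<ge> 4" using that power_mono[of 2 "norm x" 2] by (simp add: dot_square_norm)
    then show ?thesis by (simp add: cutoff_zero)
  qed
  have "?f = (\<lambda>x. indicator (cball 0 2) x *\<^sub>R ?f x)"
  proof
    fix x show "?f x = indicator (cball 0 2) x *\<^sub>R ?f x"
      by (cases "norm x \<le> 2") (use supp[of x] in auto)
  qed
  then show "integrable lborel ?f"
    using borel_integrable_compact[of "cball 0 2" ?f] continuous_on_subset[OF c] by auto
qed

lemma sphere_inner_add:
  fixes u u' v :: "'a::euclidean_space \<Rightarrow> real"
  assumes "continuous_on (sphere 0 1) u" "continuous_on (sphere 0 1) u'" "continuous_on (sphere 0 1) v"
  shows "sphere_inner (\<lambda>x. u x + u' x) v = sphere_inner u v + sphere_inner u' v"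
proof -
  have "sphere_inner (\<lambda>x. u x + u' x) v = (LINT x|lborel. cutoff (x \<bullet> x) / (x \<bullet> x) * (radial_ext u x * radial_ext v x)
     + cutoff (x \<bullet> x) / (x \<bullet> x) * (radial_ext u' x * radial_ext v x))"
    unfolding sphere_inner_def by (rule arg_cong[where f="integral\<^sup>L lborel"]) (auto simp: radial_ext_def algebra_simps)
  then show ?thesis
    using continuous_sphere_inner_integrand(3)[OF assms(1,3)] continuous_sphere_inner_integrand(3)[OF assms(2,3)]
    by (simp add: sphere_inner_def)
qed

lemma sphere_inner_cmult: "sphere_inner (\<lambda>x. c * u x) v = c * sphere_inner u v"
proof -
  have "sphere_inner (\<lambda>x. c * u x) v = (LINT x|lborel. c * (cutoff (x \<bullet> x) / (x \<bullet> x) * (radial_ext u x * radial_ext v x)))"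
    unfolding sphere_inner_def by (rule arg_cong[where f="integral\<^sup>L lborel"]) (auto simp: radial_ext_def algebra_simps)
  then show ?thesis unfolding sphere_inner_def by (simp only: integral_mult_right_zero)
qed

lemma sphere_inner_commute: "sphere_inner u v = sphere_inner v u"
  unfolding sphere_inner_def by (simp add: mult.commute)

lemma sphere_inner_diff:
  fixes u u' v :: "'a::euclidean_space \<Rightarrow> real"
  assumes "continuous_on (sphere 0 1) u" "continuous_on (sphere 0 1) u'" "continuous_on (sphere 0 1) v"
  shows "sphere_inner (\<lambda>x. u x - u' x) v = sphere_inner u v - sphere_inner u' v"
  using sphere_inner_add[OF assms(1) _ assms(3), of "\<lambda>x. -1 * u' x"] sphere_inner_cmult[of "-1" u' v] assms(2)
  by (simp add: continuous_on_minus)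

lemma sphere_inner_cong:
  assumes "\<And>x. x \<in> sphere 0 1 \<Longrightarrow> u x = u' x"
  shows "sphere_inner u v = sphere_inner u' v"
proof -
  have "radial_ext u x = radial_ext u' x" if "x \<noteq> 0" for x
    using assms[of "x /\<^sub>R norm x"] that by (simp add: radial_ext_def)
  then show ?thesis unfolding sphere_inner_def
    by (intro arg_cong[where f="integral\<^sup>L lborel"] ext) (metis cutoff_zero div_0 inner_zero_left mult_zero_left zero_le_one)
qed

lemma sphere_inner_self_eq_0:
  fixes u :: "'a::euclidean_space \<Rightarrow> real"
  assumes u: "continuous_on (sphere 0 1) u" and 0: "sphere_inner u u = 0" and x: "x \<in> sphere 0 1"
  shows "u x = 0"
proof -
  let ?f = "\<lambda>x. cutoff (x \<bullet> x) / (x \<bullet> x) * (radial_ext u x * radial_ext u x)"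
  note f = continuous_sphere_inner_integrand[OF u u]
  \<comment> \<open>All coordinates of \<open>a\<close> are 3, so the box contains the ball of
    radius 3 and with it the support of the integrand.\<close>
  define a :: 'a where "a = (\<Sum>b\<in>Basis. 3 *\<^sub>R b)"
  have box: "y \<in> box (- a) a" if "norm y < 3" for y
  proof -
    have "\<bar>y \<bullet> b\<bar> < 3" if "b \<in> Basis" for b
      using Basis_le_norm[OF that, of y] \<open>norm y < 3\<close> by simp
    then show ?thesis by (simp add: a_def mem_box abs_less_iff inner_Basis if_distrib inner_sum_left cong: if_cong) (metis abs_less_iff minus_less_iff)
  qed
  have A: "(?f has_integral 0) UNIV"

  proof -
    have "(?f has_integral (integral\<^sup>L lborel ?f)) UNIV"
      by (rule has_integral_integral_lborel[OF f(3)])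
    moreover have "integral\<^sup>L lborel ?f = 0"
      using 0 unfolding sphere_inner_def .
    ultimately show ?thesis by (simp only:)
  qed
  have B: "?f = (\<lambda>x. if x \<in> cbox (- a) a then ?f x else 0)"
  proof
    fix y show "?f y = (if y \<in> cbox (- a) a then ?f y else 0)"
    proof (cases "norm y < 2")
      case True
      then have "y \<in> cbox (- a) a" using box[of y] box_subset_cbox[of "- a" a] by auto
      then show ?thesis by (simp only: if_True)
    next
      case False
      then show ?thesis using f(2)[of y] by (simp only: if_cancel not_less)
    qed
  qed
  have "((\<lambda>x. if x \<in> cbox (- a) a then ?f x else 0) has_integral 0) UNIV"
    using A by (rule back_subst[where P="\<lambda>g. (g has_integral 0) UNIV"]) (rule B)
  then have hi: "(?f has_integral 0) (cbox (- a) a)" unfolding has_integral_restrict_UNIV .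
  \<comment> \<open>A nonnegative continuous function with integral 0 vanishes on the box. It is
    evaluated on the ray through \<open>x\<close> at radius 3/2, where the cutoff is positive
    because 9/4 lies between 1 and 4.\<close>
  have n: "norm ((3/2) *\<^sub>R x) = 3/2" using x by simp
  have "?f ((3/2) *\<^sub>R x) = 0"
  proof (rule has_integral_0_cbox_imp_0[OF _ _ hi])
    show "continuous_on (cbox (- a) a) ?f" using f(1) continuous_on_subset by blast
    show "0 \<le> ?f y" for y using cutoff_nonneg[of "y \<bullet> y"] by simp
    show "box (- a) a \<noteq> {}" using box[of 0] by auto
    show "(3/2) *\<^sub>R x \<in> cbox (- a) a" using box[of "(3/2) *\<^sub>R x"] n box_subset_cbox by force
  qed
  moreover have "cutoff (((3/2) *\<^sub>R x) \<bullet> ((3/2) *\<^sub>R x)) > 0"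
    using x by (intro cutoff_pos) (simp_all add: dot_square_norm power2_eq_square)
  moreover have "radial_ext u ((3/2) *\<^sub>R x) = u x" using x by (simp add: radial_ext_def)
  ultimately show ?thesis using x by (auto simp: zero_less_mult_iff)
qed

text \<open>Gram-Schmidt without normalisation. The induction hypothesis is used twice: for
  \<open>u\<close>, and for the new vector \<open>b\<close>, whose component \<open>e\<close>
  orthogonal to the span of \<open>B\<close> is then added to the projection.\<close>

lemma sphere_projection:
  fixes B :: "('a::euclidean_space \<Rightarrow> real) set"
  assumes "finite B" "\<And>b. b \<in> B \<Longrightarrow> continuous_on (sphere 0 1) b" "continuous_on (sphere 0 1) u"
  shows "\<exists>p\<in>fun_vs.span B. continuous_on (sphere 0 1) p \<and> (\<forall>b\<in>B. sphere_inner (\<lambda>x. u x - p x) b = 0)"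
  using assms
proof (induction B arbitrary: u rule: finite_induct)
  case empty
  then show ?case by (intro bexI[of _ "\<lambda>x. 0"]) (auto simp: zero_fun_def)
next
  case (insert b B)
  then have cb: "continuous_on (sphere 0 1) b" and cB: "\<And>c. c \<in> B \<Longrightarrow> continuous_on (sphere 0 1) c" by auto
  obtain p where p: "p \<in> fun_vs.span B" "continuous_on (sphere 0 1) p"
    "\<And>c. c \<in> B \<Longrightarrow> sphere_inner (\<lambda>x. u x - p x) c = 0"
    using insert.IH[OF cB insert.prems(2)] by blast
  obtain q where q: "q \<in> fun_vs.span B" "continuous_on (sphere 0 1) q"
    "\<And>c. c \<in> B \<Longrightarrow> sphere_inner (\<lambda>x. b x - q x) c = 0"
    using insert.IH[OF cB cb] by blast
  define e where "e x = b x - q x" for x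
  have ce: "continuous_on (sphere 0 1) e" unfolding e_def by (intro continuous_intros cb q)
  have cu: "continuous_on (sphere 0 1) (\<lambda>x. u x - p x)" by (intro continuous_intros p insert.prems)
  \<comment> \<open>If \<open>e\<close> has length 0, the quotient is 0 by convention; this is
    harmless, as \<open>e\<close> then vanishes on the sphere.\<close>
  define t where "t = sphere_inner (\<lambda>x. u x - p x) e / sphere_inner e e"
  define p' where "p' x = p x + t * e x" for x
  have cp': "continuous_on (sphere 0 1) p'" unfolding p'_def by (intro continuous_intros p ce)
  have "p' = p + (\<lambda>x. t * (b - q) x)" by (auto simp: p'_def e_def)
  moreover have "p + (\<lambda>x. t * (b - q) x) \<in> fun_vs.span (insert b B)"
    using p(1) q(1) by (intro fun_vs.span_add fun_vs.span_scale fun_vs.span_diff fun_vs.span_base[of b])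
      (use fun_vs.span_mono[of B "insert b B"] in blast)+
  ultimately have sp: "p' \<in> fun_vs.span (insert b B)" by simp
  have eq: "sphere_inner (\<lambda>x. u x - p' x) v = sphere_inner (\<lambda>x. u x - p x) v - t * sphere_inner e v"
    if "continuous_on (sphere 0 1) v" for v
  proof -
    have "(\<lambda>x. u x - p' x) = (\<lambda>x. (u x - p x) - t * e x)" by (auto simp: p'_def)
    then show ?thesis using sphere_inner_diff[OF cu _ that, of "\<lambda>x. t * e x"] ce
      by (simp add: sphere_inner_cmult continuous_on_mult_left)
  qed
  have B0: "sphere_inner (\<lambda>x. u x - p' x) c = 0" if "c \<in> B" for c
    using eq[OF cB[OF that]] p(3)[OF that] q(3)[OF that] by (simp add: e_def[abs_def])
  have span0: "sphere_inner v q = 0" if v: "continuous_on (sphere 0 1) v" "\<And>c. c \<in> B \<Longrightarrow> sphere_inner v c = 0" for v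
  proof -
    have "continuous_on (sphere 0 1) q \<and> sphere_inner q v = 0"
      using q(1)
    proof (induction rule: fun_vs.span_induct_alt)
      case base
      show ?case using sphere_inner_cmult[of 0 "\<lambda>x. 0" v] by (simp add: zero_fun_def)
    next
      case (step c x y)
      have cx: "continuous_on (sphere 0 1) (\<lambda>z. c * x z)" by (intro continuous_intros cB step)
      have "sphere_inner x v = 0" using v(2)[OF step(1)] sphere_inner_commute by metis
      then have "sphere_inner (\<lambda>z. c * x z + y z) v = 0"
        using sphere_inner_add[OF cx _ v(1)] step(2) by (simp add: sphere_inner_cmult)
      then show ?case using step(2) cx by (auto simp: plus_fun_def intro!: continuous_intros)
    qed
    then show ?thesis using sphere_inner_commute by metis
  qed
  have e0: "sphere_inner (\<lambda>x. u x - p' x) e = 0"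
  proof (cases "sphere_inner e e = 0")
    case True
    have "e x = 0" if "x \<in> sphere 0 1" for x using sphere_inner_self_eq_0[OF ce True that] .
    then have "sphere_inner e (\<lambda>x. u x - p' x) = sphere_inner (\<lambda>x. 0 * e x) (\<lambda>x. u x - p' x)"
      by (intro sphere_inner_cong) auto
    then show ?thesis by (metis mult_zero_left sphere_inner_cmult sphere_inner_commute)
  next
    case False
    then show ?thesis using eq[OF ce] by (simp add: t_def)
  qed
  have cup: "continuous_on (sphere 0 1) (\<lambda>x. u x - p' x)" by (intro continuous_intros cp' insert.prems)
  have "b = (\<lambda>x. e x + q x)" by (auto simp: e_def)
  then have "sphere_inner b (\<lambda>x. u x - p' x) = sphere_inner e (\<lambda>x. u x - p' x) + sphere_inner q (\<lambda>x. u x - p' x)"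
    using sphere_inner_add[OF ce q(2) cup] by simp
  also have "\<dots> = 0" using e0 span0[OF cup B0] sphere_inner_commute by (metis add_0)
  finally have "sphere_inner (\<lambda>x. u x - p' x) b = 0" using sphere_inner_commute by metis
  then show ?case using B0 by (intro bexI[OF _ sp] conjI cp' ballI) auto
qed


section \<open>Eigenfunctions on the sphere\<close>

lemma C_k_on_cong:
  assumes "open S" "\<And>x. x \<in> S \<Longrightarrow> f x = g x"
  shows "C_k_on k S f \<longleftrightarrow> C_k_on k S g"
  using assms(2)
proof (induction k arbitrary: f g)
  case 0
  then show ?case by (simp cong: continuous_on_cong)
next
  case (Suc k)
  have 1: "(f has_derivative D) (at x) \<longleftrightarrow> (g has_derivative D) (at x)" if "x \<in> S" for x D
    by (rule has_derivative_cong_open[OF assms(1) that]) (rule Suc.prems)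
  then have "frechet_derivative f (at x) v = frechet_derivative g (at x) v" if "x \<in> S" for x v
    using that by (simp add: frechet_derivative_def)
  then have "C_k_on k S (\<lambda>x. frechet_derivative f (at x) v) \<longleftrightarrow> C_k_on k S (\<lambda>x. frechet_derivative g (at x) v)" for v
    by (rule Suc.IH)
  then show ?case using 1 by (simp add: differentiable_def)
qed

section \<open>Polynomials as smooth functions on the sphere\<close>

text \<open>A class that contains the radial extensions of homogeneous polynomials and is closed,
  away from the origin, under directional derivatives; smoothness of every order follows without
  computing higher derivatives.\<close>

inductive radial_rational :: "('a::euclidean_space \<Rightarrow> real) \<Rightarrow> bool" where
  const: "radial_rational (\<lambda>x. c)"
| inner: "radial_rational (\<lambda>x. x \<bullet> v)"
| inv: "radial_rational (\<lambda>x. inverse (norm x))"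
| add: "radial_rational f \<Longrightarrow> radial_rational g \<Longrightarrow> radial_rational (\<lambda>x. f x + g x)"
| mult: "radial_rational f \<Longrightarrow> radial_rational g \<Longrightarrow> radial_rational (\<lambda>x. f x * g x)"

lemma radial_rational_power: "radial_rational f \<Longrightarrow> radial_rational (\<lambda>x. f x ^ k)"
  by (induction k) (auto intro: radial_rational.intros)

lemma pdiff_inverse_norm:
  fixes x :: "'a::euclidean_space"
  assumes "x \<noteq> 0"
  shows "pdiff v (\<lambda>x. inverse (norm x)) x = - (x \<bullet> v) * inverse (norm x) ^ 3"
    and "(\<lambda>x. inverse (norm x)) differentiable (at x)"
proof -
  have "((\<lambda>x. inverse (norm x)) has_derivative (\<lambda>v. - (inverse (norm x) * (v \<bullet> sgn x) * inverse (norm x)))) (at x)"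
    using assms by (intro Deriv.has_derivative_inverse has_derivative_norm) auto
  then show "pdiff v (\<lambda>x. inverse (norm x)) x = - (x \<bullet> v) * inverse (norm x) ^ 3"
    and "(\<lambda>x. inverse (norm x)) differentiable (at x)"
    by (auto simp: pdiff_eq differentiable_def sgn_div_norm inner_commute power3_eq_cube divide_inverse)
qed

lemma radial_rational_pdiff:
  assumes "radial_rational f"
  shows "(\<forall>x. x \<noteq> 0 \<longrightarrow> f differentiable (at x)) \<and> (\<exists>g. radial_rational g \<and> (\<forall>x. x \<noteq> 0 \<longrightarrow> pdiff v f x = g x))"
  using assms
proof induction
  case (const c)
  then show ?case by (auto intro!: exI[of _ "\<lambda>x. 0"] radial_rational.const)
next
  case (inner w)
  then show ?case by (auto intro!: exI[of _ "\<lambda>x. v \<bullet> w"] radial_rational.const)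
next
  case inv
  have "radial_rational (\<lambda>x::'a. (-1) * (x \<bullet> v) * inverse (norm x) ^ 3)"
    by (intro radial_rational.intros radial_rational_power)
  then show ?case using pdiff_inverse_norm
    by (intro conjI exI[of _ "\<lambda>x::'a. (-1) * (x \<bullet> v) * inverse (norm x) ^ 3"]) auto
next
  case (add f g)
  then obtain f' g' where "radial_rational f'" "\<forall>x. x \<noteq> 0 \<longrightarrow> pdiff v f x = f' x"
    "radial_rational g'" "\<forall>x. x \<noteq> 0 \<longrightarrow> pdiff v g x = g' x" by blast
  with add show ?case
    by (intro conjI exI[of _ "\<lambda>x. f' x + g' x"]) (auto simp: pdiff_add intro: radial_rational.intros)
next
  case (mult f g)
  then obtain f' g' where "radial_rational f'" "\<forall>x. x \<noteq> 0 \<longrightarrow> pdiff v f x = f' x"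
    "radial_rational g'" "\<forall>x. x \<noteq> 0 \<longrightarrow> pdiff v g x = g' x" by blast
  with mult show ?case
    by (intro conjI exI[of _ "\<lambda>x. f x * g' x + f' x * g x"]) (auto simp: pdiff_mult intro!: radial_rational.intros)
qed

lemma radial_rational_C_k: "radial_rational f \<Longrightarrow> C_k_on k (- {0}) f"
proof (induction k arbitrary: f)
  case 0
  then show ?case using radial_rational_pdiff[OF 0, of undefined]
    by (auto intro!: differentiable_imp_continuous_on_at)
next
  case (Suc k)
  have "C_k_on k (- {0}) (\<lambda>x. frechet_derivative f (at x) v)" for v
  proof -
    obtain g where "radial_rational g" "\<forall>x. x \<noteq> 0 \<longrightarrow> pdiff v f x = g x"
      using radial_rational_pdiff[OF Suc.prems] by blast
    then show ?thesis using Suc.IH[of g] C_k_on_cong[of "- {0}" "\<lambda>x. frechet_derivative f (at x) v" g k]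
      by (auto simp: pdiff_def)
  qed
  then show ?case using radial_rational_pdiff[OF Suc.prems] by auto
qed

lemma C_k_on_2_twice_diff: "C_k_on (Suc (Suc 0)) S f \<Longrightarrow> twice_diff_on S f"
  by (simp add: twice_diff_on_def pdiff_def[abs_def])

lemma hpoly_radial_rational: "p \<in> hpoly k \<Longrightarrow> radial_rational p"
  unfolding hpoly_def by (induction rule: hpoly_of_induct) (auto intro: radial_rational.intros)

lemma radial_ext_hpoly:
  assumes "p \<in> hpoly k" "\<And>x. x \<in> sphere 0 1 \<Longrightarrow> u x = p x" "x \<noteq> 0"
  shows "radial_ext u x = inverse (norm x) ^ k * p x"
  using assms(2)[of "x /\<^sub>R norm x"] hpoly_homogeneous[OF assms(1)] assms(3)
  by (simp add: radial_ext_def)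

lemma smooth_on_sphere_hpoly:
  assumes "p \<in> hpoly k" "\<And>x. x \<in> sphere 0 1 \<Longrightarrow> u x = p x"
  shows "smooth_on_sphere u"
proof -
  have "radial_rational (\<lambda>x. inverse (norm x) ^ k * p x)"
    by (intro radial_rational.mult radial_rational_power radial_rational.inv hpoly_radial_rational[OF assms(1)])
  then show ?thesis
    using C_k_on_cong[of "- {0}" "radial_ext u" "\<lambda>x. inverse (norm x) ^ k * p x"] radial_ext_hpoly[OF assms] radial_rational_C_k
    by (auto simp: smooth_on_sphere_def)
qed

section \<open>Harmonic polynomials are eigenfunctions\<close>

text \<open>\<open>n\<close> is the dimension of the ambient space, one more than that of the
  sphere; the subtraction takes place in the reals and is not truncated.\<close>

definition sphere_eigenvalue :: "nat \<Rightarrow> nat \<Rightarrow> real" where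
  "sphere_eigenvalue n k = real k * (real k + real n - 2)"

lemma pdiff_inverse_norm_power:
  fixes x :: "'a::euclidean_space"
  assumes "x \<noteq> 0"
  shows "pdiff v (\<lambda>x. inverse (norm x) ^ k) x = - real k * ((x \<bullet> v) * inverse (norm x) ^ (k + 2))"
proof (induction k)
  case 0
  then show ?case by simp
next
  case (Suc k)
  have d: "(\<lambda>x. inverse (norm x) ^ k) differentiable (at x)"
    using radial_rational_pdiff[OF radial_rational_power[OF radial_rational.inv]] assms by blast
  show ?case using pdiff_mult[OF pdiff_inverse_norm(2)[OF assms] d, of v] Suc
    by (simp add: pdiff_inverse_norm[OF assms] algebra_simps power3_eq_cube)
qed

text \<open>The radial extension of \<open>p\<close> is p / |x|^k. On the unit sphere the Laplacian
  of |x|^-k is k (k + 2 - n), and by Euler's identity the mixed term of the product rule is -2 k^2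
  p; their sum is -k (k + n - 2) p.\<close>

lemma sphere_laplacian_harmonic:
  fixes p :: "'a::euclidean_space \<Rightarrow> real"
  assumes p: "p \<in> hpoly k" "lap p = (\<lambda>x. 0)" and u: "\<And>x. x \<in> sphere 0 1 \<Longrightarrow> u x = p x" and x: "x \<in> sphere 0 1"
  shows "sphere_laplacian u x = sphere_eigenvalue DIM('a) k * u x"
proof -
  have x1: "norm x = 1" and x0: "x \<noteq> 0" and xS: "x \<in> - {0}" using x by auto
  have F: "twice_diff_on (- {0}) (radial_ext u)"
    using smooth_on_sphere_hpoly[OF p(1) u] smooth_on_sphere_imp_C2 by (auto simp: C2_sphere_def)
  let ?q = "\<lambda>x::'a. inverse (norm x) ^ k"
  have q: "twice_diff_on (- {0}) ?q"
    by (intro C_k_on_2_twice_diff radial_rational_C_k radial_rational_power radial_rational.inv)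
  have o: "open (- {0::'a})" by (rule open_Compl) simp
  have "lap ?q x = (\<Sum>b\<in>Basis. - real k + real k * real (k + 2) * ((x \<bullet> b) * (x \<bullet> b)))"
    unfolding lap_def
  proof (rule sum.cong[OF refl])
    fix b :: 'a assume b: "b \<in> Basis"
    have d: "(\<lambda>x. inverse (norm x) ^ (k + 2)) differentiable (at x)"
      using radial_rational_pdiff[OF radial_rational_power[OF radial_rational.inv]] x0 by blast
    have "pdiff b (pdiff b ?q) x = pdiff b (\<lambda>x. - real k * ((x \<bullet> b) * inverse (norm x) ^ (k + 2))) x"
      by (rule pdiff_cong_open[OF o xS]) (simp add: pdiff_inverse_norm_power)
    also have "\<dots> = - real k * pdiff b (\<lambda>x. (x \<bullet> b) * inverse (norm x) ^ (k + 2)) x"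
      by (rule pdiff_cmult) (use d in \<open>auto simp del: power_Suc power_inverse\<close>)
    also have "pdiff b (\<lambda>x. (x \<bullet> b) * inverse (norm x) ^ (k + 2)) x =
      (x \<bullet> b) * (- real (k + 2) * ((x \<bullet> b) * inverse (norm x) ^ (k + 2 + 2))) + (b \<bullet> b) * inverse (norm x) ^ (k + 2)"
      by (subst pdiff_mult) (use d in \<open>simp_all only: pdiff_inverse_norm_power[OF x0] pdiff_inner, simp_all\<close>)
    finally show "pdiff b (pdiff b ?q) x = - real k + real k * real (k + 2) * ((x \<bullet> b) * (x \<bullet> b))"
      using b x1 by (simp add: algebra_simps)
  qed
  also have "\<dots> = - real (DIM('a)) * real k + real k * real (k + 2) * (x \<bullet> x)"
    by (simp only: sum.distrib sum_distrib_left[symmetric] euclidean_inner[of x x] sum_constant)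
  finally have lq: "lap ?q x = real k * real (k + 2) - real (DIM('a)) * real k"
    using x1 by (simp add: dot_square_norm)
  have "(\<Sum>b\<in>Basis. pdiff b ?q x * pdiff b p x) = - real k * (\<Sum>b\<in>Basis. (x \<bullet> b) * pdiff b p x)"
    using x1 by (simp add: pdiff_inverse_norm_power[OF x0] sum_distrib_left sum_negf mult_ac)
  also have "\<dots> = - real k * (real k * p x)"
    using hpoly_euler[OF p(1), of x] sum_pdiff_Basis[OF hpoly_differentiable[OF p(1)], of x x] by simp
  finally have cross: "(\<Sum>b\<in>Basis. pdiff b ?q x * pdiff b p x) = - real k * (real k * p x)" .
  have "sphere_laplacian u x = - lap (radial_ext u) x" by (rule sphere_laplacian_eq_lap[OF F x1])
  also have "lap (radial_ext u) x = lap (\<lambda>x. ?q x * p x) x"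
    by (rule lap_cong_open[OF o xS]) (use radial_ext_hpoly[OF p(1) u] in auto)
  also have "\<dots> = 2 * (- real k * (real k * p x)) + (real k * real (k + 2) - real (DIM('a)) * real k) * p x"
    unfolding lap_mult[OF o xS q hpoly_twice_diff[OF p(1)]] cross lq p(2) by simp
  finally show ?thesis using u[OF x] by (simp add: sphere_eigenvalue_def algebra_simps)
qed

lemma hpoly_continuous_on: "p \<in> hpoly k \<Longrightarrow> continuous_on A p"
  by (rule differentiable_imp_continuous_on_at) (rule hpoly_differentiable)

section \<open>Completeness of the spherical harmonics\<close>

text \<open>On the sphere r^2 q agrees with q, so iterating the harmonic decomposition writes the
  restriction of a polynomial as a sum of harmonics of degrees j, j - 2, and so on.\<close>

lemma orthogonal_harmonics_imp_orthogonal_hpoly: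
  fixes w :: "'a::euclidean_space \<Rightarrow> real"
  assumes w: "continuous_on (sphere 0 1) w"
    and orth: "\<And>j h. h \<in> inv_harmonic {} j \<Longrightarrow> sphere_inner w h = 0"
  shows "p \<in> hpoly j \<Longrightarrow> sphere_inner w p = 0"
proof (induction j arbitrary: p rule: less_induct)
  case (less j)
  have pi: "p \<in> inv_hpoly {} j" using less.prems by (simp add: inv_hpoly_def)
  show ?case
  proof (cases "j < 2")
    case True
    then show ?thesis using orth[of p j] pi inv_harmonic_low_degree by blast
  next
    case False
    then obtain k where k: "j = k + 2" by (metis add.commute le_Suc_ex not_less)
    obtain h q where hq: "h \<in> inv_harmonic {} (k + 2)" "q \<in> inv_hpoly {} k" "p = (\<lambda>x. h x + (x \<bullet> x) * q x)"
      using harmonic_decomposition[of "{}" p k] pi k by auto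
    have h: "h \<in> hpoly (k + 2)" and q: "q \<in> hpoly k" using hq inv_harmonicD(1) inv_hpolyD(1) by blast+
    have "sphere_inner p w = sphere_inner (\<lambda>x. h x + q x) w"
      by (rule sphere_inner_cong) (simp add: hq dot_square_norm)
    also have "\<dots> = sphere_inner w h + sphere_inner w q"
      using sphere_inner_add[OF hpoly_continuous_on[OF h] hpoly_continuous_on[OF q] w] sphere_inner_commute by metis
    also have "\<dots> = 0" using orth[OF hq(1)] less.IH[OF _ q] k by simp
    finally show ?thesis using sphere_inner_commute by metis
  qed
qed

text \<open>Connects the polynomial functions of the Stone-Weierstrass theorem with homogeneous
  polynomials.\<close>

lemma real_polynomial_function_in_span_hpoly:
  fixes g :: "'a::euclidean_space \<Rightarrow> real"
  assumes "real_polynomial_function g" shows "g \<in> fun_vs.span (\<Union>j. hpoly j)"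
  using assms
proof induction
  case (linear f)
  interpret f: bounded_linear f by (rule linear)
  have rep: "f x = (\<Sum>b\<in>Basis. (x \<bullet> b) * f b)" for x
    by (subst euclidean_representation[symmetric, of x]) (simp only: f.sum f.scaleR real_scaleR_def)
  have "f = (\<lambda>x. x \<bullet> (\<Sum>b\<in>Basis. f b *\<^sub>R b))"
    by (rule ext, subst rep) (simp add: inner_sum_right mult.commute)
  then have "f \<in> hpoly 1" using hpoly_inner by metis
  then show ?case by (intro fun_vs.span_base) auto
next
  case (const c)
  have "(\<lambda>x::'a. c) \<in> hpoly 0" by (simp add: hpoly_def hpoly_of_const)
  then show ?case by (intro fun_vs.span_base) auto
next
  case (add f g)
  then show ?case using fun_vs.span_add[OF add.IH] by (simp add: plus_fun_def)
next
  case (mult f g)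
  let ?P = "\<Union>j. hpoly j :: ('a \<Rightarrow> real) set"
  have base: "(\<lambda>x. p x * q x) \<in> ?P" if pq: "p \<in> ?P" "q \<in> ?P" for p q
  proof -
    obtain i j where "p \<in> hpoly i" "q \<in> hpoly j" using pq by blast
    then have "(\<lambda>x. p x * q x) \<in> hpoly (i + j)" unfolding hpoly_def by (rule hpoly_of_mult)
    then show ?thesis by blast
  qed
  have *: "(\<lambda>x. p x * q x) \<in> fun_vs.span ?P" if "p \<in> ?P" "q \<in> fun_vs.span ?P" for p q
    using that(2)
  proof (induction rule: fun_vs.span_induct_alt)
    case base
    then show ?case using fun_vs.span_zero[of ?P] by (simp add: zero_fun_def)
  next
    case (step c r s)
    have "(\<lambda>x. c * (p x * r x)) + (\<lambda>x. p x * s x) \<in> fun_vs.span ?P"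
      by (intro fun_vs.span_add fun_vs.span_scale fun_vs.span_base base that step)
    then show ?case by (simp add: plus_fun_def algebra_simps)
  qed
  show ?case using mult.IH(1)
  proof (induction rule: fun_vs.span_induct_alt)
    case base
    then show ?case using fun_vs.span_zero[of ?P] by (simp add: zero_fun_def)
  next
    case (step c r s)
    have "(\<lambda>x. c * (r x * g x)) + (\<lambda>x. s x * g x) \<in> fun_vs.span ?P"
      by (intro fun_vs.span_add fun_vs.span_scale * mult.IH step)
    then show ?case by (simp add: plus_fun_def algebra_simps)
  qed
qed

lemma sphere_inner_mono:
  fixes u v :: "'a::euclidean_space \<Rightarrow> real"
  assumes "continuous_on (sphere 0 1) u" "continuous_on (sphere 0 1) v"
    "continuous_on (sphere 0 1) u'" "continuous_on (sphere 0 1) v'"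
    and le: "\<And>x. x \<in> sphere 0 1 \<Longrightarrow> u x * v x \<le> u' x * v' x"
  shows "sphere_inner u v \<le> sphere_inner u' v'"
  unfolding sphere_inner_def
proof (rule integral_mono)
  fix x :: 'a
  show "cutoff (x \<bullet> x) / (x \<bullet> x) * (radial_ext u x * radial_ext v x) \<le>
        cutoff (x \<bullet> x) / (x \<bullet> x) * (radial_ext u' x * radial_ext v' x)"
  proof (cases "x = 0")
    case False
    then show ?thesis using le[of "x /\<^sub>R norm x"] cutoff_nonneg[of "x \<bullet> x"]
      by (intro mult_left_mono) (auto simp: radial_ext_def)
  qed simp
qed (use assms continuous_sphere_inner_integrand(3) in blast)+

text \<open>If a polynomial g approximates w uniformly within e, then <w, w> = <w - g, w> is at most
  e times the L^1 norm \<open>C\<close> of w, for every e > 0.\<close>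

lemma orthogonal_harmonics_imp_0:
  fixes w :: "'a::euclidean_space \<Rightarrow> real"
  assumes w: "continuous_on (sphere 0 1) w"
    and orth: "\<And>j h. h \<in> inv_harmonic {} j \<Longrightarrow> sphere_inner w h = 0"
    and x: "x \<in> sphere 0 1"
  shows "w x = 0"
proof -
  have poly0: "sphere_inner w g = 0 \<and> continuous_on (sphere 0 1) g" if "real_polynomial_function g" for g
    using real_polynomial_function_in_span_hpoly[OF that]
  proof (induction rule: fun_vs.span_induct_alt)
    case base
    have "sphere_inner (\<lambda>x. 0) w = 0" using sphere_inner_cmult[of 0 "\<lambda>x. 0" w] by simp
    then have "sphere_inner w (\<lambda>x. 0) = 0" using sphere_inner_commute by metis
    then show ?case by (simp add: zero_fun_def)
  next
    case (step c p q)
    then obtain j where p: "p \<in> hpoly j" by auto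
    have cp: "continuous_on (sphere 0 1) (\<lambda>z. c * p z)" by (intro continuous_intros hpoly_continuous_on[OF p])
    have "sphere_inner w p = 0" by (rule orthogonal_harmonics_imp_orthogonal_hpoly[OF w _ p]) (rule orth)
    then have "sphere_inner p w = 0" using sphere_inner_commute by metis
    moreover have "sphere_inner q w = 0" using step(2) sphere_inner_commute by metis
    ultimately have "sphere_inner (\<lambda>z. c * p z + q z) w = 0"
      using sphere_inner_add[OF cp _ w] step(2) by (simp add: sphere_inner_cmult)
    then have "sphere_inner w (\<lambda>z. c * p z + q z) = 0" using sphere_inner_commute by metis
    then show ?case using step(2) cp by (auto simp: plus_fun_def intro!: continuous_intros)
  qed
  define C where "C = sphere_inner (\<lambda>x. \<bar>w x\<bar>) (\<lambda>x. 1)"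
  have "C \<ge> sphere_inner (\<lambda>x::'a. 0) (\<lambda>x. 0)" unfolding C_def
    by (rule sphere_inner_mono) (auto intro!: continuous_intros w)
  then have C: "C \<ge> 0" using sphere_inner_cmult[of 0 "\<lambda>x::'a. 0" "\<lambda>x. 0"] by simp
  have "sphere_inner w w \<ge> sphere_inner (\<lambda>x::'a. 0) (\<lambda>x. 0)"
    by (rule sphere_inner_mono) (auto intro!: continuous_intros w)
  then have nonneg: "sphere_inner w w \<ge> 0" using sphere_inner_cmult[of 0 "\<lambda>x::'a. 0" "\<lambda>x. 0"] by simp
  have bound: "sphere_inner w w \<le> e * C" if e: "e > 0" for e
  proof -
    obtain g where g: "polynomial_function g" "\<forall>x\<in>sphere 0 1. norm (w x - g x) < e"
      using Stone_Weierstrass_polynomial_function[OF compact_sphere w e] by blast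
    then have rg: "real_polynomial_function g" by (simp add: real_polynomial_function_eq)
    have cg: "continuous_on (sphere 0 1) g" and "sphere_inner g w = 0"
      using poly0[OF rg] sphere_inner_commute by metis+
    then have "sphere_inner w w = sphere_inner (\<lambda>x. w x - g x) w"
      using sphere_inner_diff[OF w cg w] by simp
    also have "\<dots> \<le> sphere_inner (\<lambda>x. e * \<bar>w x\<bar>) (\<lambda>x. 1)"
    proof (rule sphere_inner_mono)
      fix x :: 'a assume "x \<in> sphere 0 1"
      then have "\<bar>w x - g x\<bar> \<le> e" using g(2) by (auto intro: less_imp_le)
      then have "\<bar>w x - g x\<bar> * \<bar>w x\<bar> \<le> e * \<bar>w x\<bar>" by (rule mult_right_mono) simp
      moreover have "(w x - g x) * w x \<le> \<bar>w x - g x\<bar> * \<bar>w x\<bar>" by (metis abs_ge_self abs_mult)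
      ultimately show "(w x - g x) * w x \<le> e * \<bar>w x\<bar> * 1" by simp
    qed (auto intro!: continuous_intros w cg)
    also have "\<dots> = e * C" unfolding C_def by (rule sphere_inner_cmult)
    finally show ?thesis .
  qed
  have "sphere_inner w w \<le> 0"
  proof (rule ccontr)
    assume "\<not> sphere_inner w w \<le> 0"
    then have pos: "sphere_inner w w > 0" by simp
    \<comment> \<open>Chosen so that e (C + 1) is half of <w, w>; adding 1 avoids dividing by
      \<open>C\<close>, which is only known to be nonnegative.\<close>
    define e where "e = sphere_inner w w / 2 / (C + 1)"
    have C1: "C + 1 \<noteq> 0" using C by linarith
    have "e > 0" using pos C by (simp add: e_def)
    then have "sphere_inner w w \<le> e * C" by (rule bound)
    also have "\<dots> \<le> e * (C + 1)" using \<open>e > 0\<close> by simp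
    also have "\<dots> = sphere_inner w w / 2" unfolding e_def using C1 by (rule nonzero_eq_divide_eq[THEN iffD1, OF _ refl])
    finally show False using pos by simp
  qed
  then have "sphere_inner w w = 0" using nonneg by simp
  from sphere_inner_self_eq_0[OF w this x] show ?thesis .
qed

lemma C2_sphere_diff:
  fixes u v :: "'a::euclidean_space \<Rightarrow> real"
  assumes u: "C2_sphere u" and v: "C2_sphere v"
  shows "C2_sphere (\<lambda>x. u x - v x)"
    and "norm x = 1 \<Longrightarrow> sphere_laplacian (\<lambda>x. u x - v x) x = sphere_laplacian u x - sphere_laplacian v x"
proof -
  let ?F = "radial_ext u" and ?H = "radial_ext v"
  have o: "open (- {0::'a})" by (rule open_Compl) simp
  have t: "twice_diff_on (- {0}) ?F" "twice_diff_on (- {0}) (\<lambda>x. -1 * ?H x)"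
    using u v by (simp add: C2_sphere_def, intro twice_diff_on_cmult[OF o], simp add: C2_sphere_def)
  have eq: "radial_ext (\<lambda>x. u x - v x) = (\<lambda>x. ?F x + -1 * ?H x)" by (auto simp: radial_ext_def)
  have tw: "twice_diff_on (- {0}) (radial_ext (\<lambda>x. u x - v x))"
    unfolding eq by (rule twice_diff_on_add[OF o t])
  have d: "?F differentiable (at y)" "pdiff w ?F differentiable (at y)" "?H differentiable (at y)"
     "pdiff w ?H differentiable (at y)" if "y \<noteq> 0" for y w
    using u v that by (auto simp: C2_sphere_def twice_diff_on_def)
  have "pdiff w (pdiff z (radial_ext (\<lambda>x. u x - v x))) y = pdiff w (pdiff z ?F) y - pdiff w (pdiff z ?H) y"
    if "y \<in> - {0}" for w z y
  proof -
    have "pdiff w (pdiff z (radial_ext (\<lambda>x. u x - v x))) y = pdiff w (\<lambda>y. pdiff z ?F y - pdiff z ?H y) y"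
      by (rule pdiff_cong_open[OF o that]) (simp add: eq d pdiff_diff)
    also have "\<dots> = pdiff w (pdiff z ?F) y - pdiff w (pdiff z ?H) y"
      using that d by (simp add: pdiff_diff)
    finally show ?thesis .
  qed
  then have "continuous_on (- {0}) (pdiff w (pdiff z (radial_ext (\<lambda>x. u x - v x))))" for w z
    using u v by (subst continuous_on_cong[OF refl]) (auto simp: C2_sphere_def intro!: continuous_intros)
  with tw show "C2_sphere (\<lambda>x. u x - v x)" by (simp add: C2_sphere_def)
  assume x: "norm x = 1"
  then have xS: "x \<in> - {0}" by auto
  have H: "twice_diff_on (- {0}) ?H" using v by (simp add: C2_sphere_def)
  have "lap (radial_ext (\<lambda>x. u x - v x)) x = lap ?F x + lap (\<lambda>x. -1 * ?H x) x"
    unfolding eq by (rule lap_add[OF o xS t])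
  also have "lap (\<lambda>x. -1 * ?H x) x = - lap ?H x" using lap_cmult[OF o xS H, of "-1"] by simp
  finally show "sphere_laplacian (\<lambda>x. u x - v x) x = sphere_laplacian u x - sphere_laplacian v x"
    by (simp add: sphere_laplacian_eq_lap[OF tw x] sphere_laplacian_eq_lap[OF t(1) x] sphere_laplacian_eq_lap[OF H x])
qed

lemma C2_sphere_imp_continuous_on:
  assumes "C2_sphere u" shows "continuous_on (sphere 0 1) u"
proof -
  have "continuous_on (- {0}) (radial_ext u)"
    using assms by (auto simp: C2_sphere_def twice_diff_on_def intro!: differentiable_imp_continuous_on_at)
  then have "continuous_on (sphere 0 1) (radial_ext u)" by (rule continuous_on_subset) auto
  then show ?thesis by (rule continuous_on_eq) (auto simp: radial_ext_def)
qed

lemma inj_sphere_eigenvalue: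
  assumes "n \<ge> 2" shows "sphere_eigenvalue n j = sphere_eigenvalue n k \<longleftrightarrow> j = k"
proof -
  have "strict_mono (sphere_eigenvalue n)"
  proof (rule strict_monoI_Suc)
    fix k show "sphere_eigenvalue n k < sphere_eigenvalue n (Suc k)"
      using assms by (simp add: sphere_eigenvalue_def algebra_simps)
  qed
  then show ?thesis by (simp add: strict_mono_eq)
qed

text \<open>If \<mu> is none of the numbers k (k + n - 2), then u is orthogonal to all harmonics.
  Otherwise its projection to the harmonics of degree k is subtracted: the difference is again an
  eigenfunction for \<mu>, hence orthogonal to the other degrees as well. The point \<open>z\<close>
  excludes the zero function, which satisfies the equation for every \<mu>.\<close>

theorem sphere_eigenfunction:
  fixes u :: "'a::euclidean_space \<Rightarrow> real"
  assumes u: "smooth_on_sphere u" "\<And>x. x \<in> sphere 0 1 \<Longrightarrow> sphere_laplacian u x = \<mu> * u x"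
    and n: "DIM('a) \<ge> 2" and nz: "z \<in> sphere 0 1" "u z \<noteq> 0"
  shows "\<exists>k. \<mu> = sphere_eigenvalue DIM('a) k \<and> (\<exists>p\<in>inv_harmonic {} k. \<forall>x\<in>sphere 0 1. u x = p x)"
proof -
  have C2u: "C2_sphere u" by (rule smooth_on_sphere_imp_C2[OF u(1)])
  have cu: "continuous_on (sphere 0 1) u" by (rule C2_sphere_imp_continuous_on[OF C2u])
  have harm: "C2_sphere h" "\<And>x. x \<in> sphere 0 1 \<Longrightarrow> sphere_laplacian h x = sphere_eigenvalue DIM('a) j * h x"
    if "h \<in> inv_harmonic {} j" for h :: "'a \<Rightarrow> real" and j
  proof -
    have h: "h \<in> hpoly j" "lap h = (\<lambda>x. 0)" using inv_harmonicD[OF that] inv_hpolyD(1) by blast+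
    show "C2_sphere h" by (rule smooth_on_sphere_imp_C2[OF smooth_on_sphere_hpoly[OF h(1) refl]])
    show "sphere_laplacian h x = sphere_eigenvalue DIM('a) j * h x" if "x \<in> sphere 0 1" for x
      by (rule sphere_laplacian_harmonic[OF h refl that])
  qed
  show ?thesis
  proof (cases "\<exists>k. \<mu> = sphere_eigenvalue DIM('a) k")
    case False
    have "sphere_inner u h = 0" if "h \<in> inv_harmonic {} j" for h j
      by (rule sphere_inner_eigen_orthogonal[OF C2u u(2) harm[OF that]]) (use False in auto)
    then have "u z = 0" using orthogonal_harmonics_imp_0[OF cu _ nz(1)] by blast
    then show ?thesis using nz by simp
  next
    case True
    then obtain k where k: "\<mu> = sphere_eigenvalue DIM('a) k" by blast
    have "inv_harmonic {} k \<subseteq> (hpoly k :: ('a \<Rightarrow> real) set)" using inv_harmonicD(1) inv_hpolyD(1) by blast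
    then obtain B :: "('a \<Rightarrow> real) set" where B: "finite B" "fun_vs.independent B" "B \<subseteq> inv_harmonic {} k"
      "inv_harmonic {} k \<subseteq> fun_vs.span B" "card B = fun_vs.dim (inv_harmonic {} k :: ('a \<Rightarrow> real) set)"
      using finite_basis_hpoly_subspace by blast
    have cB: "continuous_on (sphere 0 1) b" if "b \<in> B" for b
      using C2_sphere_imp_continuous_on harm(1) B(3) that by blast
    obtain p where p: "p \<in> fun_vs.span B" "continuous_on (sphere 0 1) p"
      "\<And>b. b \<in> B \<Longrightarrow> sphere_inner (\<lambda>x. u x - p x) b = 0"
      using sphere_projection[OF B(1) cB cu] by blast
    have ph: "p \<in> inv_harmonic {} k" using p(1) fun_vs.span_minimal[OF B(3) subspace_inv_harmonic] by blast
    define w where "w x = u x - p x" for x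
    have C2w: "C2_sphere w" unfolding w_def[abs_def] by (rule C2_sphere_diff(1)[OF C2u harm(1)[OF ph]])
    have cw: "continuous_on (sphere 0 1) w" by (rule C2_sphere_imp_continuous_on[OF C2w])
    have lw: "sphere_laplacian w x = \<mu> * w x" if "x \<in> sphere 0 1" for x
      using C2_sphere_diff(2)[OF C2u harm(1)[OF ph], of x] u(2)[OF that] harm(2)[OF ph that] that
      by (simp add: w_def[abs_def] k algebra_simps)
    have orth: "sphere_inner w h = 0" if h: "h \<in> inv_harmonic {} j" for h j
    proof (cases "j = k")
      case False
      show ?thesis
        by (rule sphere_inner_eigen_orthogonal[OF C2w lw harm[OF h]]) (use False k inj_sphere_eigenvalue[OF n] in auto)
    next
      case True
      then have "h \<in> fun_vs.span B" using h B(4) by blast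
      then have "sphere_inner h w = 0 \<and> continuous_on (sphere 0 1) h"
      proof (induction rule: fun_vs.span_induct_alt)
        case base
        then show ?case using sphere_inner_cmult[of 0 "\<lambda>x. 0" w] by (simp add: zero_fun_def)
      next
        case (step c x y)
        have cx: "continuous_on (sphere 0 1) (\<lambda>z. c * x z)" by (intro continuous_intros cB step)
        have "sphere_inner x w = 0" using p(3)[OF step(1)] sphere_inner_commute unfolding w_def[abs_def] by metis
        then have "sphere_inner (\<lambda>z. c * x z + y z) w = 0"
          using sphere_inner_add[OF cx _ cw] step(2) by (simp add: sphere_inner_cmult)
        then show ?case using step(2) cx by (auto simp: plus_fun_def intro!: continuous_intros)
      qed
      then show ?thesis using sphere_inner_commute by metis
    qed
    have "w x = 0" if "x \<in> sphere 0 1" for x by (rule orthogonal_harmonics_imp_0[OF cw orth that])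
    then have "\<forall>x\<in>sphere 0 1. u x = p x" by (simp add: w_def)
    then show ?thesis using k ph by blast
  qed
qed


section \<open>The spectrum of a spherical space form\<close>

lemma group_orthogonal_group: "group (orthogonal_group :: (real^'n^'n) monoid)"
proof (rule groupI)
  fix Q :: "real^'n^'n" assume "Q \<in> carrier orthogonal_group"
  then show "\<exists>y\<in>carrier orthogonal_group. y \<otimes>\<^bsub>orthogonal_group\<^esub> Q = \<one>\<^bsub>orthogonal_group\<^esub>"
    by (intro bexI[of _ "transpose Q"]) (auto simp: orthogonal_group_def orthogonal_matrix_def)
qed (auto simp: orthogonal_group_def orthogonal_matrix_mul orthogonal_matrix_id matrix_mul_assoc)

definition matrix_actions :: "(real^'n^'n) set \<Rightarrow> (real^'n \<Rightarrow> real^'n) set" where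
  "matrix_actions G = (*v) ` G"

definition subgroup_of_matrices :: "(real^'n^'n) set \<Rightarrow> (real^'n^'n) monoid" where
  "subgroup_of_matrices G = orthogonal_group\<lparr>carrier := G\<rparr>"

lemma subgroup_of_matrices_simps [simp]:
  "carrier (subgroup_of_matrices G) = G"
  "mult (subgroup_of_matrices G) = (**)"
  "one (subgroup_of_matrices G) = mat 1"
  by (simp_all add: subgroup_of_matrices_def orthogonal_group_def)

lemma space_form_group:
  assumes "spherical_space_form G" shows "group (subgroup_of_matrices G)"
  using assms group.subgroup_imp_group[OF group_orthogonal_group]
  unfolding spherical_space_form_def subgroup_of_matrices_def by blast

lemma space_form_orthogonal:
  assumes "spherical_space_form G" "g \<in> G"
  shows "orthogonal_matrix g" "orthogonal_transformation ((*v) g)" "norm (g *v x) = norm x"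
proof -
  show "orthogonal_matrix g" using assms subgroup.subset
    unfolding spherical_space_form_def orthogonal_group_def by force
  then show o: "orthogonal_transformation ((*v) g)"
    by (simp add: orthogonal_transformation_matrix)
  show "norm (g *v x) = norm x" using orthogonal_transformation_norm[OF o] .
qed

lemma space_form_mult:
  assumes "spherical_space_form G" shows "g \<in> G \<Longrightarrow> h \<in> G \<Longrightarrow> g ** h \<in> G" and "mat 1 \<in> G"
    and "g \<in> G \<Longrightarrow> \<exists>h\<in>G. h ** g = mat 1 \<and> g ** h = mat 1"
proof -
  interpret G: group "subgroup_of_matrices G" by (rule space_form_group[OF assms])
  show "g \<in> G \<Longrightarrow> h \<in> G \<Longrightarrow> g ** h \<in> G" using G.m_closed[of g h] by simp
  show "mat 1 \<in> G" using G.one_closed by simp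
  show "g \<in> G \<Longrightarrow> \<exists>h\<in>G. h ** g = mat 1 \<and> g ** h = mat 1"
    using G.inv_closed[of g] G.l_inv[of g] G.r_inv[of g] by (intro bexI[of _ "inv\<^bsub>subgroup_of_matrices G\<^esub> g"]) simp_all
qed

lemma topspace_orbit_space: "topspace (orbit_space G) = orbit_map G ` sphere 0 1"
  by (simp add: orbit_space_def topspace_quotient_topology)

lemma orbit_map_eq:
  assumes G: "spherical_space_form G"
  shows "orbit_map G x = orbit_map G y \<longleftrightarrow> (\<exists>g\<in>G. y = g *v x)"
proof
  assume "orbit_map G x = orbit_map G y"
  moreover have "mat 1 *v y \<in> orbit_map G y" unfolding orbit_map_def using space_form_mult(2)[OF G] by blast
  ultimately show "\<exists>g\<in>G. y = g *v x" by (auto simp: orbit_map_def)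
next
  assume "\<exists>g\<in>G. y = g *v x"
  then obtain g where g: "g \<in> G" "y = g *v x" by blast
  obtain h where h: "h \<in> G" "h ** g = mat 1" using space_form_mult(3)[OF G g(1)] by blast
  have x: "x = h *v y" by (simp add: g matrix_vector_mul_assoc h)
  have "orbit_map G y \<subseteq> orbit_map G x"
    unfolding orbit_map_def using space_form_mult(1)[OF G _ g(1)] by (auto simp: g(2) matrix_vector_mul_assoc)
  moreover have "orbit_map G x \<subseteq> orbit_map G y"
    unfolding orbit_map_def using space_form_mult(1)[OF G _ h(1)]
    by (subst x) (auto simp: matrix_vector_mul_assoc)
  ultimately show "orbit_map G x = orbit_map G y" by blast
qed

text \<open>For an invariant \<open>p\<close> the chosen representative is irrelevant. The indicator
  is a factor so that the map is linear in \<open>p\<close> on all functions, invariant or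
  not.\<close>

definition harmonic_to_orbit :: "(real^'n^'n) set \<Rightarrow> (real^'n \<Rightarrow> real) \<Rightarrow> (real^'n) set \<Rightarrow> real" where
  "harmonic_to_orbit G p P = (if P \<in> topspace (orbit_space G) then 1 else 0) * p (SOME x. x \<in> P)"

lemma linear_harmonic_to_orbit:
  "Vector_Spaces.linear (\<lambda>c f P. c * f P) (\<lambda>c f P. c * f P) (harmonic_to_orbit G)"
  by unfold_locales (auto simp: fun_eq_iff algebra_simps harmonic_to_orbit_def)

lemma harmonic_to_orbit_orbit_map:
  assumes G: "spherical_space_form G" and p: "p \<in> inv_harmonic (matrix_actions G) k" and x: "x \<in> sphere 0 1"
  shows "harmonic_to_orbit G p (orbit_map G x) = p x"
proof -
  have "mat 1 *v x \<in> orbit_map G x" unfolding orbit_map_def using space_form_mult(2)[OF G] by blast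
  then have "(SOME y. y \<in> orbit_map G x) \<in> orbit_map G x" by (metis someI)
  then obtain g where g: "g \<in> G" "(SOME y. y \<in> orbit_map G x) = g *v x" by (auto simp: orbit_map_def)
  have "p (g *v x) = p x"
    by (rule inv_hpolyD(2)[OF inv_harmonicD(1)[OF p]]) (use g in \<open>auto simp: matrix_actions_def\<close>)
  then show ?thesis using x g by (simp add: harmonic_to_orbit_def topspace_orbit_space)
qed

lemma orbit_eigenfunction:
  fixes G :: "(real^'n^'n) set"
  assumes G: "spherical_space_form G" and f: "f \<in> eigenspace G \<mu>" "f \<noteq> 0"
  shows "\<exists>k. \<mu> = sphere_eigenvalue CARD('n) k \<and> f \<in> harmonic_to_orbit G ` inv_harmonic (matrix_actions G) k"
proof -
  define u where "u = f \<circ> orbit_map G"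
  have f0: "\<And>P. P \<notin> topspace (orbit_space G) \<Longrightarrow> f P = 0"
    and u: "smooth_on_sphere u" "\<And>x. x \<in> sphere 0 1 \<Longrightarrow> sphere_laplacian u x = \<mu> * u x"
    using f(1) by (auto simp: eigenspace_def u_def)
  obtain P where P: "f P \<noteq> 0" using f(2) by (auto simp: fun_eq_iff zero_fun_def)
  then have "P \<in> orbit_map G ` sphere 0 1" using f0[of P] unfolding topspace_orbit_space by blast
  then obtain z where z: "z \<in> sphere 0 1" "u z \<noteq> 0" using P by (auto simp: u_def)
  have n: "DIM(real^'n) \<ge> 2" using G by (simp add: spherical_space_form_def)
  obtain k p where kp: "\<mu> = sphere_eigenvalue DIM(real^'n) k" "p \<in> inv_harmonic {} k" "\<And>x. x \<in> sphere 0 1 \<Longrightarrow> u x = p x"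
    using sphere_eigenfunction[OF u n z] by blast
  have hp: "p \<in> hpoly k" using kp(2) inv_harmonicD(1) inv_hpolyD(1) by blast
  have uinv: "u (g *v x) = u x" if "g \<in> G" for g x
    using orbit_map_eq[OF G, of x "g *v x"] that by (auto simp: u_def)
  \<comment> \<open>Invariance of \<open>u\<close> gives this only on the sphere; homogeneity of
    \<open>p\<close> extends it to the whole space.\<close>
  have inv: "p (g *v x) = p x" if g: "g \<in> G" for g x
  proof (cases "x = 0")
    case False
    define y where "y = x /\<^sub>R norm x"
    have y: "x = norm x *\<^sub>R y" "norm y = 1" using False by (auto simp: y_def)
    have "p (g *v x) = norm x ^ k * p (g *v y)"
      by (subst y(1)) (simp add: matrix_vector_mult_scaleR hpoly_homogeneous[OF hp])
    also have "p (g *v y) = p y"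
      using kp(3)[of y] kp(3)[of "g *v y"] y(2) space_form_orthogonal(3)[OF G g] uinv[OF g] by simp
    also have "norm x ^ k * p y = p x" using y(1) hpoly_homogeneous[OF hp] by metis
    finally show ?thesis .
  qed simp
  have pH: "p \<in> inv_harmonic (matrix_actions G) k"
    using hp inv inv_harmonicD(2)[OF kp(2)]
    by (intro inv_harmonicI inv_hpolyI) (auto simp: matrix_actions_def)
  have "f = harmonic_to_orbit G p"
  proof
    fix P show "f P = harmonic_to_orbit G p P"
    proof (cases "P \<in> topspace (orbit_space G)")
      case True
      then obtain x where x: "x \<in> sphere 0 1" "P = orbit_map G x" by (auto simp: topspace_orbit_space)
      then show ?thesis using harmonic_to_orbit_orbit_map[OF G pH x(1)] kp(3)[OF x(1)] by (simp add: u_def)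
    next
      case False
      then show ?thesis using f0 by (simp add: harmonic_to_orbit_def)
    qed
  qed
  then show ?thesis using pH kp(1) by auto
qed

lemma eigenspace_eq:
  fixes G :: "(real^'n^'n) set"
  assumes G: "spherical_space_form G"
  shows "eigenspace G (sphere_eigenvalue CARD('n) k) = harmonic_to_orbit G ` inv_harmonic (matrix_actions G) k"
proof (intro equalityI subsetI)
  fix f assume f: "f \<in> eigenspace G (sphere_eigenvalue CARD('n) k)"
  show "f \<in> harmonic_to_orbit G ` inv_harmonic (matrix_actions G) k"
  proof (cases "f = 0")
    case True
    then show ?thesis using fun_vs.subspace_0[OF subspace_inv_harmonic]
      by (intro image_eqI[of _ _ 0]) (auto simp: harmonic_to_orbit_def fun_eq_iff)
  next
    case False
    have "CARD('n) \<ge> 2" using G by (simp add: spherical_space_form_def)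
    then show ?thesis using orbit_eigenfunction[OF G f False] inj_sphere_eigenvalue by metis
  qed
next
  fix f assume "f \<in> harmonic_to_orbit G ` inv_harmonic (matrix_actions G) k"
  then obtain p where p: "p \<in> inv_harmonic (matrix_actions G) k" "f = harmonic_to_orbit G p" by blast
  define u where "u = f \<circ> orbit_map G"
  have up: "u x = p x" if "x \<in> sphere 0 1" for x
    using harmonic_to_orbit_orbit_map[OF G p(1) that] by (simp add: u_def p)
  have hp: "p \<in> hpoly k" "lap p = (\<lambda>x. 0)" using p(1) inv_harmonicD inv_hpolyD(1) by blast+
  have "smooth_on_sphere u" by (rule smooth_on_sphere_hpoly[OF hp(1) up])
  moreover have "sphere_laplacian u x = sphere_eigenvalue CARD('n) k * u x" if "x \<in> sphere 0 1" for x
    using sphere_laplacian_harmonic[OF hp up that] by simp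
  moreover have "f P = 0" if "P \<notin> topspace (orbit_space G)" for P using that by (simp add: p harmonic_to_orbit_def)
  ultimately show "f \<in> eigenspace G (sphere_eigenvalue CARD('n) k)"
    by (simp add: eigenspace_def u_def)
qed

theorem Spec_eigenvalue:
  fixes G :: "(real^'n^'n) set"
  assumes G: "spherical_space_form G"
  shows "Spec G (sphere_eigenvalue CARD('n) k) = fun_vs.dim (inv_harmonic (matrix_actions G) k)"
proof -
  let ?V = "inv_harmonic (matrix_actions G) k"
  have "?V \<subseteq> hpoly k" using inv_harmonicD(1) inv_hpolyD(1) by blast
  then obtain B where B: "finite B" "fun_vs.independent B" "B \<subseteq> ?V" "?V \<subseteq> fun_vs.span B" "card B = fun_vs.dim ?V"
    using finite_basis_hpoly_subspace by blast
  have sp: "fun_vs.span B = ?V" using B fun_vs.span_minimal[OF B(3) subspace_inv_harmonic] by blast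
  interpret T: Vector_Spaces.linear "\<lambda>c f P. c * f P" "\<lambda>c f P. c * f P" "harmonic_to_orbit G"
    by (rule linear_harmonic_to_orbit)
  have inj: "inj_on (harmonic_to_orbit G) (fun_vs.span B)"
  proof (rule T.inj_on_iff_eq_0[THEN iffD2], rule fun_vs.subspace_span, safe)
    fix p assume "p \<in> fun_vs.span B" and 0: "harmonic_to_orbit G p = 0"
    then have p: "p \<in> ?V" using sp by blast
    then have hp: "p \<in> hpoly k" using inv_harmonicD(1) inv_hpolyD(1) by blast
    have s: "p x = 0" if "x \<in> sphere 0 1" for x
      using harmonic_to_orbit_orbit_map[OF G p that] 0 by simp
    have "p x = 0" for x
    proof (cases "x = 0")
      case True
      \<comment> \<open>A point of the sphere settles the origin also in degree 0, where
        \<open>0 ^ k\<close> is 1 and \<open>p\<close> is constant.\<close>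
      obtain z :: "real^'n" where z: "norm z = 1" using vector_choose_size[of 1] by auto
      have "p 0 = 0 ^ k * p z" using hpoly_homogeneous[OF hp, of 0 z] by simp
      then show ?thesis using True s[of z] z by simp
    next
      case False
      then have "p x = norm x ^ k * p (x /\<^sub>R norm x)" using hpoly_homogeneous[OF hp, of "norm x" "x /\<^sub>R norm x"] by simp
      then show ?thesis using s[of "x /\<^sub>R norm x"] False by simp
    qed
    then show "p = 0" by (auto simp: zero_fun_def)
  qed
  have "fun_vs.independent (harmonic_to_orbit G ` B)" by (rule T.independent_injective_image[OF B(2) inj])
  moreover have "fun_vs.span (harmonic_to_orbit G ` B) = harmonic_to_orbit G ` ?V" by (simp add: T.span_image sp)
  ultimately have "fun_vs.dim (harmonic_to_orbit G ` ?V) = card (harmonic_to_orbit G ` B)"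
    by (metis fun_vs.dim_span_eq_card_independent)
  also have "\<dots> = card B" using inj fun_vs.span_superset by (metis card_image inj_on_subset)
  finally show ?thesis using B(5) by (simp add: Spec_def eigenspace_eq[OF G])
qed

theorem Spec_not_eigenvalue:
  fixes G :: "(real^'n^'n) set"
  assumes G: "spherical_space_form G" and "\<And>k. \<mu> \<noteq> sphere_eigenvalue CARD('n) k"
  shows "Spec G \<mu> = 0"
proof -
  have "eigenspace G \<mu> \<subseteq> {0}" using orbit_eigenfunction[OF G] assms(2) by blast
  then have "fun_vs.dim (eigenspace G \<mu>) \<le> card ({} :: ((real^'n) set \<Rightarrow> real) set)"
    by (intro fun_vs.dim_le_card) auto
  then show ?thesis by (simp add: Spec_def)
qed


section \<open>Traces, monomials and Molien's formula\<close>

context vector_space begin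

text \<open>The operators act on a space of all functions; only their effect on the
  finite-dimensional span of \<open>B\<close> enters.\<close>

definition trace_on :: "'b set \<Rightarrow> ('b \<Rightarrow> 'b) \<Rightarrow> 'a" where
  "trace_on B T = (\<Sum>b\<in>B. local.representation B (T b) b)"

lemma representation_sum_scale:
  assumes "independent B" "\<And>i. i \<in> I \<Longrightarrow> x i \<in> span B"
  shows "local.representation B (\<Sum>i\<in>I. scale (a i) (x i)) b = (\<Sum>i\<in>I. a i * local.representation B (x i) b)"
  using assms by (simp add: representation_sum representation_scale span_scale)

lemma trace_on_change_basis:
  assumes B: "finite B" "independent B" and C: "finite C" "independent C" and sp: "span C = span B"
    and T: "Vector_Spaces.linear scale scale T" "\<And>b. b \<in> B \<Longrightarrow> T b \<in> span B"
  shows "local.trace_on C T = local.trace_on B T"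
proof -
  interpret T: Vector_Spaces.linear scale scale T by (rule T)
  have CB: "c \<in> span B" if "c \<in> C" for c using sp span_base that by blast
  have BC: "b \<in> span C" if "b \<in> B" for b using sp span_base that by blast
  let ?\<beta> = "\<lambda>c. local.representation B c" and ?\<gamma> = "\<lambda>b. local.representation C b" and ?\<tau> = "\<lambda>b. local.representation B (T b)"
  have 1: "local.representation C (T c) c = (\<Sum>b\<in>B. \<Sum>b'\<in>B. ?\<beta> c b * ?\<tau> b b' * ?\<gamma> b' c)" if c: "c \<in> C" for c
  proof -
    have "T c = T (\<Sum>b\<in>B. scale (?\<beta> c b) b)"
      by (simp add: sum_representation_eq[OF B(2) CB[OF c] B(1) order_refl])
    also have "\<dots> = (\<Sum>b\<in>B. scale (?\<beta> c b) (T b))" by (simp add: T.sum T.scale)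
    finally have "local.representation C (T c) c = (\<Sum>b\<in>B. ?\<beta> c b * local.representation C (T b) c)"
      using representation_sum_scale[OF C(2), of B T "?\<beta> c" c] T(2) sp by simp
    also have "\<dots> = (\<Sum>b\<in>B. ?\<beta> c b * (\<Sum>b'\<in>B. ?\<tau> b b' * ?\<gamma> b' c))"
    proof (rule sum.cong[OF refl])
      fix b assume b: "b \<in> B"
      have "T b = (\<Sum>b'\<in>B. scale (?\<tau> b b') b')"
        by (simp add: sum_representation_eq[OF B(2) T(2)[OF b] B(1) order_refl])
      then have "local.representation C (T b) c = local.representation C (\<Sum>b'\<in>B. scale (?\<tau> b b') b') c" by simp
      also have "\<dots> = (\<Sum>b'\<in>B. ?\<tau> b b' * ?\<gamma> b' c)" by (rule representation_sum_scale[OF C(2) BC])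
      finally show "?\<beta> c b * local.representation C (T b) c = ?\<beta> c b * (\<Sum>b'\<in>B. ?\<tau> b b' * ?\<gamma> b' c)" by simp
    qed
    finally show ?thesis by (simp add: sum_distrib_left mult.assoc)
  qed
  \<comment> \<open>The two changes of coordinates are inverse to each other.\<close>
  have 2: "(\<Sum>c\<in>C. ?\<gamma> b' c * ?\<beta> c b) = (if b = b' then 1 else 0)" if b': "b' \<in> B" for b b'
  proof -
    have "(\<Sum>c\<in>C. ?\<gamma> b' c * ?\<beta> c b) = local.representation B (\<Sum>c\<in>C. scale (?\<gamma> b' c) c) b"
      by (rule representation_sum_scale[OF B(2) CB, symmetric])
    also have "(\<Sum>c\<in>C. scale (?\<gamma> b' c) c) = b'" by (rule sum_representation_eq[OF C(2) BC[OF b'] C(1) order_refl])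
    finally show ?thesis by (simp add: representation_basis[OF B(2) b'])
  qed
  have "local.trace_on C T = (\<Sum>c\<in>C. \<Sum>b\<in>B. \<Sum>b'\<in>B. ?\<beta> c b * ?\<tau> b b' * ?\<gamma> b' c)"
    unfolding trace_on_def by (rule sum.cong[OF refl 1])
  also have "\<dots> = (\<Sum>b\<in>B. \<Sum>c\<in>C. \<Sum>b'\<in>B. ?\<beta> c b * ?\<tau> b b' * ?\<gamma> b' c)"
    by (rule sum.swap)
  also have "\<dots> = (\<Sum>b\<in>B. \<Sum>b'\<in>B. \<Sum>c\<in>C. ?\<beta> c b * ?\<tau> b b' * ?\<gamma> b' c)"
    by (rule sum.cong[OF refl]) (rule sum.swap)
  also have "\<dots> = (\<Sum>b\<in>B. \<Sum>b'\<in>B. ?\<tau> b b' * (\<Sum>c\<in>C. ?\<gamma> b' c * ?\<beta> c b))"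
    by (simp add: sum_distrib_left mult_ac)
  also have "\<dots> = (\<Sum>b\<in>B. ?\<tau> b b)"
    using B(1) by (intro sum.cong refl) (simp add: 2 if_distrib cong: if_cong sum.cong)
  finally show ?thesis by (simp add: trace_on_def)
qed

lemma trace_on_sum:
  assumes "independent B" "\<And>i b. i \<in> I \<Longrightarrow> b \<in> B \<Longrightarrow> T i b \<in> span B"
  shows "local.trace_on B (\<lambda>v. \<Sum>i\<in>I. scale (a i) (T i v)) = (\<Sum>i\<in>I. a i * local.trace_on B (T i))"
proof -
  have "local.trace_on B (\<lambda>v. \<Sum>i\<in>I. scale (a i) (T i v)) = (\<Sum>b\<in>B. \<Sum>i\<in>I. a i * local.representation B (T i b) b)"
    unfolding trace_on_def by (intro sum.cong refl representation_sum_scale) (use assms in auto)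
  also have "\<dots> = (\<Sum>i\<in>I. a i * local.trace_on B (T i))"
    by (subst sum.swap) (simp add: trace_on_def sum_distrib_left)
  finally show ?thesis .
qed

text \<open>In a basis that extends a basis \<open>A\<close> of W, the diagonal entries are 1 on
  \<open>A\<close>, where T is the identity, and 0 elsewhere, where T maps into the span of
  \<open>A\<close>.\<close>

lemma trace_on_projection:
  assumes B: "finite B" "independent B" and T: "Vector_Spaces.linear scale scale T"
    and W: "subspace W" "W \<subseteq> span B" "\<And>b. b \<in> span B \<Longrightarrow> T b \<in> W" "\<And>w. w \<in> W \<Longrightarrow> T w = w"
  shows "local.trace_on B T = of_nat (dim W)"
proof -
  obtain A where A: "A \<subseteq> W" "independent A" "W \<subseteq> span A" "card A = dim W" by (rule basis_exists)
  obtain C where C: "A \<subseteq> C" "C \<subseteq> span B" "independent C" "span B \<subseteq> span C"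
    using maximal_independent_subset_extend[of A "span B"] A W by blast
  have fC: "finite C" using independent_span_bound[OF B(1) C(3,2)] by blast
  have spC: "span C = span B" using C span_minimal[OF C(2) subspace_span] by blast
  have spA: "span A = W" using A span_minimal[OF A(1) W(1)] by blast
  have "local.representation C (T c) c = (if c \<in> A then 1 else 0)" if c: "c \<in> C" for c
  proof (cases "c \<in> A")
    case True
    then have "T c = c" using A W by blast
    then show ?thesis using True by (simp add: representation_basis[OF C(3) c])
  next
    case False
    have "T c \<in> span A" using c C W(3) spA by blast
    then have "local.representation C (T c) = local.representation A (T c)"
      using representation_extend[OF C(3)] C(1) by metis
    moreover have "local.representation A (T c) c = 0" using False representation_ne_zero by blast
    ultimately show ?thesis using False by simp
  qed
  then have "local.trace_on C T = of_nat (card A)"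
    using fC C(1) by (simp add: trace_on_def sum.If_cases Int_absorb1 inf.absorb2 cong: sum.cong)
  moreover have "local.trace_on C T = local.trace_on B T"
    by (rule trace_on_change_basis[OF B fC C(3) spC T]) (use W span_base in blast)
  ultimately show ?thesis using A by simp
qed

lemma independent_if_card_le_dim_span:
  assumes "finite S" "card S \<le> dim (span S)" shows "independent S"
proof -
  obtain B where B: "B \<subseteq> S" "independent B" "S \<subseteq> span B" "card B = dim S" by (rule basis_exists)
  then have "B = S" using assms card_subset_eq[of S B] card_mono[of S B] by auto
  then show ?thesis using B by simp
qed

lemma trace_on_eigenbasis:
  assumes "independent B" "\<And>b. b \<in> B \<Longrightarrow> T b = scale (l b) b"
  shows "local.trace_on B T = (\<Sum>b\<in>B. l b)"
  unfolding trace_on_def using assms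
  by (intro sum.cong refl) (simp add: representation_scale span_base representation_basis)

end

section \<open>Linear independence of the monomials\<close>

lemma digits_unique:
  fixes f g :: "nat \<Rightarrow> nat"
  assumes "\<And>i. i < n \<Longrightarrow> f i < K" "\<And>i. i < n \<Longrightarrow> g i < K" "(\<Sum>i<n. f i * K ^ i) = (\<Sum>i<n. g i * K ^ i)" "i < n"
  shows "f i = g i"
  using assms
proof (induction n arbitrary: f g i)
  case 0
  then show ?case by simp
next
  case (Suc n)
  have split: "(\<Sum>i<Suc n. f i * K ^ i) = f 0 + K * (\<Sum>i<n. f (Suc i) * K ^ i)" for f :: "nat \<Rightarrow> nat"
    by (subst sum.lessThan_Suc_shift) (simp add: sum_distrib_left mult_ac)
  have eq: "f 0 + K * (\<Sum>i<n. f (Suc i) * K ^ i) = g 0 + K * (\<Sum>i<n. g (Suc i) * K ^ i)"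
    using Suc.prems(3) split by metis
  have lt: "f 0 < K" "g 0 < K" using Suc.prems(1,2)[of 0] by auto
  have 0: "f 0 = g 0" using arg_cong[OF eq, of "\<lambda>x. x mod K"] lt by simp
  then have rest: "(\<Sum>i<n. f (Suc i) * K ^ i) = (\<Sum>i<n. g (Suc i) * K ^ i)" using eq lt by simp
  have "f (Suc j) = g (Suc j)" if "j < n" for j
    by (rule Suc.IH[of "\<lambda>i. f (Suc i)" "\<lambda>i. g (Suc i)", OF _ _ rest that]) (use Suc.prems in auto)
  then show ?case using 0 Suc.prems(4) by (cases i) auto
qed

abbreviation ccoord :: "'a::euclidean_space \<Rightarrow> 'a \<Rightarrow> complex" where
  "ccoord b x \<equiv> complex_of_real (x \<bullet> b)"

text \<open>Linear independence of the monomials, by Kronecker substitution: along a curve whose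
  coordinates are sufficiently lacunary powers of \<open>t\<close>, distinct monomials become distinct powers
  of \<open>t\<close>.\<close>

lemma complex_monomials_coeff_0:
  fixes a :: "'a::euclidean_space multiset \<Rightarrow> complex"
  assumes 0: "\<And>x. (\<Sum>M\<in>msets_of_size Basis k. a M * mset_monom ccoord M x) = 0"
    and M: "M \<in> msets_of_size Basis k"
  shows "a M = 0"
proof -
  let ?S = "msets_of_size (Basis :: 'a set) k"
  obtain e where e: "bij_betw e (Basis :: 'a set) {..<DIM('a)}"
    using ex_bij_betw_finite_nat[OF finite_Basis] by (metis atLeast0LessThan)
  \<comment> \<open>The exponent of t in the monomial \<open>M\<close> along the curve.
    Multiplicities are at most k, so they are the digits of \<open>w M\<close> in base k + 1, and
    \<open>w\<close> is injective.\<close>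
  define w where "w M = (\<Sum>b\<in>Basis. count M b * Suc k ^ e b)" for M :: "'a multiset"
  have w_inj: "inj_on w ?S"
  proof (rule inj_onI)
    fix M N assume MN: "M \<in> ?S" "N \<in> ?S" "w M = w N"
    define e' where "e' = the_inv_into Basis e"
    have e': "e' (e b) = b" if "b \<in> Basis" for b
      using that e by (simp add: e'_def bij_betw_def the_inv_into_f_f)
    have w_alt: "w M = (\<Sum>i<DIM('a). count M (e' i) * Suc k ^ i)" for M
      unfolding w_def by (rule sum.reindex_bij_betw[OF e, THEN trans[rotated]]) (simp add: e')
    have lt: "count M b < Suc k" if "M \<in> ?S" for M b
      using that count_le_size[of M b] by (simp add: msets_of_size_def less_Suc_eq_le)
    show "M = N"
    proof (rule multiset_eqI)
      fix b
      show "count M b = count N b"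
      proof (cases "b \<in> Basis")
        case True
        have "e b < DIM('a)" using e True by (auto simp: bij_betw_def)
        then have "count M (e' (e b)) = count N (e' (e b))"
          by (rule digits_unique[of _ "\<lambda>i. count M (e' i)" "Suc k" "\<lambda>i. count N (e' i)", rotated 3])
             (use lt MN w_alt in auto)
        then show ?thesis using e'[OF True] by simp
      next
        case False
        then have "b \<notin># M" "b \<notin># N" using MN by (auto simp: msets_of_size_def)
        then show ?thesis by (simp add: not_in_iff)
      qed
    qed
  qed
  define q where "q = (\<Sum>M\<in>?S. Polynomial.monom (a M) (w M))"
  have "poly q (of_real t) = 0" for t
  proof -
    define x :: 'a where "x = (\<Sum>b\<in>Basis. (t ^ (Suc k ^ e b)) *\<^sub>R b)"
    have "mset_monom ccoord M x = of_real t ^ w M" if "M \<in> ?S" for M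
    proof -
      have "mset_monom ccoord M x = (\<Prod>b\<in>Basis. ccoord b x ^ count M b)"
        unfolding mset_monom_def image_prod_mset_multiplicity using that
        by (intro prod.mono_neutral_left) (auto simp: msets_of_size_def not_in_iff)
      also have "\<dots> = (\<Prod>b\<in>Basis. of_real t ^ (count M b * Suc k ^ e b))"
        by (intro prod.cong refl) (simp add: x_def power_mult[symmetric] mult.commute del: power_Suc)
      finally show ?thesis by (simp add: w_def power_sum)
    qed
    then have "poly q (of_real t) = (\<Sum>M\<in>?S. a M * mset_monom ccoord M x)"
      by (simp add: q_def poly_sum poly_monom)
    then show ?thesis using 0 by simp
  qed
  then have "range complex_of_real \<subseteq> {z. poly q z = 0}" by auto
  moreover have "infinite (range complex_of_real)"
    using finite_imageD[of complex_of_real UNIV] by (auto simp: inj_on_def infinite_UNIV_char_0)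
  ultimately have "q = 0" using poly_roots_finite finite_subset by blast
  then have "0 = Polynomial.coeff q (w M)" by simp
  also have "\<dots> = (\<Sum>N\<in>?S. if N = M then a N else 0)"
    unfolding q_def Polynomial.coeff_sum Polynomial.coeff_monom using w_inj M by (intro sum.cong refl) (auto simp: inj_on_def)
  also have "\<dots> = a M" by (subst sum.delta[OF finite_msets_of_size[OF finite_Basis]]) (simp add: M)
  finally show ?thesis by simp
qed

lemma independent_family:
  fixes f :: "'i \<Rightarrow> 'a \<Rightarrow> 'k::field"
  assumes fin: "finite I" and ind: "\<And>a i. (\<And>x. (\<Sum>i\<in>I. a i * f i x) = 0) \<Longrightarrow> i \<in> I \<Longrightarrow> a i = 0"
  shows "inj_on f I" "fun_vs.independent (f ` I)"
proof -
  show inj: "inj_on f I"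
  proof (rule inj_onI, rule ccontr)
    fix i j assume ij: "i \<in> I" "j \<in> I" "f i = f j" "i \<noteq> j"
    \<comment> \<open>Equal members at different indices would give a vanishing combination with
      coefficients 1 and -1.\<close>
    have "(\<Sum>l\<in>I. ((if l = i then 1 else 0) - (if l = j then 1 else 0)) * f l x) = 0" for x
    proof -
      have "(\<Sum>l\<in>I. ((if l = i then 1 else 0) - (if l = j then 1 else 0)) * f l x) =
        (\<Sum>l\<in>I. if l = i then f l x else 0) - (\<Sum>l\<in>I. if l = j then f l x else 0)"
        unfolding sum_subtractf[symmetric] by (rule sum.cong[OF refl]) auto
      also have "\<dots> = f i x - f j x" using ij(1,2) fin by (simp add: sum.delta)
      finally show ?thesis using ij(3) by simp
    qed
    from ind[OF this ij(1)] ij(4) show False by simp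
  qed
  show "fun_vs.independent (f ` I)"
  proof (rule fun_vs.independent_if_scalars_zero)
    fix a v assume 0: "(\<Sum>v\<in>f ` I. (\<lambda>P. a v * v P)) = 0" and v: "v \<in> f ` I"
    have "(\<Sum>i\<in>I. a (f i) * f i x) = 0" for x
      using fun_cong[OF 0, of x] by (simp add: sum_fun_apply sum.reindex[OF inj])
    then show "a v = 0" using ind[of "\<lambda>i. a (f i)"] v by blast
  qed (use fin in simp)
qed

lemma real_monomials_coeff_0:
  fixes a :: "'a::euclidean_space multiset \<Rightarrow> real"
  assumes 0: "\<And>x. (\<Sum>M\<in>msets_of_size Basis k. a M * mset_monom (\<lambda>b x. x \<bullet> b) M x) = 0"
    and M: "M \<in> msets_of_size Basis k"
  shows "a M = 0"
proof -
  have mm: "complex_of_real (mset_monom (\<lambda>b x. x \<bullet> b) M x) = mset_monom ccoord M x" for M and x :: 'a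
    by (induction M) auto
  have "(\<Sum>M\<in>msets_of_size Basis k. complex_of_real (a M) * mset_monom ccoord M x) = 0" for x :: 'a
    using arg_cong[OF 0[of x], of complex_of_real] by (simp add: mm)
  from complex_monomials_coeff_0[OF this M] show ?thesis by simp
qed

section \<open>Linear maps acting on real and complex polynomials\<close>

definition pullback :: "('a \<Rightarrow> 'a) \<Rightarrow> ('a \<Rightarrow> 'k) \<Rightarrow> 'a \<Rightarrow> 'k" where
  "pullback g f x = f (g x)"

lemma linear_pullback:
  "Vector_Spaces.linear (\<lambda>(c::'k::field) f P. c * f P) (\<lambda>c f P. c * f P) (pullback g)"
  by unfold_locales (auto simp: fun_eq_iff pullback_def)

definition complexify :: "('a \<Rightarrow> real) \<Rightarrow> 'a \<Rightarrow> complex" where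
  "complexify f x = complex_of_real (f x)"

lemma inj_complexify: "inj complexify"
  by (auto simp: inj_def complexify_def fun_eq_iff)

text \<open>If a real basis stays independent over the complex numbers, the real coordinates of a
  real function are also its complex ones. Traces of real operators can therefore be computed with
  complex eigenvectors.\<close>

lemma trace_on_complexify:
  assumes B: "finite B" "fun_vs.independent B" "fun_vs.independent (complexify ` B)"
    and T: "\<And>b. b \<in> B \<Longrightarrow> T b \<in> fun_vs.span B" "\<And>b. b \<in> B \<Longrightarrow> T' (complexify b) = complexify (T b)"
  shows "fun_vs.trace_on (complexify ` B) T' = complex_of_real (fun_vs.trace_on B T)"
proof -
  have inj: "inj_on complexify B" using inj_complexify inj_on_subset by blast
  have "fun_vs.representation (complexify ` B) (complexify f) (complexify b) = complex_of_real (fun_vs.representation B f b)"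
    if f: "f \<in> fun_vs.span B" and b: "b \<in> B" for f b
  proof -
    let ?r = "fun_vs.representation B f"
    have "f = (\<Sum>c\<in>B. (\<lambda>P. ?r c * c P))"
      by (rule fun_vs.sum_representation_eq[OF B(2) f B(1) order_refl, symmetric])
    then have fx: "f x = (\<Sum>c\<in>B. ?r c * c x)" for x by (metis (no_types, lifting) sum.cong sum_fun_apply)
    have "complexify f = (\<Sum>c\<in>B. (\<lambda>P. complex_of_real (?r c) * complexify c P))"
    proof
      fix x show "complexify f x = (\<Sum>c\<in>B. (\<lambda>P. complex_of_real (?r c) * complexify c P)) x"
        using arg_cong[OF fx[of x], of complex_of_real] by (simp add: complexify_def sum_fun_apply)
    qed
    then have "fun_vs.representation (complexify ` B) (complexify f) (complexify b) =
       (\<Sum>c\<in>B. complex_of_real (?r c) * fun_vs.representation (complexify ` B) (complexify c) (complexify b))"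
      using fun_vs.representation_sum_scale[OF B(3), of B complexify "\<lambda>c. complex_of_real (?r c)" "complexify b"]
      by (simp add: fun_vs.span_base)
    also have "\<dots> = (\<Sum>c\<in>B. if c = b then complex_of_real (?r c) else 0)"
      by (intro sum.cong refl) (use b inj in \<open>auto simp: fun_vs.representation_basis[OF B(3)] inj_on_def\<close>)
    finally show ?thesis using b B(1) by simp
  qed
  then have "fun_vs.trace_on (complexify ` B) T' = (\<Sum>b\<in>B. complex_of_real (fun_vs.representation B (T b) b))"
    unfolding fun_vs.trace_on_def sum.reindex[OF inj] by (intro sum.cong refl) (simp add: T)
  then show ?thesis by (simp add: fun_vs.trace_on_def)
qed

definition monomial_basis :: "nat \<Rightarrow> ('a::euclidean_space \<Rightarrow> real) set" where
  "monomial_basis k = mset_monom (\<lambda>b x. x \<bullet> b) ` msets_of_size Basis k"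

lemma finite_monomial_basis: "finite (monomial_basis k)"
  unfolding monomial_basis_def by (rule finite_imageI[OF finite_msets_of_size[OF finite_Basis]])

lemma span_monomial_basis: "fun_vs.span (monomial_basis k) = hpoly k"
  unfolding monomial_basis_def hpoly_def hpoly_of_def ..

lemma independent_monomial_basis: "fun_vs.independent (monomial_basis k)"
  unfolding monomial_basis_def
  by (rule independent_family(2)[OF finite_msets_of_size[OF finite_Basis]]) (rule real_monomials_coeff_0)

lemma complexify_monomial_basis: "complexify ` monomial_basis k = mset_monom ccoord ` msets_of_size Basis k"
proof -
  have "complexify (mset_monom (\<lambda>b x. x \<bullet> b) M) = mset_monom ccoord M" for M :: "'a multiset"
  proof
    fix x show "complexify (mset_monom (\<lambda>b x. x \<bullet> b) M) x = mset_monom ccoord M x"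
      by (induction M) (auto simp: complexify_def)
  qed
  then show ?thesis unfolding monomial_basis_def image_image by simp
qed

lemma independent_complex_monomials: "fun_vs.independent (complexify ` monomial_basis k)"
  unfolding complexify_monomial_basis
  by (rule independent_family(2)[OF finite_msets_of_size[OF finite_Basis]]) (rule complex_monomials_coeff_0)

lemma card_complex_monomials: "card (complexify ` (monomial_basis k :: ('a::euclidean_space \<Rightarrow> real) set)) = card (msets_of_size (Basis :: 'a set) k)"
  unfolding complexify_monomial_basis
  by (rule card_image, rule independent_family(1)[OF finite_msets_of_size[OF finite_Basis]]) (rule complex_monomials_coeff_0)

lemma span_complex_monomials: "fun_vs.span (complexify ` monomial_basis k) = hpoly_of ccoord Basis k"
  unfolding complexify_monomial_basis hpoly_of_def ..

text \<open>The averaging operator is a projection onto the invariants, so its trace is their dimension.\<close>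

lemma dim_inv_hpoly_eq_trace:
  fixes \<G> :: "('a::euclidean_space \<Rightarrow> 'a) set"
  assumes fin: "finite \<G>" "\<G> \<noteq> {}" and lin: "\<And>g. g \<in> \<G> \<Longrightarrow> linear g"
    and shift: "\<And>h. h \<in> \<G> \<Longrightarrow> (\<lambda>g. g \<circ> h) ` \<G> = \<G>"
  shows "real (fun_vs.dim (inv_hpoly \<G> k)) = (\<Sum>g\<in>\<G>. fun_vs.trace_on (monomial_basis k) (pullback g)) / card \<G>"
proof -
  define T where "T p = (\<Sum>g\<in>\<G>. (\<lambda>P. (1 / real (card \<G>)) * pullback g p P))" for p :: "'a \<Rightarrow> real"
  have Tx: "T p x = (\<Sum>g\<in>\<G>. (1 / real (card \<G>)) * p (g x))" for p x
    by (simp add: T_def sum_fun_apply pullback_def)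
  have pull: "pullback g p \<in> hpoly k" if "g \<in> \<G>" "p \<in> hpoly k" for g p
    using hpoly_linear_comp[OF that(2) lin[OF that(1)]] by (simp add: pullback_def[abs_def])
  have card: "real (card \<G>) \<noteq> 0" using fin by auto
  have "fun_vs.trace_on (monomial_basis k) T = real (fun_vs.dim (inv_hpoly \<G> k))"
  proof (rule fun_vs.trace_on_projection[OF finite_monomial_basis independent_monomial_basis _ subspace_inv_hpoly])
    show "Vector_Spaces.linear (\<lambda>c f P. c * f P) (\<lambda>c f P. c * f P) T"
      by unfold_locales (auto simp: fun_eq_iff Tx sum.distrib sum_distrib_left algebra_simps)
    show "inv_hpoly \<G> k \<subseteq> fun_vs.span (monomial_basis k)"
      unfolding span_monomial_basis using inv_hpolyD(1) by blast
  next
    fix p :: "'a \<Rightarrow> real" assume "p \<in> fun_vs.span (monomial_basis k)"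
    then have p: "p \<in> hpoly k" by (simp add: span_monomial_basis)
    have "T p \<in> hpoly k" unfolding T_def
      by (intro fun_vs.subspace_sum fun_vs.subspace_scale pull p)
        (auto simp: hpoly_def subspace_hpoly_of)
    moreover have "T p (h x) = T p x" if h: "h \<in> \<G>" for h x
    proof -
      have "inj_on (\<lambda>g. g \<circ> h) \<G>" using shift[OF h] fin(1) by (simp add: finite_surj_inj)
      then have "(\<Sum>g\<in>(\<lambda>g. g \<circ> h) ` \<G>. (1 / real (card \<G>)) * p (g x)) = (\<Sum>g\<in>\<G>. (1 / real (card \<G>)) * p ((g \<circ> h) x))"
        by (simp add: sum.reindex)
      then show ?thesis unfolding shift[OF h] by (simp add: Tx)
    qed
    ultimately show "T p \<in> inv_hpoly \<G> k" by (rule inv_hpolyI)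
  next
    fix p assume p: "p \<in> inv_hpoly \<G> k"
    show "T p = p"
    proof
      fix x
      have "T p x = (\<Sum>g\<in>\<G>. (1 / real (card \<G>)) * p x)"
        unfolding Tx by (intro sum.cong refl) (simp add: inv_hpolyD(2)[OF p])
      then show "T p x = p x" using card by simp
    qed
  qed
  moreover have "fun_vs.trace_on (monomial_basis k) T =
    (\<Sum>g\<in>\<G>. (1 / real (card \<G>)) * fun_vs.trace_on (monomial_basis k) (pullback g))"
    unfolding T_def
    by (rule fun_vs.trace_on_sum[OF independent_monomial_basis])
       (metis pull fun_vs.span_base span_monomial_basis)
  ultimately show ?thesis by (simp add: sum_divide_distrib)
qed

section \<open>Eigenforms of maps of finite order\<close>

lemma primitive_root_of_unity_exists:
  assumes "N > 0" obtains w :: complex where "\<And>j. w ^ j = 1 \<longleftrightarrow> N dvd j"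
proof -
  define w where "w = exp (2 * of_real pi * \<i> * of_nat 1 / of_nat N)"
  have "w ^ j = exp (2 * of_real pi * \<i> * of_nat j / of_nat N)" for j
    unfolding w_def by (simp add: exp_of_nat_mult[symmetric] mult_ac)
  then have "w ^ j = 1 \<longleftrightarrow> N dvd j" for j
    using complex_root_unity_eq_1[of N j] assms by simp
  then show ?thesis by (rule that)
qed

lemma sum_powers_root_of_unity:
  fixes x :: "'k::field_char_0"
  assumes "x ^ N = 1" shows "(\<Sum>j<N. x ^ j) = (if x = 1 then of_nat N else 0)"
  using assms geometric_sum[of x N] by auto

lemma msets_of_size_1: "msets_of_size X 1 = (\<lambda>b. {#b#}) ` X"
  by (auto simp: msets_of_size_def dest!: size_1_singleton_mset[unfolded One_nat_def])

lemma hpoly_of_1: "hpoly_of l X 1 = fun_vs.span (l ` X)"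
proof -
  have "mset_monom l {#b#} = l b" for b by (auto simp: fun_eq_iff mset_monom_def)
  then show ?thesis by (simp add: hpoly_of_def image_image msets_of_size_1 del: One_nat_def)
qed

lemma ccoord_inner: "(\<lambda>x. complex_of_real (x \<bullet> v)) \<in> hpoly_of ccoord Basis 1"
proof -
  have "(\<lambda>x. complex_of_real (x \<bullet> v)) = (\<lambda>x. \<Sum>b\<in>Basis. complex_of_real (v \<bullet> b) * ccoord b x)"
    by (auto simp: fun_eq_iff euclidean_inner[of _ v] mult_ac)
  moreover have "(\<lambda>x. \<Sum>b\<in>Basis. complex_of_real (v \<bullet> b) * ccoord b x) \<in> hpoly_of ccoord Basis 1"
    by (intro hpoly_of_sum hpoly_of_cmult hpoly_of_linear_form)
  ultimately show ?thesis by metis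
qed

lemma complex_hpoly_pullback:
  fixes g :: "'a::euclidean_space \<Rightarrow> 'a"
  assumes "linear g" "f \<in> hpoly_of ccoord Basis k"
  shows "pullback g f \<in> hpoly_of ccoord Basis k"
  unfolding pullback_def[abs_def] using assms(2)
proof (rule hpoly_of_subst)
  fix b :: 'a
  have "(\<lambda>x. complex_of_real (g x \<bullet> b)) = (\<lambda>x. complex_of_real (x \<bullet> adjoint g b))"
    using adjoint_works[OF assms(1)] by (auto simp: inner_commute)
  then show "(\<lambda>x. ccoord b (g x)) \<in> hpoly_of ccoord Basis 1" using ccoord_inner by metis
qed

lemma linear_funpow: "linear g \<Longrightarrow> linear (g ^^ j)" for g :: "'a::real_vector \<Rightarrow> 'a"
  by (induction j) (auto simp: linear_compose linear_id[unfolded id_def] id_def)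

text \<open>A linear form is the sum of its projections to the eigenspaces of an operator of finite order.\<close>

lemma complex_eigenbasis:
  fixes g :: "'a::euclidean_space \<Rightarrow> 'a"
  assumes g: "linear g" "g ^^ N = id" and N: "N > 0"
  obtains B and l :: "('a \<Rightarrow> complex) \<Rightarrow> complex" where
    "finite B" "fun_vs.independent B" "fun_vs.span B = hpoly_of ccoord Basis 1" "card B = DIM('a)"
    "\<And>b. b \<in> B \<Longrightarrow> pullback g b = (\<lambda>x. l b * b x)" "\<And>b. b \<in> B \<Longrightarrow> l b ^ N = 1"
proof -
  let ?V = "hpoly_of ccoord Basis 1 :: ('a \<Rightarrow> complex) set"
  define E where "E = {v \<in> ?V. \<exists>l. l ^ N = 1 \<and> pullback g v = (\<lambda>x. l * v x)}"
  obtain w :: complex where w: "\<And>j. w ^ j = 1 \<longleftrightarrow> N dvd j" using primitive_root_of_unity_exists[OF N] by blast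
  have w0: "w \<noteq> 0" using w[of N] N by (metis dvd_refl power_eq_0_iff zero_neq_one)
  have "v \<in> fun_vs.span E" if v: "v \<in> ?V" for v
  proof -
    \<comment> \<open>A discrete Fourier transform along the powers of g: \<open>pr i\<close> is the
      component of v for the eigenvalue \<open>inverse (w ^ i)\<close>, and by orthogonality of the
      characters these components add up to v.\<close>
    define pr where "pr i = (\<lambda>x. \<Sum>j<N. (1 / of_nat N) * (w ^ i) ^ j * v ((g ^^ j) x))" for i
    have prV: "pr i \<in> ?V" for i unfolding pr_def
    proof (intro hpoly_of_sum hpoly_of_cmult)
      fix j show "(\<lambda>x. v ((g ^^ j) x)) \<in> ?V"
        using complex_hpoly_pullback[OF linear_funpow[OF g(1)] v, of j] by (simp add: pullback_def[abs_def])
    qed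
    have "pr i \<in> E" for i
    proof -
      have wN: "(w ^ i) ^ N = 1" using w[of "i * N"] by (simp add: power_mult[symmetric])
      have "pullback g (pr i) x = inverse (w ^ i) * pr i x" for x
      proof -
        let ?F = "\<lambda>j. (1 / of_nat N) * (w ^ i) ^ j * v ((g ^^ j) x)"
        have "(\<Sum>j<N. ?F (Suc j)) = (\<Sum>j<Suc N. ?F j) - ?F 0" by (subst sum.lessThan_Suc_shift) simp
        also have "\<dots> = (\<Sum>j<N. ?F j)" using wN g(2) by simp
        finally have shift: "(\<Sum>j<N. ?F (Suc j)) = pr i x" by (simp add: pr_def)
        have "pullback g (pr i) x = (\<Sum>j<N. inverse (w ^ i) * ?F (Suc j))"
          unfolding pullback_def pr_def using w0
          by (intro sum.cong refl) (simp add: funpow_swap1[symmetric] field_simps)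
        then show ?thesis using shift by (simp only: sum_distrib_left[symmetric])
      qed
      moreover have "inverse (w ^ i) ^ N = 1" using wN by (simp add: power_inverse)
      ultimately show ?thesis using prV by (auto simp: E_def)
    qed
    then have "(\<Sum>i<N. pr i) \<in> fun_vs.span E" by (intro fun_vs.span_sum fun_vs.span_base)
    moreover have "(\<Sum>i<N. pr i) = v"
    proof
      fix x
      have "(\<Sum>i<N. pr i) x = (\<Sum>j<N. (1 / of_nat N) * v ((g ^^ j) x) * (\<Sum>i<N. (w ^ j) ^ i))"
        unfolding sum_fun_apply pr_def
        by (subst sum.swap) (simp add: sum_distrib_left power_mult[symmetric] mult_ac)
      also have "\<dots> = (\<Sum>j<N. if j = 0 then v x else 0)"
      proof (rule sum.cong[OF refl])
        fix j assume "j \<in> {..<N}"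
        then have "w ^ j = 1 \<longleftrightarrow> j = 0" using w[of j] by (auto dest: dvd_imp_le)
        moreover have "(w ^ j) ^ N = 1" using w[of "j * N"] by (simp add: power_mult[symmetric])
        ultimately show "(1 / of_nat N) * v ((g ^^ j) x) * (\<Sum>i<N. (w ^ j) ^ i) = (if j = 0 then v x else 0)"
          using sum_powers_root_of_unity[of "w ^ j" N] N by simp
      qed
      finally show "(\<Sum>i<N. pr i) x = v x" using N by (simp add: sum.delta)
    qed
    ultimately show ?thesis by simp
  qed
  then have VE: "?V \<subseteq> fun_vs.span E" by blast
  obtain B where B: "B \<subseteq> E" "fun_vs.independent B" "E \<subseteq> fun_vs.span B"
    by (rule fun_vs.maximal_independent_subset)
  have EV: "E \<subseteq> ?V" by (auto simp: E_def)
  have spB: "fun_vs.span B = ?V"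
  proof
    show "fun_vs.span B \<subseteq> ?V" using B(1) EV by (intro fun_vs.span_minimal subspace_hpoly_of) blast
    show "?V \<subseteq> fun_vs.span B" using VE fun_vs.span_minimal[OF B(3) fun_vs.subspace_span] by blast
  qed
  let ?C = "complexify ` (monomial_basis 1 :: ('a \<Rightarrow> real) set)"
  have finB: "finite B"
    using fun_vs.independent_span_bound[OF finite_imageI[OF finite_monomial_basis[of 1]] B(2), of complexify]
      span_complex_monomials[of 1] B(1) EV by blast
  have "card B = card ?C"
    using fun_vs.dim_span_eq_card_independent[OF B(2)]
      fun_vs.dim_span_eq_card_independent[OF independent_complex_monomials[of 1]] spB span_complex_monomials[of 1]
    by metis
  also have "\<dots> = card ((\<lambda>b. {#b#}) ` (Basis :: 'a set))"
    by (simp only: card_complex_monomials msets_of_size_1)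
  also have "\<dots> = DIM('a)" by (rule card_image) (auto simp: inj_on_def)
  finally have cardB: "card B = DIM('a)" .
  have "\<forall>b\<in>B. \<exists>l. l ^ N = 1 \<and> pullback g b = (\<lambda>x. l * b x)" using B(1) by (auto simp: E_def)
  then obtain l where "\<forall>b\<in>B. l b ^ N = 1 \<and> pullback g b = (\<lambda>x. l b * b x)" by metis
  then show ?thesis using that[OF finB B(2) spB cardB] by blast
qed

text \<open>The complete homogeneous symmetric polynomial of degree k in the values of
  \<open>l\<close>, that is, the trace of the k-th symmetric power of a diagonal operator.\<close>

definition complete_sym :: "('b \<Rightarrow> 'k::comm_ring_1) \<Rightarrow> 'b set \<Rightarrow> nat \<Rightarrow> 'k" where
  "complete_sym l X k = (\<Sum>M\<in>msets_of_size X k. \<Prod>b\<in>#M. l b)"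

lemma card_msets_of_size_le:
  assumes "finite X" "finite Y" "card X = card Y" shows "card (msets_of_size X k) \<le> card (msets_of_size Y k)"
proof -
  obtain f where f: "bij_betw f X Y" using finite_same_card_bij[OF assms] by blast
  have "inj_on (image_mset f) (msets_of_size X k)"
  proof (rule inj_on_inverseI)
    fix M assume "M \<in> msets_of_size X k"
    then have "image_mset (\<lambda>b. the_inv_into X f (f b)) M = image_mset (\<lambda>b. b) M"
      using f by (intro image_mset_cong) (auto simp: msets_of_size_def bij_betw_def the_inv_into_f_f)
    then show "image_mset (the_inv_into X f) (image_mset f M) = M" by (simp add: multiset.map_comp comp_def)
  qed
  moreover have "image_mset f ` msets_of_size X k \<subseteq> msets_of_size Y k"
    using f by (auto simp: msets_of_size_def bij_betw_def) blast
  ultimately show ?thesis by (rule card_inj_on_le) (rule finite_msets_of_size[OF assms(2)])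
qed

text \<open>The monomials in the eigenforms are eigenvectors. They span the same space as the
  coordinate monomials and are not more numerous, so they form a basis; thus their independence
  comes from a count.\<close>

lemma trace_pullback_eigenbasis:
  fixes g :: "'a::euclidean_space \<Rightarrow> 'a"
  assumes g: "linear g" and B: "finite B" "fun_vs.span B = hpoly_of ccoord Basis 1" "card B = DIM('a)"
    and l: "\<And>b. b \<in> B \<Longrightarrow> pullback g b = (\<lambda>x. l b * b x)"
  shows "complex_of_real (fun_vs.trace_on (monomial_basis k) (pullback g)) = complete_sym l B k"
proof -
  let ?C = "complexify ` (monomial_basis k :: ('a \<Rightarrow> real) set)"
  let ?m = "mset_monom (\<lambda>b. b) :: ('a \<Rightarrow> complex) multiset \<Rightarrow> 'a \<Rightarrow> complex"
  let ?D = "?m ` msets_of_size B k"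
  have B1: "hpoly_of (\<lambda>b. b) B 1 = hpoly_of ccoord Basis 1" using B(2) by (simp only: hpoly_of_1 image_ident)
  have "hpoly_of (\<lambda>b. b) B k = hpoly_of ccoord Basis k"
  proof (intro equalityI subsetI)
    fix p assume p: "p \<in> hpoly_of (\<lambda>b. b) B k"
    show "p \<in> hpoly_of ccoord Basis k"
      using hpoly_of_subst[OF p, of "\<lambda>x. x" ccoord Basis] hpoly_of_linear_form[of _ B "\<lambda>b. b"] B1 by auto
  next
    fix p :: "'a \<Rightarrow> complex" assume p: "p \<in> hpoly_of ccoord Basis k"
    show "p \<in> hpoly_of (\<lambda>b. b) B k"
      using hpoly_of_subst[OF p, of "\<lambda>x. x" "\<lambda>b. b" B] hpoly_of_linear_form[of _ "Basis :: 'a set" ccoord] B1 by auto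
  qed
  then have sp: "fun_vs.span ?D = fun_vs.span ?C" by (simp add: hpoly_of_def complexify_monomial_basis)
  have dimC: "fun_vs.dim (fun_vs.span ?C) = card (msets_of_size (Basis :: 'a set) k)"
    by (simp only: fun_vs.dim_span_eq_card_independent[OF independent_complex_monomials] card_complex_monomials)
  have finD: "finite ?D" using finite_msets_of_size[OF B(1)] by blast
  have c1: "card ?D \<le> card (msets_of_size B k)" by (rule card_image_le[OF finite_msets_of_size[OF B(1)]])
  have c2: "card (msets_of_size B k) \<le> card (msets_of_size (Basis :: 'a set) k)"
    using B by (intro card_msets_of_size_le) auto
  have indD: "fun_vs.independent ?D"
    by (rule fun_vs.independent_if_card_le_dim_span[OF finD]) (use c1 c2 sp dimC in simp)
  have "card ?D = card (msets_of_size (Basis :: 'a set) k)"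
    using fun_vs.dim_span_eq_card_independent[OF indD] sp dimC by simp
  then have inj: "inj_on ?m (msets_of_size B k)"
    using c1 c2 by (intro eq_card_imp_inj_on finite_msets_of_size[OF B(1)]) simp
  have eig: "pullback g (?m M) = (\<lambda>x. (\<Prod>b\<in>#M. l b) * ?m M x)" if "set_mset M \<subseteq> B" for M
    using that
  proof (induction M)
    case empty
    then show ?case by (simp add: pullback_def fun_eq_iff)
  next
    case (add b M)
    have "b (g x) = l b * b x" for x using fun_cong[OF l[of b], of x] add.prems by (simp add: pullback_def)
    moreover have "?m M (g x) = (\<Prod>b\<in>#M. l b) * ?m M x" for x
      using add by (simp add: pullback_def fun_eq_iff)
    ultimately show ?case by (simp add: pullback_def fun_eq_iff mult_ac)
  qed
  define e where "e d = (\<Prod>b\<in>#the_inv_into (msets_of_size B k) ?m d. l b)" for d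
  have e: "e (?m M) = (\<Prod>b\<in>#M. l b)" if "M \<in> msets_of_size B k" for M
    using that by (simp add: e_def the_inv_into_f_f[OF inj])
  have "fun_vs.trace_on ?D (pullback g) = (\<Sum>d\<in>?D. e d)"
  proof (rule fun_vs.trace_on_eigenbasis[OF indD])
    fix d assume "d \<in> ?D"
    then obtain M where M: "M \<in> msets_of_size B k" "d = ?m M" by blast
    then show "pullback g d = (\<lambda>P. e d * d P)" using eig[of M] e[OF M(1)] by (simp add: msets_of_size_def)
  qed
  also have "\<dots> = complete_sym l B k"
    unfolding complete_sym_def sum.reindex[OF inj] by (intro sum.cong refl) (simp add: e)
  finally have D: "fun_vs.trace_on ?D (pullback g) = complete_sym l B k" .
  have pull: "pullback g b \<in> hpoly k" if "b \<in> monomial_basis k" for b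
    unfolding pullback_def[abs_def]
    by (rule hpoly_linear_comp[OF _ g]) (metis fun_vs.span_base[OF that] span_monomial_basis)
  have "fun_vs.trace_on ?C (pullback g) = complex_of_real (fun_vs.trace_on (monomial_basis k) (pullback g))"
    by (rule trace_on_complexify[OF finite_monomial_basis independent_monomial_basis independent_complex_monomials])
       (use pull span_monomial_basis in \<open>auto simp: pullback_def complexify_def fun_eq_iff\<close>)
  moreover have "fun_vs.trace_on ?D (pullback g) = fun_vs.trace_on ?C (pullback g)"
  proof (rule fun_vs.trace_on_change_basis[OF finite_imageI[OF finite_monomial_basis] independent_complex_monomials finD indD sp linear_pullback])
    fix b assume "b \<in> ?C"
    then have "b \<in> hpoly_of ccoord Basis k" using span_complex_monomials fun_vs.span_base by metis
    then show "pullback g b \<in> fun_vs.span ?C" using complex_hpoly_pullback[OF g] span_complex_monomials by metis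
  qed
  ultimately show ?thesis using D by simp
qed

section \<open>Eigenvalues of the elements of a freely acting group\<close>

lemma matrix_power_action:
  "(*v) (g [^]\<^bsub>subgroup_of_matrices G\<^esub> (j::nat)) = ((*v) g) ^^ j" for g :: "real^'n^'n"
  by (induction j) (auto simp: fun_eq_iff nat_pow_def matrix_vector_mul_assoc[symmetric] funpow_swap1)

lemma complex_linear_form_parts:
  assumes "f \<in> hpoly_of ccoord Basis 1" obtains r s where "\<And>x. f x = Complex (x \<bullet> r) (x \<bullet> s)"
proof -
  have "f \<in> fun_vs.span (ccoord ` Basis)" using assms by (simp only: hpoly_of_1)
  then have "\<exists>r s. \<forall>x. f x = Complex (x \<bullet> r) (x \<bullet> s)"
  proof (induction rule: fun_vs.span_induct_alt)
    case base
    show ?case by (intro exI[of _ 0]) (simp add: complex_eq_iff)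
  next
    case (step c v y)
    then obtain b r s where b: "v = ccoord b" and y: "\<forall>x. y x = Complex (x \<bullet> r) (x \<bullet> s)" by blast
    show ?case
      by (intro exI[of _ "Re c *\<^sub>R b + r"] exI[of _ "Im c *\<^sub>R b + s"])
         (simp add: b y complex_eq_iff inner_add_right)
  qed
  then show ?thesis using that by blast
qed

text \<open>A nonzero complex linear form fixed by an orthogonal map yields a fixed unit vector, since its
  real and imaginary parts are fixed covectors.\<close>

lemma fixed_linear_form_imp_fixed_vector:
  assumes h: "orthogonal_transformation h" and f: "f \<in> hpoly_of ccoord Basis 1" "pullback h f = f" "f \<noteq> 0"
  obtains r where "norm r = 1" "h r = r"
proof -
  obtain r s where rs: "\<And>x. f x = Complex (x \<bullet> r) (x \<bullet> s)" using complex_linear_form_parts[OF f(1)] by blast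
  have eq: "h x \<bullet> r = x \<bullet> r" "h x \<bullet> s = x \<bullet> s" for x
    using fun_cong[OF f(2), of x] by (simp_all add: pullback_def rs)
  have fixed: "h v = v" if "\<And>x. h x \<bullet> v = x \<bullet> v" for v
  proof -
    obtain x where x: "h x = v - h v" using orthogonal_transformation_surj[OF h] by (metis surjD)
    have "h x \<bullet> h v = x \<bullet> v" using h by (simp add: orthogonal_transformation_def)
    then have "h x \<bullet> (v - h v) = 0" using that[of x] by (simp add: inner_diff_right)
    then show ?thesis using x by simp
  qed
  have "r \<noteq> 0 \<or> s \<noteq> 0" using f(3) rs by (auto simp: fun_eq_iff complex_eq_iff)
  then obtain v where v: "v \<noteq> 0" "h v = v" using fixed eq by metis
  have "linear h" using h by (simp add: orthogonal_transformation_def)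
  then have "h (v /\<^sub>R norm v) = v /\<^sub>R norm v" using v by (simp add: linear_scale)
  then show ?thesis using that[of "v /\<^sub>R norm v"] v by simp
qed

text \<open>By Fourier inversion on the N-th roots of unity, the multiplicity of z is a combination
  of the power sums with coefficients z^-j / N. As the power sums are real, complex conjugation
  turns the formula for z into the one for its conjugate.\<close>

lemma eigenvalue_multiplicity_conj:
  fixes l :: "'b \<Rightarrow> complex"
  assumes B: "finite B" and lN: "\<And>b. b \<in> B \<Longrightarrow> l b ^ N = 1" and N: "N > 0"
    and real: "\<And>j. (\<Sum>b\<in>B. l b ^ j) \<in> \<real>"
  shows "card {b \<in> B. l b = z} = card {b \<in> B. l b = cnj z}"
proof (cases "z ^ N = 1")
  case True
  have formula: "of_nat (card {b \<in> B. l b = z}) = (1 / of_nat N) * (\<Sum>j<N. inverse z ^ j * (\<Sum>b\<in>B. l b ^ j))"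
    if z: "z ^ N = 1" for z
  proof -
    have z0: "z \<noteq> 0" using z N by (auto simp: power_0_left)
    have "(\<Sum>j<N. inverse z ^ j * (\<Sum>b\<in>B. l b ^ j)) = (\<Sum>b\<in>B. \<Sum>j<N. (inverse z * l b) ^ j)"
      unfolding sum_distrib_left power_mult_distrib by (rule sum.swap)
    also have "\<dots> = (\<Sum>b\<in>B. if l b = z then of_nat N else 0)"
    proof (rule sum.cong[OF refl])
      fix b assume b: "b \<in> B"
      have "(inverse z * l b) ^ N = 1" using z lN[OF b] by (simp add: power_mult_distrib power_inverse)
      moreover have "inverse z * l b = 1 \<longleftrightarrow> l b = z" using z0 by (auto simp: field_simps)
      ultimately show "(\<Sum>j<N. (inverse z * l b) ^ j) = (if l b = z then of_nat N else 0)"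
        using sum_powers_root_of_unity by metis
    qed
    also have "\<dots> = of_nat N * of_nat (card {b \<in> B. l b = z})"
      using B by (simp add: sum.If_cases Int_def mult.commute)
    finally show ?thesis using N by simp
  qed
  have cz: "cnj z ^ N = 1" using True by (metis complex_cnj_one complex_cnj_power)
  have "complex_of_nat (card {b \<in> B. l b = z}) = cnj (of_nat (card {b \<in> B. l b = z}))" by simp
  also have "\<dots> = (1 / of_nat N) * (\<Sum>j<N. inverse (cnj z) ^ j * cnj (\<Sum>b\<in>B. l b ^ j))"
    unfolding formula[OF True] by (simp add: cnj_sum)
  also have "\<dots> = (1 / of_nat N) * (\<Sum>j<N. inverse (cnj z) ^ j * (\<Sum>b\<in>B. l b ^ j))"
    using real by (simp add: Reals_cnj_iff del: cnj_sum)
  also have "\<dots> = of_nat (card {b \<in> B. l b = cnj z})" using formula[OF cz] by simp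
  finally show ?thesis using of_nat_eq_iff by blast
next
  case False
  then have "cnj z ^ N \<noteq> 1" by (metis complex_cnj_cnj complex_cnj_one complex_cnj_power)
  then have "l b \<noteq> z \<and> l b \<noteq> cnj z" if "b \<in> B" for b using lN[OF that] False by metis
  then have "{b \<in> B. l b = z} = {}" "{b \<in> B. l b = cnj z} = {}" by auto
  then show ?thesis by (simp only:)
qed

section \<open>Generating function of the complete symmetric polynomials\<close>

lemma complete_sym_0: "complete_sym l X 0 = 1"
proof -
  have "msets_of_size X 0 = {{#}}" by (auto simp: msets_of_size_def)
  then show ?thesis by (simp add: complete_sym_def)
qed

lemma complete_sym_insert:
  assumes "finite X" "b \<notin> X"
  shows "complete_sym l (insert b X) (Suc k) = complete_sym l X (Suc k) + l b * complete_sym l (insert b X) k"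
proof -
  have eq: "msets_of_size (insert b X) (Suc k) = msets_of_size X (Suc k) \<union> add_mset b ` msets_of_size (insert b X) k"
  proof (intro equalityI subsetI)
    fix M assume M: "M \<in> msets_of_size (insert b X) (Suc k)"
    show "M \<in> msets_of_size X (Suc k) \<union> add_mset b ` msets_of_size (insert b X) k"
    proof (cases "b \<in># M")
      case True
      then obtain M' where M': "M = add_mset b M'" by (metis insert_DiffM)
      then have "M' \<in> msets_of_size (insert b X) k" using M by (auto simp: msets_of_size_def)
      then show ?thesis using M' by blast
    next
      case False
      then show ?thesis using M by (auto simp: msets_of_size_def)
    qed
  qed (auto simp: msets_of_size_def)
  have disj: "msets_of_size X (Suc k) \<inter> add_mset b ` msets_of_size (insert b X) k = {}"
    using assms(2) by (auto simp: msets_of_size_def)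
  have "inj_on (add_mset b) (msets_of_size (insert b X) k)" by (simp add: inj_on_def)
  then show ?thesis
    unfolding complete_sym_def eq using finite_msets_of_size[of X] finite_msets_of_size[of "insert b X"] assms(1)
    by (subst sum.union_disjoint[OF _ _ disj]) (simp_all add: sum.reindex sum_distrib_left)
qed

lemma complete_sym_insert_convolution:
  assumes "finite X" "b \<notin> X"
  shows "complete_sym l (insert b X) k = (\<Sum>i\<le>k. complete_sym l X i * l b ^ (k - i))"
proof (induction k)
  case 0
  then show ?case by (simp add: complete_sym_0)
next
  case (Suc k)
  have "(\<Sum>i\<le>k. complete_sym l X i * l b ^ (Suc k - i)) = l b * (\<Sum>i\<le>k. complete_sym l X i * l b ^ (k - i))"
    unfolding sum_distrib_left by (intro sum.cong refl) (simp add: Suc_diff_le mult_ac)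
  then show ?case using Suc complete_sym_insert[OF assms, of l k] by simp
qed

text \<open>A new variable multiplies the series by a geometric series. Absolute convergence is part
  of the claim because the Cauchy product requires it.\<close>

lemma complete_sym_generating_function:
  fixes l :: "'b \<Rightarrow> complex"
  assumes "finite X" "\<And>b. b \<in> X \<Longrightarrow> norm (l b) \<le> 1" "norm z < 1"
  shows "summable (\<lambda>k. norm (complete_sym l X k * z ^ k)) \<and>
    (\<lambda>k. complete_sym l X k * z ^ k) sums (\<Prod>b\<in>X. 1 / (1 - l b * z))"
  using assms(1,2)
proof (induction X rule: finite_induct)
  case empty
  have "complete_sym l {} k * z ^ k = (if k = 0 then 1 else 0)" for k
    by (cases k) (auto simp: complete_sym_0, auto simp: complete_sym_def msets_of_size_def)
  then show ?case using sums_If_finite_set[of "{0}" "\<lambda>_. 1::complex"] by (auto intro!: summable_finite[of "{0}"] split: if_splits)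
next
  case (insert b X)
  define q where "q = l b * z"
  have q: "norm q < 1" using insert.prems[of b] assms(3) mult_le_one[of "norm (l b)" "norm z"]
    unfolding q_def norm_mult by (metis insertI1 mult_left_le_one_le norm_ge_zero order_le_less_trans)
  define a where "a k = complete_sym l X k * z ^ k" for k
  have a: "summable (\<lambda>k. norm (a k))" "a sums (\<Prod>b\<in>X. 1 / (1 - l b * z))"
    using insert.IH insert.prems by (auto simp: a_def[abs_def])
  have qs: "summable (\<lambda>k. norm (q ^ k))" using q by (simp add: norm_power)
  have term_eq: "complete_sym l (insert b X) k * z ^ k = (\<Sum>i\<le>k. a i * q ^ (k - i))" for k
    unfolding complete_sym_insert_convolution[OF insert.hyps] sum_distrib_right
    by (intro sum.cong refl) (simp add: a_def q_def power_mult_distrib power_add[symmetric])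
  have "(\<lambda>k. complete_sym l (insert b X) k * z ^ k) sums ((\<Prod>b\<in>X. 1 / (1 - l b * z)) * (1 / (1 - q)))"
    using Cauchy_product_sums[OF a(1) qs] sums_unique[OF a(2)] suminf_geometric[OF q] by (simp add: term_eq)
  moreover have "summable (\<lambda>k. norm (complete_sym l (insert b X) k * z ^ k))"
  proof (rule summable_comparison_test')
    show "summable (\<lambda>k. \<Sum>i\<le>k. norm (a i) * norm (q ^ (k - i)))"
      using summable_Cauchy_product[of "\<lambda>k. norm (a k)" "\<lambda>k. norm (q ^ k)"] a(1) qs by simp
    show "norm (norm (complete_sym l (insert b X) k * z ^ k)) \<le> (\<Sum>i\<le>k. norm (a i) * norm (q ^ (k - i)))" if "k \<ge> 0" for k
      unfolding term_eq real_norm_def abs_norm_cancel norm_mult[symmetric] by (rule norm_sum)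
  qed
  ultimately show ?case using insert.hyps by (simp add: q_def mult.commute)
qed

text \<open>The multiset of eigenvalues of \<open>g\<close>: by freeness, all of them have the order of \<open>g\<close>.\<close>

definition eigen_data :: "(real^'n^'n) set \<Rightarrow> (real^'n^'n \<Rightarrow> complex multiset) \<Rightarrow> bool" where
  "eigen_data G \<Lambda> \<longleftrightarrow> (\<forall>g\<in>G.
     size (\<Lambda> g) = CARD('n) \<and>
     image_mset cnj (\<Lambda> g) = \<Lambda> g \<and>
     (\<forall>l\<in>#\<Lambda> g. \<forall>j. l ^ j = 1 \<longleftrightarrow> group.ord (subgroup_of_matrices G) g dvd j) \<and>
     (\<forall>l\<in>#\<Lambda> g. \<forall>j. l ^ j \<in># \<Lambda> (g [^]\<^bsub>subgroup_of_matrices G\<^esub> j)) \<and>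
     (\<forall>z. norm z < 1 \<longrightarrow> (\<lambda>k. complex_of_real (fun_vs.trace_on (monomial_basis k) (pullback ((*v) g))) * z ^ k)
        sums (\<Prod>l\<in>#\<Lambda> g. 1 / (1 - l * z))))"

text \<open>The characterisation of eigenvalues by eigenforms appears here and not in
  \<open>eigen_data\<close>: it links the multisets of different elements, because an eigenform of g
  for l is one of the j-th power of g for l^j.\<close>

lemma eigen_data_pointwise:
  fixes G :: "(real^'n^'n) set"
  assumes G: "spherical_space_form G" and g: "g \<in> G"
  shows "\<exists>L. size L = CARD('n) \<and> image_mset cnj L = L \<and>
     (\<forall>l\<in>#L. \<forall>j. l ^ j = 1 \<longleftrightarrow> group.ord (subgroup_of_matrices G) g dvd j) \<and>
     (\<forall>l. l \<in># L \<longleftrightarrow> (\<exists>f\<in>hpoly_of ccoord Basis 1. f \<noteq> 0 \<and> pullback ((*v) g) f = (\<lambda>x. l * f x))) \<and>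
     (\<forall>z. norm z < 1 \<longrightarrow> (\<lambda>k. complex_of_real (fun_vs.trace_on (monomial_basis k) (pullback ((*v) g))) * z ^ k)
        sums (\<Prod>l\<in>#L. 1 / (1 - l * z)))"
proof -
  let ?S = "subgroup_of_matrices G"
  interpret S: group ?S by (rule space_form_group[OF G])
  have finS: "finite (carrier ?S)" using G by (simp add: spherical_space_form_def)
  have gS: "g \<in> carrier ?S" using g by simp
  define N where "N = S.ord g"
  have N: "N > 0" unfolding N_def using S.ord_ge_1[OF finS gS] by linarith
  have lg: "linear ((*v) g)" by (rule matrix_vector_mul_linear)
  have gN: "((*v) g) ^^ N = id"
    using S.pow_ord_eq_1[OF gS] matrix_power_action[where g=g and G=G and j=N] by (simp add: N_def fun_eq_iff)
  obtain B l where B: "finite B" "fun_vs.independent B" "fun_vs.span B = hpoly_of ccoord Basis 1" "card B = DIM(real^'n)"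
    and l: "\<And>b. b \<in> B \<Longrightarrow> pullback ((*v) g) b = (\<lambda>x. l b * b x)" "\<And>b. b \<in> B \<Longrightarrow> l b ^ N = 1"
    using complex_eigenbasis[OF lg gN N] by blast
  define L where "L = image_mset l (mset_set B)"
  have inL: "z \<in># L \<longleftrightarrow> (\<exists>b\<in>B. z = l b)" for z using B(1) by (auto simp: L_def)
  have bV: "b \<in> hpoly_of ccoord Basis 1" "b \<noteq> 0" if "b \<in> B" for b
    using fun_vs.span_base[OF that] B(3) fun_vs.dependent_zero B(2) that by metis+
  have pw: "pullback (((*v) g) ^^ j) b = (\<lambda>x. l b ^ j * b x)" if "b \<in> B" for b j
  proof (induction j)
    case (Suc j)
    have "b ((((*v) g) ^^ Suc j) x) = l b * b ((((*v) g) ^^ j) x)" for x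
      using fun_cong[OF l(1)[OF that], of "(((*v) g) ^^ j) x"] by (simp add: pullback_def)
    then show ?case using Suc by (simp add: pullback_def fun_eq_iff mult_ac)
  qed (simp add: pullback_def)
  have prim: "l b ^ j = 1 \<longleftrightarrow> S.ord g dvd j" if b: "b \<in> B" for b j
  proof
    assume "S.ord g dvd j"
    then show "l b ^ j = 1" using l(2)[OF b] by (auto simp: N_def power_mult elim!: dvdE)
  next
    \<comment> \<open>The eigenform \<open>b\<close> is then fixed by the j-th power of g, which
      therefore has a fixed unit vector and is the identity by freeness.\<close>
    assume 1: "l b ^ j = 1"
    let ?h = "g [^]\<^bsub>?S\<^esub> j"
    have hG: "?h \<in> G" using S.nat_pow_closed[OF gS, of j] by simp
    have "pullback ((*v) ?h) b = b" using pw[OF b, of j] 1 by (simp add: matrix_power_action)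
    then obtain r where "norm r = 1" "?h *v r = r"
      using fixed_linear_form_imp_fixed_vector[OF space_form_orthogonal(2)[OF G hG] bV(1)[OF b] _ bV(2)[OF b]] by blast
    then have "?h = mat 1" using G hG by (auto simp: spherical_space_form_def)
    then show "S.ord g dvd j" using S.pow_eq_id[OF gS, of j] by simp
  qed
  have norm_l: "norm (l b) \<le> 1" if "b \<in> B" for b
  proof -
    show ?thesis using power_eq_1_iff[OF l(2)[OF that]] N by auto
  qed
  have tr: "complex_of_real (fun_vs.trace_on (monomial_basis k) (pullback ((*v) g))) = complete_sym l B k" for k
    by (rule trace_pullback_eigenbasis[OF lg B(1,3,4) l(1)])
  \<comment> \<open>The power sums are the traces of the powers of g on linear forms, and g is a
    real matrix.\<close>
  have real: "(\<Sum>b\<in>B. l b ^ j) \<in> \<real>" for j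
  proof -
    have "complete_sym (\<lambda>b. l b ^ j) B 1 = (\<Sum>b\<in>B. l b ^ j)"
      unfolding complete_sym_def msets_of_size_1 by (subst sum.reindex) (auto simp: inj_on_def)
    then show ?thesis
      using trace_pullback_eigenbasis[OF linear_funpow[OF lg] B(1,3,4) pw, where k=1] by (metis Reals_of_real)
  qed
  have cnt: "count (image_mset f (mset_set B)) z = card {b \<in> B. f b = z}" for f :: "_ \<Rightarrow> complex" and z
    by (rule count_image_mset_eq_card_vimage[OF B(1)])
  have "image_mset cnj L = L"
  proof (rule multiset_eqI)
    fix z
    have "count (image_mset cnj L) z = card {b \<in> B. cnj (l b) = z}"
      using cnt[of "\<lambda>b. cnj (l b)" z] by (simp add: L_def multiset.map_comp comp_def)
    also have "{b \<in> B. cnj (l b) = z} = {b \<in> B. l b = cnj z}" by (metis (no_types) complex_cnj_cnj)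
    also have "card \<dots> = card {b \<in> B. l b = z}"
      using eigenvalue_multiplicity_conj[OF B(1) l(2) N real, of z] by simp
    finally show "count (image_mset cnj L) z = count L z" using cnt[of l z] by (simp add: L_def)
  qed
  then have conj: "image_mset cnj L = L" .
  have conv: "(\<exists>b\<in>B. z = l b)" if f: "f \<in> hpoly_of ccoord Basis 1" "f \<noteq> 0" "pullback ((*v) g) f = (\<lambda>x. z * f x)" for f z
  proof (rule ccontr)
    assume no: "\<not> (\<exists>b\<in>B. z = l b)"
    let ?r = "fun_vs.representation B f"
    have "f \<in> fun_vs.span B" using f(1) B(3) by simp
    then have fr: "(\<Sum>b\<in>B. (\<lambda>P. ?r b * b P)) = f"
      by (rule fun_vs.sum_representation_eq[OF B(2) _ B(1) order_refl])
    have "(\<Sum>b\<in>B. (\<lambda>P. (?r b * (l b - z)) * b P)) = 0"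
    proof
      fix x
      have fx: "f y = (\<Sum>b\<in>B. ?r b * b y)" for y using fun_cong[OF fr, of y] by (simp add: sum_fun_apply)
      have "f (g *v x) = (\<Sum>b\<in>B. ?r b * (l b * b x))"
      proof (subst fx, rule sum.cong[OF refl])
        fix b assume "b \<in> B"
        from fun_cong[OF l(1)[OF this], of x] have "b (g *v x) = l b * b x" by (simp only: pullback_def)
        then show "?r b * b (g *v x) = ?r b * (l b * b x)" by (simp only:)
      qed
      moreover have "f (g *v x) = z * (\<Sum>b\<in>B. ?r b * b x)"
        using fun_cong[OF f(3), of x] fx[of x] by (simp add: pullback_def)
      ultimately show "(\<Sum>b\<in>B. (\<lambda>P. (?r b * (l b - z)) * b P)) x = 0 x"
        by (simp add: sum_fun_apply algebra_simps sum_subtractf sum_distrib_left)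
    qed
    then have "?r b * (l b - z) = 0" if "b \<in> B" for b
      using fun_vs.independentD[OF B(2,1) order_refl, of "\<lambda>b. ?r b * (l b - z)"] that by blast
    then have "?r b = 0" if "b \<in> B" for b using no that by force
    then have "f = 0" using fr by (simp add: fun_eq_iff sum_fun_apply)
    then show False using f(2) by simp
  qed
  show ?thesis
  proof (intro exI[of _ L] conjI allI ballI impI)
    show "image_mset cnj L = L" by (rule conj)
    show "size L = CARD('n)" using B(1,4) by (simp add: L_def)
    show "(\<lambda>k. complex_of_real (fun_vs.trace_on (monomial_basis k) (pullback ((*v) g))) * z ^ k)
        sums (\<Prod>l\<in>#L. 1 / (1 - l * z))" if "norm z < 1" for z
    proof -
      have "(\<Prod>l\<in>#L. 1 / (1 - l * z)) = (\<Prod>b\<in>B. 1 / (1 - l b * z))"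
        by (simp add: L_def multiset.map_comp comp_def prod_unfold_prod_mset)
      then show ?thesis
        using complete_sym_generating_function[of B l z] B(1) norm_l that unfolding tr by simp
    qed
    show "(l' ^ j = 1) = (S.ord g dvd j)" if l': "l' \<in># L" for l' j
    proof -
      obtain b where "b \<in> B" "l' = l b" using l' inL by blast
      then show ?thesis using prim[of b j] by (simp only:)
    qed
    show "(z \<in># L) = (\<exists>f\<in>hpoly_of ccoord Basis 1. f \<noteq> 0 \<and> pullback ((*v) g) f = (\<lambda>x. z * f x))" for z
    proof
      assume "z \<in># L"
      then obtain b where "b \<in> B" "z = l b" using inL by blast
      then show "\<exists>f\<in>hpoly_of ccoord Basis 1. f \<noteq> 0 \<and> pullback ((*v) g) f = (\<lambda>x. z * f x)"
        using bV l(1) by blast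
    next
      assume "\<exists>f\<in>hpoly_of ccoord Basis 1. f \<noteq> 0 \<and> pullback ((*v) g) f = (\<lambda>x. z * f x)"
      then show "z \<in># L" using conv[of _ z] unfolding inL by blast
    qed
  qed
qed

lemma eigen_data_exists:
  fixes G :: "(real^'n^'n) set"
  assumes G: "spherical_space_form G" shows "\<exists>\<Lambda>. eigen_data G \<Lambda>"
proof -
  let ?S = "subgroup_of_matrices G"
  interpret S: group ?S by (rule space_form_group[OF G])
  let ?P = "\<lambda>g L. size L = CARD('n) \<and> image_mset cnj L = L \<and>
     (\<forall>l\<in>#L. \<forall>j. l ^ j = 1 \<longleftrightarrow> group.ord (subgroup_of_matrices G) g dvd j) \<and>
     (\<forall>l. l \<in># L \<longleftrightarrow> (\<exists>f\<in>hpoly_of ccoord Basis 1. f \<noteq> 0 \<and> pullback ((*v) g) f = (\<lambda>x. l * f x))) \<and>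
     (\<forall>z. norm z < 1 \<longrightarrow> (\<lambda>k. complex_of_real (fun_vs.trace_on (monomial_basis k) (pullback ((*v) g))) * z ^ k)
        sums (\<Prod>l\<in>#L. 1 / (1 - l * z)))"
  have "\<forall>g\<in>G. \<exists>L. ?P g L" using eigen_data_pointwise[OF G] by (rule ballI)
  from bchoice[OF this] obtain \<Lambda> where all: "\<forall>g\<in>G. ?P g (\<Lambda> g)" ..
  have \<Lambda>: "?P g (\<Lambda> g)" if "g \<in> G" for g using bspec[OF all that] .
  have "l ^ j \<in># \<Lambda> (g [^]\<^bsub>?S\<^esub> j)" if g: "g \<in> G" and l: "l \<in># \<Lambda> g" for g l and j :: nat
  proof -
    have h: "g [^]\<^bsub>?S\<^esub> j \<in> G" using S.nat_pow_closed[of g j] g by simp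
    obtain f where f: "f \<in> hpoly_of ccoord Basis 1" "f \<noteq> 0" "pullback ((*v) g) f = (\<lambda>x. l * f x)"
      using \<Lambda>[OF g] l by blast
    have "f ((((*v) g) ^^ j) x) = l ^ j * f x" for x
    proof (induction j)
      case (Suc j)
      then show ?case using fun_cong[OF f(3), of "(((*v) g) ^^ j) x"] by (simp add: pullback_def)
    qed simp
    then have "pullback ((*v) (g [^]\<^bsub>?S\<^esub> j)) f = (\<lambda>x. l ^ j * f x)"
      by (simp add: pullback_def fun_eq_iff matrix_power_action)
    then show ?thesis using \<Lambda>[OF h] f by blast
  qed
  then have "eigen_data G \<Lambda>" unfolding eigen_data_def
    by (intro ballI conjI) (use \<Lambda> in simp_all)
  then show ?thesis by blast
qed

text \<open>Stated for complex z, because the roots of unity on the boundary of the disc will be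
  approached.\<close>

theorem molien_series:
  fixes G :: "(real^'n^'n) set"
  assumes G: "spherical_space_form G" and \<Lambda>: "eigen_data G \<Lambda>" and z: "norm z < 1"
  shows "(\<lambda>k. of_nat (fun_vs.dim (inv_hpoly (matrix_actions G) k)) * z ^ k) sums
    ((\<Sum>g\<in>G. \<Prod>l\<in>#\<Lambda> g. 1 / (1 - l * z)) / of_nat (card G))"
proof -
  have inj: "inj_on ((*v) :: real^'n^'n \<Rightarrow> _) G" by (auto simp: inj_on_def matrix_eq)
  have fin: "finite G" "G \<noteq> {}" using G space_form_mult(2)[OF G] by (auto simp: spherical_space_form_def)
  have shift: "(\<lambda>g. g \<circ> h) ` matrix_actions G = matrix_actions G" if h: "h \<in> matrix_actions G" for h
  proof -
    obtain a where a: "a \<in> G" "h = (*v) a" using h by (auto simp: matrix_actions_def)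
    obtain b where b: "b \<in> G" "b ** a = mat 1" using space_form_mult(3)[OF G a(1)] by blast
    have 1: "(*v) c \<circ> h = (*v) (c ** a)" for c by (auto simp: a matrix_vector_mul_assoc)
    have 2: "(*v) c = (*v) (c ** b) \<circ> h" for c
      by (auto simp: a matrix_vector_mul_assoc matrix_mul_assoc[symmetric] b)
    show ?thesis unfolding matrix_actions_def image_image
    proof (intro equalityI subsetI)
      fix f assume "f \<in> (\<lambda>g. (*v) g \<circ> h) ` G"
      then show "f \<in> (*v) ` G" using space_form_mult(1)[OF G _ a(1)] by (auto simp: 1)
    next
      fix f assume "f \<in> (*v) ` G"
      then obtain c where "c \<in> G" "f = (*v) c" by blast
      then show "f \<in> (\<lambda>g. (*v) g \<circ> h) ` G" using space_form_mult(1)[OF G _ b(1)] 2[of c] by blast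
    qed
  qed
  have dim: "complex_of_nat (fun_vs.dim (inv_hpoly (matrix_actions G) k)) =
     (\<Sum>g\<in>G. complex_of_real (fun_vs.trace_on (monomial_basis k) (pullback ((*v) g)))) / of_nat (card G)" for k
  proof -
    have "real (fun_vs.dim (inv_hpoly (matrix_actions G) k)) =
      (\<Sum>g\<in>matrix_actions G. fun_vs.trace_on (monomial_basis k) (pullback g)) / card (matrix_actions G)"
      by (rule dim_inv_hpoly_eq_trace) (use fin shift in \<open>auto simp: matrix_actions_def\<close>)
    also have "\<dots> = (\<Sum>g\<in>G. fun_vs.trace_on (monomial_basis k) (pullback ((*v) g))) / card G"
      by (simp add: matrix_actions_def sum.reindex[OF inj] card_image[OF inj])
    finally show ?thesis by (metis (no_types, lifting) of_real_divide of_real_of_nat_eq of_real_sum sum.cong)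
  qed
  have "(\<lambda>k. (\<Sum>g\<in>G. complex_of_real (fun_vs.trace_on (monomial_basis k) (pullback ((*v) g))) * z ^ k) / of_nat (card G)) sums
    ((\<Sum>g\<in>G. \<Prod>l\<in>#\<Lambda> g. 1 / (1 - l * z)) / of_nat (card G))"
    using \<Lambda> z by (intro sums_divide sums_sum) (auto simp: eigen_data_def)
  then show ?thesis by (simp add: dim sum_distrib_right)
qed


section \<open>Poles of the generating function\<close>

lemma tendsto_prod_mset:
  fixes f :: "'a \<Rightarrow> 'b \<Rightarrow> complex"
  assumes "\<And>l. l \<in># L \<Longrightarrow> ((\<lambda>t. f l t) \<longlongrightarrow> c l) F"
  shows "((\<lambda>t. \<Prod>l\<in>#L. f l t) \<longlongrightarrow> (\<Prod>l\<in>#L. c l)) F"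
  using assms by (induction L) (auto intro!: tendsto_intros)

text \<open>Along the radius t * \<open>\<zeta>\<close>, each factor with
  \<open>l * \<zeta> = 1\<close> is exactly 1 / (1 - t), and the other factors are continuous at t =
  1. \<open>M\<close> is only an upper bound for the order of the pole, so that one \<open>M\<close>
  serves all group elements and those with a weaker pole contribute 0.\<close>

lemma pole_of_product:
  fixes L :: "complex multiset"
  assumes M: "size (filter_mset (\<lambda>l. l * \<zeta> = 1) L) \<le> M"
  shows "((\<lambda>t::real. of_real ((1 - t) ^ M) * (\<Prod>l\<in>#L. 1 / (1 - l * (of_real t * \<zeta>)))) \<longlongrightarrow>
    (if size (filter_mset (\<lambda>l. l * \<zeta> = 1) L) = M then \<Prod>l\<in>#filter_mset (\<lambda>l. l * \<zeta> \<noteq> 1) L. 1 / (1 - l * \<zeta>) else 0)) (at_left 1)"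
proof -
  let ?A = "filter_mset (\<lambda>l. l * \<zeta> = 1) L" and ?B = "filter_mset (\<lambda>l. l * \<zeta> \<noteq> 1) L"
  have L: "L = ?A + ?B" by (rule multiset_partition)
  have eq: "of_real ((1 - t) ^ M) * (\<Prod>l\<in>#L. 1 / (1 - l * (of_real t * \<zeta>))) =
      of_real ((1 - t) ^ (M - size ?A)) * (\<Prod>l\<in>#?B. 1 / (1 - l * (of_real t * \<zeta>)))" if t: "t < 1" for t :: real
  proof -
    have "(\<Prod>l\<in>#?A. 1 / (1 - l * (of_real t * \<zeta>))) = (\<Prod>l\<in>#?A. 1 / (1 - complex_of_real t))"
    proof (rule arg_cong[where f=prod_mset], rule image_mset_cong)
      fix l assume "l \<in># ?A"
      then have "l * \<zeta> = 1" by simp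
      then show "1 / (1 - l * (of_real t * \<zeta>)) = 1 / (1 - complex_of_real t)" by (simp add: mult.left_commute)
    qed
    also have "\<dots> = (1 / (1 - complex_of_real t)) ^ size ?A" by (simp add: image_mset_const_eq)
    finally have A: "(\<Prod>l\<in>#?A. 1 / (1 - l * (of_real t * \<zeta>))) = (1 / (1 - complex_of_real t)) ^ size ?A" .
    have "1 - complex_of_real t \<noteq> 0" using t by (metis eq_iff_diff_eq_0 less_irrefl of_real_1 of_real_eq_iff)
    then have "of_real ((1 - t) ^ M) * (1 / (1 - complex_of_real t)) ^ size ?A = of_real ((1 - t) ^ (M - size ?A))"
      using M by (simp add: power_diff power_one_over)
    moreover have "(\<Prod>l\<in>#L. 1 / (1 - l * (of_real t * \<zeta>))) =
       (\<Prod>l\<in>#?A. 1 / (1 - l * (of_real t * \<zeta>))) * (\<Prod>l\<in>#?B. 1 / (1 - l * (of_real t * \<zeta>)))"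
      by (subst L) (simp only: image_mset_union prod_mset.union)
    ultimately show ?thesis unfolding A by (metis (no_types, lifting) mult.assoc)
  qed
  have lim1: "((\<lambda>t::real. \<Prod>l\<in>#?B. 1 / (1 - l * (of_real t * \<zeta>))) \<longlongrightarrow> (\<Prod>l\<in>#?B. 1 / (1 - l * (of_real 1 * \<zeta>)))) (at_left 1)"
    by (intro tendsto_prod_mset tendsto_intros) auto
  have lim2: "((\<lambda>t::real. complex_of_real ((1 - t) ^ (M - size ?A))) \<longlongrightarrow> of_real ((1 - 1) ^ (M - size ?A))) (at_left 1)"
    by (intro tendsto_intros)
  have "((\<lambda>t. of_real ((1 - t) ^ (M - size ?A)) * (\<Prod>l\<in>#?B. 1 / (1 - l * (of_real t * \<zeta>)))) \<longlongrightarrow>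
    of_real ((1 - 1) ^ (M - size ?A)) * (\<Prod>l\<in>#?B. 1 / (1 - l * (of_real 1 * \<zeta>)))) (at_left 1)"
    by (rule tendsto_mult[OF lim2 lim1])
  moreover have "of_real ((1 - 1) ^ (M - size ?A)) * (\<Prod>l\<in>#?B. 1 / (1 - l * (of_real 1 * \<zeta>))) =
     (if size ?A = M then \<Prod>l\<in>#?B. 1 / (1 - l * \<zeta>) else 0)"
    using M by (auto simp: power_0_left)
  ultimately show ?thesis
    by (subst tendsto_cong[OF eventually_mono[OF eventually_at_left_real[of 0 1] eq]]) auto
qed

lemma pole_of_sum:
  fixes \<Lambda> :: "'g \<Rightarrow> complex multiset"
  assumes "finite G" "\<And>g. g \<in> G \<Longrightarrow> size (filter_mset (\<lambda>l. l * \<zeta> = 1) (\<Lambda> g)) \<le> M"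
  shows "((\<lambda>t::real. of_real ((1 - t) ^ M) * (\<Sum>g\<in>G. \<Prod>l\<in>#\<Lambda> g. 1 / (1 - l * (of_real t * \<zeta>)))) \<longlongrightarrow>
    (\<Sum>g\<in>{g \<in> G. size (filter_mset (\<lambda>l. l * \<zeta> = 1) (\<Lambda> g)) = M}. \<Prod>l\<in>#filter_mset (\<lambda>l. l * \<zeta> \<noteq> 1) (\<Lambda> g). 1 / (1 - l * \<zeta>))) (at_left 1)"
proof -
  have "((\<lambda>t::real. \<Sum>g\<in>G. of_real ((1 - t) ^ M) * (\<Prod>l\<in>#\<Lambda> g. 1 / (1 - l * (of_real t * \<zeta>)))) \<longlongrightarrow>
    (\<Sum>g\<in>G. if size (filter_mset (\<lambda>l. l * \<zeta> = 1) (\<Lambda> g)) = M then \<Prod>l\<in>#filter_mset (\<lambda>l. l * \<zeta> \<noteq> 1) (\<Lambda> g). 1 / (1 - l * \<zeta>) else 0)) (at_left 1)"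
    by (intro tendsto_sum pole_of_product assms(2))
  then show ?thesis using assms(1) by (simp add: sum_distrib_left sum.If_cases Int_def)
qed

text \<open>The leading coefficient of the pole at \<open>\<zeta> = exp (2\<pi>i/K)\<close> contributed by an element of order \<open>K\<close>: since
  \<open>\<zeta>\<close> has the largest real part among the primitive roots of unity of order \<open>K\<close>, its argument depends only
  on the order of the pole.\<close>

lemma leading_coefficient:
  fixes L :: "complex multiset" and K :: nat
  assumes K: "K \<ge> 3" and \<zeta>: "\<zeta> = cis (2 * pi / K)"
    and prim: "\<And>l j. l \<in># L \<Longrightarrow> l ^ j = 1 \<longleftrightarrow> K dvd j" and conj: "image_mset cnj L = L"
    and M: "size (filter_mset (\<lambda>l. l * \<zeta> = 1) L) = M"
  shows "\<exists>\<rho>>0. (\<Prod>l\<in>#filter_mset (\<lambda>l. l * \<zeta> \<noteq> 1) L. 1 / (1 - l * \<zeta>)) =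
    (1 / (1 - \<zeta>\<^sup>2)) ^ M * (1 / \<zeta>) ^ ((size L - 2 * M) div 2) * of_real \<rho>"
proof -
  have \<zeta>0: "\<zeta> \<noteq> 0" and \<zeta>c: "\<zeta> * cnj \<zeta> = 1" by (simp_all add: \<zeta> cis_cnj cis_mult)
  have Im\<zeta>: "Im \<zeta> > 0" unfolding \<zeta> using K by (simp add: sin_gt_zero field_simps)
  have \<zeta>1: "l * \<zeta> = 1 \<longleftrightarrow> l = cnj \<zeta>" for l
  proof
    assume "l * \<zeta> = 1"
    then have "l * \<zeta> * cnj \<zeta> = cnj \<zeta>" by simp
    then show "l = cnj \<zeta>" using \<zeta>c by (simp add: mult.assoc)
  qed (use \<zeta>c in \<open>simp add: mult.commute\<close>)
  have root: "l ^ K = 1" "Im l \<noteq> 0" if l: "l \<in># L" for l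
  proof -
    show lK: "l ^ K = 1" using prim[OF l] by simp
    have nl: "norm l = 1" using power_eq_1_iff[OF lK] K by simp
    show "Im l \<noteq> 0"
    proof
      assume 0: "Im l = 0"
      then have "l = of_real (Re l)" by (simp add: complex_eq_iff)
      then have "l ^ 2 = 1" using nl 0 by (metis norm_of_real of_real_1 of_real_power power2_abs power_one)
      then have "K dvd 2" using prim[OF l] by simp
      then show False using K by (auto dest: dvd_imp_le)
    qed
  qed
  have Re_less: "Re l < Re \<zeta>" if l: "l \<in># L" and Im: "Im l > 0" and ne: "l \<noteq> \<zeta>" for l
  proof -
    have "l \<in> {z. z ^ K = 1}" using root(1)[OF l] by simp
    then obtain j where j: "j < K" "l = cis (2 * pi * real j / real K)"
      using Complex.bij_betw_roots_unity[of K] K by (auto simp: bij_betw_def)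
    have "j \<noteq> 0" using Im j by (intro notI) simp
    moreover have "j \<noteq> 1" using ne j \<zeta> by (intro notI) simp
    ultimately have j1: "1 < real j" by simp
    define x where "x = 2 * pi * real j / real K"
    have "x < pi"
    proof (rule ccontr)
      assume "\<not> x < pi"
      moreover have "x < 2 * pi" using j(1) K by (simp add: x_def field_simps)
      ultimately have "sin x \<le> 0" by (intro sin_le_zero) auto
      then show False using Im j by (simp add: x_def)
    qed
    moreover have "2 * pi / K < x" using j1 K by (simp add: x_def field_simps)
    ultimately have "cos x < cos (2 * pi / K)" by (intro cos_monotone_0_pi) auto
    then show ?thesis by (simp add: j \<zeta> x_def)
  qed
  \<comment> \<open>One member of each conjugate pair other than that of \<open>\<zeta>\<close>; no
    eigenvalue is real since K >= 3. The copies of \<open>cnj \<zeta>\<close> make the pole, those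
    of \<open>\<zeta>\<close> give the powers of 1 / (1 - \<open>\<zeta>\<close>^2), and each pair
    in \<open>P\<close> gives 1 / \<open>\<zeta>\<close> times a positive number.\<close>
  define P where "P = filter_mset (\<lambda>l. Im l > 0 \<and> l \<noteq> \<zeta>) L"
  have cP: "image_mset cnj P = filter_mset (\<lambda>l. Im l < 0 \<and> l \<noteq> cnj \<zeta>) L"
  proof -
    have "filter_mset (\<lambda>l. Im l < 0 \<and> l \<noteq> cnj \<zeta>) L = filter_mset (\<lambda>l. Im l < 0 \<and> l \<noteq> cnj \<zeta>) (image_mset cnj L)"
      by (simp only: conj)
    also have "\<dots> = image_mset cnj (filter_mset (\<lambda>l. Im (cnj l) < 0 \<and> cnj l \<noteq> cnj \<zeta>) L)"
      by (simp only: filter_mset_image_mset)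
    finally show ?thesis by (simp add: P_def)
  qed
  have A: "filter_mset (\<lambda>l. l = cnj \<zeta>) L = replicate_mset M (cnj \<zeta>)"
    using M by (simp add: \<zeta>1 filter_eq_replicate_mset)
  have M': "count L (cnj \<zeta>) = M"
    using arg_cong[OF A, of size] by (simp add: filter_eq_replicate_mset)
  have "count L (cnj \<zeta>) = count L \<zeta>"
  proof -
    have "count (image_mset cnj L) (cnj \<zeta>) = count L \<zeta>"
      by (induction L) (auto simp: complex_cnj_cancel_iff)
    then show ?thesis using conj by simp
  qed
  then have C: "filter_mset (\<lambda>l. l = \<zeta>) L = replicate_mset M \<zeta>"
    using M' by (simp add: filter_eq_replicate_mset)
  have B: "filter_mset (\<lambda>l. l * \<zeta> \<noteq> 1) L = replicate_mset M \<zeta> + (P + image_mset cnj P)"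
  proof -
    have "filter_mset (\<lambda>l. l * \<zeta> \<noteq> 1) L = filter_mset (\<lambda>l. l = \<zeta>) L +
       (filter_mset (\<lambda>l. Im l > 0 \<and> l \<noteq> \<zeta>) L + filter_mset (\<lambda>l. Im l < 0 \<and> l \<noteq> cnj \<zeta>) L)"
    proof (rule multiset_eqI)
      fix x
      show "count (filter_mset (\<lambda>l. l * \<zeta> \<noteq> 1) L) x = count (filter_mset (\<lambda>l. l = \<zeta>) L +
       (filter_mset (\<lambda>l. Im l > 0 \<and> l \<noteq> \<zeta>) L + filter_mset (\<lambda>l. Im l < 0 \<and> l \<noteq> cnj \<zeta>) L)) x"
      proof (cases "x \<in># L")
        case True
        have "\<zeta> \<noteq> cnj \<zeta>" using Im\<zeta> by (auto simp: complex_eq_iff)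
        then show ?thesis using root(2)[OF True] Im\<zeta> by (auto simp: \<zeta>1)
      next
        case False
        then have "count L x = 0" by (simp add: not_in_iff)
        then show ?thesis by auto
      qed
    qed
    then show ?thesis unfolding C cP[symmetric] P_def[symmetric] .
  qed
  have sL: "size L = 2 * M + 2 * size P"
  proof -
    have "L = filter_mset (\<lambda>l. l * \<zeta> = 1) L + filter_mset (\<lambda>l. l * \<zeta> \<noteq> 1) L" by (rule multiset_partition)
    then have "size L = size (filter_mset (\<lambda>l. l * \<zeta> = 1) L) + size (filter_mset (\<lambda>l. l * \<zeta> \<noteq> 1) L)"
      by (metis size_union)
    then show ?thesis using M by (simp add: B)
  qed
  define \<rho> where "\<rho> = (\<Prod>l\<in>#P. 1 / (2 * (Re \<zeta> - Re l)))"
  have Psub: "l \<in># L \<and> Im l > 0 \<and> l \<noteq> \<zeta>" if "l \<in># P" for l using that by (auto simp: P_def)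
  have pos: "\<rho> > 0"
  proof -
    have "(\<Prod>l\<in>#Q. 1 / (2 * (Re \<zeta> - Re l))) > 0" if "set_mset Q \<subseteq> set_mset P" for Q
      using that
    proof (induction Q)
      case (add l Q)
      then have "l \<in># P" "set_mset Q \<subseteq> set_mset P" by auto
      then show ?case using add.IH Re_less Psub by (auto intro!: mult_pos_pos divide_pos_pos)
    qed simp
    then show ?thesis by (simp add: \<rho>_def)
  qed
  have pair: "(1 / (1 - l * \<zeta>)) * (1 / (1 - cnj l * \<zeta>)) = (1 / \<zeta>) * of_real (1 / (2 * (Re \<zeta> - Re l)))" if l: "l \<in># P" for l
  proof -
    have "norm l = 1" using power_eq_1_iff[OF root(1)] Psub[OF l] K by force
    then have ll: "l * cnj l = 1" by (metis complex_norm_square mult_1 of_real_1 power2_eq_square)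
    have "(1 - l * \<zeta>) * (1 - cnj l * \<zeta>) = \<zeta> * cnj \<zeta> - (l + cnj l) * \<zeta> + (l * cnj l) * (\<zeta> * \<zeta>)"
      by (simp add: \<zeta>c algebra_simps)
    also have "\<dots> = \<zeta> * (\<zeta> + cnj \<zeta> - (l + cnj l))" by (simp add: ll algebra_simps)
    also have "\<dots> = \<zeta> * of_real (2 * (Re \<zeta> - Re l))" by (simp add: complex_add_cnj algebra_simps)
    finally show ?thesis by (metis (no_types, lifting) mult_1 of_real_1 of_real_divide times_divide_times_eq)
  qed
  have "(\<Prod>l\<in>#filter_mset (\<lambda>l. l * \<zeta> \<noteq> 1) L. 1 / (1 - l * \<zeta>)) =
    (1 / (1 - \<zeta> * \<zeta>)) ^ M * (\<Prod>l\<in>#P. (1 / (1 - l * \<zeta>)) * (1 / (1 - cnj l * \<zeta>)))"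
    unfolding B prod_mset.distrib by (simp add: multiset.map_comp comp_def)
  also have "(\<Prod>l\<in>#P. (1 / (1 - l * \<zeta>)) * (1 / (1 - cnj l * \<zeta>))) = (\<Prod>l\<in>#P. (1 / \<zeta>) * of_real (1 / (2 * (Re \<zeta> - Re l))))"
    by (rule arg_cong[where f=prod_mset], rule image_mset_cong) (rule pair)
  also have "\<dots> = (1 / \<zeta>) ^ size P * of_real \<rho>"
    unfolding \<rho>_def by (induction P) (simp_all add: mult_ac)
  finally show ?thesis using pos sL by (intro exI[of _ \<rho>]) (simp add: power2_eq_square mult.assoc)
qed

text \<open>The right-hand side depends only on the sum over the group, hence on the spectrum. A
  pole needs an element with eigenvalue 1 / \<open>\<zeta>\<close>, and such an element has order K.
  Conversely, an element of order K has a power with this eigenvalue.\<close>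

lemma element_order_iff_pole:
  fixes G :: "(real^'n^'n) set"
  assumes G: "spherical_space_form G" and \<Lambda>: "eigen_data G \<Lambda>" and K: "K \<ge> 3" and \<zeta>: "\<zeta> = cis (2 * pi / K)"
  shows "(\<exists>g\<in>G. group.ord (subgroup_of_matrices G) g = K) \<longleftrightarrow>
    (\<exists>M\<ge>1. \<exists>c\<noteq>0. ((\<lambda>t::real. of_real ((1 - t) ^ M) * (\<Sum>g\<in>G. \<Prod>l\<in>#\<Lambda> g. 1 / (1 - l * (of_real t * \<zeta>)))) \<longlongrightarrow> c) (at_left 1))"
proof -
  let ?S = "subgroup_of_matrices G"
  interpret S: group ?S by (rule space_form_group[OF G])
  have finG: "finite G" using G by (simp add: spherical_space_form_def)
  define m where "m g = size (filter_mset (\<lambda>l. l * \<zeta> = 1) (\<Lambda> g))" for g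
  have \<zeta>0: "\<zeta> \<noteq> 0" and \<zeta>c: "\<zeta> * cnj \<zeta> = 1" by (simp_all add: \<zeta> cis_cnj cis_mult)
  have inv: "l * \<zeta> = 1 \<longleftrightarrow> l = inverse \<zeta>" for l using \<zeta>0 by (auto simp: field_simps)
  have "\<zeta> ^ K = cis (real K * (2 * pi / real K))" by (simp only: \<zeta> Complex.DeMoivre)
  also have "\<dots> = 1" using K by simp
  finally have \<zeta>prim: "\<zeta> ^ K = 1" .
  have \<zeta>ord: "K dvd j" if "\<zeta> ^ j = 1" for j
  proof -
    have "\<zeta> = exp (2 * of_real pi * \<i> * of_nat 1 / of_nat K)" by (simp add: \<zeta> cis_conv_exp mult_ac)
    then have "\<zeta> ^ j = exp (2 * of_real pi * \<i> * of_nat j / of_nat K)"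
      by (simp add: exp_of_nat_mult[symmetric] mult_ac)
    then show ?thesis using complex_root_unity_eq_1[of K j] K that by simp
  qed
  have ordK: "S.ord g = K" if g: "g \<in> G" and mg: "m g \<noteq> 0" for g
  proof -
    have "filter_mset (\<lambda>l. l * \<zeta> = 1) (\<Lambda> g) \<noteq> {#}" using mg by (simp add: m_def)
    then obtain l where "l \<in># filter_mset (\<lambda>l. l * \<zeta> = 1) (\<Lambda> g)" by (rule multiset_nonemptyE)
    then have l: "l \<in># \<Lambda> g" "l * \<zeta> = 1" by simp_all
    then have l': "l = inverse \<zeta>" by (simp add: inv)
    have pr: "l ^ j = 1 \<longleftrightarrow> S.ord g dvd j" for j using \<Lambda> g l(1) by (auto simp: eigen_data_def)
    have "S.ord g dvd K" using pr[of K] \<zeta>prim by (simp add: l' power_inverse)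
    moreover have "K dvd S.ord g" using pr[of "S.ord g"] \<zeta>ord[of "S.ord g"] by (simp add: l' power_inverse)
    ultimately show ?thesis by (rule dvd_antisym)
  qed
  show ?thesis
  proof
    assume "\<exists>M\<ge>1. \<exists>c\<noteq>0. ((\<lambda>t::real. of_real ((1 - t) ^ M) * (\<Sum>g\<in>G. \<Prod>l\<in>#\<Lambda> g. 1 / (1 - l * (of_real t * \<zeta>)))) \<longlongrightarrow> c) (at_left 1)"
    then obtain M c where M: "M \<ge> 1" "c \<noteq> 0"
      "((\<lambda>t::real. of_real ((1 - t) ^ M) * (\<Sum>g\<in>G. \<Prod>l\<in>#\<Lambda> g. 1 / (1 - l * (of_real t * \<zeta>)))) \<longlongrightarrow> c) (at_left 1)" by blast
    show "\<exists>g\<in>G. S.ord g = K"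
    proof (rule ccontr)
      assume no: "\<not> (\<exists>g\<in>G. S.ord g = K)"
      then have m0: "m g = 0" if "g \<in> G" for g using ordK[OF that] that by blast
      have "{g \<in> G. m g = M} = {}" using m0 M(1) by fastforce
      moreover have "((\<lambda>t::real. of_real ((1 - t) ^ M) * (\<Sum>g\<in>G. \<Prod>l\<in>#\<Lambda> g. 1 / (1 - l * (of_real t * \<zeta>)))) \<longlongrightarrow>
        (\<Sum>g\<in>{g \<in> G. m g = M}. \<Prod>l\<in>#filter_mset (\<lambda>l. l * \<zeta> \<noteq> 1) (\<Lambda> g). 1 / (1 - l * \<zeta>))) (at_left 1)"
        unfolding m_def by (rule pole_of_sum[OF finG]) (fold m_def, simp add: m0)
      ultimately have "((\<lambda>t::real. of_real ((1 - t) ^ M) * (\<Sum>g\<in>G. \<Prod>l\<in>#\<Lambda> g. 1 / (1 - l * (of_real t * \<zeta>)))) \<longlongrightarrow> 0) (at_left 1)"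
        by (simp only: sum.empty)
      then have "c = 0" using tendsto_unique[OF trivial_limit_at_left_real M(3)] by blast
      then show False using M(2) by simp
    qed
  next
    assume "\<exists>g\<in>G. S.ord g = K"
    then obtain g where g: "g \<in> G" "S.ord g = K" by blast
    have "size (\<Lambda> g) \<noteq> 0" using \<Lambda> g(1) by (simp add: eigen_data_def)
    then obtain l where l: "l \<in># \<Lambda> g" by (metis multiset_nonemptyE size_empty)
    have lprim: "l ^ j = 1 \<longleftrightarrow> K dvd j" for j using \<Lambda> g l by (auto simp: eigen_data_def)
    have l0: "l \<noteq> 0" using lprim[of K] K by (auto simp: power_0_left)
    \<comment> \<open>The powers of one primitive root exhaust the K-th roots of unity and so reach
      1 / \<open>\<zeta>\<close>.\<close>
    have "(\<lambda>j. l ^ j) ` {..<K} = {z. z ^ K = 1}"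
    proof (rule card_subset_eq)
      show "finite {z::complex. z ^ K = 1}" using finite_roots_unity[of K] K by simp
      show "(\<lambda>j. l ^ j) ` {..<K} \<subseteq> {z. z ^ K = 1}" using lprim by (auto simp: power_mult[symmetric])
      have "inj_on (\<lambda>j. l ^ j) {..<K}"
      proof (rule linorder_inj_onI)
        fix i j assume ij: "i < j" "i \<in> {..<K}" "j \<in> {..<K}"
        show "l ^ i \<noteq> l ^ j"
        proof
          assume "l ^ i = l ^ j"
          then have "l ^ (j - i) = 1" using ij l0 by (simp add: power_diff)
          then have "K dvd j - i" by (simp add: lprim)
          then show False using ij by (auto dest!: dvd_imp_le)
        qed
      qed auto
      then show "card ((\<lambda>j. l ^ j) ` {..<K}) = card {z::complex. z ^ K = 1}"
        using card_roots_unity_eq[of K] K by (simp add: card_image)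
    qed
    moreover have "inverse \<zeta> \<in> {z. z ^ K = 1}" using \<zeta>prim by (simp add: power_inverse)
    ultimately obtain j where j: "inverse \<zeta> = l ^ j" by (metis (no_types, lifting) imageE)
    define h where "h = g [^]\<^bsub>?S\<^esub> j"
    have h: "h \<in> G" "inverse \<zeta> \<in># \<Lambda> h"
      using S.nat_pow_closed[of g j] g(1) \<Lambda> l by (auto simp: h_def j eigen_data_def)
    then have "inverse \<zeta> \<in># filter_mset (\<lambda>l. l * \<zeta> = 1) (\<Lambda> h)" by (simp add: inv)
    then have mh: "m h \<ge> 1" unfolding m_def by (metis One_nat_def Suc_leI empty_iff set_mset_empty size_eq_0_iff_empty zero_less_iff_neq_zero)
    \<comment> \<open>The strongest pole among the elements. Only those that attain it contribute to
      the limit, and \<open>leading_coefficient\<close> gives all of them the same factor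
      \<open>?u\<close> up to positive reals.\<close>
    define M where "M = Max (m ` G)"
    have Mge: "m g \<le> M" if "g \<in> G" for g using that finG by (simp add: M_def)
    have M1: "M \<ge> 1" using Mge[OF h(1)] mh by simp
    let ?G = "{g \<in> G. m g = M}"
    have "M \<in> m ` G" unfolding M_def using finG h(1) by (intro Max_in) auto
    then have ne: "?G \<noteq> {}" by auto
    let ?u = "(1 / (1 - \<zeta>\<^sup>2)) ^ M * (1 / \<zeta>) ^ ((CARD('n) - 2 * M) div 2)"
    have "\<forall>g\<in>?G. \<exists>\<rho>>0. (\<Prod>l\<in>#filter_mset (\<lambda>l. l * \<zeta> \<noteq> 1) (\<Lambda> g). 1 / (1 - l * \<zeta>)) = ?u * of_real \<rho>"
    proof
      fix g assume g: "g \<in> ?G"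
      then have gK: "S.ord g = K" using ordK M1 by simp
      have L: "size (\<Lambda> g) = CARD('n)" "image_mset cnj (\<Lambda> g) = \<Lambda> g" "\<And>l j. l \<in># \<Lambda> g \<Longrightarrow> l ^ j = 1 \<longleftrightarrow> K dvd j"
        using \<Lambda> g gK by (auto simp: eigen_data_def)
      show "\<exists>\<rho>>0. (\<Prod>l\<in>#filter_mset (\<lambda>l. l * \<zeta> \<noteq> 1) (\<Lambda> g). 1 / (1 - l * \<zeta>)) = ?u * of_real \<rho>"
        using leading_coefficient[OF K \<zeta> L(3,2), of M] g L(1) by (simp add: m_def)
    qed
    from bchoice[OF this] obtain \<rho> where \<rho>: "\<And>g. g \<in> ?G \<Longrightarrow> \<rho> g > 0"
      "\<And>g. g \<in> ?G \<Longrightarrow> (\<Prod>l\<in>#filter_mset (\<lambda>l. l * \<zeta> \<noteq> 1) (\<Lambda> g). 1 / (1 - l * \<zeta>)) = ?u * of_real (\<rho> g)" by blast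
    have "(\<Sum>g\<in>?G. \<Prod>l\<in>#filter_mset (\<lambda>l. l * \<zeta> \<noteq> 1) (\<Lambda> g). 1 / (1 - l * \<zeta>)) = ?u * of_real (\<Sum>g\<in>?G. \<rho> g)"
      unfolding of_real_sum sum_distrib_left by (rule sum.cong[OF refl \<rho>(2)])
    moreover have "(\<Sum>g\<in>?G. \<rho> g) > 0" using finG ne \<rho>(1) by (intro sum_pos) auto
    moreover have "\<zeta>\<^sup>2 \<noteq> 1" using \<zeta>ord[of 2] K dvd_imp_le[of K 2] by auto
    ultimately have "(\<Sum>g\<in>?G. \<Prod>l\<in>#filter_mset (\<lambda>l. l * \<zeta> \<noteq> 1) (\<Lambda> g). 1 / (1 - l * \<zeta>)) \<noteq> 0"
      using \<zeta>0 by (simp del: of_real_sum)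
    moreover have "((\<lambda>t::real. of_real ((1 - t) ^ M) * (\<Sum>g\<in>G. \<Prod>l\<in>#\<Lambda> g. 1 / (1 - l * (of_real t * \<zeta>)))) \<longlongrightarrow>
        (\<Sum>g\<in>?G. \<Prod>l\<in>#filter_mset (\<lambda>l. l * \<zeta> \<noteq> 1) (\<Lambda> g). 1 / (1 - l * \<zeta>))) (at_left 1)"
      unfolding m_def by (rule pole_of_sum[OF finG]) (fold m_def, rule Mge)
    ultimately show "\<exists>M\<ge>1. \<exists>c\<noteq>0. ((\<lambda>t::real. of_real ((1 - t) ^ M) * (\<Sum>g\<in>G. \<Prod>l\<in>#\<Lambda> g. 1 / (1 - l * (of_real t * \<zeta>)))) \<longlongrightarrow> c) (at_left 1)"
      using M1 by blast
  qed
qed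


section \<open>Order and element orders from the spectrum\<close>

definition molien_value :: "(real^'n^'n) set \<Rightarrow> (real^'n^'n \<Rightarrow> complex multiset) \<Rightarrow> complex \<Rightarrow> complex" where
  "molien_value G \<Lambda> z = (\<Sum>g\<in>G. \<Prod>l\<in>#\<Lambda> g. 1 / (1 - l * z)) / of_nat (card G)"

text \<open>An eigenvalue 1 forces the order to be 1, so only the identity has a pole here, of order
  n and with coefficient 1.\<close>

lemma molien_value_pole_at_1:
  fixes G :: "(real^'n^'n) set"
  assumes G: "spherical_space_form G" and \<Lambda>: "eigen_data G \<Lambda>"
  shows "((\<lambda>t::real. (1 - t) ^ CARD('n) * Re (molien_value G \<Lambda> (of_real t))) \<longlongrightarrow> 1 / card G) (at_left 1)"
proof -
  let ?S = "subgroup_of_matrices G"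
  interpret S: group ?S by (rule space_form_group[OF G])
  have finG: "finite G" using G by (simp add: spherical_space_form_def)
  define m where "m g = size (filter_mset (\<lambda>l. l * 1 = 1) (\<Lambda> g))" for g
  have one: "mat 1 \<in> G" by (rule space_form_mult(2)[OF G])
  have d: "size (\<Lambda> g) = CARD('n)" "l \<in># \<Lambda> g \<Longrightarrow> l ^ j = 1 \<longleftrightarrow> S.ord g dvd j" if "g \<in> G" for g l j
    using \<Lambda> that by (auto simp: eigen_data_def)
  have l1: "l = 1 \<longleftrightarrow> g = mat 1" if "g \<in> G" "l \<in># \<Lambda> g" for g l
    using d(2)[OF that, of 1] S.ord_eq_1[of g] that(1) by simp
  have m1: "m (mat 1) = CARD('n)" and f1: "filter_mset (\<lambda>l. l * 1 \<noteq> 1) (\<Lambda> (mat 1)) = {#}"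
  proof -
    have "filter_mset (\<lambda>l. l = 1) (\<Lambda> (mat 1)) = \<Lambda> (mat 1)" using l1[OF one] by (simp add: filter_mset_eq_conv)
    then show "m (mat 1) = CARD('n)" using d(1)[OF one] by (simp add: m_def)
    show "filter_mset (\<lambda>l. l * 1 \<noteq> 1) (\<Lambda> (mat 1)) = {#}" using l1[OF one] by (simp add: filter_mset_eq_conv)
  qed
  have m0: "m g = 0" if "g \<in> G" "g \<noteq> mat 1" for g
    using l1[OF that(1)] that(2) by (simp add: m_def)
  have set1: "{g \<in> G. m g = CARD('n)} = {mat 1}"
  proof (intro equalityI subsetI)
    fix g assume "g \<in> {g \<in> G. m g = CARD('n)}"
    then have "g \<in> G" "m g \<noteq> 0" by simp_all
    then show "g \<in> {mat 1}" using m0[of g] by (cases "g = mat 1") simp_all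
  next
    fix g :: "real^'n^'n" assume "g \<in> {mat 1}"
    then show "g \<in> {g \<in> G. m g = CARD('n)}" using one m1 by simp
  qed
  have le: "m g \<le> CARD('n)" if "g \<in> G" for g using m0[OF that] m1 by (cases "g = mat 1") simp_all
  let ?Q = "\<lambda>t::real. \<Sum>g\<in>G. \<Prod>l\<in>#\<Lambda> g. 1 / (1 - l * of_real t)"
  have R: "(\<Sum>g\<in>{g \<in> G. m g = CARD('n)}. \<Prod>l\<in>#filter_mset (\<lambda>l. l * 1 \<noteq> 1) (\<Lambda> g). 1 / (1 - l * 1)) = 1"
  proof -
    have "(\<Sum>g\<in>{mat 1}. F g) = F (mat 1)" for F :: "real^'n^'n \<Rightarrow> complex" by simp
    then show ?thesis unfolding set1 by (simp only: f1 image_mset_empty prod_mset_empty)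
  qed
  have "((\<lambda>t::real. of_real ((1 - t) ^ CARD('n)) * (\<Sum>g\<in>G. \<Prod>l\<in>#\<Lambda> g. 1 / (1 - l * (of_real t * 1)))) \<longlongrightarrow>
    (\<Sum>g\<in>{g \<in> G. m g = CARD('n)}. \<Prod>l\<in>#filter_mset (\<lambda>l. l * 1 \<noteq> 1) (\<Lambda> g). 1 / (1 - l * 1))) (at_left 1)"
    unfolding m_def by (rule pole_of_sum[OF finG]) (fold m_def, rule le)
  then have "((\<lambda>t. of_real ((1 - t) ^ CARD('n)) * ?Q t) \<longlongrightarrow> 1) (at_left 1)"
    unfolding R by (simp only: mult_1_right)
  moreover have "of_nat (card G) \<noteq> (0::complex)" using finG one by auto
  ultimately have "((\<lambda>t. of_real ((1 - t) ^ CARD('n)) * ?Q t / of_nat (card G)) \<longlongrightarrow> 1 / of_nat (card G)) (at_left 1)"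
    by (intro tendsto_divide tendsto_const)
  from tendsto_Re[OF this]
  have "((\<lambda>t. Re (of_real ((1 - t) ^ CARD('n)) * ?Q t / of_nat (card G))) \<longlongrightarrow> Re (1 / of_nat (card G))) (at_left 1)" .
  moreover have "Re (of_real ((1 - t) ^ CARD('n)) * ?Q t / of_nat (card G)) =
     (1 - t) ^ CARD('n) * Re (molien_value G \<Lambda> (of_real t))" for t
    unfolding molien_value_def times_divide_eq_right[symmetric] by (simp only: times_complex.sel Re_complex_of_real Im_complex_of_real mult_zero_left diff_zero)
  moreover have "Re (1 / of_nat (card G)) = 1 / card G"
    by (metis Re_complex_of_real of_real_1 of_real_divide of_real_of_nat_eq)
  ultimately show ?thesis by (simp only:)
qed

text \<open>The harmonic dimension in degree k + 2 is the difference of the polynomial dimensions in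
  degrees k + 2 and k, which amounts to multiplying the series by 1 - t^2.\<close>

lemma harmonic_series:
  fixes G :: "(real^'n^'n) set" and t :: real
  assumes G: "spherical_space_form G" and \<Lambda>: "eigen_data G \<Lambda>" and t: "\<bar>t\<bar> < 1"
  shows "(\<lambda>k. real (fun_vs.dim (inv_harmonic (matrix_actions G) k)) * t ^ k) sums ((1 - t\<^sup>2) * Re (molien_value G \<Lambda> (of_real t)))"
proof -
  define a where "a k = real (fun_vs.dim (inv_hpoly (matrix_actions G) k))" for k
  define h where "h k = real (fun_vs.dim (inv_harmonic (matrix_actions G) k))" for k
  let ?X = "Re (molien_value G \<Lambda> (of_real t))"
  have orth: "\<And>g. g \<in> matrix_actions G \<Longrightarrow> orthogonal_transformation g"
    using space_form_orthogonal(2)[OF G] by (auto simp: matrix_actions_def)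
  have h2: "h (k + 2) = a (k + 2) - a k" for k
    using dim_inv_hpoly_Suc_Suc[OF orth, where k=k] by (simp add: a_def h_def)
  have h0: "h k = a k" if "k < 2" for k by (simp add: a_def h_def inv_harmonic_low_degree[OF that])
  have "(\<lambda>k. complex_of_real (a k * t ^ k)) sums molien_value G \<Lambda> (of_real t)"
    using molien_series[OF G \<Lambda>, of "of_real t"] t by (simp add: a_def molien_value_def)
  from sums_Re[OF this] have a_sums: "(\<lambda>k. a k * t ^ k) sums ?X" by simp
  define b where "b k = (if k < 2 then 0 else t\<^sup>2 * (a (k - 2) * t ^ (k - 2)))" for k
  have "(\<lambda>k. b (k + 2)) sums (t\<^sup>2 * ?X)" using sums_mult[OF a_sums, of "t\<^sup>2"] by (simp add: b_def)
  then have "b sums (t\<^sup>2 * ?X)" by (subst (asm) sums_zero_iff_shift) (auto simp: b_def)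
  from sums_diff[OF a_sums this] have "(\<lambda>k. a k * t ^ k - b k) sums ((1 - t\<^sup>2) * ?X)" by (simp add: algebra_simps)
  moreover have "a k * t ^ k - b k = h k * t ^ k" for k
  proof (cases "k < 2")
    case True
    then show ?thesis by (simp add: b_def h0)
  next
    case False
    then obtain j where "k = j + 2" by (metis add.commute le_Suc_ex not_less)
    then show ?thesis by (simp only: h2) (simp add: b_def power_add power2_eq_square algebra_simps)
  qed
  ultimately show ?thesis by (simp add: h_def)
qed

text \<open>With t = exp (-s) this is the trace of exp (-s sqrt Delta), where Delta is the
  Laplacian. The sum runs over all real numbers; those that are not eigenvalues contribute
  0.\<close>

definition spectral_zeta :: "(real \<Rightarrow> nat) \<Rightarrow> real \<Rightarrow> real" where
  "spectral_zeta S t = (\<Sum>\<^sub>\<infinity>\<mu>. real (S \<mu>) * t powr sqrt \<mu>)"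

text \<open>Weyl's law in Abelian form: since \<open>k \<le> sqrt (k (k + n - 2)) \<le> k + n - 2\<close>, replacing \<open>t\<close> to the power
  \<open>sqrt \<mu>\<close> by \<open>t\<^sup>k\<close> is harmless as \<open>t\<close> tends to 1, and the sum so obtained is intrinsic to the spectrum.\<close>

lemma spectral_zeta_bounds:
  fixes G :: "(real^'n^'n) set" and t :: real
  assumes G: "spherical_space_form G" and \<Lambda>: "eigen_data G \<Lambda>" and t: "0 < t" "t < 1"
  shows "spectral_zeta (Spec G) t \<le> (1 - t\<^sup>2) * Re (molien_value G \<Lambda> (of_real t))"
    and "t ^ (CARD('n) - 2) * ((1 - t\<^sup>2) * Re (molien_value G \<Lambda> (of_real t))) \<le> spectral_zeta (Spec G) t"
proof -
  let ?n = "CARD('n)" and ?ev = "sphere_eigenvalue CARD('n)"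
  define h where "h k = real (fun_vs.dim (inv_harmonic (matrix_actions G) k))" for k
  let ?H = "(1 - t\<^sup>2) * Re (molien_value G \<Lambda> (of_real t))"
  have n: "?n \<ge> 2" using G by (simp add: spherical_space_form_def)
  have s: "(\<lambda>k. h k * t ^ k) sums ?H" using harmonic_series[OF G \<Lambda>, of t] t by (simp add: h_def)
  have hs: "((\<lambda>k. h k * t ^ k) has_sum ?H) UNIV"
    using s t by (intro norm_summable_imp_has_sum) (auto simp: h_def intro: sums_summable)
  have ev_bounds: "real k \<le> sqrt (?ev k)" "sqrt (?ev k) \<le> real k + real (?n - 2)" for k
  proof -
    have "?ev k = (real k)\<^sup>2 + real k * real (?n - 2)" using n by (simp add: sphere_eigenvalue_def power2_eq_square algebra_simps of_nat_diff)
    moreover have "(real k + real (?n - 2))\<^sup>2 = (real k)\<^sup>2 + 2 * (real k * real (?n - 2)) + (real (?n - 2))\<^sup>2"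
      by (simp add: power2_eq_square algebra_simps)
    moreover have "0 \<le> real k * real (?n - 2)" "0 \<le> (real (?n - 2))\<^sup>2" by simp_all
    ultimately show "real k \<le> sqrt (?ev k)" "sqrt (?ev k) \<le> real k + real (?n - 2)"
      by (intro real_le_rsqrt real_le_lsqrt; linarith)+
  qed
  define \<phi> where "\<phi> k = h k * t powr sqrt (?ev k)" for k
  have up: "\<phi> k \<le> h k * t ^ k" for k
  proof -
    have "t powr sqrt (?ev k) \<le> t powr real k" using ev_bounds(1) t by (intro powr_mono') auto
    then show ?thesis using t by (simp add: \<phi>_def powr_realpow h_def mult_left_mono)
  qed
  have low: "t ^ (?n - 2) * (h k * t ^ k) \<le> \<phi> k" for k
  proof -
    have "t powr (real k + real (?n - 2)) \<le> t powr sqrt (?ev k)" using ev_bounds(2) t by (intro powr_mono') auto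
    then have "t ^ (k + (?n - 2)) \<le> t powr sqrt (?ev k)" using t by (simp add: powr_realpow[symmetric])
    then have "h k * t ^ (k + (?n - 2)) \<le> \<phi> k" by (simp add: \<phi>_def h_def mult_left_mono)
    then show ?thesis by (simp add: power_add mult_ac)
  qed
  have \<phi>0: "0 \<le> \<phi> k" for k by (simp add: \<phi>_def h_def)
  have \<phi>s: "\<phi> summable_on UNIV"
    by (rule summable_on_comparison_test[OF has_sum_imp_summable[OF hs]]) (use up \<phi>0 in auto)
  have inj: "inj ?ev" using inj_sphere_eigenvalue[OF n] by (auto simp: inj_def)
  have "spectral_zeta (Spec G) t = (\<Sum>\<^sub>\<infinity>\<mu>\<in>range ?ev. real (Spec G \<mu>) * t powr sqrt \<mu>)"
    unfolding spectral_zeta_def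
    by (rule infsum_cong_neutral) (use Spec_not_eigenvalue[OF G] in auto)
  also have "\<dots> = (\<Sum>\<^sub>\<infinity>k. \<phi> k)"
    by (subst infsum_reindex[OF inj]) (simp add: comp_def \<phi>_def[abs_def] h_def Spec_eigenvalue[OF G])
  finally have Z: "spectral_zeta (Spec G) t = (\<Sum>\<^sub>\<infinity>k. \<phi> k)" .
  show "spectral_zeta (Spec G) t \<le> ?H"
    unfolding Z infsumI[OF hs, symmetric] by (rule infsum_mono[OF \<phi>s has_sum_imp_summable[OF hs]]) (rule up)
  have ls: "((\<lambda>k. t ^ (?n - 2) * (h k * t ^ k)) has_sum (t ^ (?n - 2) * ?H)) UNIV"
    by (rule has_sum_cmult_right[OF hs])
  show "t ^ (?n - 2) * ?H \<le> spectral_zeta (Spec G) t"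
    unfolding Z infsumI[OF ls, symmetric] by (rule infsum_mono[OF has_sum_imp_summable[OF ls] \<phi>s]) (rule low)
qed

text \<open>Of the factors of 1 - t^2 = (1 - t) (1 + t), the first lowers the order of the pole from
  n to n - 1 and the second tends to 2.\<close>

lemma spectral_zeta_limit:
  fixes G :: "(real^'n^'n) set"
  assumes G: "spherical_space_form G"
  shows "((\<lambda>t. (1 - t) ^ (CARD('n) - 1) * spectral_zeta (Spec G) t) \<longlongrightarrow> 2 / card G) (at_left 1)"
proof -
  obtain \<Lambda> where \<Lambda>: "eigen_data G \<Lambda>" using eigen_data_exists[OF G] by blast
  let ?n = "CARD('n)"
  define H where "H t = (1 - t\<^sup>2) * Re (molien_value G \<Lambda> (of_real t))" for t
  have n: "?n \<ge> 1" using G by (simp add: spherical_space_form_def)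
  have "((\<lambda>t. (1 + t) * ((1 - t) ^ ?n * Re (molien_value G \<Lambda> (of_real t)))) \<longlongrightarrow> (1 + 1) * (1 / card G)) (at_left 1)"
    by (intro tendsto_mult molien_value_pole_at_1[OF G \<Lambda>] tendsto_intros)
  moreover have "(1 + t) * ((1 - t) ^ ?n * Re (molien_value G \<Lambda> (of_real t))) = (1 - t) ^ (?n - 1) * H t" for t
  proof -
    have "(1 - t) ^ ?n = (1 - t) ^ (?n - 1) * (1 - t)" using n by (metis power_minus_mult zero_less_card_finite)
    then show ?thesis unfolding H_def by (simp only:) (simp add: power2_eq_square algebra_simps)
  qed
  ultimately have HL: "((\<lambda>t. (1 - t) ^ (?n - 1) * H t) \<longlongrightarrow> 2 / card G) (at_left 1)" by simp
  have ev: "\<forall>\<^sub>F t in at_left (1::real). t \<in> {0<..<1}" by (rule eventually_at_left_real) simp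
  have "((\<lambda>t. t ^ (?n - 2) * ((1 - t) ^ (?n - 1) * H t)) \<longlongrightarrow> 1 ^ (?n - 2) * (2 / card G)) (at_left 1)"
    by (intro tendsto_mult HL tendsto_intros)
  then have LL: "((\<lambda>t. t ^ (?n - 2) * ((1 - t) ^ (?n - 1) * H t)) \<longlongrightarrow> 2 / card G) (at_left 1)" by simp
  show ?thesis
  proof (rule tendsto_sandwich[OF _ _ LL HL])
    show "\<forall>\<^sub>F t in at_left 1. t ^ (?n - 2) * ((1 - t) ^ (?n - 1) * H t) \<le> (1 - t) ^ (?n - 1) * spectral_zeta (Spec G) t"
      using ev
    proof eventually_elim
      case (elim t)
      have "(1 - t) ^ (?n - 1) * (t ^ (?n - 2) * H t) \<le> (1 - t) ^ (?n - 1) * spectral_zeta (Spec G) t"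
        using spectral_zeta_bounds(2)[OF G \<Lambda>, of t] elim by (intro mult_left_mono) (auto simp: H_def)
      then show ?case by (simp add: mult_ac)
    qed
    show "\<forall>\<^sub>F t in at_left 1. (1 - t) ^ (?n - 1) * spectral_zeta (Spec G) t \<le> (1 - t) ^ (?n - 1) * H t"
      using ev
    proof eventually_elim
      case (elim t)
      show ?case
        using spectral_zeta_bounds(1)[OF G \<Lambda>, of t] elim by (intro mult_left_mono) (auto simp: H_def)
    qed
  qed
qed

lemma pole_order_unique:
  fixes Z :: "real \<Rightarrow> real"
  assumes a: "((\<lambda>t. (1 - t) ^ i * Z t) \<longlongrightarrow> a) (at_left 1)" and b: "((\<lambda>t. (1 - t) ^ j * Z t) \<longlongrightarrow> b) (at_left 1)" "b \<noteq> 0"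
  shows "j \<le> i"
proof (rule ccontr)
  assume "\<not> j \<le> i"
  then have j: "j = (j - i) + i" "j - i > 0" by auto
  have "((\<lambda>t. (1 - t) ^ (j - i) * ((1 - t) ^ i * Z t)) \<longlongrightarrow> (1 - 1) ^ (j - i) * a) (at_left 1)"
    by (intro tendsto_mult a tendsto_intros)
  moreover have "(1 - t) ^ (j - i) * ((1 - t) ^ i * Z t) = (1 - t) ^ j * Z t" for t
    using j(1) by (metis mult.assoc power_add)
  ultimately have "((\<lambda>t. (1 - t) ^ j * Z t) \<longlongrightarrow> 0) (at_left 1)" using j(2) by (simp add: power_0_left)
  then show False using tendsto_unique[OF trivial_limit_at_left_real b(1)] b(2) by blast
qed

lemma isospectral_dimension_order:
  fixes G :: "(real^'n^'n) set" and G' :: "(real^'m^'m) set"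
  assumes G: "spherical_space_form G" and G': "spherical_space_form G'" and iso: "isospectral G' G"
  shows "CARD('n) = CARD('m)" "card G = card G'"
proof -
  have S: "Spec G' = Spec G" using iso by (simp add: isospectral_def)
  have fin: "finite G" "G \<noteq> {}" "finite G'" "G' \<noteq> {}"
    using G G' space_form_mult(2) by (auto simp: spherical_space_form_def)
  have l: "((\<lambda>t. (1 - t) ^ (CARD('n) - 1) * spectral_zeta (Spec G) t) \<longlongrightarrow> 2 / card G) (at_left 1)"
    by (rule spectral_zeta_limit[OF G])
  have l': "((\<lambda>t. (1 - t) ^ (CARD('m) - 1) * spectral_zeta (Spec G) t) \<longlongrightarrow> 2 / card G') (at_left 1)"
    using spectral_zeta_limit[OF G'] by (simp add: S)
  have "CARD('m) - 1 \<le> CARD('n) - 1" by (rule pole_order_unique[OF l l']) (use fin in simp)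
  moreover have "CARD('n) - 1 \<le> CARD('m) - 1" by (rule pole_order_unique[OF l' l]) (use fin in simp)
  moreover have "CARD('n) \<ge> 3" "CARD('m) \<ge> 3" using G G' by (auto simp: spherical_space_form_def)
  ultimately show n: "CARD('n) = CARD('m)" by linarith
  have "2 / real (card G) = 2 / card G'"
    using tendsto_unique[OF trivial_limit_at_left_real l] l' unfolding n by blast
  then show "card G = card G'" using fin by (simp add: field_simps)
qed

text \<open>Once the dimensions agree, the same k labels the same eigenvalue on both sides, so the
  harmonic dimensions agree; by recursion so do those of the invariant polynomials. The Molien sums
  then coincide in the open disc, and with them all radial limits.\<close>

theorem isospectral_element_orders:
  fixes G :: "(real^'n^'n) set" and G' :: "(real^'m^'m) set"
  assumes G: "spherical_space_form G" and G': "spherical_space_form G'" and iso: "isospectral G' G" and K: "K \<ge> 3"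
  shows "(\<exists>g\<in>G. group.ord (subgroup_of_matrices G) g = K) \<longleftrightarrow> (\<exists>g\<in>G'. group.ord (subgroup_of_matrices G') g = K)"
proof -
  have S: "Spec G' = Spec G" using iso by (simp add: isospectral_def)
  note n = isospectral_dimension_order[OF G G' iso]
  obtain \<Lambda> where \<Lambda>: "eigen_data G \<Lambda>" using eigen_data_exists[OF G] by blast
  obtain \<Lambda>' where \<Lambda>': "eigen_data G' \<Lambda>'" using eigen_data_exists[OF G'] by blast
  have harm: "fun_vs.dim (inv_harmonic (matrix_actions G) k) = fun_vs.dim (inv_harmonic (matrix_actions G') k)" for k
    using Spec_eigenvalue[OF G, of k] Spec_eigenvalue[OF G', of k] S n(1) by simp
  have orth: "\<And>g. g \<in> matrix_actions G \<Longrightarrow> orthogonal_transformation g"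
    and orth': "\<And>g. g \<in> matrix_actions G' \<Longrightarrow> orthogonal_transformation g"
    using space_form_orthogonal(2)[OF G] space_form_orthogonal(2)[OF G'] by (auto simp: matrix_actions_def)
  have poly: "fun_vs.dim (inv_hpoly (matrix_actions G) k) = fun_vs.dim (inv_hpoly (matrix_actions G') k)" for k
  proof (induction k rule: less_induct)
    case (less k)
    show ?case
    proof (cases "k < 2")
      case True
      then show ?thesis using harm[of k] by (simp add: inv_harmonic_low_degree)
    next
      case False
      then obtain j where j: "k = j + 2" by (metis add.commute le_Suc_ex not_less)
      then show ?thesis
        using dim_inv_hpoly_Suc_Suc[OF orth, where k=j] dim_inv_hpoly_Suc_Suc[OF orth', where k=j] harm less.IH[of j] by simp
    qed
  qed
  have fin: "card G \<noteq> 0" using G space_form_mult(2)[OF G] by (auto simp: spherical_space_form_def)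
  have eq: "(\<Sum>g\<in>G. \<Prod>l\<in>#\<Lambda> g. 1 / (1 - l * z)) = (\<Sum>g\<in>G'. \<Prod>l\<in>#\<Lambda>' g. 1 / (1 - l * z))" if z: "norm z < 1" for z
  proof -
    have "(\<Sum>g\<in>G. \<Prod>l\<in>#\<Lambda> g. 1 / (1 - l * z)) / of_nat (card G) = (\<Sum>g\<in>G'. \<Prod>l\<in>#\<Lambda>' g. 1 / (1 - l * z)) / of_nat (card G')"
      by (rule sums_unique2[OF molien_series[OF G \<Lambda> z]]) (unfold poly, rule molien_series[OF G' \<Lambda>' z])
    then show ?thesis using fin by (simp add: n(2)[symmetric])
  qed
  define \<zeta> where "\<zeta> = cis (2 * pi / K)"
  have "((\<lambda>t::real. of_real ((1 - t) ^ M) * (\<Sum>g\<in>G. \<Prod>l\<in>#\<Lambda> g. 1 / (1 - l * (of_real t * \<zeta>)))) \<longlongrightarrow> c) (at_left 1) \<longleftrightarrow>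
    ((\<lambda>t::real. of_real ((1 - t) ^ M) * (\<Sum>g\<in>G'. \<Prod>l\<in>#\<Lambda>' g. 1 / (1 - l * (of_real t * \<zeta>)))) \<longlongrightarrow> c) (at_left 1)" for M c
  proof (rule tendsto_cong)
    have "\<forall>\<^sub>F t in at_left (1::real). t \<in> {0<..<1}" by (rule eventually_at_left_real) simp
    then show "\<forall>\<^sub>F t in at_left 1. of_real ((1 - t) ^ M) * (\<Sum>g\<in>G. \<Prod>l\<in>#\<Lambda> g. 1 / (1 - l * (of_real t * \<zeta>))) =
       of_real ((1 - t) ^ M) * (\<Sum>g\<in>G'. \<Prod>l\<in>#\<Lambda>' g. 1 / (1 - l * (of_real t * \<zeta>)))"
    proof eventually_elim
      case (elim t)
      have "norm (of_real t * \<zeta>) < 1" using elim by (simp add: norm_mult \<zeta>_def)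
      from eq[OF this] show ?case by simp
    qed
  qed
  then show ?thesis
    unfolding element_order_iff_pole[OF G \<Lambda> K \<zeta>_def] element_order_iff_pole[OF G' \<Lambda>' K \<zeta>_def] by simp
qed


section \<open>Metacyclic groups\<close>

text \<open>Normal forms exhaust the group, and the cardinality makes them unique. The conjugation
  relation is written without inverses, so that natural exponents suffice throughout.\<close>

definition metacyclic :: "('a, 'b) monoid_scheme \<Rightarrow> 'a \<Rightarrow> 'a \<Rightarrow> nat \<Rightarrow> nat \<Rightarrow> nat \<Rightarrow> bool" where
  "metacyclic H a b m n r \<longleftrightarrow> group H \<and> m > 0 \<and> n > 0 \<and> a \<in> carrier H \<and> b \<in> carrier H \<and>
    a [^]\<^bsub>H\<^esub> m = \<one>\<^bsub>H\<^esub> \<and> b [^]\<^bsub>H\<^esub> n = \<one>\<^bsub>H\<^esub> \<and> b \<otimes>\<^bsub>H\<^esub> a = a [^]\<^bsub>H\<^esub> r \<otimes>\<^bsub>H\<^esub> b \<and>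
    (\<lambda>(i, j). a [^]\<^bsub>H\<^esub> i \<otimes>\<^bsub>H\<^esub> b [^]\<^bsub>H\<^esub> j) ` ({..<m} \<times> {..<n}) = carrier H \<and> card (carrier H) = m * n"

context group begin

lemma nat_pow_mod:
  assumes "a \<in> carrier G" "a [^] (m::nat) = \<one>" "m > 0" shows "a [^] (i mod m) = a [^] i"
proof -
  have "a [^] i = a [^] (m * (i div m) + i mod m)" by simp
  also have "\<dots> = (a [^] m) [^] (i div m) \<otimes> a [^] (i mod m)"
    using assms(1) by (simp only: nat_pow_mult[symmetric] nat_pow_pow[symmetric] nat_pow_closed)
  finally show ?thesis using assms by (simp add: nat_pow_one)
qed

lemma conj_pow:
  assumes "a \<in> carrier G" "b \<in> carrier G" "b \<otimes> a = a [^] (r::nat) \<otimes> b"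
  shows "b [^] (j::nat) \<otimes> a [^] (i::nat) = a [^] (r ^ j * i) \<otimes> b [^] j"
proof -
  have 1: "b \<otimes> a [^] i = a [^] (r * i) \<otimes> b" for i :: nat
  proof (induction i)
    case (Suc i)
    have "b \<otimes> a [^] Suc i = (b \<otimes> a [^] i) \<otimes> a" using assms by (simp add: m_assoc)
    also have "\<dots> = a [^] (r * i) \<otimes> (b \<otimes> a)" using assms Suc by (simp add: m_assoc)
    also have "\<dots> = (a [^] (r * i) \<otimes> a [^] r) \<otimes> b" using assms by (simp add: m_assoc)
    also have "\<dots> = a [^] (r * Suc i) \<otimes> b" using assms by (simp add: nat_pow_mult add.commute)
    finally show ?case .
  qed (use assms in simp)
  show ?thesis
  proof (induction j arbitrary: i)
    case (Suc j)
    have "b [^] Suc j \<otimes> a [^] i = b [^] j \<otimes> (b \<otimes> a [^] i)" using assms by (simp add: m_assoc)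
    also have "\<dots> = (b [^] j \<otimes> a [^] (r * i)) \<otimes> b" using assms by (simp add: 1 m_assoc)
    also have "\<dots> = a [^] (r ^ j * (r * i)) \<otimes> (b [^] j \<otimes> b)" using assms Suc by (simp add: m_assoc)
    finally show ?case by (simp add: mult_ac)
  qed (use assms in simp)
qed

lemma mult_normal_form:
  assumes "a \<in> carrier G" "b \<in> carrier G" "b \<otimes> a = a [^] (r::nat) \<otimes> b"
  shows "(a [^] (i::nat) \<otimes> b [^] (j::nat)) \<otimes> (a [^] (i'::nat) \<otimes> b [^] (j'::nat)) = a [^] (i + r ^ j * i') \<otimes> b [^] (j + j')"
proof -
  have "(a [^] i \<otimes> b [^] j) \<otimes> (a [^] i' \<otimes> b [^] j') = a [^] i \<otimes> (b [^] j \<otimes> a [^] i') \<otimes> b [^] j'"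
    using assms by (simp add: m_assoc)
  also have "\<dots> = (a [^] i \<otimes> a [^] (r ^ j * i')) \<otimes> (b [^] j \<otimes> b [^] j')"
    using assms by (simp add: conj_pow m_assoc)
  finally show ?thesis using assms by (simp add: nat_pow_mult)
qed

end

lemma metacyclic_inj:
  fixes H (structure)
  assumes "metacyclic H a b m n r"
  shows "inj_on (\<lambda>(i, j). a [^] i \<otimes> b [^] j) ({..<m} \<times> {..<n})"
  using assms by (intro eq_card_imp_inj_on) (auto simp: metacyclic_def)

lemma metacyclic_elem:
  fixes H (structure)
  assumes "metacyclic H a b m n r" "x \<in> carrier H"
  obtains i j where "i < m" "j < n" "x = a [^] i \<otimes> b [^] j"
proof -
  have "x \<in> (\<lambda>(i, j). a [^] i \<otimes> b [^] j) ` ({..<m} \<times> {..<n})"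
    using assms by (simp add: metacyclic_def)
  then show ?thesis using that by auto
qed

text \<open>Equal normal forms are matched; by \<open>mult_normal_form\<close> the exponents of a
  product depend on r alone.\<close>

lemma metacyclic_iso:
  fixes H (structure)
  assumes H: "metacyclic H a b m n r" and H': "metacyclic H' a' b' m n r"
  shows "H \<cong> H'"
proof -
  interpret H: group H using H by (simp add: metacyclic_def)
  interpret H': group H' using H' by (simp add: metacyclic_def)
  let ?D = "{..<m} \<times> {..<n}"
  define f where "f = (\<lambda>(i::nat, j::nat). a [^] i \<otimes> b [^] j)"
  define f' where "f' = (\<lambda>(i::nat, j::nat). a' [^]\<^bsub>H'\<^esub> i \<otimes>\<^bsub>H'\<^esub> b' [^]\<^bsub>H'\<^esub> j)"
  have bij: "bij_betw f ?D (carrier H)" using metacyclic_inj[OF H] H by (auto simp: bij_betw_def metacyclic_def f_def)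
  have bij': "bij_betw f' ?D (carrier H')" using metacyclic_inj[OF H'] H' by (auto simp: bij_betw_def metacyclic_def f'_def)
  define h where "h = f' \<circ> the_inv_into ?D f"
  have hb: "bij_betw h (carrier H) (carrier H')"
    unfolding h_def by (rule bij_betw_trans[OF bij_betw_the_inv_into[OF bij] bij'])
  note d = H[unfolded metacyclic_def] and d' = H'[unfolded metacyclic_def]
  have h: "h (a [^] i \<otimes> b [^] j) = a' [^]\<^bsub>H'\<^esub> i \<otimes>\<^bsub>H'\<^esub> b' [^]\<^bsub>H'\<^esub> j" for i j :: nat
  proof -
    have D: "(i mod m, j mod n) \<in> ?D" using d by simp
    have "a [^] i \<otimes> b [^] j = f (i mod m, j mod n)"
      using d H.nat_pow_mod[of a m i] H.nat_pow_mod[of b n j] by (simp add: f_def)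
    then have "h (a [^] i \<otimes> b [^] j) = f' (i mod m, j mod n)"
      using bij D by (simp add: h_def bij_betw_def the_inv_into_f_f)
    then show ?thesis using d' H'.nat_pow_mod[of a' m i] H'.nat_pow_mod[of b' n j] by (simp add: f'_def)
  qed
  have "h \<in> hom H H'"
  proof (rule homI)
    show "h x \<in> carrier H'" if "x \<in> carrier H" for x using hb that by (auto simp: bij_betw_def)
    fix x y assume "x \<in> carrier H" "y \<in> carrier H"
    then obtain i j i' j' where x: "x = a [^] (i::nat) \<otimes> b [^] (j::nat)"
      and y: "y = a [^] (i'::nat) \<otimes> b [^] (j'::nat)"
      using metacyclic_elem[OF H] by metis
    show "h (x \<otimes> y) = h x \<otimes>\<^bsub>H'\<^esub> h y"
      unfolding x y h using d d' by (simp add: H.mult_normal_form[where r=r] H'.mult_normal_form[where r=r] h)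
  qed
  then show ?thesis using hb by (auto simp: is_iso_def iso_def)
qed

lemma metacyclic_transfer:
  fixes H (structure)
  assumes H: "group H" and M: "metacyclic K a b m n r" and iso: "H \<cong> K"
  shows "\<exists>a' b'. metacyclic H a' b' m n r"
proof -
  interpret H: group H by (rule H)
  interpret K: group K using M by (simp add: metacyclic_def)
  have "K \<cong> H" using H.iso_sym[OF iso] .
  then obtain f where f: "f \<in> hom K H" "bij_betw f (carrier K) (carrier H)" by (auto simp: is_iso_def iso_def)
  interpret f: group_hom K H f by unfold_locales (rule f(1))
  note d = M[unfolded metacyclic_def]
  have pw: "f (x [^]\<^bsub>K\<^esub> i) = f x [^] i" if "x \<in> carrier K" for x and i :: nat using that by (rule f.hom_nat_pow)
  have "(\<lambda>(i, j). f a [^] i \<otimes> f b [^] j) ` ({..<m} \<times> {..<n}) = f ` (\<lambda>(i, j). a [^]\<^bsub>K\<^esub> i \<otimes>\<^bsub>K\<^esub> b [^]\<^bsub>K\<^esub> j) ` ({..<m} \<times> {..<n})"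
    unfolding image_image using d by (intro image_cong refl) (auto simp: pw)
  also have "\<dots> = carrier H" using d f(2) by (simp add: bij_betw_def)
  finally have img: "(\<lambda>(i, j). f a [^] i \<otimes> f b [^] j) ` ({..<m} \<times> {..<n}) = carrier H" .
  have "card (carrier H) = m * n" using bij_betw_same_card[OF f(2)] d by simp
  moreover have "f b \<otimes> f a = f a [^] r \<otimes> f b"
    using d by (metis K.nat_pow_closed f.hom_mult pw)
  ultimately have "metacyclic H (f a) (f b) m n r"
    unfolding metacyclic_def using d img H pw[of a m] pw[of b n] by auto
  then show ?thesis by blast
qed

section \<open>Presented groups and the normal forms of the metacyclic presentation\<close>

definition word_class :: "('g word \<times> 'g word) set \<Rightarrow> 'g word \<Rightarrow> 'g word set" where
  "word_class R u = {w. pres_eq R u w}"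

lemma word_class_eq_iff: "word_class R u = word_class R v \<longleftrightarrow> pres_eq R u v"
  unfolding word_class_def by (auto intro: pres_refl pres_sym pres_trans)

lemma carrier_presented_group: "carrier (presented_group R) = range (word_class R)"
  by (auto simp: presented_group_def quotient_def word_class_def)

lemma mult_presented_group: "word_class R u \<otimes>\<^bsub>presented_group R\<^esub> word_class R v = word_class R (u @ v)"
proof -
  have "{w. pres_eq R (u' @ v') w} = word_class R (u @ v)" if "u' \<in> word_class R u" "v' \<in> word_class R v" for u' v'
    using that word_class_eq_iff[of R "u' @ v'" "u @ v"] unfolding word_class_def by (auto intro: pres_append pres_sym)
  moreover have "u \<in> word_class R u" "v \<in> word_class R v" by (auto simp: word_class_def intro: pres_refl)
  ultimately show ?thesis unfolding presented_group_def by auto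
qed

lemma one_presented_group: "\<one>\<^bsub>presented_group R\<^esub> = word_class R []"
  by (simp add: presented_group_def word_class_def)

definition inverse_word :: "'g word \<Rightarrow> 'g word" where
  "inverse_word u = rev (map (\<lambda>(a, e). (a, \<not> e)) u)"

lemma pres_eq_inverse_word: "pres_eq R (inverse_word u @ u) []"
proof (induction u)
  case Nil
  then show ?case by (simp add: inverse_word_def pres_refl)
next
  case (Cons x u)
  obtain a e where x: "x = (a, e)" by (cases x)
  have "pres_eq R [(a, \<not> e), (a, e)] []" using pres_cancel[of R a "\<not> e"] by simp
  then have "pres_eq R (inverse_word u @ [(a, \<not> e), (a, e)] @ u) (inverse_word u @ [] @ u)"
    by (intro pres_append pres_refl)
  then show ?case using Cons by (auto simp: inverse_word_def x intro: pres_trans)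
qed

lemma group_presented_group: "group (presented_group R)"
proof (rule groupI)
  fix x assume "x \<in> carrier (presented_group R)"
  then obtain u where "x = word_class R u" by (auto simp: carrier_presented_group)
  then show "\<exists>y\<in>carrier (presented_group R). y \<otimes>\<^bsub>presented_group R\<^esub> x = \<one>\<^bsub>presented_group R\<^esub>"
    by (intro bexI[of _ "word_class R (inverse_word u)"])
       (auto simp: mult_presented_group one_presented_group carrier_presented_group word_class_eq_iff pres_eq_inverse_word)
qed (auto simp: carrier_presented_group mult_presented_group one_presented_group)

lemma pow_presented_group: "word_class R u [^]\<^bsub>presented_group R\<^esub> (i::nat) = word_class R (concat (replicate i u))"
proof (induction i)
  case 0
  then show ?case by (simp add: one_presented_group)
next
  case (Suc i)
  have "concat (replicate i u) @ u = u @ concat (replicate i u)" by (induction i) auto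
  then show ?case using Suc by (simp add: mult_presented_group)
qed

text \<open>The pair (i, j) stands for \<open>A^i B^j\<close>, and a letter acts by multiplication
  from the left. The inverse letters act as the powers m - 1 and n - 1, which keeps exponents
  natural; \<open>r ^ (n - 1)\<close> inverts r modulo m.\<close>

fun gamma_act :: "nat \<Rightarrow> nat \<Rightarrow> nat \<Rightarrow> metacyclic_gen \<times> bool \<Rightarrow> nat \<times> nat \<Rightarrow> nat \<times> nat" where
  "gamma_act m n r (gen_A, True) (i, j) = ((i + 1) mod m, j)"
| "gamma_act m n r (gen_A, False) (i, j) = ((i + (m - 1)) mod m, j)"
| "gamma_act m n r (gen_B, True) (i, j) = ((r * i) mod m, (j + 1) mod n)"
| "gamma_act m n r (gen_B, False) (i, j) = ((r ^ (n - 1) * i) mod m, (j + (n - 1)) mod n)"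

abbreviation gamma_rels :: "nat \<Rightarrow> nat \<Rightarrow> nat \<Rightarrow> (metacyclic_gen word \<times> metacyclic_gen word) set" where
  "gamma_rels m n r \<equiv> {(replicate m (gen_A, True), []), (replicate n (gen_B, True), []),
     ([(gen_B, True), (gen_A, True), (gen_B, False)], replicate r (gen_A, True))}"

lemma foldr_gamma_act_replicate:
  assumes "i < m" "j < n"
  shows "foldr (gamma_act m n r) (replicate k (gen_A, True)) (i, j) = ((i + k) mod m, j)"
    and "foldr (gamma_act m n r) (replicate k (gen_B, True)) (i, j) = ((r ^ k * i) mod m, (j + k) mod n)"
  using assms by (induction k) (auto simp: mod_Suc_eq mod_mult_right_eq mult_ac)

text \<open>The left regular action on normal forms \<open>A\<^sup>iB\<^sup>j\<close> shows that these are pairwise distinct.\<close>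

lemma gamma_act_respects_pres_eq:
  assumes m: "m > 0" and n: "n > 0" and rn: "[r ^ n = 1] (mod m)"
    and "pres_eq (gamma_rels m n r) u v" "p \<in> {..<m} \<times> {..<n}"
  shows "foldr (gamma_act m n r) u p = foldr (gamma_act m n r) v p"
proof -
  let ?D = "{..<m} \<times> {..<n}"
  have rnm: "(r ^ n * i) mod m = i mod m" for i
    using cong_mult[OF rn cong_refl[of i m]] by (simp add: cong_def)
  have r1: "r * r ^ (n - 1) = r ^ n" using n by (simp add: power_eq_if)
  have closed1: "gamma_act m n r x p \<in> ?D" if "p \<in> ?D" for x p
  proof (cases p)
    case (Pair i j)
    obtain g e where x: "x = (g, e)" by (cases x)
    show ?thesis using that m n by (cases g; cases e) (auto simp: Pair x)
  qed
  have closed: "foldr (gamma_act m n r) u p \<in> ?D" if "p \<in> ?D" for u p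
    using that by (induction u) (simp_all add: closed1)
  have "\<forall>p\<in>?D. foldr (gamma_act m n r) u p = foldr (gamma_act m n r) v p"
    using assms(4)
  proof induction
    case (pres_rel u v)
    show ?case
    proof
      fix p assume "p \<in> ?D"
      then obtain i j where p: "p = (i, j)" "i < m" "j < n" by auto
      have "foldr (gamma_act m n r) [(gen_B, True), (gen_A, True), (gen_B, False)] p = ((i + r) mod m, j)"
      proof -
        have "r * (r ^ (n - 1) * i) = r ^ n * i" by (metis mult.assoc r1)
        then have "(r + r * (r ^ (n - 1) * i)) mod m = (r + i) mod m" by (metis mod_add_right_eq rnm)
        then show ?thesis using p n by (simp add: mod_mult_right_eq mod_Suc_eq add.commute)
      qed
      then show "foldr (gamma_act m n r) u p = foldr (gamma_act m n r) v p"
        using pres_rel p foldr_gamma_act_replicate[OF p(2,3), of r] by (auto simp: rnm simp del: foldr_Cons)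
    qed
  next
    case (pres_cancel g e)
    show ?case
    proof
      fix p assume "p \<in> ?D"
      then obtain i j where p: "p = (i, j)" "i < m" "j < n" by auto
      have 1: "(r * ((r ^ (n - 1) * i) mod m)) mod m = i" "(r ^ (n - 1) * ((r * i) mod m)) mod m = i"
        using rnm[of i] p by (simp_all only: mod_mult_right_eq mult.assoc[symmetric] mult.commute[of "r ^ (n - 1)" r] r1 mod_less)
      have 2: "((i + (m - 1)) mod m + 1) mod m = i" "((i + 1) mod m + (m - 1)) mod m = i"
        "((j + (n - 1)) mod n + 1) mod n = j" "((j + 1) mod n + (n - 1)) mod n = j"
      proof -
        have *: "((x + a) mod k + b) mod k = x" if "a + b = k" "x < k" for x a b k :: nat
          using that by (metis add.assoc mod_add_left_eq mod_add_self2 mod_less)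
        show "((i + (m - 1)) mod m + 1) mod m = i" "((i + 1) mod m + (m - 1)) mod m = i"
          "((j + (n - 1)) mod n + 1) mod n = j" "((j + 1) mod n + (n - 1)) mod n = j"
          by (rule *; use p m n in simp)+
      qed
      show "foldr (gamma_act m n r) [(g, e), (g, \<not> e)] p = foldr (gamma_act m n r) [] p"
        by (cases g; cases e)
          (simp_all only: p(1) 1 2 foldr.simps comp_apply id_apply gamma_act.simps not_True_eq_False not_False_eq_True)
    qed
  next
    case (pres_append u u' v v')
    show ?case
    proof
      fix p assume p: "p \<in> ?D"
      show "foldr (gamma_act m n r) (u @ v) p = foldr (gamma_act m n r) (u' @ v') p"
        using bspec[OF pres_append.IH(1) closed[OF p, of v']] bspec[OF pres_append.IH(2) p]
        by (simp only: foldr_append comp_apply)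
    qed
  qed auto
  then show ?thesis using assms(5) by blast
qed

text \<open>The relations bring every word into normal form, and the action on (0, 0) recovers the
  exponents; so the order is exactly m n.\<close>

theorem metacyclic_Gamma_group:
  assumes "Gamma_params d m n r"
  shows "\<exists>a b. metacyclic (Gamma_group m n r) a b m n r"
proof -
  have m: "m > 0" and n: "n > 0" and rn: "[r ^ n = 1] (mod m)" using assms by (auto simp: Gamma_params_def)
  let ?R = "gamma_rels m n r"
  define K where "K = presented_group ?R"
  interpret K: group K unfolding K_def by (rule group_presented_group)
  let ?c = "word_class ?R"
  define \<alpha> where "\<alpha> = ?c [(gen_A, True)]"
  define \<beta> where "\<beta> = ?c [(gen_B, True)]"
  have mult: "?c u \<otimes>\<^bsub>K\<^esub> ?c v = ?c (u @ v)" for u v unfolding K_def by (rule mult_presented_group)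
  have one: "\<one>\<^bsub>K\<^esub> = ?c []" unfolding K_def by (rule one_presented_group)
  have car: "carrier K = range ?c" unfolding K_def by (rule carrier_presented_group)
  have cr: "concat (replicate k [x]) = replicate k x" for k and x :: "metacyclic_gen \<times> bool" by (induction k) auto
  have powA: "\<alpha> [^]\<^bsub>K\<^esub> k = ?c (replicate k (gen_A, True))" and powB: "\<beta> [^]\<^bsub>K\<^esub> k = ?c (replicate k (gen_B, True))" for k :: nat
    unfolding K_def \<alpha>_def \<beta>_def pow_presented_group cr by rule+
  have ab: "\<alpha> \<in> carrier K" "\<beta> \<in> carrier K" by (auto simp: car \<alpha>_def \<beta>_def)
  have am: "\<alpha> [^]\<^bsub>K\<^esub> m = \<one>\<^bsub>K\<^esub>" and bn: "\<beta> [^]\<^bsub>K\<^esub> n = \<one>\<^bsub>K\<^esub>"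
    unfolding powA powB one word_class_eq_iff by (auto intro: pres_rel)
  have binv: "?c [(gen_B, False)] \<otimes>\<^bsub>K\<^esub> \<beta> = \<one>\<^bsub>K\<^esub>" "?c [(gen_A, False)] \<otimes>\<^bsub>K\<^esub> \<alpha> = \<one>\<^bsub>K\<^esub>"
    unfolding \<alpha>_def \<beta>_def mult one word_class_eq_iff using pres_cancel[of ?R _ False] by auto
  have "\<beta> \<otimes>\<^bsub>K\<^esub> \<alpha> \<otimes>\<^bsub>K\<^esub> ?c [(gen_B, False)] = \<alpha> [^]\<^bsub>K\<^esub> r"
    unfolding powA unfolding \<alpha>_def \<beta>_def mult word_class_eq_iff by (auto intro: pres_rel)
  then have "\<beta> \<otimes>\<^bsub>K\<^esub> \<alpha> \<otimes>\<^bsub>K\<^esub> (?c [(gen_B, False)] \<otimes>\<^bsub>K\<^esub> \<beta>) = \<alpha> [^]\<^bsub>K\<^esub> r \<otimes>\<^bsub>K\<^esub> \<beta>"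
    using ab by (metis K.m_assoc K.m_closed car rangeI)
  then have ba: "\<beta> \<otimes>\<^bsub>K\<^esub> \<alpha> = \<alpha> [^]\<^bsub>K\<^esub> r \<otimes>\<^bsub>K\<^esub> \<beta>" using ab by (simp add: binv)
  have Ainv: "?c [(gen_A, False)] = \<alpha> [^]\<^bsub>K\<^esub> (m - 1)"
  proof -
    have "\<alpha> [^]\<^bsub>K\<^esub> (m - 1) \<otimes>\<^bsub>K\<^esub> \<alpha> = \<one>\<^bsub>K\<^esub>" using am m by (metis K.nat_pow_Suc Suc_diff_1)
    then show ?thesis using binv(2) ab by (metis K.inv_equality K.nat_pow_closed car rangeI)
  qed
  have Binv: "?c [(gen_B, False)] = \<beta> [^]\<^bsub>K\<^esub> (n - 1)"
  proof -
    have "\<beta> [^]\<^bsub>K\<^esub> (n - 1) \<otimes>\<^bsub>K\<^esub> \<beta> = \<one>\<^bsub>K\<^esub>" using bn n by (metis K.nat_pow_Suc Suc_diff_1)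
    then show ?thesis using binv(1) ab by (metis K.inv_equality K.nat_pow_closed car rangeI)
  qed
  have gen: "\<exists>i j. ?c [x] = \<alpha> [^]\<^bsub>K\<^esub> (i::nat) \<otimes>\<^bsub>K\<^esub> \<beta> [^]\<^bsub>K\<^esub> (j::nat)" for x
  proof -
    obtain g e where x: "x = (g, e)" by (cases x)
    have "?c [(gen_A, True)] = \<alpha> [^]\<^bsub>K\<^esub> (1::nat) \<otimes>\<^bsub>K\<^esub> \<beta> [^]\<^bsub>K\<^esub> (0::nat)"
      "?c [(gen_B, True)] = \<alpha> [^]\<^bsub>K\<^esub> (0::nat) \<otimes>\<^bsub>K\<^esub> \<beta> [^]\<^bsub>K\<^esub> (1::nat)"
      "?c [(gen_A, False)] = \<alpha> [^]\<^bsub>K\<^esub> (m - 1) \<otimes>\<^bsub>K\<^esub> \<beta> [^]\<^bsub>K\<^esub> (0::nat)"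
      "?c [(gen_B, False)] = \<alpha> [^]\<^bsub>K\<^esub> (0::nat) \<otimes>\<^bsub>K\<^esub> \<beta> [^]\<^bsub>K\<^esub> (n - 1)"
      using ab by (simp_all add: Ainv Binv \<alpha>_def[symmetric] \<beta>_def[symmetric] del: One_nat_def)
    then show ?thesis unfolding x by (cases g; cases e) metis+
  qed
  have nf: "\<exists>i j. ?c u = \<alpha> [^]\<^bsub>K\<^esub> (i::nat) \<otimes>\<^bsub>K\<^esub> \<beta> [^]\<^bsub>K\<^esub> (j::nat)" for u
  proof (induction u)
    case Nil
    show ?case by (intro exI[of _ 0]) (simp add: one[symmetric])
  next
    case (Cons x u)
    obtain i j i' j' where ij: "?c [x] = \<alpha> [^]\<^bsub>K\<^esub> (i::nat) \<otimes>\<^bsub>K\<^esub> \<beta> [^]\<^bsub>K\<^esub> (j::nat)"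
      "?c u = \<alpha> [^]\<^bsub>K\<^esub> (i'::nat) \<otimes>\<^bsub>K\<^esub> \<beta> [^]\<^bsub>K\<^esub> (j'::nat)" using gen Cons by metis
    have "?c (x # u) = ?c [x] \<otimes>\<^bsub>K\<^esub> ?c u" by (simp add: mult)
    then show ?case unfolding ij K.mult_normal_form[OF ab ba] by blast
  qed
  let ?f = "\<lambda>(i, j). \<alpha> [^]\<^bsub>K\<^esub> (i::nat) \<otimes>\<^bsub>K\<^esub> \<beta> [^]\<^bsub>K\<^esub> (j::nat)"
  have surj: "?f ` ({..<m} \<times> {..<n}) = carrier K"
  proof (intro equalityI subsetI)
    fix x assume "x \<in> carrier K"
    then obtain u where u: "x = ?c u" unfolding car by (rule imageE)
    obtain i j where "?c u = \<alpha> [^]\<^bsub>K\<^esub> (i::nat) \<otimes>\<^bsub>K\<^esub> \<beta> [^]\<^bsub>K\<^esub> (j::nat)" using nf[of u] by (elim exE)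
    then have x: "x = \<alpha> [^]\<^bsub>K\<^esub> i \<otimes>\<^bsub>K\<^esub> \<beta> [^]\<^bsub>K\<^esub> j" using u by (simp only:)
    have "x = ?f (i mod m, j mod n)"
      using x K.nat_pow_mod[OF ab(1) am m, of i] K.nat_pow_mod[OF ab(2) bn n, of j] by simp
    then show "x \<in> ?f ` ({..<m} \<times> {..<n})" using m n by (intro image_eqI) auto
  qed (use ab in auto)
  have "inj_on ?f ({..<m} \<times> {..<n})"
  proof (rule inj_onI)
    fix p q assume p: "p \<in> {..<m} \<times> {..<n}" and q: "q \<in> {..<m} \<times> {..<n}" and eq: "?f p = ?f q"
    have f: "?f p = ?c (replicate (fst p) (gen_A, True) @ replicate (snd p) (gen_B, True))" for p
      by (cases p) (simp add: powA powB mult)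
    have "foldr (gamma_act m n r) (replicate (fst p) (gen_A, True) @ replicate (snd p) (gen_B, True)) (0, 0) =
        (fst p mod m, snd p mod n)" if "p \<in> {..<m} \<times> {..<n}" for p
      using foldr_gamma_act_replicate(2)[of 0 m 0 n r "snd p"] foldr_gamma_act_replicate(1)[of 0 m "snd p mod n" n r "fst p"] m n by simp
    moreover have "foldr (gamma_act m n r) (replicate (fst p) (gen_A, True) @ replicate (snd p) (gen_B, True)) (0, 0) =
      foldr (gamma_act m n r) (replicate (fst q) (gen_A, True) @ replicate (snd q) (gen_B, True)) (0, 0)"
      by (rule gamma_act_respects_pres_eq[OF m n rn]) (use eq m n in \<open>simp_all add: f word_class_eq_iff\<close>)
    ultimately have "(fst p mod m, snd p mod n) = (fst q mod m, snd q mod n)" using p q by metis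
    then show "p = q" using p q by (cases p; cases q) auto
  qed
  then have "card (carrier K) = m * n" unfolding surj[symmetric] by (simp add: card_image)
  then have "metacyclic K \<alpha> \<beta> m n r"
    unfolding metacyclic_def using surj ab am bn ba m n K.is_group by simp
  then show ?thesis unfolding K_def Gamma_group_def by blast
qed


section \<open>Metacyclic groups with prescribed element orders\<close>

context group begin

lemma ord_mult_coprime:
  assumes xy: "x \<in> carrier G" "y \<in> carrier G" "x \<otimes> y = y \<otimes> x" and cop: "coprime (ord x) (ord y)"
  shows "ord (x \<otimes> y) = ord x * ord y"
proof (rule dvd_antisym)
  show "ord (x \<otimes> y) dvd ord x * ord y" by (rule ord_mul_divides[OF xy(3,1,2)])
  have pw: "x [^] (t::nat) \<otimes> y [^] t = \<one>" if "ord (x \<otimes> y) dvd t" for t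
    using that pow_mult_distrib[OF xy(3,1,2)] pow_eq_id[of "x \<otimes> y" t] xy by simp
  have "x [^] (ord (x \<otimes> y) * ord y) = \<one>"
    using pw[of "ord (x \<otimes> y) * ord y"] pow_eq_id[OF xy(2), of "ord (x \<otimes> y) * ord y"] xy by simp
  then have 1: "ord x dvd ord (x \<otimes> y)"
    using pow_eq_id[OF xy(1)] cop by (simp add: coprime_dvd_mult_left_iff)
  have "y [^] (ord (x \<otimes> y) * ord x) = \<one>"
    using pw[of "ord (x \<otimes> y) * ord x"] pow_eq_id[OF xy(1), of "ord (x \<otimes> y) * ord x"] xy by simp
  then have 2: "ord y dvd ord (x \<otimes> y)"
    using pow_eq_id[OF xy(2)] cop by (simp add: coprime_dvd_mult_left_iff coprime_commute)
  show "ord x * ord y dvd ord (x \<otimes> y)" using 1 2 cop by (rule divides_mult)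
qed

lemma pow_eq_iff_cong_ord:
  assumes x: "x \<in> carrier G" and o: "ord x > 0"
  shows "x [^] (i::nat) = x [^] (j::nat) \<longleftrightarrow> [i = j] (mod ord x)"
proof -
  have main: "x [^] i = x [^] j \<longleftrightarrow> [i = j] (mod ord x)" if "i \<le> j" for i j :: nat
  proof -
    have "x [^] j = x [^] i \<otimes> x [^] (j - i)" using x that by (simp add: nat_pow_mult)
    then have "x [^] i = x [^] j \<longleftrightarrow> x [^] (j - i) = \<one>" using x r_cancel_one'[of "x [^] i" "x [^] (j - i)"] by simp
    also have "\<dots> \<longleftrightarrow> [j = i] (mod ord x)" using pow_eq_id[OF x, of "j - i"] cong_altdef_nat[OF that] by simp
    finally show ?thesis by (simp only: cong_sym_eq)
  qed
  show ?thesis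
  proof (cases "i \<le> j")
    case False
    then have "x [^] j = x [^] i \<longleftrightarrow> [j = i] (mod ord x)" using main[of j i] by simp
    then show ?thesis by (simp only: cong_sym_eq[of j] eq_commute[of "x [^] j"])
  qed (rule main)
qed

lemma pow_intertwine:
  assumes "x \<in> carrier G" "y \<in> carrier G" "z \<in> carrier G" "x \<otimes> z = y \<otimes> x"
  shows "x \<otimes> z [^] (u::nat) = y [^] u \<otimes> x"
proof (induction u)
  case (Suc u)
  have "x \<otimes> z [^] Suc u = (x \<otimes> z [^] u) \<otimes> z" using assms by (simp add: m_assoc)
  also have "\<dots> = y [^] u \<otimes> (x \<otimes> z)" using Suc assms by (simp add: m_assoc)
  also have "\<dots> = y [^] Suc u \<otimes> x" using assms by (simp add: m_assoc)
  finally show ?case .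
qed (use assms in simp)

end

lemma metacyclic_ord:
  fixes H (structure)
  assumes H: "metacyclic H a b m n r"
  shows "group.ord H a = m" "group.ord H b = n"
    and "a [^] (i::nat) \<otimes> b [^] (j::nat) = \<one> \<Longrightarrow> m dvd i \<and> n dvd j"
proof -
  interpret H: group H using H by (simp add: metacyclic_def)
  note d = H[unfolded metacyclic_def]
  have nf: "m dvd i \<and> n dvd j" if "a [^] (i::nat) \<otimes> b [^] (j::nat) = \<one>" for i j
  proof -
    have "a [^] (i mod m) \<otimes> b [^] (j mod n) = a [^] (0::nat) \<otimes> b [^] (0::nat)"
      using that d H.nat_pow_mod[of a m i] H.nat_pow_mod[of b n j] by simp
    from inj_onD[OF metacyclic_inj[OF H], of "(i mod m, j mod n)" "(0, 0)"] this d
    have "i mod m = 0 \<and> j mod n = 0" by simp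
    then show ?thesis by auto
  qed
  then show "a [^] i \<otimes> b [^] j = \<one> \<Longrightarrow> m dvd i \<and> n dvd j" .
  have "H.ord a dvd m" using d H.pow_eq_id[of a m] by simp
  moreover have "m dvd H.ord a" using nf[of "H.ord a" 0] d H.pow_ord_eq_1[of a] by simp
  ultimately show "H.ord a = m" by (rule dvd_antisym)
  have "H.ord b dvd n" using d H.pow_eq_id[of b n] by simp
  moreover have "n dvd H.ord b" using nf[of 0 "H.ord b"] d H.pow_ord_eq_1[of b] by simp
  ultimately show "H.ord b = n" by (rule dvd_antisym)
qed

lemma metacyclic_commute_iff:
  fixes H (structure)
  assumes H: "metacyclic H a b m n r"
  shows "b [^] (j::nat) \<otimes> a = a \<otimes> b [^] j \<longleftrightarrow> ord m r dvd j"
proof -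
  interpret H: group H using H by (simp add: metacyclic_def)
  note d = H[unfolded metacyclic_def]
  have "b [^] j \<otimes> a = a [^] (r ^ j) \<otimes> b [^] j"
    using H.conj_pow[of a b r j 1] d by simp
  then have "b [^] j \<otimes> a = a \<otimes> b [^] j \<longleftrightarrow> a [^] (r ^ j) = a [^] (1::nat)" using d by simp
  also have "\<dots> \<longleftrightarrow> [r ^ j = 1] (mod m)"
    using H.pow_eq_iff_cong_ord[of a "r ^ j" 1] metacyclic_ord(1)[OF H] d by simp
  finally show ?thesis by (simp only: ord_divides)
qed

text \<open>The witness is a b^e with e the order of r modulo m: b^e commutes with a, and the orders
  m and n / e are coprime.\<close>

lemma metacyclic_max_order:
  fixes H (structure)
  assumes H: "metacyclic H a b m n r" and cop: "coprime m n" and rn: "[r ^ n = 1] (mod m)"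
  shows "\<exists>x\<in>carrier H. group.ord H x = m * (n div ord m r)"
proof -
  interpret H: group H using H by (simp add: metacyclic_def)
  note d = H[unfolded metacyclic_def]
  define e where "e = ord m r"
  have en: "e dvd n" using rn ord_divides[of r n m] by (simp only: e_def)
  have e0: "e > 0" using en d by (metis dvd_0_left gr_zeroI)
  have ob: "b [^] e \<in> carrier H" using d by simp
  have "H.ord (b [^] e) = n div e"
  proof (rule dvd_antisym)
    show "H.ord (b [^] e) dvd n div e"
      using H.pow_eq_id[OF ob, of "n div e"] d en by (simp add: H.nat_pow_pow)
    have "b [^] (e * H.ord (b [^] e)) = \<one>"
      using H.pow_ord_eq_1[OF ob] d by (metis H.nat_pow_pow)
    then have "n dvd e * H.ord (b [^] e)" using H.pow_eq_id[of b "e * H.ord (b [^] e)"] metacyclic_ord(2)[OF H] d by simp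
    then show "n div e dvd H.ord (b [^] e)" using en e0 by (metis div_dvd_iff_mult mult.commute not_gr_zero)
  qed
  moreover have "a \<otimes> b [^] e = b [^] e \<otimes> a"
    using metacyclic_commute_iff[OF H, of e] unfolding e_def by (metis dvd_refl)
  moreover have "coprime m (n div e)" using cop en by (metis coprime_mult_right_iff dvd_mult_div_cancel)
  ultimately have "H.ord (a \<otimes> b [^] e) = m * (n div e)"
    using H.ord_mult_coprime[of a "b [^] e"] metacyclic_ord(1)[OF H] d ob by simp
  then show ?thesis using d ob by (intro bexI[of _ "a \<otimes> b [^] e"]) (simp_all add: e_def)
qed

text \<open>A power of x generates the subgroup of a, so x commutes with a. Writing x = a^i b^j, the
  order of r divides j, and then x is annihilated by p^k times n divided by that order.\<close>

lemma metacyclic_order_bound: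
  fixes H (structure)
  assumes H: "metacyclic H a b (p ^ k) n r" and p: "prime p" and k: "k \<ge> 1" and cop: "coprime (p ^ k) n"
    and rn: "[r ^ n = 1] (mod (p ^ k))" and x: "x \<in> carrier H" "group.ord H x = p ^ k * e"
  shows "e dvd n div ord (p ^ k) r"
proof -
  interpret H: group H using H by (simp add: metacyclic_def)
  let ?m = "p ^ k"
  note d = H[unfolded metacyclic_def]
  have ab: "a \<in> carrier H" "b \<in> carrier H" "b \<otimes> a = a [^] r \<otimes> b" using d by auto
  have en: "ord ?m r dvd n" using rn ord_divides[of r n] by simp
  have pow_nf: "\<exists>c. (a [^] (i::nat) \<otimes> b [^] (j::nat)) [^] t = a [^] (c::nat) \<otimes> b [^] (j * t)" for i j t :: nat
  proof (induction t)
    case 0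
    show ?case by (intro exI[of _ 0]) simp
  next
    case (Suc t)
    then obtain c where "(a [^] i \<otimes> b [^] j) [^] t = a [^] (c::nat) \<otimes> b [^] (j * t)" by blast
    then have "(a [^] i \<otimes> b [^] j) [^] Suc t = a [^] (c + r ^ (j * t) * i) \<otimes> b [^] (j * t + j)"
      using H.mult_normal_form[OF ab, of c "j * t" i j] by simp
    then show ?case by (auto simp: add.commute)
  qed
  \<comment> \<open>If p^k annihilates y, then n divides j p^k, hence j, because n is prime to p; so
    y has no component in b.\<close>
  have in_a: "\<exists>s. y = a [^] (s::nat)" if y: "y \<in> carrier H" "y [^] ?m = \<one>" for y
  proof -
    obtain i j where ij: "y = a [^] (i::nat) \<otimes> b [^] (j::nat)" using metacyclic_elem[OF H y(1)] by metis
    obtain c where "y [^] ?m = a [^] (c::nat) \<otimes> b [^] (j * ?m)" using pow_nf[of i j ?m] ij by blast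
    then have "n dvd j * ?m" using metacyclic_ord(3)[OF H, of c "j * ?m"] y(2) by simp
    then have "n dvd j" using cop by (simp add: coprime_dvd_mult_left_iff coprime_commute)
    then have "b [^] j = \<one>" using H.pow_eq_id[OF ab(2)] metacyclic_ord(2)[OF H] by simp
    then show ?thesis using ij ab by auto
  qed
  have fin: "finite (carrier H)" using d p by (metis card.infinite mult_is_0 not_less_zero)
  have "H.ord x > 0" using H.ord_ge_1[OF fin x(1)] by simp
  then have e0: "e > 0" using x(2) by (metis mult_0_right neq0_conv)
  have xe: "x [^] e \<in> carrier H" using x by simp
  have oxe: "(x [^] e) [^] t = \<one> \<longleftrightarrow> ?m dvd t" for t :: nat
    using H.pow_eq_id[OF x(1), of "e * t"] x e0 by (simp add: H.nat_pow_pow mult.commute[of e])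
  obtain s where s: "x [^] e = a [^] (s::nat)" using in_a[OF xe] oxe[of ?m] by auto
  \<comment> \<open>Otherwise x^e would have order less than p^k. Hence s is invertible modulo p^k,
    and a itself is a power of x.\<close>
  have "\<not> p dvd s"
  proof
    assume "p dvd s"
    moreover have pk: "?m = p * p ^ (k - 1)" using k by (metis One_nat_def Suc_le_eq power_eq_if not_gr_zero)
    ultimately have "?m dvd s * p ^ (k - 1)" by simp
    then have "(a [^] s) [^] (p ^ (k - 1)) = \<one>"
      using H.pow_eq_id[OF ab(1)] metacyclic_ord(1)[OF H] ab by (simp add: H.nat_pow_pow)
    then have "?m dvd p ^ (k - 1)" using oxe s by simp
    then show False using pk prime_gt_1_nat[OF p] by (auto dest: dvd_imp_le)
  qed
  then have "coprime p s" by (rule prime_imp_coprime[OF p])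
  then have "coprime s ?m" by (simp only: coprime_commute[of s] coprime_power_left_iff simp_thms)
  from cong_solve_coprime_nat[OF this] obtain u where u: "[s * u = 1] (mod ?m)" by auto
  have "a [^] (s * u) = a [^] (1::nat)"
    using H.pow_eq_iff_cong_ord[OF ab(1), of "s * u" 1] metacyclic_ord(1)[OF H] u d by simp
  then have "a = (x [^] e) [^] u" using s ab by (simp add: H.nat_pow_pow)
  then have a_pow: "a = x [^] (e * u)" using x by (simp add: H.nat_pow_pow)
  obtain i j where ij: "x = a [^] (i::nat) \<otimes> b [^] (j::nat)" using metacyclic_elem[OF H x(1)] by metis
  have "x \<otimes> x [^] (e * u) = x [^] (e * u) \<otimes> x" using x by (metis H.nat_pow_Suc H.nat_pow_Suc2)
  then have "x \<otimes> a = a \<otimes> x" using a_pow by simp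
  then have "a [^] i \<otimes> (b [^] j \<otimes> a) = a [^] i \<otimes> (a \<otimes> b [^] j)"
    unfolding ij using ab by (metis H.m_assoc H.nat_pow_Suc H.nat_pow_Suc2 H.nat_pow_closed)
  then have com: "b [^] j \<otimes> a = a \<otimes> b [^] j" using ab by simp
  then have dj: "ord ?m r dvd j" using metacyclic_commute_iff[OF H] by blast
  have "a [^] i \<otimes> b [^] j = b [^] j \<otimes> a [^] i"
    using H.pow_intertwine[of "b [^] j" a a i] com ab by simp
  then have "x [^] (?m * (n div ord ?m r)) = a [^] (i * (?m * (n div ord ?m r))) \<otimes> b [^] (j * (?m * (n div ord ?m r)))"
    unfolding ij using H.pow_mult_distrib[of "a [^] i" "b [^] j"] ab by (simp add: H.nat_pow_pow)
  also have "a [^] (i * (?m * (n div ord ?m r))) = \<one>"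
    using H.pow_eq_id[OF ab(1)] metacyclic_ord(1)[OF H] by simp
  also have "b [^] (j * (?m * (n div ord ?m r))) = \<one>"
  proof -
    have "ord ?m r * (n div ord ?m r) dvd j * (n div ord ?m r)" using dj by (rule mult_dvd_mono) simp
    then have "n dvd j * (?m * (n div ord ?m r))" using en by (metis dvd_mult dvd_mult_div_cancel mult.left_commute)
    then show ?thesis using H.pow_eq_id[OF ab(2)] metacyclic_ord(2)[OF H] by simp
  qed
  finally have "H.ord x dvd ?m * (n div ord ?m r)" using H.pow_eq_id[OF x(1)] by simp
  then show ?thesis using x(2) p by (simp add: prime_gt_0_nat)
qed

text \<open>\<open>m - j\<close> stands for the exponent -j modulo m.\<close>

lemma dvd_complement_imp_eq:
  fixes i j m :: nat
  assumes "i < m" "j < m" "m dvd m - j + i"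
  shows "i = j"
proof (cases "i < j")
  case True
  then have "m - j + i < m" "0 < m - j + i" using assms by auto
  then show ?thesis using assms(3) by (auto dest: dvd_imp_le)
next
  case False
  then have "m - j + i = m + (i - j)" using assms by simp
  then have "m dvd i - j" using assms(3) by simp
  then show ?thesis using False assms(1) by (auto dest: dvd_imp_le)
qed

text \<open>Let \<open>a = c\<^sup>q\<close>. Since \<open>d < p\<close>, the pigeonhole principle yields an exponent \<open>s\<close> prime to \<open>p\<close> such
  that \<open>b\<close> conjugates \<open>a\<^sup>s\<close> into the subgroup generated by \<open>c\<close>; hence \<open>b\<close> normalises the subgroup
  generated by \<open>a\<close>.\<close>

lemma metacyclic_from_element_orders:
  fixes H (structure)
  assumes H: "group H" and card: "card (carrier H) = p ^ k * n" and p: "prime p" and k: "k \<ge> 1"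
    and cop: "coprime (p ^ k) n" and n: "n > 0" and dq: "n = d * q" "d < p"
    and c: "c \<in> carrier H" "group.ord H c = p ^ k * q" and b: "b \<in> carrier H" "group.ord H b = n"
  shows "\<exists>a r. metacyclic H a b (p ^ k) n r \<and> [r ^ n = 1] (mod (p ^ k))"
proof -
  interpret H: group H by (rule H)
  let ?m = "p ^ k"
  have m0: "?m > 0" using p by (simp add: prime_gt_0_nat)
  have q0: "q > 0" using n dq by (metis mult_0_right neq0_conv)
  have fin: "finite (carrier H)" using card m0 n by (metis card.infinite mult_is_0 less_irrefl)
  define a where "a = c [^] q"
  have a: "a \<in> carrier H" using c by (simp add: a_def)
  have oc: "c [^] t = \<one> \<longleftrightarrow> ?m * q dvd t" for t :: nat using H.pow_eq_id[OF c(1)] c(2) by simp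
  have a_pow: "a [^] t = c [^] (q * t)" for t :: nat using c by (simp add: a_def H.nat_pow_pow)
  have oa: "a [^] t = \<one> \<longleftrightarrow> ?m dvd t" for t :: nat unfolding a_pow oc using q0 by (simp add: mult.commute[of q])
  have orda: "H.ord a = ?m" using oa H.pow_eq_id[OF a] by (metis dvd_antisym dvd_refl)
  have ob: "b [^] t = \<one> \<longleftrightarrow> n dvd t" for t :: nat using H.pow_eq_id[OF b(1)] b(2) by simp
  define F where "F = (\<lambda>(i::nat, t::nat). c [^] t \<otimes> b \<otimes> a [^] i)"
  \<comment> \<open>This set has (d + 1) p^k q elements, the group only d p^k q. In a collision the
    exponents of a differ by some s with 0 < s <= d < p.\<close>
  let ?D = "{..d} \<times> {..<?m * q}"
  have "F ` ?D \<subseteq> carrier H" using a b c by (auto simp: F_def)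
  then have "card (F ` ?D) \<le> ?m * n" using card_mono[OF fin] card by metis
  also have "\<dots> < card ?D" using dq m0 q0 by simp
  finally have "\<not> inj_on F ?D" by (rule pigeonhole)
  then obtain v w where vw: "v \<in> ?D" "w \<in> ?D" "F v = F w" "v \<noteq> w" by (auto simp: inj_on_def)
  have "fst v \<noteq> fst w"
  proof
    assume "fst v = fst w"
    then have "c [^] snd v = c [^] snd w" using vw(3) a b c by (simp add: F_def case_prod_beta H.m_assoc)
    then have "[snd v = snd w] (mod (?m * q))" using H.pow_eq_iff_cong_ord[OF c(1)] c(2) m0 q0 by simp
    then have "snd v = snd w" using vw(1,2) by (auto simp: cong_def)
    then show False using \<open>fst v = fst w\<close> vw(4) by (simp add: prod_eq_iff)
  qed
  then obtain i t i' t' where it: "(i, t) \<in> ?D" "(i', t') \<in> ?D" "F (i, t) = F (i', t')" "i < i'"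
    using vw by (cases v; cases w) (metis fst_conv linorder_neqE_nat)
  define s where "s = i' - i"
  have s: "0 < s" "s < p" using it dq(2) by (auto simp: s_def)
  have "c [^] t \<otimes> b \<otimes> a [^] i = (c [^] t' \<otimes> (b \<otimes> a [^] s)) \<otimes> a [^] i"
    using it a b c by (simp add: F_def s_def H.m_assoc H.nat_pow_mult)
  then have eq: "c [^] t \<otimes> b = c [^] t' \<otimes> (b \<otimes> a [^] s)" using a b c by simp
  \<comment> \<open>The exponent t - t', made natural by adding the order of c.\<close>
  define w' where "w' = (?m * q - t') + t"
  have "c [^] w' \<otimes> b = c [^] (?m * q - t') \<otimes> (c [^] t \<otimes> b)"
    using b c by (simp add: w'_def H.nat_pow_mult[symmetric] H.m_assoc)
  also have "\<dots> = (c [^] (?m * q - t') \<otimes> c [^] t') \<otimes> (b \<otimes> a [^] s)"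
    unfolding eq using a b c by (simp add: H.m_assoc)
  also have "c [^] (?m * q - t') \<otimes> c [^] t' = \<one>"
    using it(2) c oc[of "?m * q"] by (simp add: H.nat_pow_mult)
  finally have bs: "b \<otimes> a [^] s = c [^] w' \<otimes> b" using a b by simp
  have "\<not> p dvd s" using s by (auto dest: dvd_imp_le)
  then have "coprime p s" by (rule prime_imp_coprime[OF p])
  then have "coprime s ?m" by (simp only: coprime_commute[of s] coprime_power_left_iff simp_thms)
  from cong_solve_coprime_nat[OF this] obtain u where u: "[s * u = 1] (mod ?m)" by auto
  have "(a [^] s) [^] u = a [^] (1::nat)"
    using H.pow_eq_iff_cong_ord[OF a, of "s * u" 1] orda u m0 a by (simp add: H.nat_pow_pow)
  then have bac: "b \<otimes> a = c [^] (w' * u) \<otimes> b"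
    using H.pow_intertwine[of b "c [^] w'" "a [^] s" u] bs a b c by (simp add: H.nat_pow_pow)
  \<comment> \<open>Raising both sides of the conjugation relation to the power p^k kills a. Hence q
    divides the exponent of c, and the conjugate of a is a power of a.\<close>
  have "b = (c [^] (w' * u * ?m)) \<otimes> b"
    using H.pow_intertwine[of b "c [^] (w' * u)" a ?m] bac a b c oa[of ?m] by (simp add: H.nat_pow_pow)
  then have "c [^] (w' * u * ?m) = \<one>" using b c H.r_cancel_one'[of b "c [^] (w' * u * ?m)"] by simp
  then have "?m * q dvd w' * u * ?m" by (simp only: oc)
  then have "q dvd w' * u" using m0 by (auto simp: mult.commute)
  then obtain r where r: "w' * u = q * r" by blast
  have bar: "b \<otimes> a = a [^] r \<otimes> b" unfolding a_pow r[symmetric] by (rule bac)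
  let ?f = "\<lambda>(i, j). a [^] (i::nat) \<otimes> b [^] (j::nat)"
  have "inj_on ?f ({..<?m} \<times> {..<n})"
  proof (rule inj_onI)
    fix v w assume vw: "v \<in> {..<?m} \<times> {..<n}" "w \<in> {..<?m} \<times> {..<n}" "?f v = ?f w"
    obtain i j where v: "v = (i, j)" by (cases v)
    obtain i' j' where w: "w = (i', j')" by (cases w)
    have ij: "i < ?m" "j < n" "i' < ?m" "j' < n"
      and eq: "a [^] i \<otimes> b [^] j = a [^] i' \<otimes> b [^] j'"
      using vw by (auto simp: v w)
    have "a [^] (?m - i' + i) \<otimes> b [^] j = a [^] (?m - i') \<otimes> (a [^] i \<otimes> b [^] j)"
      using a b by (simp add: H.nat_pow_mult[symmetric] H.m_assoc)
    also have "\<dots> = a [^] (?m - i' + i') \<otimes> b [^] j'"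
      unfolding eq using a b by (simp only: H.nat_pow_mult[symmetric] H.m_assoc H.nat_pow_closed)
    also have "a [^] (?m - i' + i') = \<one>" using ij oa[of ?m] by simp
    finally have "a [^] (?m - i' + i) \<otimes> b [^] j \<otimes> b [^] (n - j) = b [^] j' \<otimes> b [^] (n - j)"
      using b by simp
    then have z: "a [^] (?m - i' + i) = b [^] (j' + (n - j))"
      using a b ij ob[of n] by (simp add: H.m_assoc H.nat_pow_mult)
    \<comment> \<open>An element common to the cyclic subgroups of a and b, whose orders are
      coprime.\<close>
    define z where "z = a [^] (?m - i' + i)"
    have zc: "z \<in> carrier H" using a by (simp add: z_def)
    have "z [^] ?m = \<one>" using a oa by (simp add: z_def H.nat_pow_pow)
    moreover have "z [^] n = \<one>" unfolding z_def z using b ob by (simp add: H.nat_pow_pow)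
    ultimately have "H.ord z dvd ?m" "H.ord z dvd n" using H.pow_eq_id[OF zc] by simp_all
    then have "is_unit (H.ord z)" using cop by (meson coprime_def)
    then have z1: "z = \<one>" using H.ord_eq_1[OF zc] by simp
    have "?m dvd ?m - i' + i" using z1 oa by (simp add: z_def)
    then have "i = i'" using ij dvd_complement_imp_eq[of i ?m i'] by simp
    moreover have "n dvd n - j + j'" using z1[unfolded z_def z] ob[of "j' + (n - j)"] by (simp add: add.commute)
    then have "j' = j" using ij dvd_complement_imp_eq[of j' n j] by simp
    ultimately show "v = w" by (simp add: v w)
  qed
  then have "card (?f ` ({..<?m} \<times> {..<n})) = card (carrier H)" by (simp add: card_image card)
  then have img: "?f ` ({..<?m} \<times> {..<n}) = carrier H" using fin a b by (intro card_subset_eq) auto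
  have M: "metacyclic H a b ?m n r"
    unfolding metacyclic_def using H m0 n a b oa[of ?m] ob[of n] bar img card by simp
  have "ord ?m r dvd n" using metacyclic_commute_iff[OF M, of n] a ob[of n] by simp
  then show ?thesis using M ord_divides by blast
qed

section \<open>Independence of the choice of r\<close>

text \<open>Take i + d t with t the product of the primes that divide n but not i. Each prime
  divisor of n divides exactly one of i and d t, hence not the sum.\<close>

lemma coprime_lift_divisor:
  fixes i d n :: nat
  assumes "coprime i d" "n > 0"
  shows "\<exists>c. coprime c n \<and> [c = i] (mod d)"
proof -
  let ?Q = "{q. prime q \<and> q dvd n \<and> \<not> q dvd i}"
  define t where "t = \<Prod>?Q"
  have fin: "finite ?Q" using assms(2) by (intro finite_subset[OF _ finite_atMost[of n]]) (auto dest: dvd_imp_le)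
  have pt: "q dvd t \<longleftrightarrow> q \<in> ?Q" if "prime q" for q
    unfolding t_def using fin that by (auto simp: prime_dvd_prod_iff dest: primes_dvd_imp_eq[OF that])
  have "coprime (i + d * t) n"
  proof (rule ccontr)
    assume "\<not> coprime (i + d * t) n"
    then have "gcd (i + d * t) n \<noteq> 1" by (metis coprime_iff_gcd_eq_1)
    from prime_factor_nat[OF this] obtain q where q: "prime q" "q dvd i + d * t" "q dvd n" by auto
    show False
    proof (cases "q dvd i")
      case True
      then have "q dvd d * t" using q(2) by (simp add: dvd_add_right_iff)
      then have "q dvd d \<or> q dvd t" using q(1) by (simp add: prime_dvd_mult_iff)
      moreover have "\<not> q dvd t" using pt[OF q(1)] True by simp
      moreover have "\<not> q dvd d"
        using coprime_common_divisor_nat[OF assms(1) True] prime_gt_1_nat[OF q(1)] by (metis less_irrefl)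
      ultimately show False by simp
    next
      case False
      then have "q dvd t" using pt[OF q(1)] q by simp
      then have "q dvd d * t" by simp
      then have "q dvd i" using q(2) dvd_add_left_iff[of q "d * t" i] by simp
      then show False using False by simp
    qed
  qed
  moreover have "[i + d * t = i] (mod d)" by (simp add: cong_def)
  ultimately show ?thesis by blast
qed

text \<open>With discrete logarithms u and v of r and r' to a primitive root, equal orders mean
  \<open>gcd u N = gcd v N\<close>, so v is a multiple of u modulo N. Since both orders agree, the
  exponent found must be prime to them.\<close>

lemma same_ord_power:
  fixes p k r r' :: nat
  assumes p: "prime p" "odd p" and k: "k \<ge> 1" and r: "coprime (p ^ k) r" and r': "coprime (p ^ k) r'"
    and eq: "ord (p ^ k) r = ord (p ^ k) r'"
  shows "\<exists>i. coprime i (ord (p ^ k) r) \<and> [r ^ i = r'] (mod (p ^ k))"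
proof -
  let ?m = "p ^ k"
  have m1: "?m > 1" using one_less_power[OF prime_gt_1_nat[OF p(1)], of k] k by simp
  obtain g where "\<forall>k>0. residue_primroot (p ^ k) g" using residue_primroot_odd_prime_power_exists[OF p] .
  then have g: "residue_primroot ?m g" using k by simp
  define N where "N = totient ?m"
  have og: "ord ?m g = N" "coprime ?m g" using g by (auto simp: residue_primroot_def N_def)
  have gen: "\<exists>u. [g ^ u = s] (mod ?m)" if "coprime ?m s" for s
  proof -
    have cs: "coprime (s mod ?m) ?m" using that m1 coprime_mod_left_iff[of ?m s] by (simp only: coprime_commute)
    moreover have "s mod ?m \<noteq> 0" using cs m1 by (metis coprime_0_left_iff nat_dvd_1_iff_1 less_irrefl)
    moreover have "s mod ?m \<le> ?m" using mod_less_divisor[of ?m s] m1 by linarith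
    ultimately have "s mod ?m \<in> totatives ?m"
      by (simp only: totatives_def mem_Collect_eq greaterThanAtMost_iff neq0_conv simp_thms)
    then have "s mod ?m \<in> (\<lambda>i. g ^ i mod ?m) ` {..<totient ?m}"
      using residue_primroot_is_generator[OF m1 g] by (simp only: bij_betw_def)
    then obtain u where "s mod ?m = g ^ u mod ?m" by (rule imageE)
    then show ?thesis unfolding cong_def by metis
  qed
  obtain u v where u: "[g ^ u = r] (mod ?m)" and v: "[g ^ v = r'] (mod ?m)" using gen[OF r] gen[OF r'] by auto
  have ou: "ord ?m r * gcd u N = N" using ord_power_aux[of ?m g u] ord_cong[OF u] og by simp
  have ov: "ord ?m r * gcd v N = N" using ord_power_aux[of ?m g v] ord_cong[OF v] og eq by simp
  have r0: "ord ?m r > 0" using r ord_eq_0[of ?m r] by auto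
  have "gcd u N = gcd v N" using ou ov r0 by (metis mult_left_cancel not_gr_zero)
  moreover obtain x where x: "[u * x = gcd u N] (mod N)" using cong_solve_nat by blast
  moreover obtain w where w: "v = gcd v N * w" by (meson dvdE gcd_dvd1)
  ultimately have "[u * x * w = v] (mod N)" by (metis cong_scalar_right)
  then have "[g ^ (u * x * w) = g ^ v] (mod ?m)" using order_divides_expdiff[OF og(2)] og(1) by simp
  then have 1: "[(g ^ u) ^ (x * w) = r'] (mod ?m)" using v by (metis cong_trans mult.assoc power_mult)
  have "[r ^ (x * w) = (g ^ u) ^ (x * w)] (mod ?m)" using u by (simp add: cong_pow cong_sym)
  then have i: "[r ^ (x * w) = r'] (mod ?m)" using 1 by (rule cong_trans)
  have "ord ?m r * gcd (x * w) (ord ?m r) = ord ?m r" using ord_power_aux[of ?m r "x * w"] ord_cong[OF i] eq by simp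
  then have "gcd (x * w) (ord ?m r) = 1" using r0 by simp
  then show ?thesis using i coprime_iff_gcd_eq_1 by blast
qed

lemma metacyclic_cong:
  fixes H (structure)
  assumes M: "metacyclic H a b m n r" and "[r = r'] (mod m)"
  shows "metacyclic H a b m n r'"
proof -
  interpret H: group H using M by (simp add: metacyclic_def)
  note d = M[unfolded metacyclic_def]
  have "a [^] r = a [^] r'" using H.pow_eq_iff_cong_ord[of a r r'] metacyclic_ord(1)[OF M] d assms(2) by simp
  then show ?thesis using M by (simp add: metacyclic_def)
qed

lemma metacyclic_change_generator:
  fixes H (structure)
  assumes M: "metacyclic H a b m n r" and c: "coprime c n"
  shows "metacyclic H a (b [^] c) m n (r ^ c)"
proof -
  interpret H: group H using M by (simp add: metacyclic_def)
  note d = M[unfolded metacyclic_def]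
  from cong_solve_coprime_nat[OF c] obtain e where e: "[c * e = 1] (mod n)" by auto
  let ?b = "b [^] c"
  have bc: "?b \<in> carrier H" using d by simp
  have ab: "a \<in> carrier H" "b \<in> carrier H" using d by auto
  have bn: "?b [^] n = \<one>" using H.pow_eq_id[OF ab(2), of "c * n"] metacyclic_ord(2)[OF M] ab by (simp add: H.nat_pow_pow)
  have "(\<lambda>(i, j). a [^] (i::nat) \<otimes> ?b [^] (j::nat)) ` ({..<m} \<times> {..<n}) = carrier H" (is "?f ` ?D = _")
  proof
    show "?f ` ?D \<subseteq> carrier H" using d by auto
    show "carrier H \<subseteq> ?f ` ?D"
    proof
      fix x assume "x \<in> carrier H"
      then obtain i j where ij: "i < m" "j < n" "x = a [^] i \<otimes> b [^] j" using metacyclic_elem[OF M] by metis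
      have "[c * (e * j) = j] (mod n)" using cong_scalar_right[OF e, of j] by (simp add: mult.assoc)
      then have "b [^] (c * (e * j)) = b [^] j"
        using H.pow_eq_iff_cong_ord[OF ab(2), of "c * (e * j)" j] metacyclic_ord(2)[OF M] d by simp
      then have "?b [^] (e * j) = b [^] j" using ab by (simp add: H.nat_pow_pow)
      then have "?b [^] (e * j mod n) = b [^] j" using H.nat_pow_mod[OF bc bn] d by simp
      then have "x = ?f (i, e * j mod n)" using ij by simp
      moreover have "(i, e * j mod n) \<in> ?D" using ij d by simp
      ultimately show "x \<in> ?f ` ?D" by (rule image_eqI)
    qed
  qed
  moreover have "?b \<otimes> a = a [^] (r ^ c) \<otimes> ?b" using H.conj_pow[of a b r c 1] d by simp
  ultimately show ?thesis unfolding metacyclic_def using d bc bn by simp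
qed

text \<open>Replacing b by b^c replaces r by r^c. For b^c to generate the same subgroup, c must be
  prime to n and not only to the order of r, which is why the exponent is lifted.\<close>

lemma metacyclic_iso_same_ord:
  assumes H: "metacyclic H a b (p ^ k) n r" and H': "metacyclic H' a' b' (p ^ k) n r'"
    and p: "prime p" "odd p" and k: "k \<ge> 1"
    and r: "[r ^ n = 1] (mod (p ^ k))" and r': "[r' ^ n = 1] (mod (p ^ k))"
    and eq: "ord (p ^ k) r = ord (p ^ k) r'"
  shows "H \<cong> H'"
proof -
  let ?m = "p ^ k"
  have n: "n > 0" using H by (simp add: metacyclic_def)
  have cop: "coprime ?m s" if "[s ^ n = 1] (mod ?m)" for s
  proof -
    have "coprime ?m (s ^ n)" using cong_imp_coprime[OF cong_sym[OF that]] by (simp add: coprime_commute)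
    then show ?thesis using n by simp
  qed
  obtain i where i: "coprime i (ord ?m r)" "[r ^ i = r'] (mod ?m)"
    using same_ord_power[OF p k cop[OF r] cop[OF r'] eq] by blast
  obtain c where c: "coprime c n" "[c = i] (mod (ord ?m r))" using coprime_lift_divisor[OF i(1) n] by blast
  have "[r ^ c = r ^ i] (mod ?m)" using order_divides_expdiff[OF cop[OF r]] c(2) by blast
  then have "[r ^ c = r'] (mod ?m)" using i(2) by (rule cong_trans)
  from metacyclic_iso[OF metacyclic_cong[OF metacyclic_change_generator[OF H c(1)] this] H'] show ?thesis .
qed

text \<open>Cauchy's theorem for the prime 2. It fills the gap left by the spectral criterion, which
  starts at K = 3.\<close>

lemma exists_element_of_order_2:
  fixes H (structure)
  assumes H: "group H" and card: "even (card (carrier H))" and fin: "finite (carrier H)"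
  shows "\<exists>x\<in>carrier H. group.ord H x = 2"
proof -
  interpret H: group H by (rule H)
  obtain s where "order H = 2 ^ 1 * s" using card by (auto simp: order_def)
  from sylow_thm[OF two_is_prime_nat H this fin] obtain S where S: "subgroup S H" "card S = 2" by auto
  have "\<one> \<in> S" using S(1) by (rule subgroup.one_closed)
  then obtain x where x: "x \<in> S" "x \<noteq> \<one>" using S(2) by (metis card_2_iff')
  interpret S: group "H\<lparr>carrier := S\<rparr>" using H.subgroup_imp_group[OF S(1)] .
  have xH: "x \<in> carrier H" using x S(1) subgroup.subset by blast
  have "x [^]\<^bsub>H\<lparr>carrier := S\<rparr>\<^esub> (2::nat) = \<one>" using S.pow_order_eq_1[of x] x S(2) by (simp add: order_def)
  then have "x [^] (2::nat) = \<one>" by (simp only: H.nat_pow_consistent[symmetric])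
  then have "H.ord x dvd 2" using H.pow_eq_id[OF xH] by simp
  then have "H.ord x = 1 \<or> H.ord x = 2" using two_is_prime_nat by (simp add: prime_nat_iff)
  then show ?thesis using H.ord_eq_1[OF xH] x xH by auto
qed

text \<open>The order divides p^(k-1) (p - 1), and as a divisor of n it is prime to p. This gives
  the bound below p on which the pigeonhole argument rests.\<close>

lemma ord_dvd_pred_prime:
  fixes p k n r :: nat
  assumes p: "prime p" and k: "k \<ge> 1" and cop: "coprime (p ^ k) n" and r: "[r ^ n = 1] (mod (p ^ k))"
  shows "ord (p ^ k) r dvd p - 1"
proof (cases "n = 0")
  case False
  have dn: "ord (p ^ k) r dvd n" using r ord_divides[of r n "p ^ k"] by simp
  have "coprime (p ^ k) (r ^ n)" using cong_imp_coprime[OF cong_sym[OF r]] by (simp add: coprime_commute)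
  then have "coprime (p ^ k) r" using False by simp
  then have "ord (p ^ k) r dvd p ^ (k - 1) * (p - 1)" using order_divides_totient[of "p ^ k" r] totient_prime_power[OF p, of k] k by simp
  moreover have "coprime (ord (p ^ k) r) (p ^ (k - 1))"
  proof -
    have "coprime (p ^ k) (ord (p ^ k) r)" using cop dn by (meson coprime_divisors dvd_refl)
    then show ?thesis using k by (auto simp: coprime_commute)
  qed
  ultimately show ?thesis by (simp add: coprime_dvd_mult_right_iff)
qed (use assms in simp)

text \<open>The construction in H' yields some r' with no control over its order. Writing n = ord r
  * q = ord r' * q' (orders modulo p^k), both p^k q and p^k q' occur as element orders in both
  groups; the order bound applied in each of them gives q = q'.\<close>

theorem metacyclic_iso_if_same_element_orders:
  assumes M: "metacyclic H a b (p ^ k) n r" and p: "prime p" "odd p" and k: "k \<ge> 1" and cop: "coprime (p ^ k) n"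
    and r: "[r ^ n = 1] (mod (p ^ k))" and H': "group H'" and card: "card (carrier H') = card (carrier H)"
    and ords: "\<And>K. K \<ge> 3 \<Longrightarrow> (\<exists>x\<in>carrier H. group.ord H x = K) \<longleftrightarrow> (\<exists>x\<in>carrier H'. group.ord H' x = K)"
  shows "H \<cong> H'"
proof -
  let ?m = "p ^ k"
  interpret H': group H' by (rule H')
  note d = M[unfolded metacyclic_def]
  have H: "group H" and n: "n > 0" and cardH: "card (carrier H) = ?m * n" using d by auto
  have fin: "finite (carrier H')" using card cardH d by (metis card.infinite mult_is_0 less_irrefl)
  have "p \<ge> 3" using p prime_ge_2_nat[OF p(1)] by (cases "p = 2") auto
  moreover have "p \<le> ?m" using k prime_gt_0_nat[OF p(1)] by (metis One_nat_def Suc_le_eq less_eq_Suc_le self_le_power)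
  ultimately have m3: "?m \<ge> 3" by simp
  define q where "q = n div ord ?m r"
  have dn: "ord ?m r dvd n" using r ord_divides[of r n ?m] by simp
  have nq: "n = ord ?m r * q" using dn by (simp add: q_def)
  have q0: "q > 0" using nq n by (metis mult_0_right neq0_conv)
  have dp: "ord ?m r < p"
    using dvd_imp_le[OF ord_dvd_pred_prime[OF p(1) k cop r]] prime_gt_1_nat[OF p(1)] by simp
  \<comment> \<open>Orders that are multiples of p^k are at least 3, so the spectrum always detects
    them; only the order n may be too small.\<close>
  have max3: "?m * e \<ge> 3" if "e > 0" for e using m3 that by (metis le_trans mult_le_mono2 nat_mult_1_right less_eq_Suc_le One_nat_def)
  obtain c where c: "c \<in> carrier H'" "H'.ord c = ?m * q"
    using metacyclic_max_order[OF M cop r] ords[OF max3[OF q0]] by (auto simp: q_def)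
  have "\<exists>x\<in>carrier H'. H'.ord x = n"
  proof -
    \<comment> \<open>For n = 1 the identity serves; for n = 2 the group has even order.\<close>
    consider "n = 1" | "n = 2" | "n \<ge> 3" using n by linarith
    then show ?thesis
    proof cases
      case 1
      then show ?thesis using H'.ord_eq_1[of "\<one>\<^bsub>H'\<^esub>"] by (intro bexI[of _ "\<one>\<^bsub>H'\<^esub>"]) auto
    next
      case 2
      then show ?thesis using exists_element_of_order_2[OF H' _ fin] card cardH by simp
    next
      case 3
      then show ?thesis using ords[OF 3] metacyclic_ord(2)[OF M] d by blast
    qed
  qed
  then obtain b' where b': "b' \<in> carrier H'" "H'.ord b' = n" by blast
  have "card (carrier H') = ?m * n" using card cardH by simp
  then obtain a' r' where M': "metacyclic H' a' b' ?m n r'" and r': "[r' ^ n = 1] (mod ?m)"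
    using metacyclic_from_element_orders[OF H' _ p(1) k cop n nq dp c b'] by blast
  define q' where "q' = n div ord ?m r'"
  have dn': "ord ?m r' dvd n" using r' ord_divides[of r' n ?m] by simp
  have nq': "n = ord ?m r' * q'" using dn' by (simp add: q'_def)
  have q'0: "q' > 0" using nq' n by (metis mult_0_right neq0_conv)
  obtain x where x: "x \<in> carrier H" "group.ord H x = ?m * q'"
    using metacyclic_max_order[OF M' cop r'] ords[OF max3[OF q'0]] by (auto simp: q'_def)
  have "q' dvd q" using metacyclic_order_bound[OF M p(1) k cop r x] by (simp add: q_def)
  moreover have "q dvd q'" using metacyclic_order_bound[OF M' p(1) k cop r' c] by (simp add: q'_def)
  ultimately have "q = q'" by (rule dvd_antisym[rotated])
  then have "ord ?m r * q = ord ?m r' * q" using nq nq' by metis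
  then have "ord ?m r = ord ?m r'" using q0 by simp
  then show ?thesis using metacyclic_iso_same_ord[OF M M' p k r r'] by simp
qed


section \<open>The fundamental group of the orbit space\<close>

text \<open>The covering space theorems speak of subsets of topological types, whereas an orbit is a
  plain set. Its distance function, truncated at 1 to be bounded, is a point of the metric space of
  bounded continuous functions and determines the orbit, which is closed.\<close>

definition orbit_code :: "'a::metric_space set \<Rightarrow> 'a \<Rightarrow>\<^sub>C real" where
  "orbit_code A = Bcontfun (\<lambda>y. min 1 (infdist y A))"

lemma orbit_code_apply: "apply_bcontfun (orbit_code A) y = min 1 (infdist y A)"
proof -
  have "(\<lambda>y. min 1 (infdist y A)) \<in> bcontfun"
  proof (rule bcontfun_normI[where b=1])
    show "continuous_on UNIV (\<lambda>y. min 1 (infdist y A))" by (intro continuous_intros)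
    show "norm (min 1 (infdist y A)) \<le> 1" for y using infdist_nonneg[of y A] by simp
  qed
  then show ?thesis by (simp add: orbit_code_def Bcontfun_inverse)
qed

lemma orbit_code_inject:
  assumes "closed A" "closed B" "A \<noteq> {}" "B \<noteq> {}" "orbit_code A = orbit_code B"
  shows "A = B"
proof -
  have "y \<in> A \<longleftrightarrow> y \<in> B" for y
  proof -
    have "min 1 (infdist y A) = min 1 (infdist y B)" by (metis assms(5) orbit_code_apply)
    then have "infdist y A = 0 \<longleftrightarrow> infdist y B = 0" by (auto simp: min_def split: if_splits)
    then show ?thesis using in_closed_iff_infdist_zero[OF assms(1,3), of y] in_closed_iff_infdist_zero[OF assms(2,4), of y] by simp
  qed
  then show ?thesis by blast
qed

context
  fixes G :: "(real^'n^'n) set"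
  assumes G: "spherical_space_form G"
begin

lemma space_form_finite: "finite G" "G \<noteq> {}"
  using G space_form_mult(2)[OF G] by (auto simp: spherical_space_form_def)

lemma space_form_free: "g \<in> G \<Longrightarrow> x \<in> sphere 0 1 \<Longrightarrow> g *v x = x \<Longrightarrow> g = mat 1"
  using G unfolding spherical_space_form_def by blast

lemma space_form_dist: "g \<in> G \<Longrightarrow> dist (g *v x) (g *v y) = dist x y"
  using space_form_orthogonal(3)[OF G, of g "x - y"] by (simp add: dist_norm matrix_vector_mult_diff_distrib)

lemma space_form_sphere: "g \<in> G \<Longrightarrow> x \<in> sphere 0 1 \<Longrightarrow> g *v x \<in> sphere 0 1"
  using space_form_orthogonal(3)[OF G, of g x] by simp

lemma finite_orbit: "finite (orbit_map G x)" "orbit_map G x \<noteq> {}"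
  using space_form_finite by (auto simp: orbit_map_def)

text \<open>Below 1 the truncation is invisible, and the distance to a finite orbit is
  attained.\<close>

lemma orbit_code_orbit_less:
  assumes "\<epsilon> \<le> 1"
  shows "apply_bcontfun (orbit_code (orbit_map G x)) y < \<epsilon> \<longleftrightarrow> (\<exists>g\<in>G. dist y (g *v x) < \<epsilon>)"
proof -
  have "infdist y (orbit_map G x) = Min ((\<lambda>g. dist y (g *v x)) ` G)"
    using space_form_finite finite_orbit
    by (simp add: infdist_def orbit_map_def image_image cInf_eq_Min)
  then have "infdist y (orbit_map G x) < \<epsilon> \<longleftrightarrow> (\<exists>g\<in>G. dist y (g *v x) < \<epsilon>)"
    using space_form_finite by (simp add: Min_less_iff)
  then show ?thesis using assms by (auto simp: orbit_code_apply)
qed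

text \<open>The map is 1-Lipschitz because the group acts by isometries.\<close>

lemma continuous_orbit_code: "continuous_on UNIV (\<lambda>x. orbit_code (orbit_map G x))"
proof -
  have le: "infdist y (orbit_map G x) \<le> infdist y (orbit_map G x') + dist x x'" for x x' y
  proof -
    have "closed (orbit_map G x')" using finite_orbit(1) by (rule finite_imp_closed)
    then obtain w where w: "w \<in> orbit_map G x'" "infdist y (orbit_map G x') = dist y w"
      using infdist_attains_inf[of "orbit_map G x'" y] finite_orbit by metis
    then obtain g where g: "g \<in> G" "w = g *v x'" by (auto simp: orbit_map_def)
    have "infdist y (orbit_map G x) \<le> dist y (g *v x)" using g by (intro infdist_le) (auto simp: orbit_map_def)
    also have "\<dots> \<le> dist y w + dist w (g *v x)" by (rule dist_triangle)
    also have "dist w (g *v x) = dist x x'" using space_form_dist[OF g(1), of x' x] g by (simp add: dist_commute)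
    finally show ?thesis using w by simp
  qed
  have "dist (orbit_code (orbit_map G x)) (orbit_code (orbit_map G x')) \<le> dist x x'" for x x'
  proof (rule dist_bound)
    fix y
    show "dist (apply_bcontfun (orbit_code (orbit_map G x)) y) (apply_bcontfun (orbit_code (orbit_map G x')) y) \<le> dist x x'"
      using le[where x=x and x'=x' and y=y] le[where x=x' and x'=x and y=y] unfolding orbit_code_apply dist_real_def by (simp add: dist_commute)
  qed
  then show ?thesis unfolding continuous_on_iff by (metis order_le_less_trans)
qed

lemma orbit_code_orbit_eq_iff: "orbit_code (orbit_map G x) = orbit_code (orbit_map G y) \<longleftrightarrow> (\<exists>g\<in>G. y = g *v x)"
proof -
  have "orbit_code (orbit_map G x) = orbit_code (orbit_map G y) \<longleftrightarrow> orbit_map G x = orbit_map G y"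
    using orbit_code_inject[of "orbit_map G x" "orbit_map G y"] finite_orbit finite_imp_closed by auto
  then show ?thesis using orbit_map_eq[OF G] by simp
qed

lemma space_form_action_inj:
  assumes x: "x \<in> sphere 0 1" and gh: "g \<in> G" "h \<in> G" "g *v x = h *v x"
  shows "g = h"
proof -
  obtain k where k: "k \<in> G" "k ** g = mat 1" "g ** k = mat 1" using space_form_mult(3)[OF G gh(1)] by blast
  have "(k ** h) *v x = x" using k(2) gh(3) by (metis matrix_vector_mul_assoc matrix_vector_mul_lid)
  then have "k ** h = mat 1" using space_form_free[OF space_form_mult(1)[OF G k(1) gh(2)] x] by simp
  then show ?thesis using k(3) by (metis matrix_mul_assoc matrix_mul_lid matrix_mul_rid)
qed

lemma space_form_separated:
  assumes x: "x \<in> sphere 0 1"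
  obtains \<epsilon> where "0 < \<epsilon>" "\<epsilon> \<le> 1" "\<And>g h. g \<in> G \<Longrightarrow> h \<in> G \<Longrightarrow> g \<noteq> h \<Longrightarrow> cball (g *v x) \<epsilon> \<inter> cball (h *v x) \<epsilon> = {}"
proof -
  \<comment> \<open>The distances between distinct points of the orbit; a third of the minimum
    separates the closed balls. The extra 3 keeps the set nonempty for the trivial group and ensures
    \<open>\<epsilon> \<le> 1\<close>.\<close>
  define D where "D = insert 3 ((\<lambda>(g, h). dist (g *v x) (h *v x)) ` {(g, h). g \<in> G \<and> h \<in> G \<and> g \<noteq> h})"
  have "{(g, h). g \<in> G \<and> h \<in> G \<and> g \<noteq> h} \<subseteq> G \<times> G" by blast
  then have fin: "finite D" unfolding D_def using space_form_finite by (meson finite.insertI finite_SigmaI finite_imageI finite_subset)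
  have pos: "\<forall>t\<in>D. 0 < t" using space_form_action_inj[OF x] by (auto simp: D_def)
  define \<epsilon> where "\<epsilon> = Min D / 3"
  have D3: "3 \<in> D" by (simp add: D_def)
  have e: "0 < \<epsilon>" "\<epsilon> \<le> 1" using pos Min_in[OF fin] Min_le[OF fin D3] D3 unfolding \<epsilon>_def by force+
  have "cball (g *v x) \<epsilon> \<inter> cball (h *v x) \<epsilon> = {}" if "g \<in> G" "h \<in> G" "g \<noteq> h" for g h
  proof (rule ccontr)
    assume "cball (g *v x) \<epsilon> \<inter> cball (h *v x) \<epsilon> \<noteq> {}"
    then obtain y where "dist (g *v x) y \<le> \<epsilon>" "dist (h *v x) y \<le> \<epsilon>" by auto
    then have "dist (g *v x) (h *v x) \<le> 2 * \<epsilon>" using dist_triangle2[of "g *v x" "h *v x" y] by simp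
    moreover have "dist (g *v x) (h *v x) \<ge> 3 * \<epsilon>" using that fin by (auto simp: \<epsilon>_def D_def intro!: Min_le)
    ultimately show False using e by simp
  qed
  then show ?thesis using that e by blast
qed

text \<open>Small balls about the points of the orbit of \<open>a\<close> are the sheets: a group
  element that maps a point of a ball into the same ball must be the identity, since the balls about
  different orbit points are disjoint.\<close>

lemma covering_space_orbit_code:
  "covering_space (sphere 0 1) (\<lambda>x. orbit_code (orbit_map G x)) ((\<lambda>x. orbit_code (orbit_map G x)) ` sphere 0 1)"
proof
  define P where "P = (\<lambda>x. orbit_code (orbit_map G x))"
  let ?S = "sphere 0 1 :: (real^'n) set"
  have P_eq: "P x = P y \<longleftrightarrow> (\<exists>g\<in>G. y = g *v x)" for x y unfolding P_def by (rule orbit_code_orbit_eq_iff)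
  have contP: "continuous_on A P" for A using continuous_orbit_code continuous_on_subset unfolding P_def by blast
  show "continuous_on ?S (\<lambda>x. orbit_code (orbit_map G x))" using contP by (simp add: P_def)
  show "(\<lambda>x. orbit_code (orbit_map G x)) ` ?S = (\<lambda>x. orbit_code (orbit_map G x)) ` ?S" ..
  fix z assume "z \<in> (\<lambda>x. orbit_code (orbit_map G x)) ` ?S"
  then obtain a where a: "a \<in> ?S" "z = P a" by (auto simp: P_def)
  obtain \<epsilon> where e: "0 < \<epsilon>" "\<epsilon> \<le> 1" and sep: "\<And>g h. g \<in> G \<Longrightarrow> h \<in> G \<Longrightarrow> g \<noteq> h \<Longrightarrow> cball (g *v a) \<epsilon> \<inter> cball (h *v a) \<epsilon> = {}"
    using space_form_separated[OF a(1)] by metis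
  define u where "u = (\<lambda>g. ?S \<inter> ball (g *v a) \<epsilon>)"
  \<comment> \<open>The orbits that meet the ball about \<open>a\<close>: evaluating a code at
    \<open>a\<close> gives the truncated distance from \<open>a\<close> to the orbit, and evaluation
    is continuous.\<close>
  define T where "T = P ` ?S \<inter> (\<lambda>w. apply_bcontfun w a) -` {..<\<epsilon>}"
  have PT: "P y \<in> T \<longleftrightarrow> (\<exists>g\<in>G. dist a (g *v y) < \<epsilon>)" if "y \<in> ?S" for y
    using that orbit_code_orbit_less[OF e(2), of y a] by (auto simp: T_def P_def)
  have near: "(\<exists>g\<in>G. dist a (g *v y) < \<epsilon>) \<longleftrightarrow> (\<exists>g\<in>G. y \<in> ball (g *v a) \<epsilon>)" for y
  proof
    assume "\<exists>g\<in>G. dist a (g *v y) < \<epsilon>"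
    then obtain g where g: "g \<in> G" "dist a (g *v y) < \<epsilon>" by blast
    obtain k where k: "k \<in> G" "k ** g = mat 1" using space_form_mult(3)[OF G g(1)] by blast
    have "dist (k *v a) (k *v (g *v y)) < \<epsilon>" using space_form_dist[OF k(1)] g(2) by simp
    then have "dist (k *v a) y < \<epsilon>" using k(2) by (simp add: matrix_vector_mul_assoc)
    then show "\<exists>g\<in>G. y \<in> ball (g *v a) \<epsilon>" using k(1) by auto
  next
    assume "\<exists>g\<in>G. y \<in> ball (g *v a) \<epsilon>"
    then obtain g where g: "g \<in> G" "dist (g *v a) y < \<epsilon>" by auto
    obtain k where k: "k \<in> G" "k ** g = mat 1" using space_form_mult(3)[OF G g(1)] by blast
    have "dist (k *v (g *v a)) (k *v y) < \<epsilon>" using space_form_dist[OF k(1)] g(2) by simp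
    then have "dist a (k *v y) < \<epsilon>" using k(2) by (simp add: matrix_vector_mul_assoc)
    then show "\<exists>g\<in>G. dist a (g *v y) < \<epsilon>" using k(1) by auto
  qed
  have zT: "z \<in> T" using PT[OF a(1)] a(2) space_form_mult(2)[OF G] e(1) by (metis dist_self matrix_vector_mul_lid)
  have opT: "openin (top_of_set (P ` ?S)) T"
    unfolding T_def
  proof (rule continuous_openin_preimage_gen)
    show "continuous_on (P ` ?S) (\<lambda>w. apply_bcontfun w a)"
      unfolding continuous_on_iff by (metis dist_bounded order_le_less_trans)
  qed simp
  have union: "\<Union> (u ` G) = ?S \<inter> P -` T" using PT near by (auto simp: u_def)
  have opu: "openin (top_of_set ?S) (u g)" for g unfolding u_def by (simp add: openin_open_Int)
  have disj: "pairwise disjnt (u ` G)"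
  proof -
    have "disjnt (u g) (u h)" if "g \<in> G" "h \<in> G" "g \<noteq> h" for g h
      using sep[OF that] ball_subset_cball[of "g *v a" \<epsilon>] ball_subset_cball[of "h *v a" \<epsilon>]
      unfolding u_def disjnt_def by blast
    then show ?thesis by (auto simp: pairwise_def)
  qed
  have hom: "\<exists>q. homeomorphism (u g) T P q" if g: "g \<in> G" for g
  proof -
    \<comment> \<open>The ball is closed here so that compactness turns the injective continuous
      \<open>P\<close> into a homeomorphism onto its image; this is then restricted to the open
      sheet.\<close>
    let ?K = "?S \<inter> cball (g *v a) \<epsilon>"
    have inj: "inj_on P ?K"
    proof (rule inj_onI)
      fix y y' assume y: "y \<in> ?K" "y' \<in> ?K" "P y = P y'"
      then obtain h where h: "h \<in> G" "y' = h *v y" using P_eq by blast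
      have "dist (h *v (g *v a)) (h *v y) \<le> \<epsilon>" using space_form_dist[OF h(1)] y(1) by simp
      then have "y' \<in> cball ((h ** g) *v a) \<epsilon>" using h(2) by (simp add: matrix_vector_mul_assoc)
      then have "h ** g = g" using sep[OF space_form_mult(1)[OF G h(1) g] g] y(2) by blast
      then have "h = mat 1" using space_form_mult(3)[OF G g] by (metis matrix_mul_assoc matrix_mul_rid)
      then show "y = y'" using h by simp
    qed
    have "compact ?K" by (intro compact_Int_closed compact_sphere closed_cball)
    then obtain q where q: "homeomorphism ?K (P ` ?K) P q"
      using homeomorphism_compact[OF _ contP refl inj] by blast
    have "P ` u g = T"
    proof
      show "P ` u g \<subseteq> T" using union g by blast
      show "T \<subseteq> P ` u g"
      proof
        fix w assume "w \<in> T"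
        then obtain y where y: "y \<in> ?S" "w = P y" by (auto simp: T_def)
        then obtain h where h: "h \<in> G" "dist a (h *v y) < \<epsilon>" using PT \<open>w \<in> T\<close> by blast
        have "dist (g *v a) (g *v (h *v y)) < \<epsilon>" using space_form_dist[OF g] h(2) by simp
        then have "g *v (h *v y) \<in> u g" using space_form_sphere g h y by (simp add: u_def)
        moreover have "P (g *v (h *v y)) = w"
          using P_eq[of y "g *v (h *v y)"] space_form_mult(1)[OF G g h(1)] y(2) by (metis matrix_vector_mul_assoc)
        ultimately show "w \<in> P ` u g" by blast
      qed
    qed
    moreover have "u g \<subseteq> ?K" using ball_subset_cball by (auto simp: u_def)
    ultimately have "homeomorphism (u g) T P q" using homeomorphism_of_subsets[OF q] by blast
    then show ?thesis by blast
  qed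
  show "\<exists>T. z \<in> T \<and> openin (top_of_set ((\<lambda>x. orbit_code (orbit_map G x)) ` ?S)) T \<and>
    (\<exists>v. \<Union>v = ?S \<inter> (\<lambda>x. orbit_code (orbit_map G x)) -` T \<and> (\<forall>u\<in>v. openin (top_of_set ?S) u) \<and>
      pairwise disjnt v \<and> (\<forall>u\<in>v. \<exists>q. homeomorphism u T (\<lambda>x. orbit_code (orbit_map G x)) q))"
    unfolding P_def[symmetric]
  proof (intro exI[of _ T] conjI zT opT exI[of _ "u ` G"] union disj)
    show "\<forall>u\<in>u ` G. openin (top_of_set ?S) u" using opu by blast
    show "\<forall>u\<in>u ` G. \<exists>q. homeomorphism u T P q" using hom by blast
  qed
qed

end

section \<open>Loops in the orbit space and their lifts\<close>

text \<open>Here g is the deck transformation attached to the loop. Being a relation, it separates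
  existence, which is path lifting, from uniqueness, which comes from monodromy and
  freeness.\<close>

definition lifts_to :: "(real^'n^'n) set \<Rightarrow> real^'n \<Rightarrow> (real \<Rightarrow> (real^'n) set) \<Rightarrow> real^'n^'n \<Rightarrow> bool" where
  "lifts_to G x0 p g \<longleftrightarrow> (\<exists>h. path h \<and> path_image h \<subseteq> sphere 0 1 \<and> pathstart h = x0 \<and> pathfinish h = g *v x0 \<and>
    (\<forall>t\<in>{0..1}. orbit_map G (h t) = p t))"

context
  fixes G :: "(real^'n^'n) set" and x0 :: "real^'n"
  assumes G: "spherical_space_form G" and x0: "x0 \<in> sphere 0 1"
begin

lemma continuous_map_orbit_map: "continuous_map (top_of_set (sphere 0 1)) (orbit_space G) (orbit_map G)"
  unfolding orbit_space_def by (rule quotient_imp_continuous_map[OF quotient_map_quotient_topology])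

text \<open>Loops and homotopies pass by this map from the quotient to the codes, where they are
  lifted; they return to the quotient from the sphere by \<open>orbit_map\<close>.\<close>

lemma continuous_map_orbit_code: "continuous_map (orbit_space G) (top_of_set ((\<lambda>z. orbit_code (orbit_map G z)) ` sphere 0 1)) orbit_code"
proof -
  have "continuous_map (top_of_set (sphere 0 1)) euclidean (orbit_code \<circ> orbit_map G)"
    using continuous_on_subset[OF continuous_orbit_code[OF G] subset_UNIV] by (simp add: o_def)
  then have "continuous_map (orbit_space G) euclidean orbit_code"
    unfolding orbit_space_def by (rule continuous_compose_quotient_map[OF quotient_map_quotient_topology])
  then show ?thesis unfolding continuous_map_in_subtopology topspace_orbit_space by auto
qed

lemma simply_connected_unit_sphere: "simply_connected (sphere (0::real^'n) 1)"
  using G by (intro simply_connected_sphere) (simp add: spherical_space_form_def)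

lemma space_form_homotopic_paths:
  assumes "path h" "path_image h \<subseteq> sphere 0 1" "path h'" "path_image h' \<subseteq> sphere (0::real^'n) 1"
    and "pathstart h' = pathstart h" "pathfinish h' = pathfinish h"
  shows "homotopic_paths (sphere 0 1) h h'"
proof -
  show ?thesis using assms simply_connected_unit_sphere unfolding simply_connected_eq_homotopic_paths by blast
qed

lemma loops_at_lifts_to:
  assumes p: "p \<in> loops_at (orbit_space G) (orbit_map G x0)"
  shows "\<exists>g\<in>G. lifts_to G x0 p g"
proof -
  have pc: "continuous_map (top_of_set {0..1}) (orbit_space G) p" and p01: "p 0 = orbit_map G x0" "p 1 = orbit_map G x0"
    using p by (auto simp: loops_at_def pathin_def)
  have "continuous_map (top_of_set {0..1}) (top_of_set ((\<lambda>z. orbit_code (orbit_map G z)) ` sphere 0 1)) (orbit_code \<circ> p)"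
    using pc continuous_map_orbit_code by (rule continuous_map_compose)
  then have "path (orbit_code \<circ> p)" "path_image (orbit_code \<circ> p) \<subseteq> (\<lambda>z. orbit_code (orbit_map G z)) ` sphere 0 1"
    by (auto simp: path_def path_image_def continuous_map_in_subtopology dest: funcset_mem)
  moreover have "pathstart (orbit_code \<circ> p) = orbit_code (orbit_map G x0)" by (simp add: pathstart_def p01)
  ultimately obtain h where h: "path h" "path_image h \<subseteq> sphere 0 1" "pathstart h = x0"
    and hp: "\<And>t. t \<in> {0..1} \<Longrightarrow> orbit_code (orbit_map G (h t)) = (orbit_code \<circ> p) t"
    using covering_space_lift_path_strong[OF covering_space_orbit_code[OF G] x0] by metis
  have hp': "orbit_map G (h t) = p t" if t: "t \<in> {0..1}" for t
  proof -
    have "p t \<in> topspace (orbit_space G)" using pc t by (auto simp: continuous_map_def)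
    then obtain w where w: "p t = orbit_map G w" by (auto simp: topspace_orbit_space)
    then have "orbit_code (orbit_map G (h t)) = orbit_code (orbit_map G w)" using hp[OF t] by simp
    then show ?thesis using orbit_code_orbit_eq_iff[OF G] orbit_map_eq[OF G] w by metis
  qed
  have "orbit_map G x0 = orbit_map G (h 1)" using hp'[of 1] p01 by simp
  then obtain g where g: "g \<in> G" "h 1 = g *v x0" using orbit_map_eq[OF G] by blast
  have "lifts_to G x0 p g" unfolding lifts_to_def using h hp' g(2) by (intro exI[of _ h]) (auto simp: pathfinish_def)
  then show ?thesis using g(1) by blast
qed

lemma loop_homotopy_imp_same_end:
  assumes pq: "(p, q) \<in> loop_homotopy (orbit_space G) (orbit_map G x0)" and "lifts_to G x0 p g" "lifts_to G x0 q g'" "g \<in> G" "g' \<in> G"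
  shows "g = g'"
proof -
  have hom: "homotopic_with (\<lambda>h. h 0 = orbit_map G x0 \<and> h 1 = orbit_map G x0) (top_of_set {0..1}) (orbit_space G) p q" and p: "p 0 = orbit_map G x0" "p 1 = orbit_map G x0"
    using pq by (auto simp: loop_homotopy_def loops_at_def)
  have hp: "homotopic_paths ((\<lambda>z. orbit_code (orbit_map G z)) ` sphere 0 1) (orbit_code \<circ> p) (orbit_code \<circ> q)"
    unfolding homotopic_paths_def
    by (rule homotopic_with_compose_continuous_map_left[OF hom continuous_map_orbit_code])
       (simp add: pathstart_def pathfinish_def p)
  obtain h where h: "path h" "path_image h \<subseteq> sphere 0 1" "pathstart h = x0" "pathfinish h = g *v x0"
      "\<And>t. t \<in> {0..1} \<Longrightarrow> orbit_map G (h t) = p t"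
    using assms(2) by (auto simp: lifts_to_def)
  obtain h' where h': "path h'" "path_image h' \<subseteq> sphere 0 1" "pathstart h' = x0" "pathfinish h' = g' *v x0"
      "\<And>t. t \<in> {0..1} \<Longrightarrow> orbit_map G (h' t) = q t"
    using assms(3) by (auto simp: lifts_to_def)
  have "pathfinish h = pathfinish h'"
    by (rule covering_space_monodromy[OF covering_space_orbit_code[OF G], of "orbit_code \<circ> p" "orbit_code \<circ> q"])
       (use h h' homotopic_paths_imp_path[OF hp] homotopic_paths_imp_subset[OF hp] hp in auto)
  then show ?thesis using space_form_action_inj[OF G x0] assms(4,5) h(4) h'(4) by simp
qed

text \<open>Two lifts with the same ends are homotopic in the simply connected sphere, and
  \<open>orbit_map\<close> carries the homotopy down. The loops agree with the projected lifts only
  on [0, 1], hence the two further homotopies.\<close>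

lemma same_end_imp_loop_homotopy:
  assumes p: "p \<in> loops_at (orbit_space G) (orbit_map G x0)" and q: "q \<in> loops_at (orbit_space G) (orbit_map G x0)" and pg: "lifts_to G x0 p g" and qg: "lifts_to G x0 q g"
  shows "(p, q) \<in> loop_homotopy (orbit_space G) (orbit_map G x0)"
proof -
  let ?hom = "homotopic_with (\<lambda>h. h 0 = orbit_map G x0 \<and> h 1 = orbit_map G x0) (top_of_set {0..1}) (orbit_space G)"
  obtain h where h: "path h" "path_image h \<subseteq> sphere 0 1" "pathstart h = x0" "pathfinish h = g *v x0"
      "\<And>t. t \<in> {0..1} \<Longrightarrow> orbit_map G (h t) = p t"
    using pg by (auto simp: lifts_to_def)
  obtain h' where h': "path h'" "path_image h' \<subseteq> sphere 0 1" "pathstart h' = x0" "pathfinish h' = g *v x0"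
      "\<And>t. t \<in> {0..1} \<Longrightarrow> orbit_map G (h' t) = q t"
    using qg by (auto simp: lifts_to_def)
  have p01: "p 0 = orbit_map G x0" "p 1 = orbit_map G x0" and q01: "q 0 = orbit_map G x0" "q 1 = orbit_map G x0"
    and pc: "continuous_map (top_of_set {0..1}) (orbit_space G) p" and qc: "continuous_map (top_of_set {0..1}) (orbit_space G) q"
    using p q by (auto simp: loops_at_def pathin_def)
  have "homotopic_paths (sphere 0 1) h h'" using space_form_homotopic_paths h h' by simp
  then have 1: "?hom (orbit_map G \<circ> h) (orbit_map G \<circ> h')"
    unfolding homotopic_paths_def
    by (rule homotopic_with_compose_continuous_map_left[OF _ continuous_map_orbit_map])
       (use h p01 h(5)[of 0] h(5)[of 1] in \<open>auto simp: pathstart_def pathfinish_def\<close>)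
  have 2: "?hom p (orbit_map G \<circ> h)"
    by (rule homotopic_with_equal) (use h(5) p01 pc in auto)
  have 3: "?hom q (orbit_map G \<circ> h')"
    by (rule homotopic_with_equal) (use h'(5) q01 qc in auto)
  have "?hom p q" using homotopic_with_trans[OF homotopic_with_trans[OF 2 1]] 3 homotopic_with_symD by blast
  then show ?thesis using p q by (simp add: loop_homotopy_def)
qed

lemma lifts_to_exists:
  assumes g: "g \<in> G"
  shows "\<exists>p\<in>loops_at (orbit_space G) (orbit_map G x0). lifts_to G x0 p g"
proof -
  have "path_connected (sphere (0::real^'n) 1)"
    using simply_connected_unit_sphere by (rule simply_connected_imp_path_connected)
  then obtain h where h: "path h" "path_image h \<subseteq> sphere 0 1" "pathstart h = x0" "pathfinish h = g *v x0"
    using x0 space_form_sphere[OF G g x0] unfolding path_connected_def by blast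
  have "continuous_map (top_of_set {0..1}) (top_of_set (sphere 0 1)) h"
    using h by (auto simp: continuous_map_in_subtopology path_def path_image_def)
  from continuous_map_compose[OF this continuous_map_orbit_map]
  have "pathin (orbit_space G) (orbit_map G \<circ> h)" by (simp add: pathin_def)
  moreover have "orbit_map G (g *v x0) = orbit_map G x0" using orbit_map_eq[OF G, of x0 "g *v x0"] g by metis
  ultimately have "orbit_map G \<circ> h \<in> loops_at (orbit_space G) (orbit_map G x0)" using h by (simp add: loops_at_def pathstart_def pathfinish_def)
  moreover have "lifts_to G x0 (orbit_map G \<circ> h) g" unfolding lifts_to_def using h by (intro exI[of _ h]) simp
  ultimately show ?thesis by blast
qed

lemma lifts_to_concat:
  assumes p: "p \<in> loops_at (orbit_space G) (orbit_map G x0)" "lifts_to G x0 p g" "g \<in> G" and q: "q \<in> loops_at (orbit_space G) (orbit_map G x0)" "lifts_to G x0 q g'"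
  shows "loop_concat p q \<in> loops_at (orbit_space G) (orbit_map G x0)" "lifts_to G x0 (loop_concat p q) (g ** g')"
proof -
  obtain h where h: "path h" "path_image h \<subseteq> sphere 0 1" "pathstart h = x0" "pathfinish h = g *v x0"
      "\<And>t. t \<in> {0..1} \<Longrightarrow> orbit_map G (h t) = p t"
    using p by (auto simp: lifts_to_def)
  obtain h' where h': "path h'" "path_image h' \<subseteq> sphere 0 1" "pathstart h' = x0" "pathfinish h' = g' *v x0"
      "\<And>t. t \<in> {0..1} \<Longrightarrow> orbit_map G (h' t) = q t"
    using q by (auto simp: lifts_to_def)
  \<comment> \<open>The lift of q must start at g x0, where the lift of p ends, so it is translated
    by g. It ends at g g' x0, which makes the correspondence a homomorphism and not an
    antihomomorphism.\<close>
  define k where "k = h +++ ((*v) g \<circ> h')"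
  have gh': "path ((*v) g \<circ> h')" using h'(1) by (intro path_continuous_image) (simp_all add: matrix_vector_mul_linear linear_continuous_on linear_linear)
  have inv: "orbit_map G (g *v z) = orbit_map G z" for z using orbit_map_eq[OF G, of z "g *v z"] p(3) by metis
  have kp: "path k" unfolding k_def using h h' gh' by (intro path_join_imp) (simp_all add: pathstart_compose)
  have kS: "path_image k \<subseteq> sphere 0 1"
    unfolding k_def using h(2) h'(2) space_form_sphere[OF G p(3)]
    by (intro subset_path_image_join) (auto simp: path_image_compose)
  have kt: "orbit_map G (k t) = loop_concat p q t" if "t \<in> {0..1}" for t
    using that h(5)[of "2 * t"] h'(5)[of "2 * t - 1"] by (auto simp: k_def joinpaths_def loop_concat_def inv)
  have k01: "pathstart k = x0" "pathfinish k = (g ** g') *v x0"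
    using h h' by (simp_all add: k_def pathfinish_compose matrix_vector_mul_assoc)
  show "lifts_to G x0 (loop_concat p q) (g ** g')" unfolding lifts_to_def using kp kS k01 kt by blast
  have "continuous_map (top_of_set {0..1}) (top_of_set (sphere 0 1)) k"
    using kp kS by (auto simp: continuous_map_in_subtopology path_def path_image_def)
  from continuous_map_compose[OF this continuous_map_orbit_map]
  have "continuous_map (top_of_set {0..1}) (orbit_space G) (loop_concat p q)"
    by (rule continuous_map_eq) (simp add: kt)
  then show "loop_concat p q \<in> loops_at (orbit_space G) (orbit_map G x0)"
    using p q by (simp add: loops_at_def pathin_def loop_concat_def)
qed

lemma loop_homotopy_class:
  assumes p: "p \<in> loops_at (orbit_space G) (orbit_map G x0)" "lifts_to G x0 p g" "g \<in> G"
  shows "loop_homotopy (orbit_space G) (orbit_map G x0) `` {p} = {q \<in> loops_at (orbit_space G) (orbit_map G x0). lifts_to G x0 q g}"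
proof (intro equalityI subsetI)
  fix q assume "q \<in> loop_homotopy (orbit_space G) (orbit_map G x0) `` {p}"
  then have pq: "(p, q) \<in> loop_homotopy (orbit_space G) (orbit_map G x0)" by simp
  then have q: "q \<in> loops_at (orbit_space G) (orbit_map G x0)" by (simp add: loop_homotopy_def)
  then obtain g' where g': "g' \<in> G" "lifts_to G x0 q g'" using loops_at_lifts_to by blast
  then have "g = g'" using loop_homotopy_imp_same_end[OF pq p(2) _ p(3)] by blast
  then show "q \<in> {q \<in> loops_at (orbit_space G) (orbit_map G x0). lifts_to G x0 q g}" using q g' by simp
next
  fix q assume "q \<in> {q \<in> loops_at (orbit_space G) (orbit_map G x0). lifts_to G x0 q g}"
  then show "q \<in> loop_homotopy (orbit_space G) (orbit_map G x0) `` {p}" using same_end_imp_loop_homotopy[OF p(1) _ p(2)] by simp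
qed

lemma space_form_iso_fundamental_group: "subgroup_of_matrices G \<cong> fundamental_group (orbit_space G) (orbit_map G x0)"
proof -
  \<comment> \<open>By \<open>loop_homotopy_class\<close> each of these sets is a single homotopy
    class.\<close>
  define \<Psi> where "\<Psi> = (\<lambda>g. {q \<in> loops_at (orbit_space G) (orbit_map G x0). lifts_to G x0 q g})"
  have carr: "carrier (fundamental_group (orbit_space G) (orbit_map G x0)) = \<Psi> ` G"
  proof (intro equalityI subsetI)
    fix C assume "C \<in> carrier (fundamental_group (orbit_space G) (orbit_map G x0))"
    then obtain p where p: "p \<in> loops_at (orbit_space G) (orbit_map G x0)" "C = loop_homotopy (orbit_space G) (orbit_map G x0) `` {p}"
      by (auto simp: fundamental_group_def quotient_def)
    then show "C \<in> \<Psi> ` G" using loops_at_lifts_to[OF p(1)] loop_homotopy_class by (auto simp: \<Psi>_def)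
  next
    fix C assume "C \<in> \<Psi> ` G"
    then obtain g where g: "g \<in> G" "C = \<Psi> g" by blast
    obtain p where p: "p \<in> loops_at (orbit_space G) (orbit_map G x0)" "lifts_to G x0 p g" using lifts_to_exists[OF g(1)] by blast
    then have "C = loop_homotopy (orbit_space G) (orbit_map G x0) `` {p}" using loop_homotopy_class[OF p g(1)] g(2) by (simp add: \<Psi>_def)
    then show "C \<in> carrier (fundamental_group (orbit_space G) (orbit_map G x0))" using p(1) by (auto simp: fundamental_group_def quotient_def)
  qed
  have inj: "inj_on \<Psi> G"
  proof (rule inj_onI)
    fix g g' assume g: "g \<in> G" "g' \<in> G" "\<Psi> g = \<Psi> g'"
    obtain p where p: "p \<in> loops_at (orbit_space G) (orbit_map G x0)" "lifts_to G x0 p g" using lifts_to_exists[OF g(1)] by blast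
    then have p': "lifts_to G x0 p g'" using g(3) by (auto simp: \<Psi>_def)
    show "g = g'" using loop_homotopy_imp_same_end[OF same_end_imp_loop_homotopy[OF p(1,1,2,2)] p(2) p' g(1,2)] .
  qed
  have "\<Psi> \<in> hom (subgroup_of_matrices G) (fundamental_group (orbit_space G) (orbit_map G x0))"
  proof (rule homI)
    show "\<Psi> g \<in> carrier (fundamental_group (orbit_space G) (orbit_map G x0))" if "g \<in> carrier (subgroup_of_matrices G)" for g
      using that by (simp add: carr)
    fix g g' assume "g \<in> carrier (subgroup_of_matrices G)" "g' \<in> carrier (subgroup_of_matrices G)"
    then have g: "g \<in> G" "g' \<in> G" by simp_all
    have cls: "loop_homotopy (orbit_space G) (orbit_map G x0) `` {loop_concat p q} = \<Psi> (g ** g')" if "p \<in> \<Psi> g" "q \<in> \<Psi> g'" for p q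
      using that lifts_to_concat[of p g q g'] loop_homotopy_class[OF _ _ space_form_mult(1)[OF G g]] g
      by (simp add: \<Psi>_def)
    have ne: "\<Psi> g \<noteq> {}" "\<Psi> g' \<noteq> {}" using lifts_to_exists g by (auto simp: \<Psi>_def)
    have "\<Psi> g \<otimes>\<^bsub>fundamental_group (orbit_space G) (orbit_map G x0)\<^esub> \<Psi> g' = (\<Union>p\<in>\<Psi> g. \<Union>q\<in>\<Psi> g'. loop_homotopy (orbit_space G) (orbit_map G x0) `` {loop_concat p q})"
      by (simp add: fundamental_group_def)
    also have "\<dots> = (\<Union>p\<in>\<Psi> g. \<Union>q\<in>\<Psi> g'. \<Psi> (g ** g'))" using cls by (intro SUP_cong refl)
    also have "\<dots> = \<Psi> (g ** g')" using ne by blast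
    finally show "\<Psi> (g \<otimes>\<^bsub>subgroup_of_matrices G\<^esub> g') = \<Psi> g \<otimes>\<^bsub>fundamental_group (orbit_space G) (orbit_map G x0)\<^esub> \<Psi> g'" by simp
  qed
  then show ?thesis using inj carr by (auto simp: is_iso_def iso_def bij_betw_def)
qed

end

theorem corollary1p8:
  fixes G :: "(real^'n^'n) set" and G' :: "(real^'m^'m) set"
    and x :: "(real^'n) set" and y :: "(real^'m) set"
    and d m n r p k :: nat
  assumes "spherical_space_form G"
    and "x \<in> topspace (orbit_space G)"
    and "Gamma_params d m n r"
    and "fundamental_group (orbit_space G) x \<cong> Gamma_group m n r"
    and "prime p" and "odd p" and "k \<ge> 1"
    and "m = p ^ k \<or> m = 2 * p ^ k"
    and "spherical_space_form G'"
    and "y \<in> topspace (orbit_space G')"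
    and "isospectral G' G"
  shows "fundamental_group (orbit_space G') y \<cong> fundamental_group (orbit_space G) x"
proof -
  obtain x0 where x0: "x0 \<in> sphere 0 1" "x = orbit_map G x0" using assms(2) by (auto simp: topspace_orbit_space)
  obtain y0 where y0: "y0 \<in> sphere 0 1" "y = orbit_map G' y0" using assms(10) by (auto simp: topspace_orbit_space)
  let ?H = "subgroup_of_matrices G" and ?H' = "subgroup_of_matrices G'"
  interpret H: group ?H by (rule space_form_group[OF assms(1)])
  interpret H': group ?H' by (rule space_form_group[OF assms(9)])
  have iso: "?H \<cong> fundamental_group (orbit_space G) x"
    using space_form_iso_fundamental_group[OF assms(1) x0(1)] x0(2) by simp
  have iso': "?H' \<cong> fundamental_group (orbit_space G') y"
    using space_form_iso_fundamental_group[OF assms(9) y0(1)] y0(2) by simp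
  have par: "n > 0" "gcd ((r - 1) * n) m = 1" "[r ^ n = 1] (mod m)" "r > 0"
    using assms(3) by (auto simp: Gamma_params_def)
  \<comment> \<open>For even m, the product (r - 1) n would be odd and so r even, contrary to r^n =
    1 modulo 2.\<close>
  have "odd m"
  proof
    assume m: "even m"
    have "coprime ((r - 1) * n) m" using par(2) by (simp only: coprime_iff_gcd_eq_1)
    then have "odd ((r - 1) * n)" using m by (meson coprime_common_divisor odd_one)
    moreover have "[r ^ n = 1] (mod 2)" using par(3) m by (rule cong_dvd_modulus_nat)
    then have "odd (r ^ n)" using cong_dvd_iff[of "r ^ n" 1 2] by simp
    then have "odd r" using par(1) by simp
    ultimately show False by simp
  qed
  then have m: "m = p ^ k" using assms(8) by auto
  have "coprime m n" using par(2) by (metis coprime_commute coprime_iff_gcd_eq_1 coprime_mult_left_iff)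
  moreover obtain a0 b0 where "metacyclic (Gamma_group m n r) a0 b0 m n r" using metacyclic_Gamma_group[OF assms(3)] by blast
  then obtain a b where "metacyclic ?H a b m n r"
    using metacyclic_transfer[OF H.group_axioms _ iso_trans[OF iso assms(4)]] by blast
  moreover have "card (carrier ?H') = card (carrier ?H)"
    using isospectral_dimension_order(2)[OF assms(1,9,11)] by simp
  moreover have "(\<exists>g\<in>carrier ?H. group.ord ?H g = K) \<longleftrightarrow> (\<exists>g\<in>carrier ?H'. group.ord ?H' g = K)" if "K \<ge> 3" for K
    using isospectral_element_orders[OF assms(1,9,11) that] by simp
  ultimately have "?H \<cong> ?H'"
    using metacyclic_iso_if_same_element_orders[OF _ assms(5,6,7), of ?H a b n r ?H'] par(3) H'.group_axioms m by blast
  then have "?H' \<cong> ?H" by (rule H.iso_sym)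
  then show ?thesis using iso_trans[OF H'.iso_sym[OF iso'] iso_trans[OF _ iso]] by blast
qed

end
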